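(* Assume: (F) $F_0$ has bounded support $\mathcal{S}_0=[0,M_0]$ and is strictly increasing on $\mathcal{S}_0$ with density $f_0$, strictly staying away from zero on $\mathcal{S}_0$; (G) $G$ has support $[0,\infty)$, is strictly increasing on $\mathcal{S}_0$ with density $g$ staying away from zero on $\mathcal{S}_0$, and $g'$ is bounded on $\mathcal{S}_0$. Let $\lambda_0=f_0/(1-F_0)$ and let $h=cn^{-1/7}$ ($c>0$) be the bandwidth used to compute $\hat\lambda_n^{\mathrm{MS}}=\hat f_n^{\mathrm{MS}}/(1-\hat F_n^{\mathrm{MS}})$. Fix $t>0$ such that $F_0(t)<1$, $f_0^{(3)}$ and $g^{(3)}$ exist and are continuous at $t$, and $r(t)\ne0$, where $$r(t)=\frac{1}{1-F_0(t)}\Big(f_0''(t)+2\frac{g''(t)f_0(t)+g'(t)f_0'(t)}{g(t)}-2\frac{g'(t)^2f_0(t)}{g(t)^2}\Big)+\frac{f_0(t)}{(1-F_0(t))^2}\Big(f_0'(t)+\frac{2g'(t)f_0(t)}{g(t)}\Big).$$ Then, as $n\to\infty$, $$n^{2/7}\big(\hat\lambda_n^{\mathrm{MS}}(t)-\lambda_0(t)\big)\rightsquigarrow\mathcal{N}(\mu_{\lambda,\mathrm{MS}},\sigma^2_{\lambda,\mathrm{MS}}),$$ where $$\mu_{\lambda,\mathrm{MS}}=\tfrac12c^2m_2(k)r(t),\qquad\sigma^2_{\lambda,\mathrm{MS}}=\frac{F_0(t)}{c^3g(t)(1-F_0(t))}\int k'(u)^2\,du.$$ This also holds if $\hat\lambda_n^{\mathrm{MS}}$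 is replaced by $\hat\lambda_n^{\mathrm{naive}}$. For fixed $t$, the aMSE-optimal bandwidth for $\hat\lambda_n^{\mathrm{MS}}(t)$ is $h_{n,\lambda,\mathrm{MS}}=c_{\lambda,\mathrm{MS}}n^{-1/7}$, where $$c_{\lambda,\mathrm{MS}}=\Big\{3\frac{F_0(t)}{g(t)(1-F_0(t))}\int k'(u)^2\,du\Big\}^{1/7}\{m_2^2(k)r^2(t)\}^{-1/7};$$ that is, $c_{\lambda,\mathrm{MS}}$ minimizes the asymptotic mean squared error $\mu_{\lambda,\mathrm{MS}}^2+\sigma_{\lambda,\mathrm{MS}}^2$ over $c>0$.
   Context: Current status model: $X_1,X_2,\dots$ are i.i.d. with distribution function $F_0$ on $[0,\infty)$, and, independently, $T_1,T_2,\dots$ are i.i.d. with distribution function $G$ on $[0,\infty)$ having Lebesgue density $g$. One observes $(T_i,\Delta_i)$, $1\le i\le n$, with $\Delta_i=1_{\{X_i\le T_i\}}$. Kernel: $k$ is a probability density with support $[-1,1]$, symmetric and twice continuously differentiable on $\mathbb{R}$; $m_2(k)=\int u^2k(u)\,du$; $k_h(u)=h^{-1}k(u/h)$. Kernel estimators: for $i=0,1$ let $\mathbb{G}_{n,i}(t)=\frac1n\sum_{j=1}^n1_{[0,t]\times\{i\}}(T_j,\Delta_j)$. Put $\hat g_{n,i}(t)=\int k_h(t-u)\,d\mathbb{G}_{n,i}(u)$ for $t>h$, and for $0\le t\le h$, with $\beta=t/h$, use the boundary-corrected estimator $\hat g_{n,i}(t)=\int h^{-1}k^\beta((t-u)/h)\,d\mathbb{G}_{n,i}(u)$,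 where $$k^\beta(u)=\frac{\nu_{2,\beta}(k)-\nu_{1,\beta}(k)u}{\nu_{0,\beta}(k)\nu_{2,\beta}(k)-\nu_{1,\beta}(k)^2}\,k(u)1_{(-1,\beta)}(u),\qquad \nu_{i,\beta}(k)=\int_{-1}^\beta u^ik(u)\,du.$$ Put $\hat g_n=\hat g_{n,0}+\hat g_{n,1}$, $\hat G_{n,i}(t)=\int_{[0,t]}\hat g_{n,i}(u)\,du$, $\hat G_n(t)=\int_{[0,t]}\hat g_n(u)\,du$; $\hat g_{n,i}'$ is the derivative of $\hat g_{n,i}$ and $\hat g_n'=\hat g_{n,0}'+\hat g_{n,1}'$. The maximum smoothed likelihood estimator $\hat F_n^{\mathrm{MS}}(t)$ is the right-continuous slope of the lower convex hull of the parameterized curve $t\mapsto(\hat G_n(t),\hat G_{n,1}(t))$, $t\in[0,\tau]$, $\tau=\sup\{t\ge0:\hat g_{n,0}(t)+\hat g_{n,1}(t)>0\}$, evaluated at the point with $x$-coordinate $\hat G_n(t)$; $\hat f_n^{\mathrm{MS}}$ is its derivative, and $\hat\lambda_n^{\mathrm{MS}}(t)=\hat f_n^{\mathrm{MS}}(t)/(1-\hat F_n^{\mathrm{MS}}(t))$ for $t>0$ with $\hat F_n^{\mathrm{MS}}(t)<1$. The naive estimators are $$\hat F_n^{\mathrm{naive}}(t)=\frac{\hat g_{n,1}(t)}{\hat g_n(t)},\quad \hat f_n^{\mathrm{naive}}(t)=\frac{\hat g_n(t)\hat g_{n,1}'(t)-\hat g_n'(t)\hat g_{n,1}(t)}{\hat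 g_n(t)^2},\quad \hat\lambda_n^{\mathrm{naive}}(t)=\frac{\hat f_n^{\mathrm{naive}}(t)}{1-\hat F_n^{\mathrm{naive}}(t)}.$$ The symbol $\rightsquigarrow$ denotes convergence in distribution. *)

theory Defs
  imports "HOL-Probability.Probability"
begin

section \<open>The current status model\<close>

text \<open>Random variables are indexed by \<open>{1..}\<close>. Mutual independence of the combined family says
  that each of the two sequences is independent and that the sequences are independent of each
  other.\<close>

definition df_density :: "(real \<Rightarrow> real) \<Rightarrow> (real \<Rightarrow> real) \<Rightarrow> bool" where
  "df_density F f \<longleftrightarrow> f \<in> borel_measurable borel \<and> (\<forall>x. 0 \<le> f x) \<and>
     (\<forall>x. set_integrable lborel {..x} f \<and> F x = (LBINT u:{..x}. f u))"

locale current_status_model = prob_space M for M :: "'a measure" +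
  fixes X T :: "nat \<Rightarrow> 'a \<Rightarrow> real" and F0 G g :: "real \<Rightarrow> real"
  assumes indep: "indep_vars (\<lambda>_. borel) (case_sum X T) ({1..} <+> {1..})"
    and df_X: "\<And>i. 1 \<le> i \<Longrightarrow> cdf (distr M borel (X i)) = F0"
    and df_T: "\<And>i. 1 \<le> i \<Longrightarrow> cdf (distr M borel (T i)) = G"
    and nonneg: "\<And>x. x < 0 \<Longrightarrow> F0 x = 0" "\<And>x. x < 0 \<Longrightarrow> G x = 0"
    and density_T: "df_density G g"

definition status :: "(nat \<Rightarrow> 'a \<Rightarrow> real) \<Rightarrow> (nat \<Rightarrow> 'a \<Rightarrow> real) \<Rightarrow> 'a \<Rightarrow> nat \<Rightarrow> nat" where
  "status X T \<omega> j = (if X j \<omega> \<le> T j \<omega> then 1 else 0)"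

text \<open>The support of a distribution function is its set of points of increase, i.e. the
  topological support of the corresponding measure.\<close>

definition df_support :: "(real \<Rightarrow> real) \<Rightarrow> real set" where
  "df_support F = {x. \<forall>e>0. F (x - e) < F (x + e)}"

text \<open>The derivative of order \<open>m\<close> exists in a neighbourhood of \<open>t\<close> and is continuous at \<open>t\<close>.\<close>

definition cont_nth_deriv_at :: "nat \<Rightarrow> (real \<Rightarrow> real) \<Rightarrow> real \<Rightarrow> bool" where
  "cont_nth_deriv_at m f t \<longleftrightarrow>
     (\<forall>\<^sub>F x in nhds t. \<forall>i<m. (deriv ^^ i) f differentiable (at x)) \<and> isCont ((deriv ^^ m) f) t"

section \<open>Kernel estimators\<close>

definition smoothing_kernel :: "(real \<Rightarrow> real) \<Rightarrow> bool" where
  "smoothing_kernel k \<longleftrightarrow>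
     (\<forall>u. 0 \<le> k u) \<and> integrable lborel k \<and> (LBINT u. k u) = 1 \<and>
     closure {u. k u \<noteq> 0} = {-1..1} \<and> (\<forall>u. k (- u) = k u) \<and>
     (\<forall>u. cont_nth_deriv_at 2 k u)"

definition m2 :: "(real \<Rightarrow> real) \<Rightarrow> real" where
  "m2 k = (LBINT u. u\<^sup>2 * k u)"

definition scaled :: "(real \<Rightarrow> real) \<Rightarrow> real \<Rightarrow> real \<Rightarrow> real" where
  "scaled k h u = k (u / h) / h"

definition bmoment :: "(real \<Rightarrow> real) \<Rightarrow> nat \<Rightarrow> real \<Rightarrow> real" where
  "bmoment k i \<beta> = (LBINT u:{-1..\<beta>}. u ^ i * k u)"

definition boundary_kernel :: "(real \<Rightarrow> real) \<Rightarrow> real \<Rightarrow> real \<Rightarrow> real" where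
  "boundary_kernel k \<beta> u =
     (bmoment k 2 \<beta> - bmoment k 1 \<beta> * u) / (bmoment k 0 \<beta> * bmoment k 2 \<beta> - (bmoment k 1 \<beta>)\<^sup>2)
       * k u * indicator {-1<..<\<beta>} u"

text \<open>Below, \<open>T\<close> and \<open>\<Delta>\<close> are the observed values, i.e. \<open>\<lambda>j. T j \<omega>\<close> and \<open>status X T \<omega>\<close>
  for a sample point \<open>\<omega>\<close>.\<close>

definition emp_subdf :: "nat \<Rightarrow> (nat \<Rightarrow> real) \<Rightarrow> (nat \<Rightarrow> nat) \<Rightarrow> nat \<Rightarrow> real \<Rightarrow> real" where
  "emp_subdf n T \<Delta> i t = (\<Sum>j=1..n. indicator ({0..t} \<times> {i}) (T j, \<Delta> j)) / real n"

text \<open>The estimator is only meant for arguments \<open>0 \<le> t\<close>; the value for \<open>t < 0\<close> is a dummy.\<close>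

definition g_est ::
  "(real \<Rightarrow> real) \<Rightarrow> real \<Rightarrow> nat \<Rightarrow> (nat \<Rightarrow> real) \<Rightarrow> (nat \<Rightarrow> nat) \<Rightarrow> nat \<Rightarrow> real \<Rightarrow> real" where
  "g_est k h n T \<Delta> i t =
     (if h < t then LINT u|interval_measure (emp_subdf n T \<Delta> i). scaled k h (t - u)
      else if 0 \<le> t then
        LINT u|interval_measure (emp_subdf n T \<Delta> i). scaled (boundary_kernel k (t / h)) h (t - u)
      else 0)"

definition g_est_tot ::
  "(real \<Rightarrow> real) \<Rightarrow> real \<Rightarrow> nat \<Rightarrow> (nat \<Rightarrow> real) \<Rightarrow> (nat \<Rightarrow> nat) \<Rightarrow> real \<Rightarrow> real" where
  "g_est_tot k h n T \<Delta> t = g_est k h n T \<Delta> 0 t + g_est k h n T \<Delta> 1 t"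

definition G_est ::
  "(real \<Rightarrow> real) \<Rightarrow> real \<Rightarrow> nat \<Rightarrow> (nat \<Rightarrow> real) \<Rightarrow> (nat \<Rightarrow> nat) \<Rightarrow> nat \<Rightarrow> real \<Rightarrow> real" where
  "G_est k h n T \<Delta> i t = (LBINT u:{0..t}. g_est k h n T \<Delta> i u)"

definition G_est_tot ::
  "(real \<Rightarrow> real) \<Rightarrow> real \<Rightarrow> nat \<Rightarrow> (nat \<Rightarrow> real) \<Rightarrow> (nat \<Rightarrow> nat) \<Rightarrow> real \<Rightarrow> real" where
  "G_est_tot k h n T \<Delta> t = (LBINT u:{0..t}. g_est_tot k h n T \<Delta> u)"

definition g_est_deriv ::
  "(real \<Rightarrow> real) \<Rightarrow> real \<Rightarrow> nat \<Rightarrow> (nat \<Rightarrow> real) \<Rightarrow> (nat \<Rightarrow> nat) \<Rightarrow> nat \<Rightarrow> real \<Rightarrow> real" where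
  "g_est_deriv k h n T \<Delta> i t = deriv (g_est k h n T \<Delta> i) t"

definition g_est_tot_deriv ::
  "(real \<Rightarrow> real) \<Rightarrow> real \<Rightarrow> nat \<Rightarrow> (nat \<Rightarrow> real) \<Rightarrow> (nat \<Rightarrow> nat) \<Rightarrow> real \<Rightarrow> real" where
  "g_est_tot_deriv k h n T \<Delta> t = g_est_deriv k h n T \<Delta> 0 t + g_est_deriv k h n T \<Delta> 1 t"

section \<open>Maximum smoothed likelihood and naive estimators\<close>

definition tau_est ::
  "(real \<Rightarrow> real) \<Rightarrow> real \<Rightarrow> nat \<Rightarrow> (nat \<Rightarrow> real) \<Rightarrow> (nat \<Rightarrow> nat) \<Rightarrow> real" where
  "tau_est k h n T \<Delta> = Sup {t. 0 \<le> t \<and> g_est k h n T \<Delta> 0 t + g_est k h n T \<Delta> 1 t > 0}"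

text \<open>The boundary kernel can take negative values, so near 0 the curve need not be the graph of
  a function of its first coordinate; hence the convex hull is taken in the plane.\<close>

definition curve ::
  "(real \<Rightarrow> real) \<Rightarrow> real \<Rightarrow> nat \<Rightarrow> (nat \<Rightarrow> real) \<Rightarrow> (nat \<Rightarrow> nat) \<Rightarrow> (real \<times> real) set" where
  "curve k h n T \<Delta> =
     (\<lambda>t. (G_est_tot k h n T \<Delta> t, G_est k h n T \<Delta> 1 t)) ` {0..tau_est k h n T \<Delta>}"

definition lower_hull :: "(real \<times> real) set \<Rightarrow> real \<Rightarrow> real" where
  "lower_hull S x = Inf {y. (x, y) \<in> convex hull S}"

text \<open>The right-continuous version of the slope of a convex function is its right derivative.
  The value is arbitrary where that limit does not exist, e.g. at the right end of the curve.\<close>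

definition right_slope :: "(real \<Rightarrow> real) \<Rightarrow> real \<Rightarrow> real" where
  "right_slope H x = Lim (at_right x) (\<lambda>y. (H y - H x) / (y - x))"

definition F_MS ::
  "(real \<Rightarrow> real) \<Rightarrow> real \<Rightarrow> nat \<Rightarrow> (nat \<Rightarrow> real) \<Rightarrow> (nat \<Rightarrow> nat) \<Rightarrow> real \<Rightarrow> real" where
  "F_MS k h n T \<Delta> t = right_slope (lower_hull (curve k h n T \<Delta>)) (G_est_tot k h n T \<Delta> t)"

definition f_MS ::
  "(real \<Rightarrow> real) \<Rightarrow> real \<Rightarrow> nat \<Rightarrow> (nat \<Rightarrow> real) \<Rightarrow> (nat \<Rightarrow> nat) \<Rightarrow> real \<Rightarrow> real" where
  "f_MS k h n T \<Delta> t = deriv (F_MS k h n T \<Delta>) t"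

text \<open>The hazard estimates are meaningful where the estimate of the distribution function is
  less than 1.\<close>

definition lambda_MS ::
  "(real \<Rightarrow> real) \<Rightarrow> real \<Rightarrow> nat \<Rightarrow> (nat \<Rightarrow> real) \<Rightarrow> (nat \<Rightarrow> nat) \<Rightarrow> real \<Rightarrow> real" where
  "lambda_MS k h n T \<Delta> t = f_MS k h n T \<Delta> t / (1 - F_MS k h n T \<Delta> t)"

definition F_naive ::
  "(real \<Rightarrow> real) \<Rightarrow> real \<Rightarrow> nat \<Rightarrow> (nat \<Rightarrow> real) \<Rightarrow> (nat \<Rightarrow> nat) \<Rightarrow> real \<Rightarrow> real" where
  "F_naive k h n T \<Delta> t = g_est k h n T \<Delta> 1 t / g_est_tot k h n T \<Delta> t"

definition f_naive ::
  "(real \<Rightarrow> real) \<Rightarrow> real \<Rightarrow> nat \<Rightarrow> (nat \<Rightarrow> real) \<Rightarrow> (nat \<Rightarrow> nat) \<Rightarrow> real \<Rightarrow> real" where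
  "f_naive k h n T \<Delta> t =
     (g_est_tot k h n T \<Delta> t * g_est_deriv k h n T \<Delta> 1 t
        - g_est_tot_deriv k h n T \<Delta> t * g_est k h n T \<Delta> 1 t) / (g_est_tot k h n T \<Delta> t)\<^sup>2"

definition lambda_naive ::
  "(real \<Rightarrow> real) \<Rightarrow> real \<Rightarrow> nat \<Rightarrow> (nat \<Rightarrow> real) \<Rightarrow> (nat \<Rightarrow> nat) \<Rightarrow> real \<Rightarrow> real" where
  "lambda_naive k h n T \<Delta> t = f_naive k h n T \<Delta> t / (1 - F_naive k h n T \<Delta> t)"

section \<open>Parameters of the limit distribution\<close>

definition hazard :: "(real \<Rightarrow> real) \<Rightarrow> (real \<Rightarrow> real) \<Rightarrow> real \<Rightarrow> real" where
  "hazard F f t = f t / (1 - F t)"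

definition r_bias ::
  "(real \<Rightarrow> real) \<Rightarrow> (real \<Rightarrow> real) \<Rightarrow> (real \<Rightarrow> real) \<Rightarrow> real \<Rightarrow> real" where
  "r_bias F f g t =
     1 / (1 - F t) *
       ((deriv ^^ 2) f t + 2 * (((deriv ^^ 2) g t * f t + deriv g t * deriv f t) / g t)
          - 2 * ((deriv g t)\<^sup>2 * f t / (g t)\<^sup>2))
     + f t / (1 - F t)\<^sup>2 * (deriv f t + 2 * deriv g t * f t / g t)"

definition mu_lambda ::
  "(real \<Rightarrow> real) \<Rightarrow> (real \<Rightarrow> real) \<Rightarrow> (real \<Rightarrow> real) \<Rightarrow> (real \<Rightarrow> real) \<Rightarrow> real \<Rightarrow> real \<Rightarrow> real" where
  "mu_lambda k F f g t c = 1 / 2 * c\<^sup>2 * m2 k * r_bias F f g t"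

definition sigma2_lambda ::
  "(real \<Rightarrow> real) \<Rightarrow> (real \<Rightarrow> real) \<Rightarrow> (real \<Rightarrow> real) \<Rightarrow> real \<Rightarrow> real \<Rightarrow> real" where
  "sigma2_lambda k F g t c =
     F t / (c ^ 3 * g t * (1 - F t)) * (LBINT u. (deriv k u)\<^sup>2)"

definition c_lambda ::
  "(real \<Rightarrow> real) \<Rightarrow> (real \<Rightarrow> real) \<Rightarrow> (real \<Rightarrow> real) \<Rightarrow> (real \<Rightarrow> real) \<Rightarrow> real \<Rightarrow> real" where
  "c_lambda k F f g t =
     (3 * (F t / (g t * (1 - F t))) * (LBINT u. (deriv k u)\<^sup>2)) powr (1 / 7)
       * ((m2 k)\<^sup>2 * (r_bias F f g t)\<^sup>2) powr (- 1 / 7)"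

definition normal_law :: "real \<Rightarrow> real \<Rightarrow> real measure" where
  "normal_law \<mu> v = density lborel (normal_density \<mu> (sqrt v))"

end

theory Submission
  imports Defs "HOL-Real_Asymp.Real_Asymp"
begin

text \<open>Write \<open>g0\<close> and \<open>g1\<close> for the densities of the observation
  times with status 0 and 1. Since \<open>F = g1 / (g0 + g1)\<close>, the hazard rate is
  \<open>(g1' - (g1 / g0) g0') / (g0 + g1)\<close>: it is linear in the derivatives of the two
  densities, with coefficients that only involve their values. For \<open>h = c n^(-1/7)\<close>
  the estimated derivatives fluctuate at the order \<open>(n h^3)^(-1/2)\<close>, a multiple of
  \<open>n^(-2/7)\<close>, the estimated values at the smaller order \<open>n^(-3/7)\<close>, and
  all biases are of order \<open>h^2\<close>, which is again a multiple of
  \<open>n^(-2/7)\<close>. Hence \<open>n^(2/7)\<close> times the error of the naive estimator is,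
  up to terms that vanish, one centered linear combination of the two estimated derivatives, which
  is a sum of independent bounded terms and obeys a central limit theorem
  (\<open>triangular_array_clt\<close>), plus a deterministic bias that a Taylor expansion
  identifies (\<open>naive_expansion\<close>, \<open>bias_eq\<close>).

  Everything else takes place on a good event whose probability tends to one
  (\<open>good_prob_lim\<close>). On it the two empirical subdistribution functions are uniformly
  within \<open>2 n^(-1/3)\<close> of their limits, which is \<open>o(h^2)\<close>, and the
  estimated values at \<open>t\<close> are within \<open>n^(-9/28)\<close> of their means, which
  is \<open>o(n^(-2/7))\<close>. Both parts follow from Hoeffding's inequality, the first by
  bracketing the half lines between finitely many quantiles. A property holds uniformly on the
  good events as soon as it holds along every sequence of good sample points
  (\<open>eventually_Ball_if_sequences\<close>), and along such a sequence all arguments are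
  deterministic.

  The maximum smoothed likelihood estimator coincides with the naive one near \<open>t\<close> on
  the good event (\<open>eventually_MS_eq_naive\<close>). Integrating by parts, the estimators and
  their derivatives are kernel averages of the empirical subdistribution functions, so they are
  uniformly consistent near \<open>t\<close>, and the naive estimator of the distribution function
  increases there with a slope bounded away from zero. Therefore the tangent at a point of the
  curve near \<open>t\<close> lies below the curve: nearby because the slope increases, farther
  away because the slope separates values of \<open>F0\<close>, so that the curve gains a fixed
  amount over the tangent which the uniform error cannot compensate
  (\<open>far_increment\<close>), and in the boundary region because the boundary kernels are
  uniformly bounded and few observations are close to zero. A curve with supporting lines is its
  own lower hull, and the slope of the hull is the slope of the curve
  (\<open>right_slope_hull\<close>).

  The law of an estimator is an image measure, which has this meaning only for a measurable
  function; measurability of the hull slope and of its derivative is proved in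
  \<open>lambda_MS_measurable\<close>. By duality the hull is a supremum over rational slopes of
  infima over rational parameters, its right slope is the limit of a sequence of difference
  quotients, and the derivative at \<open>t\<close> is determined by the values at rational points
  because the slope is monotone along the curve.

  Finally, the asymptotic mean squared error has the form \<open>a c^4 + b / c^3\<close>, whose
  only minimizer is \<open>(3 b / (4 a))^(1/7)\<close>.\<close>

section \<open>Weak convergence and uniformity along sequences\<close>

text \<open>A form of Slutsky's theorem: on the event \<open>A n\<close> the two variables differ
  by at most \<open>e\<close>, so the distribution function of \<open>Y n\<close> at
  \<open>x\<close> lies between those of \<open>X n\<close> at \<open>x - e\<close> and \<open>x +
  e\<close>, up to the probability that \<open>A n\<close> fails; continuity of the limit closes
  the gap.\<close>

lemma (in prob_space) weak_conv_m_transfer: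
  fixes X Y :: "nat \<Rightarrow> 'a \<Rightarrow> real"
  assumes conv: "weak_conv_m (\<lambda>n. distr M borel (X n)) N"
    and cont: "\<And>x. isCont (cdf N) x"
    and X[measurable]: "\<And>n. X n \<in> borel_measurable M"
    and Y: "\<forall>\<^sub>F n in sequentially. Y n \<in> borel_measurable M"
    and A[measurable]: "\<And>n. A n \<in> events"
    and PA: "(\<lambda>n. prob (A n)) \<longlonglongrightarrow> 1"
    and close: "\<And>e. 0 < e \<Longrightarrow> \<forall>\<^sub>F n in sequentially. \<forall>\<omega>\<in>A n. \<bar>Y n \<omega> - X n \<omega>\<bar> \<le> e"
  shows "weak_conv_m (\<lambda>n. distr M borel (Y n)) N"
  unfolding weak_conv_m_def weak_conv_def
proof safe
  fix x :: real
  have cX: "(\<lambda>n. cdf (distr M borel (X n)) y) \<longlonglongrightarrow> cdf N y" for y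
    using conv cont unfolding weak_conv_m_def weak_conv_def by auto
  have cdfX: "cdf (distr M borel (Z n)) y = prob {\<omega>\<in>space M. Z n \<omega> \<le> y}"
    if "Z n \<in> borel_measurable M" for n y and Z :: "nat \<Rightarrow> 'a \<Rightarrow> real"
    using that unfolding cdf_def by (subst measure_distr) (auto simp: vimage_def Int_def conj_commute)
  have bad: "(\<lambda>n. 1 - prob (A n)) \<longlonglongrightarrow> 0"
    using tendsto_diff[OF tendsto_const PA, of 1] by simp
  show "(\<lambda>n. cdf (distr M borel (Y n)) x) \<longlonglongrightarrow> cdf N x"
  proof (rule LIMSEQ_I)
    fix r :: real assume r: "0 < r"
    obtain d where d: "d > 0" "\<And>y. \<bar>y - x\<bar> < d \<Longrightarrow> \<bar>cdf N y - cdf N x\<bar> < r / 3"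
      using cont[of x, unfolded continuous_at_eps_delta, rule_format, of "r/3"] r
      by (auto simp: dist_real_def)
    define e where "e = d / 2"
    have e: "0 < e" "e < d" using d by (auto simp: e_def)
    have up: "\<bar>cdf N (x + e) - cdf N x\<bar> < r / 3" "\<bar>cdf N (x - e) - cdf N x\<bar> < r / 3"
      using e by (intro d; simp)+
    have "\<forall>\<^sub>F n in sequentially. \<bar>cdf (distr M borel (X n)) (x + e) - cdf N (x + e)\<bar> < r / 3"
      "\<forall>\<^sub>F n in sequentially. \<bar>cdf (distr M borel (X n)) (x - e) - cdf N (x - e)\<bar> < r / 3"
      "\<forall>\<^sub>F n in sequentially. \<bar>(1 - prob (A n)) - 0\<bar> < r / 3"
      using tendstoD[OF cX, of "r/3"] tendstoD[OF bad, of "r/3"] r by (auto simp: dist_real_def)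
    then have "\<forall>\<^sub>F n in sequentially. norm (cdf (distr M borel (Y n)) x - cdf N x) < r"
      using close[OF e(1)] Y
    proof eventually_elim
      case (elim n)
      note [measurable] = elim(5)
      have "prob {\<omega>\<in>space M. Y n \<omega> \<le> x} \<le> prob ({\<omega>\<in>space M. X n \<omega> \<le> x + e} \<union> (space M - A n))"
        using elim(4) by (intro finite_measure_mono) (force, measurable)
      also have "\<dots> \<le> prob {\<omega>\<in>space M. X n \<omega> \<le> x + e} + prob (space M - A n)"
        by (rule measure_subadditive) auto
      finally have 1: "cdf (distr M borel (Y n)) x \<le> cdf (distr M borel (X n)) (x + e) + (1 - prob (A n))"
        by (simp add: cdfX prob_compl)
      have "prob {\<omega>\<in>space M. X n \<omega> \<le> x - e} \<le> prob ({\<omega>\<in>space M. Y n \<omega> \<le> x} \<union> (space M - A n))"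
        using elim(4) by (intro finite_measure_mono) (force, measurable)
      also have "\<dots> \<le> prob {\<omega>\<in>space M. Y n \<omega> \<le> x} + prob (space M - A n)"
        by (rule measure_subadditive) auto
      finally have 2: "cdf (distr M borel (X n)) (x - e) \<le> cdf (distr M borel (Y n)) x + (1 - prob (A n))"
        by (simp add: cdfX prob_compl)
      show ?case using 1 2 elim(1,2,3) up unfolding real_norm_def by linarith
    qed
    then show "\<exists>no. \<forall>n\<ge>no. norm (cdf (distr M borel (Y n)) x - cdf N x) < r"
      by (simp add: eventually_sequentially)
  qed
qed

lemma normal_law_eq_distr:
  assumes "0 < v"
  shows "normal_law m v = distr std_normal_distribution borel (\<lambda>x. m + sqrt v * x)"
proof -
  interpret prob_space std_normal_distribution by (rule prob_space_normal_density) simp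
  have "distributed std_normal_distribution lborel (\<lambda>x. x) std_normal_density"
    unfolding distributed_def by (auto simp: distr_id2)
  from normal_density_affine[OF this, of "sqrt v" m]
  have "distributed std_normal_distribution lborel (\<lambda>x. m + sqrt v * x) (normal_density m (sqrt v))"
    using assms by simp
  from distributed_distr_eq_density[OF this] show ?thesis
    unfolding normal_law_def by (metis distr_cong sets_lborel)
qed

lemma real_distribution_normal_law: "0 < v \<Longrightarrow> real_distribution (normal_law m v)"
  unfolding normal_law_def real_distribution_def real_distribution_axioms_def
  by (auto intro!: prob_space_normal_density)

lemma isCont_cdf_normal_law:
  assumes "0 < v"
  shows "isCont (cdf (normal_law m v)) x"
proof -
  interpret real_distribution "normal_law m v" by (rule real_distribution_normal_law) fact
  have "emeasure (normal_law m v) {x} = 0"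
    unfolding normal_law_def by (subst emeasure_density) (auto simp: nn_integral_null_set)
  then show ?thesis by (simp add: isCont_cdf measure_def)
qed

lemma char_normal_law:
  assumes "0 < v"
  shows "char (normal_law m v) t = iexp (t * m) * complex_of_real (exp (- (t\<^sup>2 * v) / 2))"
proof -
  interpret prob_space std_normal_distribution by (rule prob_space_normal_density) simp
  have "char (normal_law m v) t = (CLINT x|std_normal_distribution. iexp (t * (m + sqrt v * x)))"
    unfolding normal_law_eq_distr[OF assms] char_def by (subst integral_distr) auto
  also have "\<dots> = (CLINT x|std_normal_distribution. iexp (t * m) * iexp ((t * sqrt v) * x))"
    by (intro Bochner_Integration.integral_cong) (auto simp: exp_add[symmetric] algebra_simps)
  also have "\<dots> = iexp (t * m) * char std_normal_distribution (t * sqrt v)"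
    unfolding char_def by simp
  also have "char std_normal_distribution (t * sqrt v) = complex_of_real (exp (- (t\<^sup>2 * v) / 2))"
    using assms by (simp add: char_std_normal_distribution power_mult_distrib)
  finally show ?thesis .
qed

lemma exp_minus_quadratic:
  assumes "0 \<le> (x::real)"
  shows "\<bar>(1 - x) - exp (- x)\<bar> \<le> x\<^sup>2"
proof -
  have 1: "1 - x \<le> exp (- x)" using exp_ge_add_one_self[of "-x"] by simp
  have "exp (- x) \<le> 1 / (1 + x)"
    using exp_ge_add_one_self[of x] assms by (simp add: exp_minus field_simps)
  also have "\<dots> \<le> 1 - x + x\<^sup>2"
    using assms by (simp add: field_simps power2_eq_square)
  finally show ?thesis using 1 by simp
qed

text \<open>The characteristic function of each summand differs from \<open>exp (- t^2 V /
  2)\<close> by at most a constant times \<open>(B + V) V\<close>, because the third absolute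
  moment is at most \<open>B V\<close>. Replacing the \<open>n\<close> factors one at a time costs
  \<open>n\<close> such errors, and \<open>n V\<close> is bounded while \<open>B\<close> and
  \<open>V \<le> B^2\<close> tend to zero.\<close>

lemma (in prob_space) triangular_array_clt:
  fixes Y :: "nat \<Rightarrow> nat \<Rightarrow> 'a \<Rightarrow> real"
  assumes indep: "\<And>n. indep_vars (\<lambda>_. borel) (Y n) {1..n}"
    and bdd: "\<And>n j \<omega>. j \<in> {1..n} \<Longrightarrow> \<omega> \<in> space M \<Longrightarrow> \<bar>Y n j \<omega>\<bar> \<le> B n"
    and B: "B \<longlonglongrightarrow> 0"
    and mean: "\<And>n j. j \<in> {1..n} \<Longrightarrow> expectation (Y n j) = 0"
    and var: "\<And>n j. j \<in> {1..n} \<Longrightarrow> expectation (\<lambda>\<omega>. (Y n j \<omega>)\<^sup>2) = V n"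
    and V: "(\<lambda>n. real n * V n) \<longlonglongrightarrow> v" and v: "0 < v"
    and shift: "\<beta> \<longlonglongrightarrow> b"
  shows "weak_conv_m (\<lambda>n. distr M borel (\<lambda>\<omega>. (\<Sum>j=1..n. Y n j \<omega>) + \<beta> n)) (normal_law b v)"
proof (rule levy_continuity)
  have Ym: "Y n j \<in> borel_measurable M" if "j \<in> {1..n}" for n j
    using indep[of n] that unfolding indep_vars_def by auto
  then have Sm: "(\<lambda>\<omega>. \<Sum>j=1..n. Y n j \<omega>) \<in> borel_measurable M" for n
    by (intro borel_measurable_sum) auto
  show "real_distribution (distr M borel (\<lambda>\<omega>. (\<Sum>j=1..n. Y n j \<omega>) + \<beta> n))" for n
    using Sm by (intro real_distribution_distr) auto
  show "real_distribution (normal_law b v)" by (rule real_distribution_normal_law) fact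
  fix t :: real
  define \<phi> where "\<phi> n j = char (distr M borel (Y n j)) t" for n j
  define w where "w n = complex_of_real (exp (- (t\<^sup>2 * V n / 2)))" for n
  have char_eq: "char (distr M borel (\<lambda>\<omega>. (\<Sum>j=1..n. Y n j \<omega>) + \<beta> n)) t
      = iexp (t * \<beta> n) * (\<Prod>j=1..n. \<phi> n j)" for n
  proof -
    have "char (distr M borel (\<lambda>\<omega>. (\<Sum>j=1..n. Y n j \<omega>) + \<beta> n)) t
        = (CLINT \<omega>|M. iexp (t * ((\<Sum>j=1..n. Y n j \<omega>) + \<beta> n)))"
      unfolding char_def using Sm by (subst integral_distr) auto
    also have "\<dots> = (CLINT \<omega>|M. iexp (t * \<beta> n) * iexp (t * (\<Sum>j=1..n. Y n j \<omega>)))"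
      by (intro Bochner_Integration.integral_cong) (auto simp: exp_add[symmetric] algebra_simps)
    also have "\<dots> = iexp (t * \<beta> n) * char (distr M borel (\<lambda>\<omega>. \<Sum>j=1..n. Y n j \<omega>)) t"
      unfolding char_def using Sm by (subst integral_distr) auto
    also have "char (distr M borel (\<lambda>\<omega>. \<Sum>j=1..n. Y n j \<omega>)) t = (\<Prod>j=1..n. \<phi> n j)"
      unfolding \<phi>_def by (rule char_distr_sum) (rule indep)
    finally show ?thesis .
  qed
  have B0: "0 \<le> B n" if "1 \<le> n" for n
  proof -
    obtain \<omega> where "\<omega> \<in> space M" using not_empty by auto
    from bdd[OF _ this, of 1 n] that show ?thesis using abs_ge_zero[of "Y n 1 \<omega>"] by simp
  qed
  have intY: "integrable M (Y n j)" "integrable M (\<lambda>\<omega>. (Y n j \<omega>)\<^sup>2)" "integrable M (\<lambda>\<omega>. \<bar>Y n j \<omega>\<bar> ^ 3)"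
    if j: "j \<in> {1..n}" for n j
  proof -
    note [measurable] = Ym[OF j]
    show "integrable M (Y n j)" by (rule integrable_const_bound[where B="B n"], rule AE_I2, use bdd[OF j] in auto)
    show "integrable M (\<lambda>\<omega>. (Y n j \<omega>)\<^sup>2)"
      by (rule integrable_const_bound[where B="(B n)\<^sup>2"])
        (rule AE_I2, use bdd[OF j] B0[of n] j in \<open>auto simp: power2_le_iff_abs_le\<close>)
    show "integrable M (\<lambda>\<omega>. \<bar>Y n j \<omega>\<bar> ^ 3)"
      by (rule integrable_const_bound[where B="(B n) ^ 3"])
        (rule AE_I2, use bdd[OF j] in \<open>auto intro!: power_mono simp: power_abs\<close>)
  qed
  have V0: "0 \<le> V n" and VB: "V n \<le> (B n)\<^sup>2" if "1 \<le> n" for n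
  proof -
    have j: "1 \<in> {1..n}" using that by auto
    show "0 \<le> V n" using var[OF j] by (metis Bochner_Integration.integral_nonneg zero_le_power2)
    have "expectation (\<lambda>\<omega>. (Y n 1 \<omega>)\<^sup>2) \<le> expectation (\<lambda>_. (B n)\<^sup>2)"
      using intY(2)[OF j] bdd[OF j] B0[OF that]
      by (intro integral_mono) (auto simp: power2_le_iff_abs_le)
    then show "V n \<le> (B n)\<^sup>2" using var[OF j] prob_space by simp
  qed
  have each: "cmod (\<phi> n j - w n) \<le> \<bar>t\<bar> ^ 3 / 6 * B n * V n + t ^ 4 / 4 * (V n)\<^sup>2" if j: "j \<in> {1..n}" for n j
  proof -
    have n: "1 \<le> n" using j by auto
    note [measurable] = Ym[OF j]
    have 0: "cmod (\<phi> n j - (1 - t\<^sup>2 * V n / 2)) \<le>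
        (t\<^sup>2 / 6) * expectation (\<lambda>x. min (6 * (Y n j x)\<^sup>2) (\<bar>t\<bar> * \<bar>Y n j x\<bar> ^ 3))"
      unfolding \<phi>_def using intY[OF j] mean[OF j] var[OF j]
      by (intro char_approx3') auto
    have "expectation (\<lambda>x. min (6 * (Y n j x)\<^sup>2) (\<bar>t\<bar> * \<bar>Y n j x\<bar> ^ 3))
        \<le> expectation (\<lambda>x. \<bar>t\<bar> * (B n * (Y n j x)\<^sup>2))"
    proof (rule integral_mono)
      show "integrable M (\<lambda>x. min (6 * (Y n j x)\<^sup>2) (\<bar>t\<bar> * \<bar>Y n j x\<bar> ^ 3))"
        using intY[OF j] by (intro integrable_min) auto
      show "integrable M (\<lambda>x. \<bar>t\<bar> * (B n * (Y n j x)\<^sup>2))" using intY[OF j] by auto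
      fix \<omega> assume "\<omega> \<in> space M"
      then have "\<bar>Y n j \<omega>\<bar> * (Y n j \<omega>)\<^sup>2 \<le> B n * (Y n j \<omega>)\<^sup>2"
        using bdd[OF j] by (intro mult_right_mono) auto
      then have "\<bar>Y n j \<omega>\<bar> ^ 3 \<le> B n * (Y n j \<omega>)\<^sup>2" by (simp add: power3_eq_cube power2_eq_square)
      then have "\<bar>t\<bar> * \<bar>Y n j \<omega>\<bar> ^ 3 \<le> \<bar>t\<bar> * (B n * (Y n j \<omega>)\<^sup>2)" by (intro mult_left_mono) auto
      then show "min (6 * (Y n j \<omega>)\<^sup>2) (\<bar>t\<bar> * \<bar>Y n j \<omega>\<bar> ^ 3) \<le> \<bar>t\<bar> * (B n * (Y n j \<omega>)\<^sup>2)" by simp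
    qed
    also have "expectation (\<lambda>x. \<bar>t\<bar> * (B n * (Y n j x)\<^sup>2)) = \<bar>t\<bar> * (B n * V n)"
      using var[OF j] by simp
    finally have "(t\<^sup>2 / 6) * expectation (\<lambda>x. min (6 * (Y n j x)\<^sup>2) (\<bar>t\<bar> * \<bar>Y n j x\<bar> ^ 3))
        \<le> (t\<^sup>2 / 6) * (\<bar>t\<bar> * (B n * V n))"
      by (intro mult_left_mono) auto
    also have "\<dots> = \<bar>t\<bar> ^ 3 / 6 * B n * V n"
      by (simp add: power3_eq_cube power2_eq_square)
    finally have 1: "cmod (\<phi> n j - (1 - t\<^sup>2 * V n / 2)) \<le> \<bar>t\<bar> ^ 3 / 6 * B n * V n"
      using 0 by (rule order_trans[rotated])
    have "\<bar>(1 - t\<^sup>2 * V n / 2) - exp (- (t\<^sup>2 * V n / 2))\<bar> \<le> (t\<^sup>2 * V n / 2)\<^sup>2"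
      using V0[OF n] by (intro exp_minus_quadratic) auto
    also have "(t\<^sup>2 * V n / 2)\<^sup>2 = t ^ 4 / 4 * (V n)\<^sup>2"
      by (simp add: power_mult_distrib power_divide flip: power_mult)
    finally have "cmod (complex_of_real ((1 - t\<^sup>2 * V n / 2) - exp (- (t\<^sup>2 * V n / 2)))) \<le> t ^ 4 / 4 * (V n)\<^sup>2"
      by (simp only: norm_of_real)
    then have 2: "cmod ((1 - t\<^sup>2 * V n / 2) - w n) \<le> t ^ 4 / 4 * (V n)\<^sup>2"
      unfolding w_def by (simp add: of_real_diff)
    from norm_triangle_mono[OF 1 2] show ?thesis by simp
  qed
  have main: "cmod ((\<Prod>j=1..n. \<phi> n j) - (\<Prod>j=1..n. w n))
      \<le> \<bar>t\<bar> ^ 3 / 6 * B n * (real n * V n) + t ^ 4 / 4 * (real n * V n) * (B n)\<^sup>2" if n: "1 \<le> n" for n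
  proof -
    have "cmod ((\<Prod>j=1..n. \<phi> n j) - (\<Prod>j=1..n. w n)) \<le> (\<Sum>j=1..n. cmod (\<phi> n j - w n))"
    proof (rule norm_prod_diff)
      fix j assume j: "j \<in> {1..n}"
      interpret D: real_distribution "distr M borel (Y n j)"
        using Ym[OF j] by (intro real_distribution_distr)
      show "norm (\<phi> n j) \<le> 1" unfolding \<phi>_def by (rule D.cmod_char_le_1)
      show "norm (w n) \<le> 1" using V0[OF n] by (simp add: w_def)
    qed
    also have "\<dots> \<le> (\<Sum>j=1..n. \<bar>t\<bar> ^ 3 / 6 * B n * V n + t ^ 4 / 4 * (V n)\<^sup>2)"
      by (intro sum_mono each)
    also have "\<dots> = real n * (\<bar>t\<bar> ^ 3 / 6 * B n * V n + t ^ 4 / 4 * (V n * V n))"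
      by (simp add: power2_eq_square)
    also have "\<dots> \<le> real n * (\<bar>t\<bar> ^ 3 / 6 * B n * V n + t ^ 4 / 4 * (V n * (B n)\<^sup>2))"
      using VB[OF n] V0[OF n] by (intro mult_left_mono add_left_mono) auto
    finally show ?thesis by (simp add: algebra_simps)
  qed
  have "(\<lambda>n. \<bar>t\<bar> ^ 3 / 6 * B n * (real n * V n) + t ^ 4 / 4 * (real n * V n) * (B n)\<^sup>2) \<longlonglongrightarrow>
      \<bar>t\<bar> ^ 3 / 6 * 0 * v + t ^ 4 / 4 * v * 0\<^sup>2"
    by (intro tendsto_intros B V)
  then have "(\<lambda>n. \<bar>t\<bar> ^ 3 / 6 * B n * (real n * V n) + t ^ 4 / 4 * (real n * V n) * (B n)\<^sup>2) \<longlonglongrightarrow> 0"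
    by simp
  then have "(\<lambda>n. (\<Prod>j=1..n. \<phi> n j) - (\<Prod>j=1..n. w n)) \<longlonglongrightarrow> 0"
    by (rule Lim_null_comparison[rotated], intro eventually_sequentiallyI[of 1] main)
  moreover have "(\<lambda>n. \<Prod>j=1..n. w n) \<longlonglongrightarrow> complex_of_real (exp (- (t\<^sup>2 * v) / 2))"
  proof -
    have "(\<Prod>j=1..n. w n) = complex_of_real (exp (- (t\<^sup>2 * (real n * V n)) / 2))" for n
    proof -
      have *: "exp (- (t\<^sup>2 * V n / 2)) ^ n = exp (- (t\<^sup>2 * (real n * V n)) / 2)"
        by (subst exp_of_nat_mult[symmetric]) (simp add: field_simps)
      show ?thesis unfolding *[symmetric] by (simp add: w_def)
    qed
    moreover have "(\<lambda>n. complex_of_real (exp (- (t\<^sup>2 * (real n * V n)) / 2)))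
        \<longlonglongrightarrow> complex_of_real (exp (- (t\<^sup>2 * v) / 2))"
      by (intro tendsto_intros V) auto
    ultimately show ?thesis by simp
  qed
  ultimately have "(\<lambda>n. \<Prod>j=1..n. \<phi> n j) \<longlonglongrightarrow> complex_of_real (exp (- (t\<^sup>2 * v) / 2))"
    by (rule Lim_transform[rotated])
  then have "(\<lambda>n. iexp (t * \<beta> n) * (\<Prod>j=1..n. \<phi> n j))
      \<longlonglongrightarrow> iexp (t * b) * complex_of_real (exp (- (t\<^sup>2 * v) / 2))"
    by (intro tendsto_intros shift) 
  then show "(\<lambda>n. char (distr M borel (\<lambda>\<omega>. (\<Sum>j=1..n. Y n j \<omega>) + \<beta> n)) t)
      \<longlonglongrightarrow> char (normal_law b v) t"
    unfolding char_eq char_normal_law[OF v] .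
qed

text \<open>If \<open>P n\<close> fails somewhere on \<open>A n\<close>, let \<open>w n\<close> be
  a point of failure; the assumption applied to this sequence shows that this happens only for
  finitely many \<open>n\<close>. This turns a statement that is uniform in the sample point into
  statements about single sequences of data.\<close>

lemma eventually_Ball_if_sequences:
  fixes f :: "nat \<Rightarrow> 'b \<Rightarrow> real"
  assumes ne: "\<forall>\<^sub>F n in sequentially. A n \<noteq> {}"
    and seq: "\<And>w. \<forall>\<^sub>F n in sequentially. w n \<in> A n \<Longrightarrow> \<forall>\<^sub>F n in sequentially. P n (w n)"
  shows "\<forall>\<^sub>F n in sequentially. \<forall>\<omega>\<in>A n. P n \<omega>"
proof -
  define w where "w n = (if \<exists>x\<in>A n. \<not> P n x then SOME x. x \<in> A n \<and> \<not> P n x else SOME x. x \<in> A n)" for n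
  have w1: "w n \<in> A n" if "A n \<noteq> {}" for n
  proof (cases "\<exists>x\<in>A n. \<not> P n x")
    case True
    then have "\<exists>x. x \<in> A n \<and> \<not> P n x" by auto
    from someI_ex[OF this] True show ?thesis by (auto simp: w_def)
  next
    case False
    have "\<exists>x. x \<in> A n" using that by auto
    from someI_ex[OF this] False show ?thesis by (auto simp: w_def)
  qed
  have w2: "\<forall>x\<in>A n. P n x" if "P n (w n)" for n
  proof (rule ccontr)
    assume "\<not> ?thesis"
    then have *: "\<exists>x\<in>A n. \<not> P n x" by auto
    then have "\<exists>x. x \<in> A n \<and> \<not> P n x" by auto
    from someI_ex[OF this] * that show False by (auto simp: w_def)
  qed
  have "\<forall>\<^sub>F n in sequentially. P n (w n)"
    by (rule seq) (use ne w1 in \<open>auto elim!: eventually_mono\<close>)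
  then show ?thesis by eventually_elim (rule w2)
qed

section \<open>Compactly supported kernels and their moments\<close>

lemma cont_nth_deriv_at_2:
  assumes "\<And>u. cont_nth_deriv_at 2 k u"
  shows "(k has_real_derivative deriv k u) (at u)"
    and "(deriv k has_real_derivative deriv (deriv k) u) (at u)"
    and "isCont (deriv (deriv k)) u"
proof -
  have "\<forall>\<^sub>F x in nhds u. \<forall>i<2. (deriv ^^ i) k differentiable (at x)" and c: "isCont ((deriv ^^ 2) k) u"
    using assms[of u] unfolding cont_nth_deriv_at_def by auto
  then have *: "\<forall>i<2. (deriv ^^ i) k differentiable (at u)" by (auto dest: eventually_nhds_x_imp_x)
  show "(k has_real_derivative deriv k u) (at u)"
    using *[rule_format, of 0] by (simp add: DERIV_deriv_iff_real_differentiable)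
  show "(deriv k has_real_derivative deriv (deriv k) u) (at u)"
    using *[rule_format, of 1] by (simp add: DERIV_deriv_iff_real_differentiable)
  show "isCont (deriv (deriv k)) u" using c by (simp add: numeral_2_eq_2)
qed

text \<open>The support of a kernel is closed, so a vanishing statement for points outside it only
  yields \<open>1 < \<bar>u\<bar>\<close>; continuity adds the two end points.\<close>

lemma continuous_zero_outside_closed:
  fixes f :: "real \<Rightarrow> real"
  assumes "\<And>u. isCont f u" "\<And>u. 1 < \<bar>u\<bar> \<Longrightarrow> f u = 0" "1 \<le> \<bar>u\<bar>"
  shows "f u = 0"
proof -
  have "closed {u. f u = 0}"
    using assms(1) by (intro closed_Collect_eq continuous_on_const) (auto simp: continuous_at_imp_continuous_on)
  moreover have "{1<..} \<union> {..<-1} \<subseteq> {u. f u = 0}" using assms(2) by auto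
  ultimately have "closure ({1<..} \<union> {..<-1}) \<subseteq> {u. f u = 0}" by (rule closure_minimal[rotated])
  then have "{1..} \<union> {..-1} \<subseteq> {u. f u = 0}" by (simp add: closure_Un)
  then show ?thesis using assms(3) by (auto simp: abs_if split: if_splits)
qed

text \<open>The class of weight functions for which smoothing is studied: it contains a smoothing
  kernel, its first two derivatives, and the products of these with polynomials and with each
  other.\<close>

definition unit_kernel :: "(real \<Rightarrow> real) \<Rightarrow> bool" where
  "unit_kernel \<kappa> \<longleftrightarrow> continuous_on UNIV \<kappa> \<and> (\<forall>u. 1 \<le> \<bar>u\<bar> \<longrightarrow> \<kappa> u = 0)"

lemma unit_kernel_cont: "unit_kernel \<kappa> \<Longrightarrow> isCont \<kappa> u"
  by (auto simp: unit_kernel_def continuous_on_eq_continuous_at)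

lemma unit_kernel_measurable: "unit_kernel \<kappa> \<Longrightarrow> \<kappa> \<in> borel_measurable borel"
  by (auto simp: unit_kernel_def intro: borel_measurable_continuous_onI)

lemma unit_kernel_zero: "unit_kernel \<kappa> \<Longrightarrow> 1 \<le> \<bar>u\<bar> \<Longrightarrow> \<kappa> u = 0"
  by (auto simp: unit_kernel_def)

lemma unit_kernel_bounded:
  assumes "unit_kernel \<kappa>"
  shows "\<exists>C>0. \<forall>u. \<bar>\<kappa> u\<bar> \<le> C"
proof -
  have "compact (\<kappa> ` {-1..1})"
    using assms by (intro compact_continuous_image) (auto simp: unit_kernel_def intro: continuous_on_subset)
  then obtain C where C: "\<And>u. u \<in> {-1..1} \<Longrightarrow> \<bar>\<kappa> u\<bar> \<le> C"
    using compact_imp_bounded[THEN bounded_iff[THEN iffD1]] by (metis imageI real_norm_def)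
  have "\<bar>\<kappa> u\<bar> \<le> max C 1" for u
    using C[of u] unit_kernel_zero[OF assms, of u] by (cases "u \<in> {-1..1}") auto
  then show ?thesis by (intro exI[of _ "max C 1"]) auto
qed

lemma unit_kernel_mult:
  assumes "unit_kernel \<kappa>" "continuous_on UNIV p"
  shows "unit_kernel (\<lambda>u. p u * \<kappa> u)" "unit_kernel (\<lambda>u. \<kappa> u * p u)"
  using assms by (auto simp: unit_kernel_def intro!: continuous_intros)

lemma unit_kernel_bounded_integrable:
  fixes \<phi> :: "real \<Rightarrow> real"
  assumes \<kappa>: "unit_kernel \<kappa>" and \<phi>[measurable]: "\<phi> \<in> borel_measurable borel"
    and b: "\<And>u. \<bar>u\<bar> \<le> 1 \<Longrightarrow> \<bar>\<phi> u\<bar> \<le> B"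
  shows "integrable lborel (\<lambda>u. \<kappa> u * \<phi> u)"
proof -
  note [measurable] = unit_kernel_measurable[OF \<kappa>]
  obtain C where C: "C > 0" "\<And>u. \<bar>\<kappa> u\<bar> \<le> C" using unit_kernel_bounded[OF \<kappa>] by auto
  have B: "0 \<le> B" using b[of 0] by auto
  show ?thesis
  proof (rule Bochner_Integration.integrable_bound[where f="\<lambda>u. (C * B) * indicator {-1..1} u :: real"])
    show "AE u in lborel. norm (\<kappa> u * \<phi> u) \<le> norm ((C * B) * indicator {-1..1} u :: real)"
    proof (rule AE_I2)
      fix u
      show "norm (\<kappa> u * \<phi> u) \<le> norm ((C * B) * indicator {-1..1} u :: real)"
      proof (cases "\<bar>u\<bar> \<le> 1")
        case True
        then have "\<bar>\<kappa> u\<bar> * \<bar>\<phi> u\<bar> \<le> C * B" using C B b by (intro mult_mono) (auto intro: less_imp_le)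
        then show ?thesis using True C B by (auto simp: abs_mult indicator_def)
      next
        case False
        then show ?thesis using unit_kernel_zero[OF \<kappa>, of u] by simp
      qed
    qed
  qed (auto intro!: integrable_real_mult_indicator integrable_mult_right)
qed

lemma unit_kernel_integrable:
  assumes "unit_kernel \<kappa>" shows "integrable lborel \<kappa>"
  using unit_kernel_bounded_integrable[OF assms, of "\<lambda>_. 1" 1] by simp

lemma unit_kernel_integrable_power:
  assumes "unit_kernel \<kappa>" shows "integrable lborel (\<lambda>u. u ^ m * \<kappa> u)"
  by (intro unit_kernel_integrable unit_kernel_mult assms continuous_intros)

text \<open>This links a kernel estimator, a sum of values \<open>K ((s - T j) / h)\<close>, to
  the empirical distribution function: each summand is an integral of \<open>\<kappa>\<close>
  against the indicator of a half line.\<close>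

lemma unit_kernel_halfline:
  assumes \<kappa>: "unit_kernel \<kappa>" and D: "\<And>u. (K has_real_derivative \<kappa> u) (at u)"
    and K: "\<And>u. u \<le> -1 \<Longrightarrow> K u = 0"
  shows "(LBINT v. \<kappa> v * indicator {..x} v) = K x"
proof (cases "-1 \<le> x")
  case True
  have "(LBINT v. \<kappa> v * indicator {..x} v) = (LBINT v. \<kappa> v * indicator {-1..x} v)"
    using unit_kernel_zero[OF \<kappa>] by (intro Bochner_Integration.integral_cong) (auto simp: indicator_def)
  also have "\<dots> = K x - K (-1)"
    using True unit_kernel_cont[OF \<kappa>] D by (intro integral_FTC_Icc_real) (auto simp: has_real_derivative_iff_has_vector_derivative)
  finally show ?thesis using K by simp
next
  case False
  have "(LBINT v. \<kappa> v * indicator {..x} v) = (LBINT v::real. 0::real)"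
    using False unit_kernel_zero[OF \<kappa>] by (intro Bochner_Integration.integral_cong) (auto simp: indicator_def)
  then show ?thesis using False K by simp
qed

text \<open>Integration by parts without boundary terms; it reduces the moments of
  \<open>k'\<close> and \<open>k''\<close> to those of \<open>k\<close>.\<close>

lemma unit_kernel_parts:
  assumes \<kappa>: "unit_kernel \<kappa>" and K: "unit_kernel K" and D: "\<And>u. (K has_real_derivative \<kappa> u) (at u)"
  shows "(LBINT v. v ^ m * \<kappa> v) = - real m * (LBINT v. v ^ (m - 1) * K v)"
proof -
  define f where "f v = v ^ m * \<kappa> v + real m * (v ^ (m - 1) * K v)" for v
  have fu: "unit_kernel f" unfolding f_def
    using \<kappa> K by (auto simp: unit_kernel_def intro!: continuous_intros)
  have "((\<lambda>v. v ^ m * K v) has_real_derivative f v) (at v)" for v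
    unfolding f_def using D[of v] by (auto intro!: derivative_eq_intros)
  from unit_kernel_halfline[OF fu this, of 1]
  have "(LBINT v. f v * indicator {..1} v) = 0" using unit_kernel_zero[OF K] by auto
  also have "(LBINT v. f v * indicator {..1} v) = (LBINT v. f v)"
    using unit_kernel_zero[OF fu] by (intro Bochner_Integration.integral_cong) (auto simp: indicator_def)
  also have "\<dots> = (LBINT v. v ^ m * \<kappa> v) + real m * (LBINT v. v ^ (m - 1) * K v)"
    unfolding f_def using unit_kernel_integrable_power[OF \<kappa>] unit_kernel_integrable_power[OF K]
    by (subst Bochner_Integration.integral_add) auto
  finally show ?thesis by simp
qed

text \<open>All biases come from this estimate: a function that is close to a polynomial on the
  window \<open>[s - h, s + h]\<close> has a weighted average that is close to the corresponding
  combination of kernel moments.\<close>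

lemma unit_kernel_taylor:
  fixes \<phi> :: "real \<Rightarrow> real"
  assumes \<kappa>: "unit_kernel \<kappa>" and \<phi>[measurable]: "\<phi> \<in> borel_measurable borel"
    and h: "0 \<le> h"
    and close: "\<And>v. \<bar>v\<bar> \<le> 1 \<Longrightarrow> \<bar>\<phi> (s - h * v) - (\<Sum>m\<le>p. c m * (- (h * v)) ^ m)\<bar> \<le> e"
  shows "\<bar>(LBINT v. \<kappa> v * \<phi> (s - h * v)) - (\<Sum>m\<le>p. c m * (- h) ^ m * (LBINT v. v ^ m * \<kappa> v))\<bar>
    \<le> e * (LBINT v. \<bar>\<kappa> v\<bar>)"
proof -
  define q where "q v = (\<Sum>m\<le>p. c m * (- (h * v)) ^ m)" for v
  have qc: "continuous_on UNIV q" unfolding q_def by (intro continuous_intros)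
  have [measurable]: "q \<in> borel_measurable borel" by (intro borel_measurable_continuous_onI qc)
  define r where "r v = \<phi> (s - h * v) - q v" for v
  have [measurable]: "r \<in> borel_measurable borel" unfolding r_def by measurable
  have rb: "\<bar>r v\<bar> \<le> e" if "\<bar>v\<bar> \<le> 1" for v using close[OF that] by (simp add: r_def q_def)
  have e: "0 \<le> e" using rb[of 0] by simp
  have i1: "integrable lborel (\<lambda>v. \<kappa> v * r v)" by (rule unit_kernel_bounded_integrable[OF \<kappa> _ rb]) auto
  have i2: "integrable lborel (\<lambda>v. \<kappa> v * q v)" by (intro unit_kernel_integrable unit_kernel_mult \<kappa> qc)
  have "(LBINT v. \<kappa> v * \<phi> (s - h * v)) = (LBINT v. \<kappa> v * r v + \<kappa> v * q v)"
    by (intro Bochner_Integration.integral_cong) (auto simp: r_def algebra_simps)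
  also have "\<dots> = (LBINT v. \<kappa> v * r v) + (LBINT v. \<kappa> v * q v)" using i1 i2 by (rule Bochner_Integration.integral_add)
  also have "(LBINT v. \<kappa> v * q v) = (LBINT v. (\<Sum>m\<le>p. (c m * (- h) ^ m) * (v ^ m * \<kappa> v)))"
  proof (intro Bochner_Integration.integral_cong refl)
    fix v
    have "(- (h * v)) ^ m = (- h) ^ m * v ^ m" for m by (metis mult_minus_left power_mult_distrib)
    then show "\<kappa> v * q v = (\<Sum>m\<le>p. (c m * (- h) ^ m) * (v ^ m * \<kappa> v))"
      by (simp add: q_def sum_distrib_left algebra_simps)
  qed
  also have "\<dots> = (\<Sum>m\<le>p. c m * (- h) ^ m * (LBINT v. v ^ m * \<kappa> v))"
    by (subst Bochner_Integration.integral_sum) (auto intro!: unit_kernel_integrable_power \<kappa> simp: integrable_mult_right)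
  finally have "(LBINT v. \<kappa> v * \<phi> (s - h * v)) - (\<Sum>m\<le>p. c m * (- h) ^ m * (LBINT v. v ^ m * \<kappa> v))
      = (LBINT v. \<kappa> v * r v)" by simp
  also have "\<bar>\<dots>\<bar> \<le> (LBINT v. \<bar>\<kappa> v * r v\<bar>)" by (rule integral_abs_bound)
  also have "\<dots> \<le> (LBINT v. e * \<bar>\<kappa> v\<bar>)"
  proof (rule integral_mono)
    show "integrable lborel (\<lambda>v. \<bar>\<kappa> v * r v\<bar>)" using i1 by simp
    show "integrable lborel (\<lambda>v. e * \<bar>\<kappa> v\<bar>)" using unit_kernel_integrable[OF \<kappa>] by simp
    fix v :: real
    show "\<bar>\<kappa> v * r v\<bar> \<le> e * \<bar>\<kappa> v\<bar>"
    proof (cases "\<bar>v\<bar> \<le> 1")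
      case True
      from mult_right_mono[OF rb[OF this], of "\<bar>\<kappa> v\<bar>"] show ?thesis by (simp add: abs_mult mult.commute)
    next
      case False then show ?thesis using unit_kernel_zero[OF \<kappa>, of v] by simp
    qed
  qed
  finally show ?thesis by simp
qed

locale smoothing =
  fixes k :: "real \<Rightarrow> real"
  assumes kernel: "smoothing_kernel k"
begin

lemma k_nonneg: "0 \<le> k u" and k_int: "integrable lborel k" and k_one: "(LBINT u. k u) = 1"
  and k_supp: "closure {u. k u \<noteq> 0} = {-1..1}" and k_sym: "k (- u) = k u"
  using kernel unfolding smoothing_kernel_def by auto

lemma k_has_deriv: "(k has_real_derivative deriv k u) (at u)"
  and k1_has_deriv: "(deriv k has_real_derivative deriv (deriv k) u) (at u)"
  and k2_isCont: "isCont (deriv (deriv k)) u"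
  using cont_nth_deriv_at_2[of k] kernel unfolding smoothing_kernel_def by auto

lemma k_zero_open: "k u = 0" if "1 < \<bar>u\<bar>"
proof (rule ccontr)
  assume "k u \<noteq> 0"
  then have "u \<in> closure {u. k u \<noteq> 0}" using closure_subset[of "{u. k u \<noteq> 0}"] by auto
  then show False using that k_supp by auto
qed

lemma deriv_zero_open:
  assumes "\<And>u. 1 < \<bar>u\<bar> \<Longrightarrow> f u = (0::real)" "1 < \<bar>u\<bar>" "(f has_real_derivative d) (at u)"
  shows "d = 0"
proof -
  have "open ((\<lambda>u::real. \<bar>u\<bar>) -` {1<..})" by (intro open_vimage continuous_intros)
  then have "(f has_real_derivative 0) (at u)"
    by (rule has_field_derivative_transform_within_open[where f="\<lambda>_. 0", rotated]) (use assms in auto)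
  with assms(3) show ?thesis by (rule DERIV_unique)
qed

lemma k1_zero_open: "1 < \<bar>u\<bar> \<Longrightarrow> deriv k u = 0"
  by (rule deriv_zero_open[OF k_zero_open _ k_has_deriv])

lemma k2_zero_open: "1 < \<bar>u\<bar> \<Longrightarrow> deriv (deriv k) u = 0"
  by (rule deriv_zero_open[OF k1_zero_open _ k1_has_deriv])

lemma unit_kernel_k: "unit_kernel k"
  using continuous_zero_outside_closed[OF DERIV_isCont[OF k_has_deriv] k_zero_open] DERIV_isCont[OF k_has_deriv]
  unfolding unit_kernel_def by (auto simp: continuous_at_imp_continuous_on)

lemma unit_kernel_k1: "unit_kernel (deriv k)"
  using continuous_zero_outside_closed[OF DERIV_isCont[OF k1_has_deriv] k1_zero_open] DERIV_isCont[OF k1_has_deriv]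
  unfolding unit_kernel_def by (auto simp: continuous_at_imp_continuous_on)

lemma unit_kernel_k2: "unit_kernel (deriv (deriv k))"
  using continuous_zero_outside_closed[OF k2_isCont k2_zero_open] k2_isCont
  unfolding unit_kernel_def by (auto simp: continuous_at_imp_continuous_on)

lemma k_measurable[measurable]: "k \<in> borel_measurable borel" "deriv k \<in> borel_measurable borel"
    "deriv (deriv k) \<in> borel_measurable borel"
  using unit_kernel_k unit_kernel_k1 unit_kernel_k2 by (auto intro: unit_kernel_measurable)

lemma k_moment_1: "(LBINT v. v * k v) = 0"
proof -
  have "(LBINT v. v * k v) = (LBINT v. (- v) * k (- v))"
    using lborel_integral_real_affine[of "-1" "\<lambda>v. v * k v" 0] by simp
  also have "\<dots> = - (LBINT v. v * k v)" by (simp add: k_sym)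
  finally show ?thesis by simp
qed

lemma k_moment_2: "(LBINT v. v\<^sup>2 * k v) = m2 k" by (simp add: m2_def)

lemma k1_moment_0: "(LBINT v. deriv k v) = 0"
  and k1_moment_1: "(LBINT v. v * deriv k v) = -1"
  and k1_moment_2: "(LBINT v. v\<^sup>2 * deriv k v) = 0"
  and k1_moment_3: "(LBINT v. v ^ 3 * deriv k v) = - 3 * m2 k"
  using unit_kernel_parts[OF unit_kernel_k1 unit_kernel_k k_has_deriv, of 0] unit_kernel_parts[OF unit_kernel_k1 unit_kernel_k k_has_deriv, of 1]
    unit_kernel_parts[OF unit_kernel_k1 unit_kernel_k k_has_deriv, of 2] unit_kernel_parts[OF unit_kernel_k1 unit_kernel_k k_has_deriv, of 3]
  by (auto simp: k_one k_moment_1 k_moment_2)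

lemma k2_moment_0: "(LBINT v. deriv (deriv k) v) = 0"
  and k2_moment_1: "(LBINT v. v * deriv (deriv k) v) = 0"
  and k2_moment_2: "(LBINT v. v\<^sup>2 * deriv (deriv k) v) = 2"
  using unit_kernel_parts[OF unit_kernel_k2 unit_kernel_k1 k1_has_deriv, of 0] unit_kernel_parts[OF unit_kernel_k2 unit_kernel_k1 k1_has_deriv, of 1]
    unit_kernel_parts[OF unit_kernel_k2 unit_kernel_k1 k1_has_deriv, of 2]
  by (auto simp: k1_moment_0 k1_moment_1)

lemma k_pos_near: "a < b \<Longrightarrow> -1 \<le> a \<Longrightarrow> b \<le> 1 \<Longrightarrow> \<exists>u\<in>{a<..<b}. 0 < k u"
proof -
  assume ab: "a < b" "-1 \<le> a" "b \<le> 1"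
  then have "(a + b) / 2 \<in> closure {u. k u \<noteq> 0}" using k_supp by auto
  moreover have "open {a<..<b}" "(a + b) / 2 \<in> {a<..<b}" using ab by auto
  ultimately have "{a<..<b} \<inter> {u. k u \<noteq> 0} \<noteq> {}"
    using open_Int_closure_eq_empty by blast
  then show ?thesis using k_nonneg by (force simp: less_le)
qed

text \<open>A nonnegative function that is positive at one point of continuity dominates a
  positive multiple of the indicator of an interval.\<close>

lemma pos_integral:
  fixes f :: "real \<Rightarrow> real"
  assumes f: "\<And>u. 0 \<le> f u" "integrable lborel f" and x: "isCont f x" "0 < f (x::real)"
  shows "0 < (LBINT u. f u)"
proof -
  obtain d where d: "d > 0" "\<And>y. \<bar>y - x\<bar> < d \<Longrightarrow> \<bar>f y - f x\<bar> < f x / 2"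
    using x(1)[unfolded continuous_at_eps_delta, rule_format, of "f x / 2"] x(2) by (auto simp: dist_real_def)
  have "0 < f x / 2 * d" using x d by auto
  also have "\<dots> = (LBINT u. f x / 2 * indicator {x - d/2..x + d/2} u)"
    using d by simp
  also have "\<dots> \<le> (LBINT u. f u)"
  proof (rule integral_mono)
    show "integrable lborel (\<lambda>u. f x / 2 * indicator {x - d / 2..x + d / 2} u)"
      by (intro integrable_mult_right integrable_real_indicator) (auto simp: emeasure_lborel_Icc_eq)
    fix u show "f x / 2 * indicator {x - d / 2..x + d / 2} u \<le> f u"
    proof (cases "u \<in> {x - d / 2..x + d / 2}")
      case True
      then have "\<bar>u - x\<bar> < d" using d(1) by (auto simp: abs_less_iff)
      from d(2)[OF this] have "f x / 2 \<le> f u" by linarith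
      then show ?thesis using True by simp
    qed (use f(1) in auto)
  qed (rule f)
  finally show ?thesis .
qed

lemma m2_pos: "0 < m2 k"
proof -
  obtain u where u: "u \<in> {1/2<..<1}" "0 < k u" using k_pos_near[of "1/2" 1] by auto
  show ?thesis unfolding m2_def
    by (rule pos_integral[of _ u])
      (use u k_nonneg unit_kernel_integrable_power[OF unit_kernel_k] unit_kernel_cont[OF unit_kernel_k] in \<open>auto intro!: continuous_intros mult_pos_pos\<close>)
qed

text \<open>By the mean value theorem \<open>k'\<close> does not vanish identically, because
  \<open>k\<close> rises from zero at \<open>-1\<close> to a positive value.\<close>

lemma k1_sq_pos: "0 < (LBINT u. (deriv k u)\<^sup>2)"
proof -
  obtain u where u: "u \<in> {-1<..<1}" "0 < k u" using k_pos_near[of "-1" 1] by auto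
  have "\<exists>z>-1. z < u \<and> k u - k (-1) = (u - (-1)) * deriv k z"
    using u k_has_deriv by (intro MVT2) auto
  then obtain z where z: "k u = (u + 1) * deriv k z"
    using unit_kernel_zero[OF unit_kernel_k, of "-1"] by auto
  then have nz: "deriv k z \<noteq> 0" using u by auto
  have "unit_kernel (\<lambda>u. (deriv k u)\<^sup>2)"
    unfolding power2_eq_square using unit_kernel_k1 by (intro unit_kernel_mult) (auto simp: unit_kernel_def)
  then show ?thesis
    by (intro pos_integral[of _ z]) (use nz in \<open>auto intro: unit_kernel_integrable unit_kernel_cont\<close>)
qed

end

section \<open>Estimators as finite sums and the boundary kernel\<close>

text \<open>The observations that enter the empirical subdistribution function with status
  \<open>i\<close>. A negative inspection time has probability zero but may occur at a sample
  point, and then it is not counted.\<close>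

definition class_obs :: "nat \<Rightarrow> (nat \<Rightarrow> real) \<Rightarrow> (nat \<Rightarrow> nat) \<Rightarrow> nat \<Rightarrow> nat set" where
  "class_obs n T \<Delta> i = {j \<in> {1..n}. 0 \<le> T j \<and> \<Delta> j = i}"

lemma finite_class_obs[simp]: "finite (class_obs n T \<Delta> i)" and class_obs_nonneg: "j \<in> class_obs n T \<Delta> i \<Longrightarrow> 0 \<le> T j"
  by (auto simp: class_obs_def)

lemma emp_subdf_eq: "emp_subdf n T \<Delta> i v = (\<Sum>j\<in>class_obs n T \<Delta> i. indicator {..v} (T j)) / real n"
proof -
  have "(\<Sum>j=1..n. indicator ({0..v} \<times> {i}) (T j, \<Delta> j) :: real) = (\<Sum>j\<in>class_obs n T \<Delta> i. indicator {..v} (T j))"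
    unfolding class_obs_def
    by (subst sum.inter_filter[OF finite_atLeastAtMost], rule sum.cong[OF refl]) (auto simp: indicator_def)
  then show ?thesis by (simp add: emp_subdf_def)
qed

text \<open>Integrals with respect to \<open>interval_measure\<close> of a distribution function
  become integrals with respect to a known measure once one measure with that distribution
  function is exhibited.\<close>

lemma interval_measure_cdf:
  assumes "finite_borel_measure N" shows "interval_measure (cdf N) = N"
proof -
  interpret finite_borel_measure N by fact
  note F = cdf_nondecreasing cdf_is_right_cont cdf_lim_at_bot
  have fin: "finite_borel_measure (interval_measure (cdf N))"
    by (rule finite_borel_measure_interval_measure[OF F cdf_lim_at_top]) auto
  show ?thesis
    by (rule cdf_unique'[OF fin assms cdf_interval_measure[OF F]])
qed

text \<open>The finite measure with mass \<open>1 / n\<close> at each counted observation has the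
  empirical subdistribution function as its distribution function.\<close>

lemma integral_emp_subdf:
  fixes \<phi> :: "real \<Rightarrow> real"
  assumes \<phi>: "\<phi> \<in> borel_measurable borel"
  shows "(LINT u|interval_measure (emp_subdf n T \<Delta> i). \<phi> u) = (\<Sum>j\<in>class_obs n T \<Delta> i. \<phi> (T j)) / real n"
proof -
  let ?S = "class_obs n T \<Delta> i"
  define P where "P = density (count_space ?S) (\<lambda>_. ennreal (1 / real n))"
  define N where "N = distr P borel T"
  have [measurable]: "T \<in> borel_measurable P" by (simp add: P_def)
  have fin: "finite_measure P"
    by (rule finite_measureI) (simp add: P_def emeasure_density nn_integral_count_space_finite ennreal_mult_eq_top_iff)
  have fb: "finite_borel_measure N"
    unfolding finite_borel_measure_def finite_borel_measure_axioms_def N_def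
    using fin by (auto intro!: finite_measure.finite_measure_distr)
  have int: "(LINT u|N. f u) = (\<Sum>j\<in>?S. f (T j)) / real n" if "f \<in> borel_measurable borel" for f :: "real \<Rightarrow> real"
    unfolding N_def using that
    by (subst integral_distr) (auto simp: P_def integral_density lebesgue_integral_count_space_finite sum_divide_distrib)
  have "cdf N v = emp_subdf n T \<Delta> i v" for v
  proof -
    interpret finite_borel_measure N by fact
    have "cdf N v = (LINT u|N. indicator {..v} u)"
      using borel_UNIV by (simp add: cdf_def)
    also have "\<dots> = emp_subdf n T \<Delta> i v" by (subst int) (auto simp: emp_subdf_eq)
    finally show ?thesis .
  qed
  then have "cdf N = emp_subdf n T \<Delta> i" by auto
  with interval_measure_cdf[OF fb] int[OF \<phi>] show ?thesis by simp
qed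

context smoothing
begin

text \<open>The weight that an observation at \<open>u\<close> contributes to the estimate at
  \<open>s\<close>, with the three cases of the definition of the estimator put into one
  function.\<close>

definition obs_kernel :: "real \<Rightarrow> real \<Rightarrow> real \<Rightarrow> real" where
  "obs_kernel h s u = (if h < s then k ((s - u) / h) / h
     else if 0 \<le> s then boundary_kernel k (s / h) ((s - u) / h) / h else 0)"

lemma bmoment_measurable[measurable]: "bmoment k i \<in> borel_measurable borel"
proof -
  have "bmoment k i = (\<lambda>\<beta>. LBINT u. indicator {x. -1 \<le> fst x \<and> fst x \<le> snd x} (u, \<beta>) *\<^sub>R (u ^ i * k u))"
    unfolding bmoment_def set_lebesgue_integral_def
    by (auto intro!: Bochner_Integration.integral_cong ext simp: indicator_def)
  moreover have "\<dots> \<in> borel_measurable borel"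
    by measurable
  ultimately show ?thesis by simp
qed

lemma boundary_kernel_measurable:
  "(\<lambda>x. boundary_kernel k (fst x) (snd x)) \<in> borel_measurable (borel \<Otimes>\<^sub>M borel)"
proof -
  have "(\<lambda>x. boundary_kernel k (fst x) (snd x)) = (\<lambda>x. (bmoment k 2 (fst x) - bmoment k 1 (fst x) * snd x)
      / (bmoment k 0 (fst x) * bmoment k 2 (fst x) - (bmoment k 1 (fst x))\<^sup>2)
       * k (snd x) * (if -1 < snd x \<and> snd x < fst x then 1 else 0))"
    by (auto simp: boundary_kernel_def indicator_def)
  also have "\<dots> \<in> borel_measurable (borel \<Otimes>\<^sub>M borel)" by measurable
  finally show ?thesis .
qed

lemma obs_kernel_measurable: "(\<lambda>x. obs_kernel h (fst x) (snd x)) \<in> borel_measurable (borel \<Otimes>\<^sub>M borel)"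
proof -
  have "(\<lambda>x. (fst x / h, (fst x - snd x) / h)) \<in> (borel \<Otimes>\<^sub>M borel :: (real \<times> real) measure) \<rightarrow>\<^sub>M (borel \<Otimes>\<^sub>M borel)"
    by measurable
  from measurable_compose[OF this boundary_kernel_measurable]
  have [measurable]: "(\<lambda>x. boundary_kernel k (fst x / h) ((fst x - snd x) / h)) \<in> borel_measurable (borel \<Otimes>\<^sub>M borel)"
    by simp
  show ?thesis unfolding obs_kernel_def by measurable
qed

lemma obs_kernel_measurable'[measurable (raw)]:
  assumes "f \<in> borel_measurable M" "g \<in> borel_measurable M"
  shows "(\<lambda>x. obs_kernel h (f x) (g x)) \<in> borel_measurable M"
  using measurable_compose[OF measurable_Pair[OF assms] obs_kernel_measurable] by simp

lemma g_est_eq: "g_est k h n T \<Delta> i s = (\<Sum>j\<in>class_obs n T \<Delta> i. obs_kernel h s (T j)) / real n"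
proof -
  have "(LINT u|interval_measure (emp_subdf n T \<Delta> i). obs_kernel h s u) = (\<Sum>j\<in>class_obs n T \<Delta> i. obs_kernel h s (T j)) / real n"
    by (rule integral_emp_subdf) measurable
  moreover have "g_est k h n T \<Delta> i s = (LINT u|interval_measure (emp_subdf n T \<Delta> i). obs_kernel h s u)"
    by (auto simp: g_est_def obs_kernel_def[abs_def] scaled_def)
  ultimately show ?thesis by simp
qed

lemma bmoment_integrable: "set_integrable lborel {a..b} (\<lambda>u. u ^ i * k u)"
  unfolding set_integrable_def
  using unit_kernel_integrable_power[OF unit_kernel_k, of i] by (rule integrable_mult_indicator[rotated]) simp

text \<open>Both sides are integrals of \<open>(u - m)^2 k u\<close>, over \<open>[-1, 0]\<close>
  and over the larger interval \<open>[-1, \<beta>]\<close>.\<close>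

lemma quad_integral_le:
  assumes "0 \<le> \<beta>"
  shows "bmoment k 2 0 - 2 * m * bmoment k 1 0 + m\<^sup>2 * bmoment k 0 0
    \<le> bmoment k 2 \<beta> - 2 * m * bmoment k 1 \<beta> + m\<^sup>2 * bmoment k 0 \<beta>"
proof -
  have eq: "bmoment k 2 b - 2 * m * bmoment k 1 b + m\<^sup>2 * bmoment k 0 b = (LBINT u:{-1..b}. (u - m)\<^sup>2 * k u)"
    and int: "set_integrable lborel {-1..b} (\<lambda>u. (u - m)\<^sup>2 * k u)" for b
  proof -
    note i = bmoment_integrable[of "-1" b]
    have i': "set_integrable lborel {-1..b} (\<lambda>u. 2 * m * (u ^ 1 * k u))"
      "set_integrable lborel {-1..b} (\<lambda>u. m\<^sup>2 * (u ^ 0 * k u))"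
      by (rule set_integrable_mult_right, rule i)+
    have "(LBINT u:{-1..b}. (u - m)\<^sup>2 * k u) = (LBINT u:{-1..b}. u\<^sup>2 * k u - 2 * m * (u ^ 1 * k u) + m\<^sup>2 * (u ^ 0 * k u))"
      by (intro set_lebesgue_integral_cong) (auto simp: power2_eq_square algebra_simps)
    also have "\<dots> = (LBINT u:{-1..b}. u\<^sup>2 * k u) - (LBINT u:{-1..b}. 2 * m * (u ^ 1 * k u))
        + (LBINT u:{-1..b}. m\<^sup>2 * (u ^ 0 * k u))"
      using i[of 2] i' by (simp only: set_integral_add set_integral_diff)
    finally show "bmoment k 2 b - 2 * m * bmoment k 1 b + m\<^sup>2 * bmoment k 0 b = (LBINT u:{-1..b}. (u - m)\<^sup>2 * k u)"
      by (simp add: bmoment_def)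
    have "(\<lambda>u. (u - m)\<^sup>2 * k u) = (\<lambda>u. u\<^sup>2 * k u - 2 * m * (u ^ 1 * k u) + m\<^sup>2 * (u ^ 0 * k u))"
      by (auto simp: power2_eq_square algebra_simps)
    then show "set_integrable lborel {-1..b} (\<lambda>u. (u - m)\<^sup>2 * k u)"
      using i[of 2] i' by (simp only: set_integral_add set_integral_diff)
  qed
  show ?thesis unfolding eq
    unfolding set_lebesgue_integral_def
  proof (rule integral_mono)
    show "integrable lborel (\<lambda>x. indicat_real {-1..0} x *\<^sub>R ((x - m)\<^sup>2 * k x))"
      "integrable lborel (\<lambda>x. indicat_real {-1..\<beta>} x *\<^sub>R ((x - m)\<^sup>2 * k x))"
      using int by (auto simp: set_integrable_def)
  qed (use assms k_nonneg in \<open>auto simp: indicator_def\<close>)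
qed

lemma bmoment0_mono: "0 \<le> \<beta> \<Longrightarrow> bmoment k 0 0 \<le> bmoment k 0 \<beta>"
  unfolding bmoment_def set_lebesgue_integral_def
  using bmoment_integrable[of "-1" 0 0] bmoment_integrable[of "-1" \<beta> 0] k_nonneg
  by (intro integral_mono) (auto simp: set_integrable_def indicator_def)

text \<open>The left half of the kernel already has mass near points other than a given
  \<open>c\<close>; one zero of \<open>p\<close> is allowed so that \<open>p\<close> may be a
  squared distance from a mean.\<close>

lemma half_integral_pos:
  assumes p: "continuous_on UNIV p" "\<And>u. 0 \<le> p u" "\<exists>c. \<forall>u. u \<noteq> c \<longrightarrow> 0 < p (u::real)"
  shows "0 < (LBINT u:{-1..0}. p u * k u)"
proof -
  obtain c where c: "\<And>u. u \<noteq> c \<Longrightarrow> 0 < p u" using p(3) by auto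
  obtain u where u: "u \<in> {-1<..<0}" "0 < k u" "u \<noteq> c"
  proof (cases "c \<in> {-1<..<0}")
    case True
    then obtain u where "u \<in> {c<..<0}" "0 < k u" using k_pos_near[of c 0] by auto
    then show thesis using that[of u] True by auto
  next
    case False
    obtain u where "u \<in> {-1<..<0}" "0 < k u" using k_pos_near[of "-1" 0] by auto
    then show thesis using that[of u] False by auto
  qed
  have "unit_kernel (\<lambda>u. p u * k u)" by (intro unit_kernel_mult unit_kernel_k p)
  note c = unit_kernel_cont[OF this] unit_kernel_integrable[OF this]
  have nn: "0 \<le> p u * k u" for u using p k_nonneg by simp
  have pu: "0 < p u * k u" using u \<open>\<And>u. u \<noteq> c \<Longrightarrow> 0 < p u\<close> by simp
  show ?thesis unfolding set_lebesgue_integral_def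
  proof (rule pos_integral[of _ u])
    show "0 \<le> indicat_real {- 1..0} u *\<^sub>R (p u * k u)" for u using nn by (auto simp: indicator_def)
    show "integrable lborel (\<lambda>x. indicat_real {- 1..0} x *\<^sub>R (p x * k x))"
      by (rule integrable_mult_indicator[OF _ c(2)]) simp
    have "\<forall>\<^sub>F x in nhds u. x \<in> {-1<..<0}" using u by (intro eventually_nhds_in_open) auto
    then have "\<forall>\<^sub>F x in nhds u. indicat_real {- 1..0} x *\<^sub>R (p x * k x) = p x * k x"
      by eventually_elim (auto simp: indicator_def)
    then show "isCont (\<lambda>x. indicat_real {- 1..0} x *\<^sub>R (p x * k x)) u"
      using c(1)[of u] by (subst isCont_cong)
    show "0 < indicat_real {- 1..0} u *\<^sub>R (p u * k u)" using u pu by (auto simp: indicator_def)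
  qed
qed

text \<open>The denominator of the boundary kernel at the boundary point itself. It is the zeroth
  moment times the minimum over \<open>m\<close> of the integral of \<open>(u - m)^2 k u\<close>
  over \<open>[-1, 0]\<close>, hence positive.\<close>

definition boundary_det :: real where "boundary_det = bmoment k 0 0 * bmoment k 2 0 - (bmoment k 1 0)\<^sup>2"

lemma bmoment00_pos: "0 < bmoment k 0 0"
  using half_integral_pos[of "\<lambda>_. 1"] by (simp add: bmoment_def)

lemma boundary_det_pos: "0 < boundary_det"
proof -
  let ?m = "bmoment k 1 0 / bmoment k 0 0"
  have i: "set_integrable lborel {-1..0} (\<lambda>u. 2 * m * (u ^ 1 * k u))"
      "set_integrable lborel {-1..0} (\<lambda>u. m\<^sup>2 * (u ^ 0 * k u))" for m
    by (intro set_integrable_mult_right bmoment_integrable)+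
  have "0 < (LBINT u:{-1..0}. (u - ?m)\<^sup>2 * k u)"
    by (rule half_integral_pos) (auto intro!: continuous_intros exI[of _ ?m])
  also have "(LBINT u:{-1..0}. (u - ?m)\<^sup>2 * k u)
      = (LBINT u:{-1..0}. u\<^sup>2 * k u - 2 * ?m * (u ^ 1 * k u) + ?m\<^sup>2 * (u ^ 0 * k u))"
    by (intro set_lebesgue_integral_cong) (auto simp: power2_eq_square algebra_simps)
  also have "\<dots> = bmoment k 2 0 - 2 * ?m * bmoment k 1 0 + ?m\<^sup>2 * bmoment k 0 0"
    using i[of ?m] bmoment_integrable[of "-1" 0 2] by (simp only: set_integral_add set_integral_diff) (simp add: bmoment_def)
  also have "\<dots> = boundary_det / bmoment k 0 0"
    using bmoment00_pos by (simp add: boundary_det_def field_simps power2_eq_square)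
  finally show ?thesis using bmoment00_pos by (simp add: zero_less_divide_iff)
qed

text \<open>The denominator is \<open>bmoment k 0 \<beta>\<close> times the minimum over
  \<open>m\<close> of the integral of \<open>(u - m)^2 k u\<close> over \<open>[-1,
  \<beta>]\<close>. Both factors grow with \<open>\<beta>\<close>, so the smallest value is
  attained at \<open>\<beta> = 0\<close>; this bounds all boundary kernels at once.\<close>

lemma denominator_ge:
  assumes "0 \<le> \<beta>"
  shows "boundary_det \<le> bmoment k 0 \<beta> * bmoment k 2 \<beta> - (bmoment k 1 \<beta>)\<^sup>2"
proof -
  define m where "m = bmoment k 1 \<beta> / bmoment k 0 \<beta>"
  have p: "0 < bmoment k 0 \<beta>" using bmoment0_mono[OF assms] bmoment00_pos by simp
  have ge: "boundary_det \<le> bmoment k 0 0 * (bmoment k 2 0 - 2 * m * bmoment k 1 0 + m\<^sup>2 * bmoment k 0 0)"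
  proof -
    have "bmoment k 0 0 * (bmoment k 2 0 - 2 * m * bmoment k 1 0 + m\<^sup>2 * bmoment k 0 0) - boundary_det
        = (m * bmoment k 0 0 - bmoment k 1 0)\<^sup>2"
      unfolding boundary_det_def by (simp add: power2_eq_square algebra_simps)
    then show ?thesis using zero_le_power2[of "m * bmoment k 0 0 - bmoment k 1 0"] by linarith
  qed
  note ge also have "\<dots> \<le> bmoment k 0 0 * (bmoment k 2 \<beta> - 2 * m * bmoment k 1 \<beta> + m\<^sup>2 * bmoment k 0 \<beta>)"
    using quad_integral_le[OF assms, of m] bmoment00_pos by (intro mult_left_mono) auto
  also have "\<dots> \<le> bmoment k 0 \<beta> * (bmoment k 2 \<beta> - 2 * m * bmoment k 1 \<beta> + m\<^sup>2 * bmoment k 0 \<beta>)"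
  proof (rule mult_right_mono)
    have "0 < boundary_det / bmoment k 0 0" using boundary_det_pos bmoment00_pos by simp
    also have "\<dots> \<le> bmoment k 2 0 - 2 * m * bmoment k 1 0 + m\<^sup>2 * bmoment k 0 0"
      using ge bmoment00_pos by (simp add: field_simps)
    also note quad_integral_le[OF assms, of m]
    finally show "0 \<le> bmoment k 2 \<beta> - 2 * m * bmoment k 1 \<beta> + m\<^sup>2 * bmoment k 0 \<beta>" by simp
  qed (rule bmoment0_mono[OF assms])
  also have "\<dots> = bmoment k 0 \<beta> * bmoment k 2 \<beta> - (bmoment k 1 \<beta>)\<^sup>2"
    using p by (simp add: m_def field_simps power2_eq_square)
  finally show ?thesis .
qed

lemma bmoment_le_1: "\<bar>bmoment k i \<beta>\<bar> \<le> 1"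
proof -
  have "\<bar>bmoment k i \<beta>\<bar> \<le> (LBINT u. \<bar>indicator {-1..\<beta>} u *\<^sub>R (u ^ i * k u)\<bar>)"
    unfolding bmoment_def set_lebesgue_integral_def by (rule integral_abs_bound)
  also have "\<dots> \<le> (LBINT u. k u)"
  proof (rule integral_mono)
    show "integrable lborel (\<lambda>u. \<bar>indicat_real {- 1..\<beta>} u *\<^sub>R (u ^ i * k u)\<bar>)"
      using bmoment_integrable[of "-1" \<beta> i] by (simp add: set_integrable_def)
    fix u :: real
    have "\<bar>u ^ i * k u\<bar> \<le> k u"
    proof (cases "\<bar>u\<bar> \<le> 1")
      case True
      then have "\<bar>u\<bar> ^ i * k u \<le> 1 * k u" using k_nonneg by (intro mult_right_mono power_le_one) auto
      then show ?thesis using k_nonneg[of u] by (simp add: abs_mult power_abs)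
    next
      case False then show ?thesis using unit_kernel_zero[OF unit_kernel_k, of u] by simp
    qed
    then show "\<bar>indicat_real {- 1..\<beta>} u *\<^sub>R (u ^ i * k u)\<bar> \<le> k u"
      using k_nonneg[of u] by (auto simp: indicator_def)
  qed (rule k_int)
  finally show ?thesis by (simp add: k_one)
qed

definition kmax :: real where "kmax = (SOME C. 0 < C \<and> (\<forall>u. \<bar>k u\<bar> \<le> C \<and> \<bar>deriv k u\<bar> \<le> C))"

lemma kmax_pos: "0 < kmax" and k_le: "\<bar>k u\<bar> \<le> kmax" and k1_le: "\<bar>deriv k u\<bar> \<le> kmax"
proof -
  obtain C1 C2 where "C1 > 0" "\<And>u. \<bar>k u\<bar> \<le> C1" "\<And>u. \<bar>deriv k u\<bar> \<le> C2"
    using unit_kernel_bounded[OF unit_kernel_k] unit_kernel_bounded[OF unit_kernel_k1] by auto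
  then have "\<exists>C. 0 < C \<and> (\<forall>u. \<bar>k u\<bar> \<le> C \<and> \<bar>deriv k u\<bar> \<le> C)"
    by (intro exI[of _ "max C1 C2"]) (auto simp: le_max_iff_disj)
  from someI_ex[OF this] show "0 < kmax" "\<bar>k u\<bar> \<le> kmax" "\<bar>deriv k u\<bar> \<le> kmax"
    unfolding kmax_def by auto
qed

definition bmax :: real where "bmax = max kmax (2 * kmax / boundary_det)"

lemma boundary_kernel_le:
  assumes "0 \<le> \<beta>" shows "\<bar>boundary_kernel k \<beta> u\<bar> \<le> bmax"
proof (cases "-1 < u \<and> u < \<beta> \<and> u < 1")
  case True
  let ?D = "bmoment k 0 \<beta> * bmoment k 2 \<beta> - (bmoment k 1 \<beta>)\<^sup>2"
  have D: "0 < boundary_det" "boundary_det \<le> ?D" using boundary_det_pos denominator_ge[OF assms] by auto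
  have "\<bar>bmoment k 1 \<beta>\<bar> * \<bar>u\<bar> \<le> 1 * 1" using bmoment_le_1 True by (intro mult_mono) auto
  then have N: "\<bar>bmoment k 2 \<beta> - bmoment k 1 \<beta> * u\<bar> \<le> 2"
    using bmoment_le_1[of 2 \<beta>] by (auto simp: abs_mult[symmetric])
  have "\<bar>boundary_kernel k \<beta> u\<bar> = \<bar>bmoment k 2 \<beta> - bmoment k 1 \<beta> * u\<bar> / ?D * \<bar>k u\<bar>"
    using True D by (simp add: boundary_kernel_def abs_mult)
  also have "\<dots> \<le> 2 / boundary_det * kmax"
    using N D k_le kmax_pos by (intro mult_mono frac_le) auto
  finally show ?thesis by (simp add: bmax_def)
next
  case False
  then have "boundary_kernel k \<beta> u = 0"
    using unit_kernel_zero[OF unit_kernel_k, of u] by (auto simp: boundary_kernel_def indicator_def)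
  then show ?thesis using kmax_pos by (simp add: bmax_def)
qed

lemma bmax_pos: "0 < bmax" using kmax_pos by (simp add: bmax_def)

lemma obs_kernel_le: "0 < h \<Longrightarrow> \<bar>obs_kernel h s u\<bar> \<le> bmax / h"
  using k_le[of "(s - u) / h"] boundary_kernel_le[of "s / h"] bmax_pos
  by (auto simp: obs_kernel_def abs_divide bmax_def intro!: divide_right_mono)

text \<open>The estimate in the boundary region only sees observations in \<open>(0, 2 h]\<close>.
  An observation at zero has no weight because the boundary kernel is cut off on the open interval
  \<open>(-1, \<beta>)\<close>.\<close>

lemma obs_kernel_zero:
  assumes "0 < h" "0 \<le> u" "s \<le> h" "2 * h < u \<or> u = 0"
  shows "obs_kernel h s u = 0"
  using assms unit_kernel_zero[OF unit_kernel_k, of "(s - u) / h"]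
  by (auto simp: obs_kernel_def boundary_kernel_def indicator_def field_simps)

lemma obs_kernel_nonneg: "0 < h \<Longrightarrow> h < s \<Longrightarrow> 0 \<le> obs_kernel h s u"
  using k_nonneg by (simp add: obs_kernel_def)

end

section \<open>Estimators as averages of the empirical subdistribution functions\<close>

lemma emp_subdf_measurable[measurable]: "emp_subdf n T \<Delta> i \<in> borel_measurable borel"
proof -
  have "emp_subdf n T \<Delta> i = (\<lambda>v. (\<Sum>j\<in>class_obs n T \<Delta> i. if T j \<le> v then 1 else 0) / real n)"
    by (rule ext, unfold emp_subdf_eq, rule arg_cong2[where f="(/)"], rule sum.cong) (auto simp: indicator_def)
  also have "\<dots> \<in> borel_measurable borel" by measurable
  finally show ?thesis .
qed

lemma emp_subdf_bounds: "0 \<le> emp_subdf n T \<Delta> i v" "emp_subdf n T \<Delta> i v \<le> 1"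
proof -
  show "0 \<le> emp_subdf n T \<Delta> i v" by (auto simp: emp_subdf_eq intro!: divide_nonneg_nonneg sum_nonneg)
  have "(\<Sum>j\<in>class_obs n T \<Delta> i. indicator {..v} (T j)) \<le> (\<Sum>j\<in>class_obs n T \<Delta> i. 1::real)"
    by (intro sum_mono) (auto simp: indicator_def)
  also have "\<dots> \<le> (\<Sum>j=1..n. 1::real)" by (intro sum_mono2) (auto simp: class_obs_def)
  finally show "emp_subdf n T \<Delta> i v \<le> 1" by (cases "n = 0") (auto simp: emp_subdf_eq)
qed

text \<open>Integration by parts for kernel sums: a sum over observations with weights
  \<open>K\<close> is the average of the empirical subdistribution function with weights
  \<open>K'\<close>. It makes all smoothed quantities continuous functionals of the empirical
  subdistribution function in the supremum norm.\<close>

lemma unit_kernel_average: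
  assumes \<kappa>: "unit_kernel \<kappa>" and D: "\<And>u. (K has_real_derivative \<kappa> u) (at u)"
    and K: "\<And>u. u \<le> -1 \<Longrightarrow> K u = 0" and h: "0 < h"
  shows "(\<Sum>j\<in>class_obs n T \<Delta> i. K ((s - T j) / h)) / real n = (LBINT v. \<kappa> v * emp_subdf n T \<Delta> i (s - h * v))"
proof -
  have ii: "integrable lborel (\<lambda>v. \<kappa> v * indicator {..x} v)" for x
    by (rule unit_kernel_bounded_integrable[OF \<kappa>, of _ 1]) (auto simp: indicator_def)
  have "(LBINT v. \<kappa> v * emp_subdf n T \<Delta> i (s - h * v))
      = (LBINT v. (\<Sum>j\<in>class_obs n T \<Delta> i. \<kappa> v * indicator {..(s - T j) / h} v) / real n)"
    unfolding emp_subdf_eq using h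
    by (intro Bochner_Integration.integral_cong refl)
      (auto simp: sum_distrib_left indicator_def field_simps intro!: sum.cong)
  also have "\<dots> = (LBINT v. (\<Sum>j\<in>class_obs n T \<Delta> i. \<kappa> v * indicator {..(s - T j) / h} v)) / real n"
    by (rule integral_divide_zero)
  also have "(LBINT v. (\<Sum>j\<in>class_obs n T \<Delta> i. \<kappa> v * indicator {..(s - T j) / h} v))
      = (\<Sum>j\<in>class_obs n T \<Delta> i. LBINT v. \<kappa> v * indicator {..(s - T j) / h} v)"
    by (rule Bochner_Integration.integral_sum) (rule ii)
  also have "\<dots> = (\<Sum>j\<in>class_obs n T \<Delta> i. K ((s - T j) / h))"
    by (rule sum.cong[OF refl unit_kernel_halfline[OF \<kappa> D K]])
  finally show ?thesis by simp
qed

context smoothing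
begin

lemma g_est_interior: "h < s \<Longrightarrow> g_est k h n T \<Delta> i s = (\<Sum>j\<in>class_obs n T \<Delta> i. k ((s - T j) / h)) / real n / h"
  by (simp add: g_est_eq obs_kernel_def sum_divide_distrib mult.commute)

lemma g_est_emp:
  assumes "0 < h" "h < s"
  shows "g_est k h n T \<Delta> i s = (LBINT v. deriv k v * emp_subdf n T \<Delta> i (s - h * v)) / h"
  using assms unit_kernel_zero[OF unit_kernel_k]
  by (simp add: g_est_interior unit_kernel_average[OF unit_kernel_k1 k_has_deriv])

lemma g_est_has_derivative:
  assumes "0 < h" "h < s"
  shows "(g_est k h n T \<Delta> i has_real_derivative (\<Sum>j\<in>class_obs n T \<Delta> i. deriv k ((s - T j) / h)) / real n / h\<^sup>2) (at s)"
proof -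
  have "((\<lambda>s. (\<Sum>j\<in>class_obs n T \<Delta> i. k ((s - T j) / h)) / real n / h) has_real_derivative
      (\<Sum>j\<in>class_obs n T \<Delta> i. deriv k ((s - T j) / h) * (1 / h)) / real n / h) (at s)"
    using assms by (intro DERIV_cdivide DERIV_sum DERIV_chain2[OF k_has_deriv]) (auto intro!: derivative_eq_intros)
  also have "(\<Sum>j\<in>class_obs n T \<Delta> i. deriv k ((s - T j) / h) * (1 / h)) / real n / h
      = (\<Sum>j\<in>class_obs n T \<Delta> i. deriv k ((s - T j) / h)) / real n / h\<^sup>2"
    by (simp add: sum_divide_distrib[symmetric] power2_eq_square mult.commute)
  finally show ?thesis
    by (rule has_field_derivative_transform_within_open[of _ _ _ "{h<..}"])
      (use assms in \<open>auto simp: g_est_interior\<close>)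
qed

lemma g_est_deriv_interior:
  assumes "0 < h" "h < s"
  shows "g_est_deriv k h n T \<Delta> i s = (\<Sum>j\<in>class_obs n T \<Delta> i. deriv k ((s - T j) / h)) / real n / h\<^sup>2"
  unfolding g_est_deriv_def by (rule DERIV_imp_deriv[OF g_est_has_derivative[OF assms]])

lemma g_est_deriv_has: "0 < h \<Longrightarrow> h < s \<Longrightarrow> (g_est k h n T \<Delta> i has_real_derivative g_est_deriv k h n T \<Delta> i s) (at s)"
  using g_est_has_derivative g_est_deriv_interior by simp

lemma g_est_deriv_emp:
  assumes "0 < h" "h < s"
  shows "g_est_deriv k h n T \<Delta> i s = (LBINT v. deriv (deriv k) v * emp_subdf n T \<Delta> i (s - h * v)) / h\<^sup>2"
  using assms unit_kernel_zero[OF unit_kernel_k1]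
  by (simp add: g_est_deriv_interior unit_kernel_average[OF unit_kernel_k2 k1_has_deriv])

lemma g_est_nonneg: "0 < h \<Longrightarrow> h < s \<Longrightarrow> 0 \<le> g_est k h n T \<Delta> i s"
  unfolding g_est_eq by (intro divide_nonneg_nonneg sum_nonneg obs_kernel_nonneg) auto

lemma g_est_measurable[measurable]: "g_est k h n T \<Delta> i \<in> borel_measurable borel"
proof -
  have "(\<lambda>s. g_est k h n T \<Delta> i s) \<in> borel_measurable borel" unfolding g_est_eq by measurable
  then show ?thesis by simp
qed

lemma g_est_le:
  assumes h: "0 < h" shows "\<bar>g_est k h n T \<Delta> i s\<bar> \<le> bmax / h"
proof -
  have "\<bar>\<Sum>j\<in>class_obs n T \<Delta> i. obs_kernel h s (T j)\<bar> \<le> (\<Sum>j\<in>class_obs n T \<Delta> i. bmax / h)"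
    using obs_kernel_le[OF h] by (intro order_trans[OF sum_abs sum_mono]) auto
  also have "\<dots> \<le> (\<Sum>j=1..n. bmax / h)" using bmax_pos h by (intro sum_mono2) (auto simp: class_obs_def)
  finally show ?thesis using bmax_pos h
    by (cases "n = 0") (auto simp: g_est_eq field_simps)
qed

text \<open>Near zero the estimator may be of order \<open>1 / h\<close>, but it only involves the
  observations in \<open>(0, 2 h]\<close>, and the proportion of these is small.\<close>

lemma g_est_boundary_le:
  assumes h: "0 < h" and s: "s \<le> h"
  shows "\<bar>g_est k h n T \<Delta> i s\<bar> \<le> bmax / h * emp_subdf n T \<Delta> i (2 * h)"
proof -
  have "\<bar>\<Sum>j\<in>class_obs n T \<Delta> i. obs_kernel h s (T j)\<bar> \<le> (\<Sum>j\<in>class_obs n T \<Delta> i. bmax / h * indicator {..2 * h} (T j))"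
  proof (intro order_trans[OF sum_abs sum_mono])
    fix j assume "j \<in> class_obs n T \<Delta> i"
    then show "\<bar>obs_kernel h s (T j)\<bar> \<le> bmax / h * indicator {..2 * h} (T j)"
      using obs_kernel_le[OF h, of s "T j"] obs_kernel_zero[OF h, of "T j" s] s class_obs_nonneg[of j n T \<Delta> i]
      by (auto simp: indicator_def)
  qed
  also have "\<dots> = bmax / h * (\<Sum>j\<in>class_obs n T \<Delta> i. indicator {..2 * h} (T j))"
    by (simp add: sum_distrib_left)
  finally have "\<bar>\<Sum>j\<in>class_obs n T \<Delta> i. obs_kernel h s (T j)\<bar> / real n
      \<le> bmax / h * (\<Sum>j\<in>class_obs n T \<Delta> i. indicator {..2 * h} (T j)) / real n"
    by (rule divide_right_mono) simp
  then show ?thesis by (simp add: g_est_eq emp_subdf_eq)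
qed

lemma g_est_integrable:
  assumes h: "0 < h" shows "set_integrable lborel {a..b} (g_est k h n T \<Delta> i)"
proof -
  have "set_integrable lborel {a..b} (\<lambda>_. bmax / h)"
    unfolding set_integrable_def by (intro integrable_scaleR_left integrable_real_indicator) (auto simp: emeasure_lborel_Icc_eq)
  then show ?thesis
    by (rule set_integrable_bound) (use g_est_le[OF h] bmax_pos h in \<open>auto simp: set_borel_measurable_def\<close>)
qed

lemma G_est_diff:
  assumes h: "0 < h" and s: "0 \<le> s" "s \<le> v"
  shows "G_est k h n T \<Delta> i v - G_est k h n T \<Delta> i s = (LBINT u:{s<..v}. g_est k h n T \<Delta> i u)"
proof -
  have "{0..v} = {0..s} \<union> {s<..v}" using s by auto
  then have "G_est k h n T \<Delta> i v = G_est k h n T \<Delta> i s + (LBINT u:{s<..v}. g_est k h n T \<Delta> i u)"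
    unfolding G_est_def
    by (simp, intro set_integral_Un set_integrable_subset[OF g_est_integrable[OF h, of s v]] g_est_integrable[OF h]) auto
  then show ?thesis by simp
qed

lemma set_integral_abs_le_const:
  fixes f :: "real \<Rightarrow> real"
  assumes f: "set_integrable lborel {s..v} f" and b: "\<And>u. s < u \<Longrightarrow> u \<le> v \<Longrightarrow> \<bar>f u\<bar> \<le> B" and sv: "s \<le> v"
  shows "\<bar>LBINT u:{s<..v}. f u\<bar> \<le> B * (v - s)"
proof -
  have f': "set_integrable lborel {s<..v} f" by (rule set_integrable_subset[OF f]) auto
  have "\<bar>LBINT u:{s<..v}. f u\<bar> \<le> (LBINT u:{s<..v}. \<bar>f u\<bar>)"
    using f' unfolding set_lebesgue_integral_def set_integrable_def
    by (intro order_trans[OF integral_abs_bound]) (auto simp: abs_mult)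
  also have "\<dots> \<le> (LBINT u:{s<..v}. B)"
  proof (rule set_integral_mono[OF set_integrable_abs[OF f']])
    show "set_integrable lborel {s<..v} (\<lambda>_. B)"
      unfolding set_integrable_def using sv by (intro integrable_scaleR_left integrable_real_indicator) auto
  qed (use b in auto)
  also have "\<dots> = B * (v - s)" using sv by (simp add: set_lebesgue_integral_def)
  finally show ?thesis .
qed

lemma G_est_lipschitz:
  assumes h: "0 < h" and s: "0 \<le> s" "s \<le> v"
  shows "\<bar>G_est k h n T \<Delta> i v - G_est k h n T \<Delta> i s\<bar> \<le> bmax / h * (v - s)"
  unfolding G_est_diff[OF assms]
  by (rule set_integral_abs_le_const[OF g_est_integrable[OF h]]) (use g_est_le[OF h] s in auto)

lemma G_est_continuous:
  assumes h: "0 < h" shows "continuous_on {0..} (G_est k h n T \<Delta> i)"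
proof (rule continuous_onI)
  fix s e :: real assume s: "s \<in> {0..}" and e: "0 < e"
  have B: "0 < bmax / h" using bmax_pos h by simp
  show "\<exists>d>0. \<forall>v\<in>{0..}. dist v s < d \<longrightarrow> dist (G_est k h n T \<Delta> i v) (G_est k h n T \<Delta> i s) \<le> e"
  proof (intro exI conjI ballI impI)
    show "0 < e / (bmax / h)" using e B by (rule divide_pos_pos)
    fix v assume v: "v \<in> {0..}" "dist v s < e / (bmax / h)"
    then have "bmax / h * \<bar>v - s\<bar> \<le> e" using B bmax_pos h by (simp add: dist_real_def field_simps)
    then show "dist (G_est k h n T \<Delta> i v) (G_est k h n T \<Delta> i s) \<le> e"
      using G_est_lipschitz[OF h, of s v n T \<Delta> i] G_est_lipschitz[OF h, of v s n T \<Delta> i] s v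
      by (cases "s \<le> v") (auto simp: dist_real_def abs_minus_commute)
  qed
qed

text \<open>The bound of order \<open>1 / h\<close> is integrated over an interval of length at
  most \<open>h\<close>, so the contribution of the boundary region is controlled by the
  proportion of observations in it.\<close>

lemma G_est_boundary:
  assumes h: "0 < h" and v: "0 \<le> v" "v \<le> h"
  shows "\<bar>G_est k h n T \<Delta> i h - G_est k h n T \<Delta> i v\<bar> \<le> bmax * emp_subdf n T \<Delta> i (2 * h)"
proof -
  have "\<bar>G_est k h n T \<Delta> i h - G_est k h n T \<Delta> i v\<bar> \<le> bmax / h * emp_subdf n T \<Delta> i (2 * h) * (h - v)"
    unfolding G_est_diff[OF assms]
    by (rule set_integral_abs_le_const[OF g_est_integrable[OF h] _ v(2)]) (use g_est_boundary_le[OF h] in auto)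
  also have "\<dots> \<le> bmax / h * emp_subdf n T \<Delta> i (2 * h) * h"
    using v bmax_pos h emp_subdf_bounds(1) by (intro mult_left_mono mult_nonneg_nonneg) auto
  finally show ?thesis using h by simp
qed

lemma k_antiderivative: "\<exists>K. (\<forall>u. (K has_real_derivative k u) (at u)) \<and> (\<forall>u\<le>-1. K u = 0)"
proof -
  have "\<exists>F. \<forall>x. (-\<infinity>::ereal) < ereal x \<longrightarrow> ereal x < \<infinity> \<longrightarrow> (F has_vector_derivative k x) (at x)"
    by (rule einterval_antiderivative) (auto intro: unit_kernel_cont[OF unit_kernel_k])
  then obtain F where F0: "\<forall>x. (-\<infinity>::ereal) < ereal x \<longrightarrow> ereal x < \<infinity> \<longrightarrow> (F has_vector_derivative k x) (at x)"
    by blast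
  have F: "(F has_real_derivative k x) (at x)" for x
    using F0[rule_format, of x] by (simp add: has_real_derivative_iff_has_vector_derivative)
  have "F u - F (-1) = 0" if "u \<le> -1" for u
  proof (cases "u = -1")
    case False
    have "\<exists>z>u. z < -1 \<and> F (-1) - F u = (-1 - u) * k z"
      using that False F by (intro MVT2) auto
    then show ?thesis using unit_kernel_zero[OF unit_kernel_k] by auto
  qed auto
  moreover have "((\<lambda>u. F u - F (-1)) has_real_derivative k u) (at u)" for u
  proof -
    have "((\<lambda>u. F u - F (-1)) has_real_derivative k u - 0) (at u)"
      by (rule DERIV_diff[OF F DERIV_const])
    then show ?thesis by simp
  qed
  ultimately show ?thesis
    by (intro exI[of _ "\<lambda>u. F u - F (-1)"] conjI allI impI)
qed

text \<open>To the right of the boundary region the integrated estimator is itself a kernel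
  average: with an antiderivative \<open>K\<close> of \<open>k\<close>, it has the same increments
  as the sum of the \<open>K ((v - T j) / h)\<close>.\<close>

lemma G_est_interior:
  assumes h: "0 < h" and s: "h \<le> s" "s \<le> v"
  shows "G_est k h n T \<Delta> i v - G_est k h n T \<Delta> i s
    = (LBINT w. k w * (emp_subdf n T \<Delta> i (v - h * w) - emp_subdf n T \<Delta> i (s - h * w)))"
proof -
  obtain K where K: "\<And>u. (K has_real_derivative k u) (at u)" "\<And>u. u \<le> -1 \<Longrightarrow> K u = 0"
    using k_antiderivative by auto
  define \<Phi> where "\<Phi> v = (\<Sum>j\<in>class_obs n T \<Delta> i. K ((v - T j) / h)) / real n" for v
  have D: "(\<Phi> has_real_derivative (\<Sum>j\<in>class_obs n T \<Delta> i. k ((v - T j) / h) * (1 / h)) / real n) (at v)" for v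
    unfolding \<Phi>_def using h by (intro DERIV_cdivide DERIV_sum DERIV_chain2[OF K(1)]) (auto intro!: derivative_eq_intros)
  define p where "p v = (\<Sum>j\<in>class_obs n T \<Delta> i. k ((v - T j) / h) * (1 / h)) / real n" for v
  have pc: "isCont p v" for v
  proof (rule DERIV_isCont)
    show "(p has_real_derivative
      (\<Sum>j\<in>class_obs n T \<Delta> i. deriv k ((v - T j) / h) * (1 / h) * (1 / h)) / real n) (at v)"
      unfolding p_def using h by (intro DERIV_cdivide DERIV_sum DERIV_cmult_right DERIV_chain2[OF k_has_deriv]) (auto intro!: derivative_eq_intros)
  qed
  have [measurable]: "p \<in> borel_measurable borel"
    by (intro borel_measurable_continuous_onI continuous_at_imp_continuous_on) (auto intro: pc)
  have "(LBINT u:{s<..v}. g_est k h n T \<Delta> i u) = (LBINT u:{s<..v}. p u)"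
    using s h by (intro set_lebesgue_integral_cong) (auto simp: p_def g_est_interior sum_divide_distrib mult.commute)
  also have "\<dots> = (LBINT u. p u * indicator {s..v} u)"
    unfolding set_lebesgue_integral_def
  proof (intro integral_cong_AE)
    have "AE u in lborel. u \<noteq> s" by (rule AE_lborel_singleton)
    then show "AE u in lborel. indicat_real {s<..v} u *\<^sub>R p u = p u * indicat_real {s..v} u"
      by eventually_elim (auto simp: indicator_def)
  qed measurable
  also have "\<dots> = \<Phi> v - \<Phi> s" by (rule integral_FTC_Icc_real) (use s D[folded p_def] pc in \<open>auto simp: has_real_derivative_iff_has_vector_derivative\<close>)
  also have "\<dots> = (LBINT w. k w * emp_subdf n T \<Delta> i (v - h * w)) - (LBINT w. k w * emp_subdf n T \<Delta> i (s - h * w))"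
    unfolding \<Phi>_def by (simp add: unit_kernel_average[OF unit_kernel_k K h])
  also have "\<dots> = (LBINT w. k w * emp_subdf n T \<Delta> i (v - h * w) - k w * emp_subdf n T \<Delta> i (s - h * w))"
    using emp_subdf_bounds[of n T \<Delta> i]
    by (intro Bochner_Integration.integral_diff[symmetric] unit_kernel_bounded_integrable[OF unit_kernel_k, where B=1]) auto
  also have "\<dots> = (LBINT w. k w * (emp_subdf n T \<Delta> i (v - h * w) - emp_subdf n T \<Delta> i (s - h * w)))"
    by (simp add: algebra_simps)
  finally show ?thesis using G_est_diff[OF h, of s v] s h by simp
qed

lemma G_est_has_derivative:
  assumes h: "0 < h" and s: "h < s"
  shows "(G_est k h n T \<Delta> i has_real_derivative g_est k h n T \<Delta> i s) (at s)"
proof -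
  have "isCont (g_est k h n T \<Delta> i) v" if "h < v" for v
    by (rule DERIV_isCont[OF g_est_has_derivative[OF h that]])
  then have c: "continuous_on {h<..} (g_est k h n T \<Delta> i)"
    by (auto intro!: continuous_at_imp_continuous_on)
  define h' where "h' = (h + s) / 2"
  have h': "h < h'" "h' < s" using s by (auto simp: h'_def)
  have "((\<lambda>v. integral {h'..v} (g_est k h n T \<Delta> i)) has_real_derivative g_est k h n T \<Delta> i s) (at s within {h'..s + 1})"
    by (rule integral_has_real_derivative) (use c h' in \<open>auto intro: continuous_on_subset\<close>)
  moreover have "at s within {h'..s + 1} = at s"
    using h' by (intro at_within_interior) auto
  ultimately have A: "((\<lambda>v. G_est k h n T \<Delta> i h' + integral {h'..v} (g_est k h n T \<Delta> i)) has_real_derivative g_est k h n T \<Delta> i s) (at s)"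
    by (auto intro!: derivative_eq_intros)
  have B: "G_est k h n T \<Delta> i h' + integral {h'..v} (g_est k h n T \<Delta> i) = G_est k h n T \<Delta> i v" if "h' < v" for v
  proof -
    have "(LBINT u:{h'<..v}. g_est k h n T \<Delta> i u) = (LBINT u:{h'..v}. g_est k h n T \<Delta> i u)"
      unfolding set_lebesgue_integral_def
    proof (intro integral_cong_AE)
      have "AE u in lborel. u \<noteq> h'" by (rule AE_lborel_singleton)
      then show "AE u in lborel. indicat_real {h'<..v} u *\<^sub>R g_est k h n T \<Delta> i u = indicat_real {h'..v} u *\<^sub>R g_est k h n T \<Delta> i u"
        by eventually_elim (auto simp: indicator_def)
    qed measurable
    also have "\<dots> = integral {h'..v} (g_est k h n T \<Delta> i)"
      by (rule set_borel_integral_eq_integral(2)[OF g_est_integrable[OF h]])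
    finally show ?thesis using G_est_diff[OF h, of h' v n T \<Delta> i] h' h that by simp
  qed
  show ?thesis
    by (rule has_field_derivative_transform_within_open[OF A, of "{h'<..}"]) (use h' B in auto)
qed

lemma G_est_tot_eq:
  assumes "0 < h"
  shows "G_est_tot k h n T \<Delta> v = G_est k h n T \<Delta> 0 v + G_est k h n T \<Delta> 1 v"
  unfolding G_est_tot_def G_est_def g_est_tot_def
  using g_est_integrable[OF assms] by (intro set_integral_add) auto

end

section \<open>Taylor expansion and supporting lines\<close>

text \<open>Taylor's theorem with the remainder measured by the oscillation of the last
  derivative, so that continuity of that derivative suffices for an error
  \<open>o(\<bar>x\<bar>^p)\<close>.\<close>

lemma taylor_pointwise:
  fixes D :: "nat \<Rightarrow> real \<Rightarrow> real"
  assumes D: "\<And>m u. m < p \<Longrightarrow> \<bar>u - t\<bar> < \<rho> \<Longrightarrow> (D m has_real_derivative D (Suc m) u) (at u)"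
    and near: "\<bar>s - t\<bar> + \<bar>x\<bar> < \<rho>"
    and osc: "\<And>y. \<bar>y - s\<bar> \<le> \<bar>x\<bar> \<Longrightarrow> \<bar>D p y - D p s\<bar> \<le> \<eta>"
    and p: "0 < p"
  shows "\<bar>D 0 (s + x) - (\<Sum>m\<le>p. D m s / fact m * x ^ m)\<bar> \<le> \<eta> * \<bar>x\<bar> ^ p"
proof (cases "x = 0")
  case True
  have "(\<Sum>m\<le>p. D m s / fact m * x ^ m) = D 0 s"
    using True by (simp add: sum.atMost_shift power_0_left)
  then show ?thesis using True p by (simp add: power_0_left)
next
  case False
  have "\<exists>y. (if s + x < s then s + x < y \<and> y < s else s < y \<and> y < s + x) \<and>
      D 0 (s + x) = (\<Sum>m<p. D m s / fact m * ((s + x) - s) ^ m) + D p y / fact p * ((s + x) - s) ^ p"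
    by (rule Taylor[where a="s - \<bar>x\<bar>" and b="s + \<bar>x\<bar>"]) (use p False D near in \<open>auto intro!: D\<close>)
  then obtain y where y0: "if s + x < s then s + x < y \<and> y < s else s < y \<and> y < s + x"
    and y2: "D 0 (s + x) = (\<Sum>m<p. D m s / fact m * ((s + x) - s) ^ m) + D p y / fact p * ((s + x) - s) ^ p"
    by blast
  have y1: "\<bar>y - s\<bar> \<le> \<bar>x\<bar>" using y0 by (auto split: if_splits)
  have y: "\<bar>y - s\<bar> \<le> \<bar>x\<bar>"
    "D 0 (s + x) = (\<Sum>m<p. D m s / fact m * x ^ m) + D p y / fact p * x ^ p"
    using y1 y2 by simp_all
  have "D 0 (s + x) - (\<Sum>m\<le>p. D m s / fact m * x ^ m) = (D p y - D p s) / fact p * x ^ p"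
    unfolding y(2) by (simp add: lessThan_Suc_atMost[symmetric] diff_divide_distrib algebra_simps)
  also have "\<bar>\<dots>\<bar> = \<bar>D p y - D p s\<bar> / fact p * \<bar>x\<bar> ^ p" by (simp add: abs_mult power_abs)
  also have "\<dots> \<le> \<eta> / 1 * \<bar>x\<bar> ^ p"
    using osc[OF y(1)] osc[of s] by (intro mult_right_mono frac_le) auto
  finally show ?thesis by simp
qed

text \<open>The half plane above a supporting line is convex, so it contains the hull, and the
  hull cannot pass below the curve at the point of contact.\<close>

lemma lower_hull_on_curve:
  assumes s: "s \<in> A" and sup: "\<And>v. v \<in> A \<Longrightarrow> b s + p * (a v - a s) \<le> b v"
  shows "lower_hull ((\<lambda>t. (a t, b t)) ` A) (a s) = (b s :: real)"
proof -
  let ?S = "(\<lambda>t. (a t, b t)) ` A"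
  let ?H = "{z. b s + p * (fst z - a s) \<le> snd z}"
  have "convex ?H"
  proof -
    have "?H = {z. inner (- p, 1) z \<ge> b s - p * a s}" by (auto simp: inner_prod_def algebra_simps)
    then show ?thesis by (simp add: convex_halfspace_ge)
  qed
  then have "convex hull ?S \<subseteq> ?H" by (intro hull_minimal) (use sup in auto)
  then have ge: "b s \<le> y" if "(a s, y) \<in> convex hull ?S" for y using that by fastforce
  have "(a s, b s) \<in> convex hull ?S" using s by (intro hull_inc) auto
  then show ?thesis unfolding lower_hull_def using ge by (intro cInf_eq_minimum) auto
qed

text \<open>Supporting lines at all points of an arc make the hull follow that arc. A difference
  quotient of the hull at \<open>a s\<close> then lies between the slopes \<open>\<Phi>\<close> at
  the two points of the curve, and continuity of \<open>\<Phi>\<close> at \<open>s\<close> yields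
  the limit.\<close>

lemma right_slope_hull:
  fixes a b \<Phi> :: "real \<Rightarrow> real"
  assumes I: "{l<..<r} \<subseteq> A" and s: "s \<in> {l<..<r}"
    and a: "\<And>u v. l < u \<Longrightarrow> u < v \<Longrightarrow> v < r \<Longrightarrow> a u < a v" and ac: "continuous_on {l<..<r} a"
    and mono: "\<And>u v. l < u \<Longrightarrow> u \<le> v \<Longrightarrow> v < r \<Longrightarrow> \<Phi> u \<le> \<Phi> v" and c: "isCont \<Phi> s"
    and sup: "\<And>u v. u \<in> {l<..<r} \<Longrightarrow> v \<in> A \<Longrightarrow> b u + \<Phi> u * (a v - a u) \<le> b v"
  shows "right_slope (lower_hull ((\<lambda>t. (a t, b t)) ` A)) (a s) = \<Phi> s"
proof -
  let ?H = "lower_hull ((\<lambda>t. (a t, b t)) ` A)"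
  have H: "?H (a u) = b u" if "u \<in> {l<..<r}" for u
    using that I sup by (intro lower_hull_on_curve) auto
  have "((\<lambda>y. (?H y - ?H (a s)) / (y - a s)) \<longlongrightarrow> \<Phi> s) (at_right (a s))"
  proof (rule tendstoI)
    fix e :: real assume e: "0 < e"
    obtain d where d: "d > 0" "\<And>u. \<bar>u - s\<bar> < d \<Longrightarrow> \<bar>\<Phi> u - \<Phi> s\<bar> < e"
      using c[unfolded continuous_at_eps_delta, rule_format, OF e] by (auto simp: dist_real_def)
    define v where "v = s + min (d / 2) ((r - s) / 2)"
    have v: "s < v" "v < r" "\<bar>v - s\<bar> < d" using s d by (auto simp: v_def min_def field_simps)
    have av: "a s < a v" using a[of s v] s v by auto
    have "dist ((?H y - ?H (a s)) / (y - a s)) (\<Phi> s) < e" if y: "a s < y" "y < a v" for y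
    proof -
      have "\<exists>w\<ge>s. w \<le> v \<and> a w = y"
        using y s v by (intro IVT') (auto intro: continuous_on_subset[OF ac])
      then obtain w where w: "s \<le> w" "w \<le> v" "a w = y" by auto
      have wI: "w \<in> {l<..<r}" using w s v by auto
      have A: "w \<in> A" "s \<in> A" using wI I s by auto
      have 1: "b s + \<Phi> s * (y - a s) \<le> b w" using sup[OF s A(1)] w by simp
      have 2: "b w + \<Phi> w * (a s - y) \<le> b s" using sup[OF wI A(2)] w by simp
      have "\<Phi> w \<le> \<Phi> v" using mono[of w v] w wI v by auto
      also have "\<dots> < \<Phi> s + e" using d(2)[OF v(3)] by auto
      finally have 3: "\<Phi> w < \<Phi> s + e" .
      have "(?H y - ?H (a s)) / (y - a s) = (b w - b s) / (y - a s)" using H[OF s] H[OF wI] w by simp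
      moreover have "\<Phi> s \<le> (b w - b s) / (y - a s)" using 1 y by (simp add: field_simps)
      moreover have "(b w - b s) / (y - a s) \<le> \<Phi> w" using 2 y by (simp add: field_simps)
      ultimately show ?thesis using 3 unfolding dist_real_def by linarith
    qed
    then show "\<forall>\<^sub>F y in at_right (a s). dist ((?H y - ?H (a s)) / (y - a s)) (\<Phi> s) < e"
      using av by (auto simp: eventually_at_right_field)
  qed
  then show ?thesis unfolding right_slope_def by (intro tendsto_Lim) auto
qed

section \<open>Uniform consistency near the point of interest\<close>

text \<open>The properties of the limit model that the deterministic arguments use: \<open>Gs
  i\<close> is the limiting subdistribution function of the observation times with status
  \<open>i\<close>, and \<open>D i m\<close> is the derivative of order \<open>m\<close> of its
  density near \<open>t\<close>. The inequalities \<open>cross\<close> express that the ratio of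
  the increments of \<open>Gs 1\<close> and of \<open>Gs 0 + Gs 1\<close> over an interval is a
  mean value of \<open>F0\<close>, and \<open>slope_pos\<close> that \<open>F0\<close> has a
  positive derivative at \<open>t\<close>, written as the numerator of the derivative of \<open>D
  1 0 / (D 0 0 + D 1 0)\<close>.\<close>

locale target = smoothing k for k +
  fixes Gs :: "nat \<Rightarrow> real \<Rightarrow> real" and D :: "nat \<Rightarrow> nat \<Rightarrow> real \<Rightarrow> real" and F0 :: "real \<Rightarrow> real" and t \<rho> :: real
  assumes \<rho>: "0 < \<rho>" "\<rho> \<le> t"
    and Gs_D: "\<And>i u. i \<le> 1 \<Longrightarrow> \<bar>u - t\<bar> < \<rho> \<Longrightarrow> (Gs i has_real_derivative D i 0 u) (at u)"
    and D_D: "\<And>i m u. i \<le> 1 \<Longrightarrow> m < 3 \<Longrightarrow> \<bar>u - t\<bar> < \<rho> \<Longrightarrow> (D i m has_real_derivative D i (Suc m) u) (at u)"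
    and D_cont: "\<And>i. i \<le> 1 \<Longrightarrow> isCont (D i 3) t"
    and D_meas: "\<And>i. i \<le> 1 \<Longrightarrow> D i 0 \<in> borel_measurable borel"
    and Gs_mono: "\<And>i x y. i \<le> 1 \<Longrightarrow> x \<le> y \<Longrightarrow> Gs i x \<le> Gs i y"
    and Gs_bd: "\<And>i x. i \<le> 1 \<Longrightarrow> 0 \<le> Gs i x \<and> Gs i x \<le> 1"
    and Gs_0: "\<And>i. i \<le> 1 \<Longrightarrow> (Gs i \<longlongrightarrow> 0) (at_right 0)"
    and F0_mono: "\<And>x y. x \<le> y \<Longrightarrow> F0 x \<le> F0 y" and F0_bd: "\<And>x. 0 \<le> F0 x \<and> F0 x \<le> 1"
    and F0_strict: "\<And>x y. \<bar>x - t\<bar> < \<rho> \<Longrightarrow> \<bar>y - t\<bar> < \<rho> \<Longrightarrow> x < y \<Longrightarrow> F0 x < F0 y"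
    and cross: "\<And>x y. x \<le> y \<Longrightarrow> F0 x * ((Gs 0 y + Gs 1 y) - (Gs 0 x + Gs 1 x)) \<le> Gs 1 y - Gs 1 x"
      "\<And>x y. x \<le> y \<Longrightarrow> Gs 1 y - Gs 1 x \<le> F0 y * ((Gs 0 y + Gs 1 y) - (Gs 0 x + Gs 1 x))"
    and ratio: "\<And>u. \<bar>u - t\<bar> < \<rho> \<Longrightarrow> D 1 0 u = F0 u * (D 0 0 u + D 1 0 u)"
    and D_pos: "\<And>i. i \<le> 1 \<Longrightarrow> 0 < D i 0 t"
    and slope_pos: "0 < D 0 0 t * D 1 1 t - D 0 1 t * D 1 0 t"
begin

lemma Gs_meas[measurable]: "i \<le> 1 \<Longrightarrow> Gs i \<in> borel_measurable borel"
  using Gs_mono by (intro borel_measurable_mono) (auto simp: mono_def)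

lemma D_isCont: "i \<le> 1 \<Longrightarrow> m < 3 \<Longrightarrow> \<bar>u - t\<bar> < \<rho> \<Longrightarrow> isCont (D i m) u"
  by (rule DERIV_isCont[OF D_D])

lemma D_uniform:
  assumes i: "i \<le> 1" and \<eta>: "0 < \<eta>"
  obtains \<delta> where "0 < \<delta>" "\<delta> \<le> \<rho> / 4"
    "\<And>s y. \<bar>s - t\<bar> \<le> \<rho> / 2 \<Longrightarrow> \<bar>y - s\<bar> \<le> \<delta> \<Longrightarrow> \<bar>D i 1 y - D i 1 s\<bar> \<le> \<eta>"
proof -
  have "continuous_on (cball t (3 * \<rho> / 4)) (D i 1)"
    using D_isCont[OF i, of 1] \<rho>
    by (auto intro!: continuous_at_imp_continuous_on simp: dist_real_def abs_minus_commute)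
  then have "uniformly_continuous_on (cball t (3 * \<rho> / 4)) (D i 1)"
    by (rule compact_uniformly_continuous) simp
  then obtain d where d: "d > 0" "\<And>x y. x \<in> cball t (3 * \<rho> / 4) \<Longrightarrow> y \<in> cball t (3 * \<rho> / 4) \<Longrightarrow> dist y x < d \<Longrightarrow>
      dist (D i 1 y) (D i 1 x) < \<eta>"
    using \<eta> unfolding uniformly_continuous_on_def by metis
  show thesis
  proof (rule that[of "min (d / 2) (\<rho> / 4)"])
    fix s y assume s: "\<bar>s - t\<bar> \<le> \<rho> / 2" and y: "\<bar>y - s\<bar> \<le> min (d / 2) (\<rho> / 4)"
    then have "\<bar>y - t\<bar> \<le> 3 * \<rho> / 4" "\<bar>s - t\<bar> \<le> 3 * \<rho> / 4" "\<bar>y - s\<bar> < d" using \<rho> d(1) by linarith+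
    then show "\<bar>D i 1 y - D i 1 s\<bar> \<le> \<eta>"
      using d(2)[of s y] by (auto simp: dist_real_def abs_minus_commute)
  qed (use d \<rho> in auto)
qed

text \<open>A second order expansion of the limiting subdistribution function, uniformly in
  \<open>s\<close> near \<open>t\<close>. With \<open>\<kappa> = k'\<close> only the linear term
  survives and gives the density, with \<open>\<kappa> = k''\<close> only the quadratic one, which
  gives its derivative.\<close>

lemma smoothed_Gs:
  assumes i: "i \<le> 1" and s: "\<bar>s - t\<bar> \<le> \<rho> / 2" and h: "0 < h" "h \<le> \<rho> / 4"
    and osc: "\<And>y. \<bar>y - s\<bar> \<le> h \<Longrightarrow> \<bar>D i 1 y - D i 1 s\<bar> \<le> \<eta>" and \<kappa>: "unit_kernel \<kappa>"
  shows "\<bar>(LBINT v. \<kappa> v * Gs i (s - h * v))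
     - (Gs i s * (LBINT v. \<kappa> v) - D i 0 s * h * (LBINT v. v * \<kappa> v) + D i 1 s / 2 * h\<^sup>2 * (LBINT v. v\<^sup>2 * \<kappa> v))\<bar>
     \<le> \<eta> * h\<^sup>2 * (LBINT v. \<bar>\<kappa> v\<bar>)"
proof -
  define E where "E m = (case m of 0 \<Rightarrow> Gs i | Suc m \<Rightarrow> D i m)" for m
  have "\<bar>(LBINT v. \<kappa> v * Gs i (s - h * v)) - (\<Sum>m\<le>2. E m s / fact m * (- h) ^ m * (LBINT v. v ^ m * \<kappa> v))\<bar>
    \<le> \<eta> * h\<^sup>2 * (LBINT v. \<bar>\<kappa> v\<bar>)"
  proof (rule unit_kernel_taylor[OF \<kappa>])
    fix v :: real assume v: "\<bar>v\<bar> \<le> 1"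
    have x: "\<bar>- (h * v)\<bar> \<le> h" using v h by (simp add: abs_mult mult_left_le)
    have "\<bar>E 0 (s + - (h * v)) - (\<Sum>m\<le>2. E m s / fact m * (- (h * v)) ^ m)\<bar> \<le> \<eta> * \<bar>- (h * v)\<bar> ^ 2"
    proof (rule taylor_pointwise[where t=t and \<rho>=\<rho>])
      fix m :: nat and u assume m: "m < 2" and u: "\<bar>u - t\<bar> < \<rho>"
      show "(E m has_real_derivative E (Suc m) u) (at u)"
        using Gs_D[OF i u] D_D[OF i _ u, of "m - 1"] m by (cases m) (auto simp: E_def)
    next
      show "\<bar>s - t\<bar> + \<bar>- (h * v)\<bar> < \<rho>" using s x h \<rho> by linarith
      fix y assume "\<bar>y - s\<bar> \<le> \<bar>- (h * v)\<bar>"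
      then show "\<bar>E 2 y - E 2 s\<bar> \<le> \<eta>" using osc[of y] x by (simp add: E_def numeral_2_eq_2)
    qed simp
    also have "\<dots> \<le> \<eta> * h ^ 2"
      using x osc[of s] h by (intro mult_left_mono power_mono) auto
    finally show "\<bar>Gs i (s - h * v) - (\<Sum>m\<le>2. E m s / fact m * (- (h * v)) ^ m)\<bar> \<le> \<eta> * h\<^sup>2"
      by (simp add: E_def)
  qed (use i h in auto)
  then show ?thesis by (simp add: E_def numeral_2_eq_2 algebra_simps)
qed

lemma kernel_emp_error:
  assumes i: "i \<le> 1" and \<kappa>: "unit_kernel \<kappa>" and h: "0 \<le> h"
    and e: "\<And>v. \<bar>emp_subdf n T \<Delta> i v - Gs i v\<bar> \<le> e"
  shows "\<bar>(LBINT v. \<kappa> v * emp_subdf n T \<Delta> i (s - h * v)) - (LBINT v. \<kappa> v * Gs i (s - h * v))\<bar>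
    \<le> e * (LBINT v. \<bar>\<kappa> v\<bar>)"
proof -
  note [measurable] = Gs_meas[OF i]
  have "(LBINT v. \<kappa> v * emp_subdf n T \<Delta> i (s - h * v)) - (LBINT v. \<kappa> v * Gs i (s - h * v))
     = (LBINT v. \<kappa> v * emp_subdf n T \<Delta> i (s - h * v) - \<kappa> v * Gs i (s - h * v))"
    using emp_subdf_bounds[of n T \<Delta> i] Gs_bd[OF i]
    by (intro Bochner_Integration.integral_diff[symmetric] unit_kernel_bounded_integrable[OF \<kappa>, where B=1])
      (auto simp: abs_le_iff intro: order_trans[of _ 0])
  also have "\<dots> = (LBINT v. \<kappa> v * (\<lambda>u. emp_subdf n T \<Delta> i u - Gs i u) (s - h * v)) - (\<Sum>m\<le>(0::nat). 0 * (- h) ^ m * (LBINT v. v ^ m * \<kappa> v))"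
    by (simp add: algebra_simps)
  also have "\<bar>\<dots>\<bar> \<le> e * (LBINT v. \<bar>\<kappa> v\<bar>)"
    by (rule unit_kernel_taylor[OF \<kappa>]) (use e h in auto)
  finally show ?thesis .
qed

text \<open>The estimator divides an average of the empirical subdistribution function by
  \<open>h\<close>, its derivative by \<open>h^2\<close>; this is why the uniform error
  \<open>e\<close> has to be small compared with \<open>h^2\<close>.\<close>

lemma g_est_close:
  assumes i: "i \<le> 1" and s: "\<bar>s - t\<bar> \<le> \<rho> / 2" and h: "0 < h" "h \<le> \<rho> / 4"
    and osc: "\<And>y. \<bar>y - s\<bar> \<le> h \<Longrightarrow> \<bar>D i 1 y - D i 1 s\<bar> \<le> \<eta>"
    and e: "\<And>v. \<bar>emp_subdf n T \<Delta> i v - Gs i v\<bar> \<le> e"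
  shows "\<bar>g_est k h n T \<Delta> i s - D i 0 s\<bar> \<le> (e / h + \<eta> * h) * (LBINT v. \<bar>deriv k v\<bar>)"
    and "\<bar>g_est_deriv k h n T \<Delta> i s - D i 1 s\<bar> \<le> (e / h\<^sup>2 + \<eta>) * (LBINT v. \<bar>deriv (deriv k) v\<bar>)"
proof -
  have hs: "h < s" using s h \<rho> by linarith
  let ?I = "\<lambda>\<kappa>. (LBINT v. \<kappa> v * emp_subdf n T \<Delta> i (s - h * v))"
  have "\<bar>?I (deriv k) - D i 0 s * h\<bar> \<le> e * (LBINT v. \<bar>deriv k v\<bar>) + \<eta> * h\<^sup>2 * (LBINT v. \<bar>deriv k v\<bar>)"
    using kernel_emp_error[OF i unit_kernel_k1 less_imp_le[OF h(1)] e, of s] smoothed_Gs[OF i s h osc unit_kernel_k1]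
    unfolding k1_moment_0 k1_moment_1 k1_moment_2 by simp
  then have "\<bar>?I (deriv k) - D i 0 s * h\<bar> / h \<le> (e * (LBINT v. \<bar>deriv k v\<bar>) + \<eta> * h\<^sup>2 * (LBINT v. \<bar>deriv k v\<bar>)) / h"
    using h by (intro divide_right_mono) auto
  also have "\<dots> = (e / h + \<eta> * h) * (LBINT v. \<bar>deriv k v\<bar>)"
    using h by (simp add: field_simps power2_eq_square)
  also have "\<bar>?I (deriv k) - D i 0 s * h\<bar> / h = \<bar>(?I (deriv k) - D i 0 s * h) / h\<bar>" using h by simp
  also have "(?I (deriv k) - D i 0 s * h) / h = g_est k h n T \<Delta> i s - D i 0 s"
    using h by (simp add: g_est_emp[OF h(1) hs] field_simps)
  finally show "\<bar>g_est k h n T \<Delta> i s - D i 0 s\<bar> \<le> (e / h + \<eta> * h) * (LBINT v. \<bar>deriv k v\<bar>)" .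
  let ?k2 = "deriv (deriv k)"
  have "\<bar>?I ?k2 - D i 1 s * h\<^sup>2\<bar> \<le> e * (LBINT v. \<bar>?k2 v\<bar>) + \<eta> * h\<^sup>2 * (LBINT v. \<bar>?k2 v\<bar>)"
    using kernel_emp_error[OF i unit_kernel_k2 less_imp_le[OF h(1)] e, of s] smoothed_Gs[OF i s h osc unit_kernel_k2]
    unfolding k2_moment_0 k2_moment_1 k2_moment_2 by simp
  then have "\<bar>?I ?k2 - D i 1 s * h\<^sup>2\<bar> / h\<^sup>2 \<le> (e * (LBINT v. \<bar>?k2 v\<bar>) + \<eta> * h\<^sup>2 * (LBINT v. \<bar>?k2 v\<bar>)) / h\<^sup>2"
    using h by (intro divide_right_mono) auto
  also have "\<dots> = (e / h\<^sup>2 + \<eta>) * (LBINT v. \<bar>?k2 v\<bar>)"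
    using h by (simp add: field_simps power2_eq_square)
  also have "\<bar>?I ?k2 - D i 1 s * h\<^sup>2\<bar> / h\<^sup>2 = \<bar>(?I ?k2 - D i 1 s * h\<^sup>2) / h\<^sup>2\<bar>" by simp
  also have "(?I ?k2 - D i 1 s * h\<^sup>2) / h\<^sup>2 = g_est_deriv k h n T \<Delta> i s - D i 1 s"
    using h by (simp add: g_est_deriv_emp[OF h(1) hs] field_simps)
  finally show "\<bar>g_est_deriv k h n T \<Delta> i s - D i 1 s\<bar> \<le> (e / h\<^sup>2 + \<eta>) * (LBINT v. \<bar>?k2 v\<bar>)" .
qed

end

text \<open>A deterministic sequence of data sets whose empirical subdistribution functions
  converge uniformly at a rate \<open>e n\<close> that is \<open>o(h^2)\<close>.\<close>

locale good_data = target +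
  fixes T :: "nat \<Rightarrow> nat \<Rightarrow> real" and \<Delta> :: "nat \<Rightarrow> nat \<Rightarrow> nat" and h e :: "nat \<Rightarrow> real"
  assumes h_pos: "\<forall>\<^sub>F n in sequentially. 0 < h n" and h_0: "h \<longlonglongrightarrow> 0"
    and e_0: "e \<longlonglongrightarrow> 0" and e_h: "(\<lambda>n. e n / (h n)\<^sup>2) \<longlonglongrightarrow> 0"
    and emp_close: "\<forall>\<^sub>F n in sequentially. \<forall>i\<le>1. \<forall>v. \<bar>emp_subdf n (T n) (\<Delta> n) i v - Gs i v\<bar> \<le> e n"
begin

abbreviation "gh n i s \<equiv> g_est k (h n) n (T n) (\<Delta> n) i s"
abbreviation "gh' n i s \<equiv> g_est_deriv k (h n) n (T n) (\<Delta> n) i s"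

text \<open>The derivative of the density is uniformly continuous near \<open>t\<close>, so one
  bound for its oscillation over windows of size \<open>h\<close> serves all points in
  \<open>g_est_close\<close>.\<close>

lemma uniform_consistency:
  assumes \<epsilon>: "0 < \<epsilon>"
  shows "\<forall>\<^sub>F n in sequentially. \<forall>i\<le>1. \<forall>s. \<bar>s - t\<bar> \<le> \<rho> / 2 \<longrightarrow>
    \<bar>gh n i s - D i 0 s\<bar> \<le> \<epsilon> \<and> \<bar>gh' n i s - D i 1 s\<bar> \<le> \<epsilon>"
proof -
  define C1 where "C1 = (LBINT v. \<bar>deriv k v\<bar>)"
  define C2 where "C2 = (LBINT v. \<bar>deriv (deriv k) v\<bar>)"
  have C: "0 \<le> C1" "0 \<le> C2" unfolding C1_def C2_def by (auto intro!: integral_nonneg_AE)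
  define \<eta> where "\<eta> = \<epsilon> / (2 * (C2 + 1))"
  have \<eta>: "0 < \<eta>" "\<eta> * C2 \<le> \<epsilon> / 2" using \<epsilon> C by (auto simp: \<eta>_def field_simps)
  obtain \<delta>0 where \<delta>0: "0 < \<delta>0" "\<delta>0 \<le> \<rho> / 4"
    "\<And>s y. \<bar>s - t\<bar> \<le> \<rho> / 2 \<Longrightarrow> \<bar>y - s\<bar> \<le> \<delta>0 \<Longrightarrow> \<bar>D 0 1 y - D 0 1 s\<bar> \<le> \<eta>"
    by (rule D_uniform[OF _ \<eta>(1), of 0]) auto
  obtain \<delta>1 where \<delta>1: "0 < \<delta>1" "\<delta>1 \<le> \<rho> / 4"
    "\<And>s y. \<bar>s - t\<bar> \<le> \<rho> / 2 \<Longrightarrow> \<bar>y - s\<bar> \<le> \<delta>1 \<Longrightarrow> \<bar>D 1 1 y - D 1 1 s\<bar> \<le> \<eta>"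
    by (rule D_uniform[OF _ \<eta>(1), of 1]) auto
  define \<delta> where "\<delta> = min \<delta>0 \<delta>1"
  have \<delta>: "0 < \<delta>" "\<delta> \<le> \<rho> / 4" using \<delta>0 \<delta>1 by (auto simp: \<delta>_def)
  have osc: "\<bar>D i 1 y - D i 1 s\<bar> \<le> \<eta>" if "i \<le> 1" "\<bar>s - t\<bar> \<le> \<rho> / 2" "\<bar>y - s\<bar> \<le> \<delta>" for i s y
  proof -
    have "i = 0 \<or> i = 1" using that(1) by auto
    then show ?thesis using \<delta>0(3)[of s y] \<delta>1(3)[of s y] that by (auto simp: \<delta>_def)
  qed
  have "(\<lambda>n. (e n / (h n)\<^sup>2 * h n + \<eta> * h n) * C1) \<longlonglongrightarrow> (0 * 0 + \<eta> * 0) * C1"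
    by (intro tendsto_intros e_h h_0)
  then have 1: "\<forall>\<^sub>F n in sequentially. (e n / (h n)\<^sup>2 * h n + \<eta> * h n) * C1 < \<epsilon>"
    using \<epsilon> by (intro order_tendstoD(2)) auto
  have "(\<lambda>n. (e n / (h n)\<^sup>2 + \<eta>) * C2) \<longlonglongrightarrow> (0 + \<eta>) * C2"
    by (intro tendsto_intros e_h)
  then have 2: "\<forall>\<^sub>F n in sequentially. (e n / (h n)\<^sup>2 + \<eta>) * C2 < \<epsilon>"
    by (rule order_tendstoD(2)) (use \<epsilon> \<eta> in auto)
  have 3: "\<forall>\<^sub>F n in sequentially. h n < \<delta>" using h_0 \<delta>(1) by (rule order_tendstoD(2))
  show ?thesis using 1 2 3 h_pos emp_close
  proof eventually_elim
    case (elim n)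
    show ?case
    proof (intro allI impI)
      fix i :: nat and s assume i: "i \<le> 1" and s: "\<bar>s - t\<bar> \<le> \<rho> / 2"
      have h: "0 < h n" "h n \<le> \<rho> / 4" using elim \<delta> by auto
      have o: "\<bar>D i 1 y - D i 1 s\<bar> \<le> \<eta>" if "\<bar>y - s\<bar> \<le> h n" for y using osc[OF i s] that elim by auto
      have emp: "\<bar>emp_subdf n (T n) (\<Delta> n) i v - Gs i v\<bar> \<le> e n" for v using elim(5) i by auto
      note b = g_est_close[OF i s h o emp]
      have eh: "e n / (h n)\<^sup>2 * h n = e n / h n" using h by (simp add: power2_eq_square)
      show "\<bar>gh n i s - D i 0 s\<bar> \<le> \<epsilon> \<and> \<bar>gh' n i s - D i 1 s\<bar> \<le> \<epsilon>"
        using b elim(1,2) unfolding C1_def[symmetric] C2_def[symmetric] eh by linarith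
    qed
  qed
qed

end

section \<open>The maximum smoothed likelihood estimator is locally the naive one\<close>

lemma (in smoothing) g_est_zero_far:
  assumes h: "0 < h" and s: "h < s" "\<And>j. j \<in> {1..n} \<Longrightarrow> T j + h < s"
  shows "g_est k h n T \<Delta> i s = 0"
proof -
  have "k ((s - T j) / h) = 0" if "j \<in> class_obs n T \<Delta> i" for j
  proof -
    have "T j + h < s" using that s(2) by (auto simp: class_obs_def)
    then have "1 \<le> (s - T j) / h" using h by (simp add: field_simps)
    then show ?thesis by (rule unit_kernel_zero[OF unit_kernel_k order_trans[OF _ abs_ge_self]])
  qed
  then show ?thesis using g_est_interior[OF s(1)] by simp
qed

text \<open>The set of points with a positive density estimate is bounded, because the estimate
  vanishes at distance \<open>h\<close> beyond the largest observation; so its supremum is a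
  genuine upper bound.\<close>

lemma (in smoothing) le_tau_est:
  assumes h: "0 < h" and s: "0 \<le> s" "0 < g_est_tot k h n T \<Delta> s"
  shows "s \<le> tau_est k h n T \<Delta>"
  unfolding tau_est_def
proof (rule cSup_upper)
  show "s \<in> {t. 0 \<le> t \<and> 0 < g_est k h n T \<Delta> 0 t + g_est k h n T \<Delta> 1 t}"
    using s by (simp add: g_est_tot_def)
  let ?B = "h + (\<Sum>j=1..n. \<bar>T j\<bar> + h)"
  have "x \<le> ?B" if "0 < g_est k h n T \<Delta> 0 x + g_est k h n T \<Delta> 1 x" for x
  proof (rule ccontr)
    assume x: "\<not> x \<le> ?B"
    have "T j + h < x" if "j \<in> {1..n}" for j
    proof -
      have "\<bar>T j\<bar> + h \<le> (\<Sum>j=1..n. \<bar>T j\<bar> + h)" using that h by (intro member_le_sum) auto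
      then show ?thesis using x h by linarith
    qed
    moreover have "h < x"
    proof -
      have "0 \<le> (\<Sum>j=1..n. \<bar>T j\<bar> + h)" using h by (intro sum_nonneg) auto
      then show ?thesis using x by linarith
    qed
    ultimately have "g_est k h n T \<Delta> i x = 0" for i using g_est_zero_far[OF h] by auto
    then show False using that by simp
  qed
  then show "bdd_above {t. 0 \<le> t \<and> 0 < g_est k h n T \<Delta> 0 t + g_est k h n T \<Delta> 1 t}"
    by (auto simp: bdd_above_def)
qed

context good_data
begin

text \<open>The coordinates \<open>ah\<close> and \<open>bh\<close> of the curve, the derivative
  \<open>gt\<close> of the first coordinate, the slope \<open>Fn\<close> of the curve, and the
  numerator \<open>Nn\<close> of the derivative of \<open>Fn\<close>.\<close>

abbreviation "ah n v \<equiv> G_est_tot k (h n) n (T n) (\<Delta> n) v"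
abbreviation "bh n v \<equiv> G_est k (h n) n (T n) (\<Delta> n) 1 v"
abbreviation "gt n s \<equiv> g_est_tot k (h n) n (T n) (\<Delta> n) s"
abbreviation "Fn n s \<equiv> F_naive k (h n) n (T n) (\<Delta> n) s"
abbreviation "Nn n s \<equiv> gh n 0 s * gh' n 1 s - gh' n 0 s * gh n 1 s"

lemma f_naive_eq: "f_naive k (h n) n (T n) (\<Delta> n) s = Nn n s / (gt n s)\<^sup>2"
  by (simp add: f_naive_def g_est_tot_def g_est_tot_deriv_def algebra_simps)

lemma F_naive_has_derivative:
  assumes "0 < h n" "h n < s" "0 < gt n s"
  shows "((\<lambda>s. Fn n s) has_real_derivative f_naive k (h n) n (T n) (\<Delta> n) s) (at s)"
proof -
  have "((\<lambda>s. gh n 1 s / (gh n 0 s + gh n 1 s)) has_real_derivative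
      (gh' n 1 s * (gh n 0 s + gh n 1 s) - gh n 1 s * (gh' n 0 s + gh' n 1 s))
        / ((gh n 0 s + gh n 1 s) * (gh n 0 s + gh n 1 s))) (at s)"
    using assms by (intro DERIV_divide DERIV_add g_est_deriv_has) (auto simp: g_est_tot_def)
  also have "(gh' n 1 s * (gh n 0 s + gh n 1 s) - gh n 1 s * (gh' n 0 s + gh' n 1 s))
        / ((gh n 0 s + gh n 1 s) * (gh n 0 s + gh n 1 s)) = f_naive k (h n) n (T n) (\<Delta> n) s"
    unfolding f_naive_eq by (simp add: g_est_tot_def power2_eq_square algebra_simps)
  finally show ?thesis by (simp add: F_naive_def g_est_tot_def)
qed

lemma continuous_near:
  assumes "isCont f t" "0 < f t"
  shows "\<exists>d>0. \<forall>s. \<bar>s - t\<bar> < d \<longrightarrow> f t / 2 < (f s :: real)"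
proof -
  obtain d where "d > 0" "\<And>s. \<bar>s - t\<bar> < d \<Longrightarrow> \<bar>f s - f t\<bar> < f t / 2"
    using assms(1)[unfolded continuous_at_eps_delta, rule_format, of "f t / 2"] assms(2) by (auto simp: dist_real_def)
  then show ?thesis by (intro exI[of _ d]) (smt (verit) field_sum_of_halves)
qed

text \<open>The numerator \<open>Nn\<close> and the denominator of the derivative of the naive
  estimator are polynomials in the density estimates and their derivatives, which are uniformly
  close to their limits near \<open>t\<close>; the limits are positive at \<open>t\<close>, hence
  near \<open>t\<close>.\<close>

lemma naive_regular:
  obtains \<epsilon> \<gamma> m where "0 < \<epsilon>" "2 * \<epsilon> < \<rho> / 2" "0 < \<gamma>" "0 < m"
    "\<forall>\<^sub>F n in sequentially. \<forall>s. \<bar>s - t\<bar> \<le> 2 * \<epsilon> \<longrightarrow> \<gamma> \<le> gt n s \<and> m \<le> f_naive k (h n) n (T n) (\<Delta> n) s"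
    "\<And>\<eta>. 0 < \<eta> \<Longrightarrow> \<forall>\<^sub>F n in sequentially. \<forall>s. \<bar>s - t\<bar> \<le> 2 * \<epsilon> \<longrightarrow> \<bar>Fn n s - F0 s\<bar> \<le> \<eta>"
proof -
  let ?N = "\<lambda>s. D 0 0 s * D 1 1 s - D 0 1 s * D 1 0 s"
  have c: "isCont (D i m) t" if "i \<le> 1" "m < 3" for i m using D_isCont[of i m t] that \<rho> by auto
  have cN: "isCont ?N t" by (intro continuous_intros c) auto
  have cg: "isCont (\<lambda>s. D 0 0 s + D 1 0 s) t" by (intro continuous_intros c) auto
  obtain d1 where d1: "d1 > 0" "\<And>s. \<bar>s - t\<bar> < d1 \<Longrightarrow> ?N t / 2 < ?N s"
    using continuous_near[OF cN slope_pos] by auto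
  have gpos: "0 < D 0 0 t + D 1 0 t" using D_pos[of 0] D_pos[of 1] by simp
  obtain d2 where d2: "d2 > 0" "\<And>s. \<bar>s - t\<bar> < d2 \<Longrightarrow> (D 0 0 t + D 1 0 t) / 2 < D 0 0 s + D 1 0 s"
    using continuous_near[OF cg gpos] by auto
  define \<epsilon> where "\<epsilon> = min (min d1 d2) \<rho> / 5"
  have \<epsilon>: "0 < \<epsilon>" "2 * \<epsilon> < \<rho> / 2" "2 * \<epsilon> < d1" "2 * \<epsilon> < d2" using d1(1) d2(1) \<rho> by (auto simp: \<epsilon>_def)
  define \<gamma>0 where "\<gamma>0 = (D 0 0 t + D 1 0 t) / 2"
  define m0 where "m0 = ?N t / 2"
  have pos: "0 < \<gamma>0" "0 < m0" using gpos slope_pos by (auto simp: \<gamma>0_def m0_def)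
  have "\<exists>B. \<forall>s\<in>cball t (2 * \<epsilon>). \<bar>D i m s\<bar> \<le> B" if "i \<le> 1" "m < 3" for i m
  proof -
    have "continuous_on (cball t (2 * \<epsilon>)) (D i m)"
      using D_isCont[OF that] \<epsilon> \<rho> by (auto intro!: continuous_at_imp_continuous_on simp: dist_real_def abs_minus_commute)
    then have "compact (D i m ` cball t (2 * \<epsilon>))" by (rule compact_continuous_image) simp
    then show ?thesis using compact_imp_bounded[THEN bounded_iff[THEN iffD1]] by fastforce
  qed
  then obtain B00 B01 B10 B11 where B: "\<And>s. s \<in> cball t (2 * \<epsilon>) \<Longrightarrow> \<bar>D 0 0 s\<bar> \<le> B00 \<and> \<bar>D 0 1 s\<bar> \<le> B01 \<and> \<bar>D 1 0 s\<bar> \<le> B10 \<and> \<bar>D 1 1 s\<bar> \<le> B11"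
    by (metis le_refl one_less_numeral_iff semiring_norm(77) zero_less_numeral zero_le_one)
  define B where "B = max 1 (max (max B00 B01) (max B10 B11))"
  have Bb: "\<bar>D i m s\<bar> \<le> B" if "i \<le> 1" "m \<le> 1" "\<bar>s - t\<bar> \<le> 2 * \<epsilon>" for i m s
  proof -
    have "i = 0 \<or> i = 1" "m = 0 \<or> m = 1" using that by auto
    moreover have "s \<in> cball t (2 * \<epsilon>)" using that(3) by (simp add: dist_real_def abs_minus_commute)
    ultimately show ?thesis using B[of s] by (auto simp: B_def le_max_iff_disj)
  qed
  have B1: "1 \<le> B" by (simp add: B_def)
  have unif: "\<forall>\<^sub>F n in sequentially. \<forall>s. \<bar>s - t\<bar> \<le> 2 * \<epsilon> \<longrightarrow> (\<forall>i\<le>1. \<bar>gh n i s - D i 0 s\<bar> \<le> z \<and> \<bar>gh' n i s - D i 1 s\<bar> \<le> z)"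
    if "0 < z" for z
    using uniform_consistency[OF that] \<epsilon>(2) by (auto elim!: eventually_mono)
  have gN: "\<gamma>0 < D 0 0 s + D 1 0 s" "m0 < ?N s" if "\<bar>s - t\<bar> \<le> 2 * \<epsilon>" for s
    using d1(2)[of s] d2(2)[of s] \<epsilon> that by (auto simp: \<gamma>0_def m0_def)
  \<comment> \<open>A perturbation of size at most \<open>z0 \<le> 1\<close> in each of the four
    functions changes \<open>g0 g1' - g0' g1\<close> by at most \<open>z0 * (4 * B +
    2)\<close>.\<close>
  define z0 where "z0 = min 1 (min (\<gamma>0 / 4) (m0 / (2 * (4 * B + 2))))"
  have z0: "0 < z0" "z0 \<le> 1" "z0 \<le> \<gamma>0 / 4" "z0 * (4 * B + 2) \<le> m0 / 2"
  proof -
    show "0 < z0" using pos B1 by (simp add: z0_def)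
    have "z0 \<le> m0 / (2 * (4 * B + 2))" by (simp add: z0_def)
    then show "z0 * (4 * B + 2) \<le> m0 / 2" using B1 by (simp add: field_simps)
    show "z0 \<le> 1" "z0 \<le> \<gamma>0 / 4" unfolding z0_def by linarith+
  qed
  have ev0: "\<forall>\<^sub>F n in sequentially. \<forall>s. \<bar>s - t\<bar> \<le> 2 * \<epsilon> \<longrightarrow> \<gamma>0 / 2 \<le> gt n s \<and> (m0 / 2) / (2 * B + 2)\<^sup>2 \<le> f_naive k (h n) n (T n) (\<Delta> n) s"
    using unif[OF z0(1)]
  proof eventually_elim
    case (elim n)
    show ?case
    proof (intro allI impI)
      fix s assume s: "\<bar>s - t\<bar> \<le> 2 * \<epsilon>"
      define x0 x1 y0 y1 where xy: "x0 = gh n 0 s - D 0 0 s" "x1 = gh n 1 s - D 1 0 s" "y0 = gh' n 0 s - D 0 1 s" "y1 = gh' n 1 s - D 1 1 s"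
      have x: "\<bar>x0\<bar> \<le> z0" "\<bar>x1\<bar> \<le> z0" "\<bar>y0\<bar> \<le> z0" "\<bar>y1\<bar> \<le> z0"
        using elim[rule_format, OF s, of 0] elim[rule_format, OF s, of 1] by (auto simp: xy)
      have b: "\<bar>D 0 0 s\<bar> \<le> B" "\<bar>D 0 1 s\<bar> \<le> B" "\<bar>D 1 0 s\<bar> \<le> B" "\<bar>D 1 1 s\<bar> \<le> B" using Bb s by auto
      have gt: "gt n s = (D 0 0 s + D 1 0 s) + x0 + x1" by (simp add: g_est_tot_def xy)
      have g1: "\<gamma>0 / 2 \<le> gt n s" using gN(1)[OF s] x z0(3) unfolding gt by linarith
      have g2: "gt n s \<le> 2 * B + 2" using b x z0(2) unfolding gt by linarith
      have "Nn n s = ?N s + (D 0 0 s * y1 + x0 * D 1 1 s + x0 * y1 - (D 0 1 s * x1 + y0 * D 1 0 s + y0 * x1))"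
        by (simp add: xy algebra_simps)
      moreover have "\<bar>D 0 0 s * y1\<bar> \<le> B * z0" "\<bar>x0 * D 1 1 s\<bar> \<le> z0 * B" "\<bar>x0 * y1\<bar> \<le> z0 * 1"
          "\<bar>D 0 1 s * x1\<bar> \<le> B * z0" "\<bar>y0 * D 1 0 s\<bar> \<le> z0 * B" "\<bar>y0 * x1\<bar> \<le> z0 * 1"
        unfolding abs_mult using b x z0(1,2) B1 by (intro mult_mono; linarith)+
      moreover have "z0 * (4 * B + 2) = 2 * (B * z0) + 2 * (z0 * B) + 2 * z0" by (simp add: algebra_simps)
      ultimately have N: "m0 / 2 \<le> Nn n s" using gN(2)[OF s] z0(4) by linarith
      have "(m0 / 2) / (2 * B + 2)\<^sup>2 \<le> Nn n s / (gt n s)\<^sup>2"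
        using N g1 g2 pos B1 by (intro frac_le power_mono zero_less_power) auto
      then show "\<gamma>0 / 2 \<le> gt n s \<and> (m0 / 2) / (2 * B + 2)\<^sup>2 \<le> f_naive k (h n) n (T n) (\<Delta> n) s"
        using g1 by (simp add: f_naive_eq)
    qed
  qed
  have ev1: "\<forall>\<^sub>F n in sequentially. \<forall>s. \<bar>s - t\<bar> \<le> 2 * \<epsilon> \<longrightarrow> \<bar>Fn n s - F0 s\<bar> \<le> \<eta>" if \<eta>: "0 < \<eta>" for \<eta>
  proof -
    define z where "z = \<eta> * \<gamma>0 / 6"
    have z: "0 < z" using \<eta> pos by (simp add: z_def)
    show ?thesis using unif[OF z] ev0
    proof eventually_elim
      case (elim n)
      show ?case
      proof (intro allI impI)
        fix s assume s: "\<bar>s - t\<bar> \<le> 2 * \<epsilon>"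
        have g: "0 < gt n s" "\<gamma>0 / 2 \<le> gt n s" using elim(2) s pos by force+
        have x: "\<bar>gh n 0 s - D 0 0 s\<bar> \<le> z" "\<bar>gh n 1 s - D 1 0 s\<bar> \<le> z"
          using elim(1)[rule_format, OF s, of 0] elim(1)[rule_format, OF s, of 1] by auto
        have r: "D 1 0 s = F0 s * (D 0 0 s + D 1 0 s)" using ratio[of s] s \<epsilon> \<rho> by auto
        have eq: "Fn n s - F0 s = ((gh n 1 s - D 1 0 s) - F0 s * ((gh n 0 s - D 0 0 s) + (gh n 1 s - D 1 0 s))) / gt n s"
          using g(1) r by (simp add: F_naive_def g_est_tot_def field_simps)
        have f: "\<bar>F0 s * ((gh n 0 s - D 0 0 s) + (gh n 1 s - D 1 0 s))\<bar> \<le> 1 * (2 * z)"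
          unfolding abs_mult using F0_bd[of s] x by (intro mult_mono) linarith+
        have "\<bar>Fn n s - F0 s\<bar> = \<bar>(gh n 1 s - D 1 0 s) - F0 s * ((gh n 0 s - D 0 0 s) + (gh n 1 s - D 1 0 s))\<bar> / gt n s"
          unfolding eq using g(1) by simp
        also have "\<dots> \<le> (3 * z) / (\<gamma>0 / 2)"
          using f x g pos z by (intro frac_le) linarith+
        also have "\<dots> = \<eta>" using pos by (simp add: z_def)
        finally show "\<bar>Fn n s - F0 s\<bar> \<le> \<eta>" .
      qed
    qed
  qed
  show thesis
    by (rule that[OF \<epsilon>(1,2) _ _ ev0 ev1]) (use pos B1 in auto)
qed

text \<open>The limiting subdistribution function is continuous at zero and the window \<open>[0,
  2 h]\<close> shrinks.\<close>

lemma emp_small: "0 < \<eta> \<Longrightarrow> i \<le> 1 \<Longrightarrow> \<forall>\<^sub>F n in sequentially. emp_subdf n (T n) (\<Delta> n) i (2 * h n) < \<eta>"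
proof -
  assume \<eta>: "0 < \<eta>" and i: "i \<le> 1"
  have "filterlim (\<lambda>n. 2 * h n) (at_right 0) sequentially"
    using h_pos tendsto_mult[OF tendsto_const h_0, of 2] by (auto simp: filterlim_at elim: eventually_mono)
  from filterlim_compose[OF Gs_0[OF i] this]
  have "(\<lambda>n. Gs i (2 * h n) + e n) \<longlonglongrightarrow> 0 + 0" by (intro tendsto_add e_0)
  then have "\<forall>\<^sub>F n in sequentially. Gs i (2 * h n) + e n < \<eta>" using \<eta> by (intro order_tendstoD(2)) auto
  then show ?thesis using emp_close
  proof eventually_elim
    case (elim n)
    have "\<bar>emp_subdf n (T n) (\<Delta> n) i (2 * h n) - Gs i (2 * h n)\<bar> \<le> e n" using elim(2) i by blast
    then show ?case using elim(1) by linarith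
  qed
qed

text \<open>By \<open>G_est_interior\<close> the increment of \<open>bh - p * ah\<close> is a
  kernel average of increments of the empirical subdistribution functions. The corresponding
  increments of the limits have the sign of \<open>F0 - p\<close> by \<open>cross\<close>, and
  replacing the empirical functions costs \<open>2 e\<close> for \<open>bh\<close> and \<open>4
  e\<close> for \<open>p * ah\<close>.\<close>

lemma far_increment:
  assumes h: "0 < h n" and emp: "\<And>i v. i \<le> 1 \<Longrightarrow> \<bar>emp_subdf n (T n) (\<Delta> n) i v - Gs i v\<bar> \<le> e n"
    and vw: "h n \<le> v" "v \<le> w" and p: "0 \<le> p" "p \<le> 1"
  shows "p \<le> F0 (v - h n) \<Longrightarrow> (bh n w - bh n v) - p * (ah n w - ah n v) \<ge> - (6 * e n)"
    and "F0 (w + h n) \<le> p \<Longrightarrow> (bh n w - bh n v) - p * (ah n w - ah n v) \<le> 6 * e n"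
proof -
  let ?E = "emp_subdf n (T n) (\<Delta> n)"
  let ?\<phi> = "\<lambda>u. (?E 1 (w - h n * u) - ?E 1 (v - h n * u)) - p * ((?E 0 (w - h n * u) - ?E 0 (v - h n * u)) + (?E 1 (w - h n * u) - ?E 1 (v - h n * u)))"
  have ii: "integrable lborel (\<lambda>u. k u * (?E i (w - h n * u) - ?E i (v - h n * u)))" for i
  proof (rule unit_kernel_bounded_integrable[OF unit_kernel_k, where B=1])
    fix u :: real
    show "\<bar>?E i (w - h n * u) - ?E i (v - h n * u)\<bar> \<le> 1"
      using emp_subdf_bounds[of n "T n" "\<Delta> n" i "w - h n * u"] emp_subdf_bounds[of n "T n" "\<Delta> n" i "v - h n * u"]
      by linarith
  qed measurable
  have eq: "(bh n w - bh n v) - p * (ah n w - ah n v) = (LBINT u. k u * ?\<phi> u)"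
  proof -
    have "(LBINT u. k u * ?\<phi> u) = (LBINT u. k u * (?E 1 (w - h n * u) - ?E 1 (v - h n * u))
        - p * (k u * (?E 0 (w - h n * u) - ?E 0 (v - h n * u)) + k u * (?E 1 (w - h n * u) - ?E 1 (v - h n * u))))"
      by (intro Bochner_Integration.integral_cong) (auto simp: algebra_simps)
    also have "\<dots> = (bh n w - bh n v) - p * ((G_est k (h n) n (T n) (\<Delta> n) 0 w - G_est k (h n) n (T n) (\<Delta> n) 0 v) + (bh n w - bh n v))"
      using ii[of 0] ii[of 1] unfolding G_est_interior[OF h vw] by simp
    finally show ?thesis by (simp add: G_est_tot_eq[OF h] algebra_simps)
  qed
  have int\<phi>: "integrable lborel (\<lambda>u. k u * ?\<phi> u)"
  proof -
    have "(\<lambda>u. k u * ?\<phi> u) = (\<lambda>u. k u * (?E 1 (w - h n * u) - ?E 1 (v - h n * u))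
        - p * (k u * (?E 0 (w - h n * u) - ?E 0 (v - h n * u)) + k u * (?E 1 (w - h n * u) - ?E 1 (v - h n * u))))"
      by (auto simp: algebra_simps)
    then show ?thesis using ii[of 0] ii[of 1] by simp
  qed
  have err: "\<bar>?\<phi> u - ((Gs 1 (w - h n * u) - Gs 1 (v - h n * u)) - p * ((Gs 0 (w - h n * u) - Gs 0 (v - h n * u)) + (Gs 1 (w - h n * u) - Gs 1 (v - h n * u))))\<bar> \<le> 6 * e n" for u
  proof -
    define a0 a1 b0 b1 where ab: "a0 = ?E 0 (w - h n * u) - Gs 0 (w - h n * u)" "a1 = ?E 1 (w - h n * u) - Gs 1 (w - h n * u)"
      "b0 = ?E 0 (v - h n * u) - Gs 0 (v - h n * u)" "b1 = ?E 1 (v - h n * u) - Gs 1 (v - h n * u)"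
    have b: "\<bar>a0\<bar> \<le> e n" "\<bar>a1\<bar> \<le> e n" "\<bar>b0\<bar> \<le> e n" "\<bar>b1\<bar> \<le> e n" using emp by (auto simp: ab)
    have "\<bar>p * ((a0 - b0) + (a1 - b1))\<bar> \<le> 1 * (4 * e n)"
      unfolding abs_mult using p b by (intro mult_mono) linarith+
    then have "\<bar>(a1 - b1) - p * ((a0 - b0) + (a1 - b1))\<bar> \<le> 6 * e n" using b by linarith
    moreover have "(a1 - b1) - p * ((a0 - b0) + (a1 - b1)) = ?\<phi> u - ((Gs 1 (w - h n * u) - Gs 1 (v - h n * u)) - p * ((Gs 0 (w - h n * u) - Gs 0 (v - h n * u)) + (Gs 1 (w - h n * u) - Gs 1 (v - h n * u))))"
      by (simp add: ab algebra_simps)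
    ultimately show ?thesis by simp
  qed
  have cst: "(LBINT u. k u * c) = c" "integrable lborel (\<lambda>u. k u * c)" for c :: real
    using k_int k_one by auto
  {
    assume pF: "p \<le> F0 (v - h n)"
    have "(LBINT u. k u * (- (6 * e n))) \<le> (LBINT u. k u * ?\<phi> u)"
    proof (rule integral_mono[OF cst(2) int\<phi>])
      fix u :: real
      show "k u * (- (6 * e n)) \<le> k u * ?\<phi> u"
      proof (cases "\<bar>u\<bar> \<le> 1")
        case True
        have hu: "\<bar>h n * u\<bar> \<le> h n" using True h by (simp add: abs_mult mult_left_le)
        let ?dG = "(Gs 0 (w - h n * u) + Gs 1 (w - h n * u)) - (Gs 0 (v - h n * u) + Gs 1 (v - h n * u))"
        have "p \<le> F0 (v - h n * u)" using pF F0_mono[of "v - h n" "v - h n * u"] hu by linarith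
        moreover have "0 \<le> ?dG" using Gs_mono[of 0 "v - h n * u" "w - h n * u"] Gs_mono[of 1 "v - h n * u" "w - h n * u"] vw by auto
        ultimately have "p * ?dG \<le> F0 (v - h n * u) * ?dG" by (rule mult_right_mono)
        also have "\<dots> \<le> Gs 1 (w - h n * u) - Gs 1 (v - h n * u)" using vw by (intro cross) auto
        finally have "- (6 * e n) \<le> ?\<phi> u" using err[of u] by (simp add: abs_le_iff algebra_simps)
        then show ?thesis using k_nonneg by (intro mult_left_mono)
      next
        case False then show ?thesis using unit_kernel_zero[OF unit_kernel_k, of u] by simp
      qed
    qed
    then show "(bh n w - bh n v) - p * (ah n w - ah n v) \<ge> - (6 * e n)" unfolding eq cst(1) .
  }
  {
    assume pF: "F0 (w + h n) \<le> p"
    have "(LBINT u. k u * ?\<phi> u) \<le> (LBINT u. k u * (6 * e n))"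
    proof (rule integral_mono[OF int\<phi> cst(2)])
      fix u :: real
      show "k u * ?\<phi> u \<le> k u * (6 * e n)"
      proof (cases "\<bar>u\<bar> \<le> 1")
        case True
        have hu: "\<bar>h n * u\<bar> \<le> h n" using True h by (simp add: abs_mult mult_left_le)
        let ?dG = "(Gs 0 (w - h n * u) + Gs 1 (w - h n * u)) - (Gs 0 (v - h n * u) + Gs 1 (v - h n * u))"
        have pp: "F0 (w - h n * u) \<le> p" using pF F0_mono[of "w - h n * u" "w + h n"] hu by linarith
        have "0 \<le> ?dG" using Gs_mono[of 0 "v - h n * u" "w - h n * u"] Gs_mono[of 1 "v - h n * u" "w - h n * u"] vw by auto
        with pp have 1: "F0 (w - h n * u) * ?dG \<le> p * ?dG" by (rule mult_right_mono)
        have "Gs 1 (w - h n * u) - Gs 1 (v - h n * u) \<le> F0 (w - h n * u) * ?dG" using vw by (intro cross) auto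
        also note 1
        finally have "?\<phi> u \<le> 6 * e n" using err[of u] by (simp add: abs_le_iff algebra_simps)
        then show ?thesis using k_nonneg by (intro mult_left_mono)
      next
        case False then show ?thesis using unit_kernel_zero[OF unit_kernel_k, of u] by simp
      qed
    qed
    then show "(bh n w - bh n v) - p * (ah n w - ah n v) \<le> 6 * e n" unfolding eq cst(1) .
  }
qed

lemma G_tot_has_derivative:
  assumes "0 < h n" "h n < s" shows "((\<lambda>v. ah n v) has_real_derivative gt n s) (at s)"
  unfolding G_est_tot_eq[OF assms(1)] g_est_tot_def by (intro DERIV_add G_est_has_derivative assms)

text \<open>For every \<open>s\<close> within \<open>\<epsilon>\<close> of \<open>t\<close> the
  function \<open>\<phi> v = bh v - p * ah v\<close> with \<open>p = Fn s\<close> is minimal at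
  \<open>s\<close>: its derivative is \<open>gt v * (Fn v - p)\<close> near \<open>t\<close>, and
  elsewhere \<open>p\<close> separates values of \<open>F0\<close>. So the tangent at
  \<open>s\<close> supports the whole curve, and \<open>right_slope_hull\<close> identifies the
  hull slope with \<open>Fn\<close> on a neighbourhood of \<open>t\<close>, which also gives
  equality of the derivatives.\<close>

theorem eventually_MS_eq_naive:
  "\<forall>\<^sub>F n in sequentially. lambda_MS k (h n) n (T n) (\<Delta> n) t = lambda_naive k (h n) n (T n) (\<Delta> n) t"
proof -
  obtain \<epsilon> \<gamma> m where \<epsilon>: "0 < \<epsilon>" "2 * \<epsilon> < \<rho> / 2" and \<gamma>: "0 < \<gamma>" and m: "0 < m" and
    reg: "\<forall>\<^sub>F n in sequentially. \<forall>s. \<bar>s - t\<bar> \<le> 2 * \<epsilon> \<longrightarrow> \<gamma> \<le> gt n s \<and> m \<le> f_naive k (h n) n (T n) (\<Delta> n) s" and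
    cons: "\<And>\<eta>. 0 < \<eta> \<Longrightarrow> \<forall>\<^sub>F n in sequentially. \<forall>s. \<bar>s - t\<bar> \<le> 2 * \<epsilon> \<longrightarrow> \<bar>Fn n s - F0 s\<bar> \<le> \<eta>"
    using naive_regular by blast
  \<comment> \<open>The gap by which \<open>F0\<close> changes between distance
    \<open>\<epsilon>\<close> and \<open>3/2 \<epsilon>\<close> from \<open>t\<close>: if the
    naive estimator is within \<open>\<eta>\<close> of \<open>F0\<close>, a slope at distance less
    than \<open>\<epsilon>\<close> is separated from the values of \<open>F0\<close> beyond
    \<open>3/2 \<epsilon>\<close>. The remaining \<open>\<epsilon> / 2\<close> up to \<open>2
    \<epsilon>\<close> is room for the bandwidth.\<close>
  define \<eta> where "\<eta> = min (F0 (t + 3/2 * \<epsilon>) - F0 (t + \<epsilon>)) (F0 (t - \<epsilon>) - F0 (t - 3/2 * \<epsilon>))"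
  have \<eta>: "0 < \<eta>" using F0_strict[of "t + \<epsilon>" "t + 3/2 * \<epsilon>"] F0_strict[of "t - 3/2 * \<epsilon>" "t - \<epsilon>"] \<epsilon> \<rho>
    by (auto simp: \<eta>_def)
  \<comment> \<open>A lower bound for the gain of the curve over the tangent on an interval of
    length \<open>\<epsilon> / 2\<close> between \<open>3/2 \<epsilon>\<close> and \<open>2
    \<epsilon>\<close>: there the slopes differ by at least \<open>m * (\<epsilon> / 2)\<close>,
    and the first coordinate grows at rate at least \<open>\<gamma>\<close>.\<close>
  define \<kappa> where "\<kappa> = \<gamma> * (m * (\<epsilon> / 2)) * (\<epsilon> / 2)"
  have \<kappa>: "0 < \<kappa>" using \<gamma> m \<epsilon> by (simp add: \<kappa>_def)
  have "\<forall>\<^sub>F n in sequentially. h n < \<epsilon> / 2" using h_0 by (rule order_tendstoD(2)) (use \<epsilon> in auto)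
  moreover have "\<forall>\<^sub>F n in sequentially. e n < \<kappa> / 12" using e_0 by (rule order_tendstoD(2)) (use \<kappa> in auto)
  moreover have "\<forall>\<^sub>F n in sequentially. emp_subdf n (T n) (\<Delta> n) 0 (2 * h n) < \<kappa> / (12 * bmax)"
    "\<forall>\<^sub>F n in sequentially. emp_subdf n (T n) (\<Delta> n) 1 (2 * h n) < \<kappa> / (12 * bmax)"
    using \<kappa> bmax_pos by (intro emp_small; simp)+
  ultimately show ?thesis using reg cons[OF \<eta>] h_pos emp_close
  proof eventually_elim
    case (elim n)
    have h: "0 < h n" "h n < \<epsilon> / 2" using elim by auto
    have emp: "\<bar>emp_subdf n (T n) (\<Delta> n) i v - Gs i v\<bar> \<le> e n" if "i \<le> 1" for i v using elim(8) that by blast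
    have J: "h n < s" if "\<bar>s - t\<bar> \<le> 2 * \<epsilon>" for s using that h \<epsilon> \<rho> by linarith
    have gt: "\<gamma> \<le> gt n s" "0 < gt n s" if "\<bar>s - t\<bar> \<le> 2 * \<epsilon>" for s
      using elim(5)[rule_format, OF that] \<gamma> by auto
    have FnD: "((\<lambda>s. Fn n s) has_real_derivative f_naive k (h n) n (T n) (\<Delta> n) s) (at s)" if "\<bar>s - t\<bar> \<le> 2 * \<epsilon>" for s
      by (rule F_naive_has_derivative[OF h(1) J[OF that] gt(2)[OF that]])
    have Fn_incr: "m * (y - x) \<le> Fn n y - Fn n x" if "t - 2 * \<epsilon> \<le> x" "x \<le> y" "y \<le> t + 2 * \<epsilon>" for x y
    proof -
      have "Fn n x - m * x \<le> Fn n y - m * y"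
      proof (rule DERIV_nonneg_imp_nondecreasing[OF that(2)])
        fix z assume "x \<le> z" "z \<le> y"
        then have z: "\<bar>z - t\<bar> \<le> 2 * \<epsilon>" using that by (simp add: abs_le_iff)
        have "((\<lambda>s. Fn n s - m * s) has_real_derivative f_naive k (h n) n (T n) (\<Delta> n) z - m) (at z)"
          using FnD[OF z] by (auto intro!: derivative_eq_intros)
        then show "\<exists>d. ((\<lambda>s. Fn n s - m * s) has_real_derivative d) (at z) \<and> 0 \<le> d"
          using elim(5)[rule_format, OF z] by (intro exI[of _ "f_naive k (h n) n (T n) (\<Delta> n) z - m"]) auto
      qed
      then show ?thesis by (simp add: algebra_simps)
    qed
    have Fn_mono: "Fn n x \<le> Fn n y" if "t - 2 * \<epsilon> \<le> x" "x \<le> y" "y \<le> t + 2 * \<epsilon>" for x y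
    proof -
      have "0 \<le> m * (y - x)" using that m by simp
      then show ?thesis using Fn_incr[OF that] by linarith
    qed
    have gh1: "gh n 1 s = Fn n s * gt n s" if "\<bar>s - t\<bar> \<le> 2 * \<epsilon>" for s
      using gt(2)[OF that] by (simp add: F_naive_def)
    have Fn01: "0 \<le> Fn n s" "Fn n s \<le> 1" if "\<bar>s - t\<bar> \<le> 2 * \<epsilon>" for s
      using g_est_nonneg[OF h(1) J[OF that], of n "T n" "\<Delta> n" 0] g_est_nonneg[OF h(1) J[OF that], of n "T n" "\<Delta> n" 1] gt(2)[OF that]
      by (auto simp: F_naive_def g_est_tot_def)
    have tangent: "bh n s + Fn n s * (ah n v - ah n s) \<le> bh n v" if s: "\<bar>s - t\<bar> < \<epsilon>" and v: "0 \<le> v" for s v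
    proof -
      have s2: "\<bar>s - t\<bar> \<le> 2 * \<epsilon>" and sI: "t - \<epsilon> < s" "s < t + \<epsilon>" using s \<epsilon>(1) by linarith+
      define p where "p = Fn n s"
      define \<phi> where "\<phi> v = bh n v - p * ah n v" for v
      have p: "0 \<le> p" "p \<le> 1" using Fn01[OF s2] by (auto simp: p_def)
      have \<phi>D: "(\<phi> has_real_derivative gt n u * (Fn n u - p)) (at u)" if u: "\<bar>u - t\<bar> \<le> 2 * \<epsilon>" for u
      proof -
        have "(\<phi> has_real_derivative gh n 1 u - p * gt n u) (at u)"
          unfolding \<phi>_def by (intro DERIV_diff DERIV_cmult G_est_has_derivative G_tot_has_derivative h J u)
        then show ?thesis unfolding gh1[OF u] by (simp add: algebra_simps)
      qed
      have right: "\<phi> x \<le> \<phi> y" if "s \<le> x" "x \<le> y" "y \<le> t + 2 * \<epsilon>" for x y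
      proof (rule DERIV_nonneg_imp_nondecreasing[OF that(2)])
        fix u assume u: "x \<le> u" "u \<le> y"
        then have u2: "\<bar>u - t\<bar> \<le> 2 * \<epsilon>" using that sI by (simp add: abs_le_iff)
        have "p \<le> Fn n u" unfolding p_def using u that sI by (intro Fn_mono) auto
        then show "\<exists>d. (\<phi> has_real_derivative d) (at u) \<and> 0 \<le> d"
          using \<phi>D[OF u2] gt(2)[OF u2] by (intro exI[of _ "gt n u * (Fn n u - p)"]) auto
      qed
      have left: "\<phi> y \<le> \<phi> x" if "t - 2 * \<epsilon> \<le> x" "x \<le> y" "y \<le> s" for x y
      proof (rule DERIV_nonpos_imp_nonincreasing[OF that(2)])
        fix u assume u: "x \<le> u" "u \<le> y"
        then have u2: "\<bar>u - t\<bar> \<le> 2 * \<epsilon>" using that sI by (simp add: abs_le_iff)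
        have "Fn n u \<le> p" unfolding p_def using u that sI by (intro Fn_mono) auto
        then show "\<exists>d. (\<phi> has_real_derivative d) (at u) \<and> d \<le> 0"
          using \<phi>D[OF u2] gt(2)[OF u2] by (intro exI[of _ "gt n u * (Fn n u - p)"]) (auto simp: mult_le_0_iff)
      qed
      have steep: "\<gamma> * (m * (\<epsilon> / 2)) \<le> gt n u * q" if "\<bar>u - t\<bar> \<le> 2 * \<epsilon>" "m * (\<epsilon> / 2) \<le> q" for u q
        using gt[OF that(1)] that(2) m \<epsilon> \<gamma> by (intro mult_mono) auto
      have gain_right: "\<phi> s + \<kappa> \<le> \<phi> (t + 2 * \<epsilon>)"
      proof -
        have "\<phi> (t + 3/2 * \<epsilon>) - \<gamma> * (m * (\<epsilon> / 2)) * (t + 3/2 * \<epsilon>) \<le> \<phi> (t + 2 * \<epsilon>) - \<gamma> * (m * (\<epsilon> / 2)) * (t + 2 * \<epsilon>)"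
        proof (rule DERIV_nonneg_imp_nondecreasing[where f="\<lambda>u. \<phi> u - \<gamma> * (m * (\<epsilon> / 2)) * u"])
          fix u assume u: "t + 3/2 * \<epsilon> \<le> u" "u \<le> t + 2 * \<epsilon>"
          then have u2: "\<bar>u - t\<bar> \<le> 2 * \<epsilon>" using \<epsilon> by (simp add: abs_le_iff)
          have "m * (\<epsilon> / 2) \<le> m * (u - s)" using u sI m by (intro mult_left_mono) auto
          also have "\<dots> \<le> Fn n u - p" unfolding p_def using u sI \<epsilon>(1) by (intro Fn_incr) linarith+
          finally have "\<gamma> * (m * (\<epsilon> / 2)) \<le> gt n u * (Fn n u - p)" by (rule steep[OF u2])
          moreover have "((\<lambda>u. \<phi> u - \<gamma> * (m * (\<epsilon> / 2)) * u) has_real_derivative gt n u * (Fn n u - p) - \<gamma> * (m * (\<epsilon> / 2))) (at u)"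
            using \<phi>D[OF u2] by (auto intro!: derivative_eq_intros)
          ultimately show "\<exists>d. ((\<lambda>u. \<phi> u - \<gamma> * (m * (\<epsilon> / 2)) * u) has_real_derivative d) (at u) \<and> 0 \<le> d"
            by (intro exI[of _ "gt n u * (Fn n u - p) - \<gamma> * (m * (\<epsilon> / 2))"]) auto
        qed (use \<epsilon> in auto)
        moreover have "\<phi> s \<le> \<phi> (t + 3/2 * \<epsilon>)" using sI \<epsilon> by (intro right) auto
        moreover have "\<gamma> * (m * (\<epsilon> / 2)) * (t + 2 * \<epsilon>) - \<gamma> * (m * (\<epsilon> / 2)) * (t + 3/2 * \<epsilon>) = \<kappa>"
          unfolding right_diff_distrib[symmetric] \<kappa>_def by simp
        ultimately show ?thesis by linarith
      qed
      have gain_left: "\<phi> s + \<kappa> \<le> \<phi> (t - 2 * \<epsilon>)"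
      proof -
        have "\<phi> (t - 2 * \<epsilon>) + \<gamma> * (m * (\<epsilon> / 2)) * (t - 2 * \<epsilon>) \<ge> \<phi> (t - 3/2 * \<epsilon>) + \<gamma> * (m * (\<epsilon> / 2)) * (t - 3/2 * \<epsilon>)"
        proof (rule DERIV_nonpos_imp_nonincreasing[where f="\<lambda>u. \<phi> u + \<gamma> * (m * (\<epsilon> / 2)) * u"])
          fix u assume u: "t - 2 * \<epsilon> \<le> u" "u \<le> t - 3/2 * \<epsilon>"
          then have u2: "\<bar>u - t\<bar> \<le> 2 * \<epsilon>" using \<epsilon> by (simp add: abs_le_iff)
          have "m * (\<epsilon> / 2) \<le> m * (s - u)" using u sI m by (intro mult_left_mono) auto
          also have "\<dots> \<le> p - Fn n u" unfolding p_def using u sI \<epsilon>(1) by (intro Fn_incr) linarith+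
          finally have "\<gamma> * (m * (\<epsilon> / 2)) \<le> gt n u * (p - Fn n u)" by (rule steep[OF u2])
          moreover have "((\<lambda>u. \<phi> u + \<gamma> * (m * (\<epsilon> / 2)) * u) has_real_derivative gt n u * (Fn n u - p) + \<gamma> * (m * (\<epsilon> / 2))) (at u)"
            using \<phi>D[OF u2] by (auto intro!: derivative_eq_intros)
          ultimately show "\<exists>d. ((\<lambda>u. \<phi> u + \<gamma> * (m * (\<epsilon> / 2)) * u) has_real_derivative d) (at u) \<and> d \<le> 0"
            by (intro exI[of _ "gt n u * (Fn n u - p) + \<gamma> * (m * (\<epsilon> / 2))"]) (auto simp: algebra_simps)
        qed (use \<epsilon> in auto)
        moreover have "\<phi> s \<le> \<phi> (t - 3/2 * \<epsilon>)" using sI \<epsilon> by (intro left) auto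
        moreover have "\<gamma> * (m * (\<epsilon> / 2)) * (t - 3/2 * \<epsilon>) - \<gamma> * (m * (\<epsilon> / 2)) * (t - 2 * \<epsilon>) = \<kappa>"
          unfolding right_diff_distrib[symmetric] \<kappa>_def by simp
        ultimately show ?thesis by linarith
      qed
      have pF: "\<bar>p - F0 s\<bar> \<le> \<eta>" unfolding p_def using elim(6) s2 by blast
      \<comment> \<open>Only half of the gain is spent on the error \<open>6 e\<close>; the other
        half pays for the boundary region below \<open>h\<close>.\<close>
      have far_left: "\<phi> s + \<kappa> / 2 \<le> \<phi> w" if w: "h n \<le> w" "w < t - 2 * \<epsilon>" for w
      proof -
        have "F0 (t - 2 * \<epsilon> + h n) \<le> F0 (t - 3/2 * \<epsilon>)" using h by (intro F0_mono) auto
        also have "\<dots> \<le> F0 (t - \<epsilon>) - \<eta>" by (simp add: \<eta>_def)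
        also have "\<dots> \<le> F0 s - \<eta>" using F0_mono[of "t - \<epsilon>" s] sI by simp
        also have "\<dots> \<le> p" using pF by linarith
        finally have "(bh n (t - 2 * \<epsilon>) - bh n w) - p * (ah n (t - 2 * \<epsilon>) - ah n w) \<le> 6 * e n"
          using far_increment(2)[OF h(1) emp w(1) _ p, of "t - 2 * \<epsilon>"] w by auto
        then have "\<phi> (t - 2 * \<epsilon>) - \<phi> w \<le> 6 * e n" by (simp add: \<phi>_def algebra_simps)
        then show ?thesis using gain_left elim(2) by linarith
      qed
      consider "\<bar>v - t\<bar> \<le> 2 * \<epsilon>" | "t + 2 * \<epsilon> < v" | "h n \<le> v" "v < t - 2 * \<epsilon>" | "v < h n"
        by (cases "\<bar>v - t\<bar> \<le> 2 * \<epsilon>"; cases "v < h n"; cases "t + 2 * \<epsilon> < v") linarith+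
      then have "\<phi> s \<le> \<phi> v"
      proof cases
        case 1
        then show ?thesis using right[of s v] left[of v s] sI by (cases "s \<le> v") (auto simp: abs_le_iff)
      next
        case 2
        have "p \<le> F0 s + \<eta>" using pF by linarith
        also have "\<dots> \<le> F0 (t + \<epsilon>) + \<eta>" using F0_mono[of s "t + \<epsilon>"] sI by simp
        also have "\<dots> \<le> F0 (t + 3/2 * \<epsilon>)" by (simp add: \<eta>_def)
        also have "\<dots> \<le> F0 (t + 2 * \<epsilon> - h n)" using h by (intro F0_mono) auto
        finally have "(bh n v - bh n (t + 2 * \<epsilon>)) - p * (ah n v - ah n (t + 2 * \<epsilon>)) \<ge> - (6 * e n)"
          using far_increment(1)[OF h(1) emp _ _ p, of "t + 2 * \<epsilon>" v] 2 J[of "t + 2 * \<epsilon>"] \<epsilon> by auto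
        then have "\<phi> v - \<phi> (t + 2 * \<epsilon>) \<ge> - (6 * e n)" by (simp add: \<phi>_def algebra_simps)
        then show ?thesis using gain_right elim(2) \<kappa> by linarith
      next
        case 3
        then show ?thesis using far_left[of v] \<kappa> by linarith
      next
        case 4
        have "h n < t - 2 * \<epsilon>" using h \<epsilon> \<rho> by linarith
        then have far: "\<phi> s + \<kappa> / 2 \<le> \<phi> (h n)" by (intro far_left) auto
        have b: "\<bar>G_est k (h n) n (T n) (\<Delta> n) i (h n) - G_est k (h n) n (T n) (\<Delta> n) i v\<bar> \<le> \<kappa> / 12" if "i \<le> 1" for i
        proof -
          have "i = 0 \<or> i = 1" using that by auto
          then have "emp_subdf n (T n) (\<Delta> n) i (2 * h n) < \<kappa> / (12 * bmax)" using elim(3,4) by auto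
          then have "bmax * emp_subdf n (T n) (\<Delta> n) i (2 * h n) \<le> bmax * (\<kappa> / (12 * bmax))"
            using bmax_pos by (intro mult_left_mono) auto
          then show ?thesis using G_est_boundary[OF h(1) v, of n "T n" "\<Delta> n" i] 4 bmax_pos by simp
        qed
        have "\<bar>ah n (h n) - ah n v\<bar> \<le> \<kappa> / 6" using b[of 0] b[of 1] unfolding G_est_tot_eq[OF h(1)] by linarith
        then have "\<bar>p * (ah n (h n) - ah n v)\<bar> \<le> 1 * (\<kappa> / 6)" unfolding abs_mult using p by (intro mult_mono) auto
        moreover have "\<phi> (h n) - \<phi> v = (bh n (h n) - bh n v) - p * (ah n (h n) - ah n v)"
          by (simp add: \<phi>_def algebra_simps)
        ultimately have "\<bar>\<phi> (h n) - \<phi> v\<bar> \<le> \<kappa> / 12 + \<kappa> / 6" using b[of 1] by linarith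
        then show ?thesis using far \<kappa> by linarith
      qed
      then show ?thesis by (simp add: \<phi>_def p_def algebra_simps)
    qed
    let ?A = "{0..tau_est k (h n) n (T n) (\<Delta> n)}"
    have IA: "{t - \<epsilon><..<t + \<epsilon>} \<subseteq> ?A"
    proof
      fix s assume "s \<in> {t - \<epsilon><..<t + \<epsilon>}"
      then have s: "\<bar>s - t\<bar> \<le> 2 * \<epsilon>" by (auto simp: abs_le_iff)
      then show "s \<in> ?A" using le_tau_est[OF h(1) _ gt(2)[OF s]] J[OF s] h by auto
    qed
    have F_eq: "F_MS k (h n) n (T n) (\<Delta> n) s = Fn n s" if s: "s \<in> {t - \<epsilon><..<t + \<epsilon>}" for s
      unfolding F_MS_def curve_def
    proof (rule right_slope_hull[OF IA s])
      fix u v assume uv: "t - \<epsilon> < u" "u < v" "v < t + \<epsilon>"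
      show "ah n u < ah n v"
      proof (rule DERIV_pos_imp_increasing[OF uv(2)])
        fix x assume "u \<le> x" "x \<le> v"
        then have x: "\<bar>x - t\<bar> \<le> 2 * \<epsilon>" using uv \<epsilon> by (simp add: abs_le_iff)
        show "\<exists>y. ((\<lambda>v. ah n v) has_real_derivative y) (at x) \<and> 0 < y"
          using G_tot_has_derivative[OF h(1) J[OF x]] gt(2)[OF x] by blast
      qed
    next
      have "isCont (\<lambda>v. ah n v) x" if "x \<in> {t - \<epsilon><..<t + \<epsilon>}" for x
      proof -
        have x: "\<bar>x - t\<bar> \<le> 2 * \<epsilon>" using that by (auto simp: abs_le_iff)
        show ?thesis by (rule DERIV_isCont[OF G_tot_has_derivative[OF h(1) J[OF x]]])
      qed
      then show "continuous_on {t - \<epsilon><..<t + \<epsilon>} (\<lambda>v. ah n v)" by (intro continuous_at_imp_continuous_on) auto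
    next
      fix u v assume "t - \<epsilon> < u" "u \<le> v" "v < t + \<epsilon>"
      then show "Fn n u \<le> Fn n v" using \<epsilon> by (intro Fn_mono) auto
    next
      have "\<bar>s - t\<bar> \<le> 2 * \<epsilon>" using s by (auto simp: abs_le_iff)
      then show "isCont (\<lambda>s. Fn n s) s" by (rule DERIV_isCont[OF FnD])
    next
      fix u v assume "u \<in> {t - \<epsilon><..<t + \<epsilon>}" "v \<in> ?A"
      then show "bh n u + Fn n u * (ah n v - ah n u) \<le> bh n v" by (intro tangent) (auto simp: abs_less_iff)
    qed
    have tI: "t \<in> {t - \<epsilon><..<t + \<epsilon>}" using \<epsilon> by auto
    have "\<forall>\<^sub>F s in nhds t. s \<in> {t - \<epsilon><..<t + \<epsilon>}" using tI by (intro eventually_nhds_in_open) auto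
    then have "\<forall>\<^sub>F s in nhds t. F_MS k (h n) n (T n) (\<Delta> n) s = Fn n s" by eventually_elim (rule F_eq)
    then have "f_MS k (h n) n (T n) (\<Delta> n) t = deriv (\<lambda>s. Fn n s) t"
      unfolding f_MS_def by (intro deriv_cong_ev) auto
    also have "\<dots> = f_naive k (h n) n (T n) (\<Delta> n) t"
      by (rule DERIV_imp_deriv[OF FnD]) (use \<epsilon> in auto)
    finally show ?case using F_eq[OF tI] by (simp add: lambda_MS_def lambda_naive_def)
  qed
qed

section \<open>Bias and expansion of the naive hazard estimator\<close>

lemma small_multiplier:
  fixes \<epsilon> c C :: real
  assumes "0 < \<epsilon>" "0 < c" "0 \<le> C"
  shows "\<exists>\<eta>>0. \<eta> * c * C < \<epsilon>"
proof (intro exI conjI)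
  show "0 < \<epsilon> / (c * (C + 1))" using assms by (intro divide_pos_pos mult_pos_pos) auto
  have "\<epsilon> / (c * (C + 1)) * c * C = \<epsilon> * (C / (C + 1))" using assms by (simp add: divide_simps)
  also have "\<dots> < \<epsilon> * 1" using assms by (intro mult_strict_left_mono) auto
  finally show "\<epsilon> / (c * (C + 1)) * c * C < \<epsilon>" by simp
qed

text \<open>The same expansion as in \<open>smoothed_Gs\<close>, now for the density, at the
  single point \<open>t\<close> and up to second or third order; an error \<open>o(h^3)\<close>
  needs no more than continuity at \<open>t\<close> of the third derivative.\<close>

lemma smoothed_D:
  assumes i: "i \<le> 1" and p: "p = 2 \<or> p = 3" and \<kappa>: "unit_kernel \<kappa>" and \<eta>: "0 < \<eta>"
  shows "\<forall>\<^sub>F n in sequentially. \<bar>(LBINT v. \<kappa> v * D i 0 (t - h n * v)) - (\<Sum>m\<le>p. D i m t / fact m * (- h n) ^ m * (LBINT v. v ^ m * \<kappa> v))\<bar>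
     \<le> \<eta> * h n ^ p * (LBINT v. \<bar>\<kappa> v\<bar>)"
proof -
  have "isCont (D i p) t" using p D_cont[OF i] D_isCont[OF i, of 2 t] \<rho> by auto
  then obtain d where d: "d > 0" "\<And>y. \<bar>y - t\<bar> < d \<Longrightarrow> \<bar>D i p y - D i p t\<bar> < \<eta>"
    unfolding continuous_at_eps_delta dist_real_def using \<eta> by blast
  have "\<forall>\<^sub>F n in sequentially. h n < min d \<rho>" using h_0 by (rule order_tendstoD(2)) (use d \<rho> in auto)
  then show ?thesis using h_pos
  proof eventually_elim
    case (elim n)
    show ?case
    proof (rule unit_kernel_taylor[OF \<kappa> D_meas[OF i]])
      fix v :: real assume v: "\<bar>v\<bar> \<le> 1"
      have x: "\<bar>- (h n * v)\<bar> \<le> h n" using v elim by (simp add: abs_mult mult_left_le)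
      have "\<bar>D i 0 (t + - (h n * v)) - (\<Sum>m\<le>p. D i m t / fact m * (- (h n * v)) ^ m)\<bar> \<le> \<eta> * \<bar>- (h n * v)\<bar> ^ p"
      proof (rule taylor_pointwise[where t=t and \<rho>=\<rho>])
        fix m u assume "m < p" "\<bar>u - t\<bar> < \<rho>"
        then show "(D i m has_real_derivative D i (Suc m) u) (at u)" using p by (intro D_D i) auto
      next
        show "\<bar>t - t\<bar> + \<bar>- (h n * v)\<bar> < \<rho>" using x elim by auto
        fix y assume "\<bar>y - t\<bar> \<le> \<bar>- (h n * v)\<bar>"
        then have "\<bar>y - t\<bar> < d" using x elim by linarith
        then show "\<bar>D i p y - D i p t\<bar> \<le> \<eta>" using d(2) by (simp add: less_imp_le)
      qed (use p in auto)
      also have "\<dots> \<le> \<eta> * h n ^ p" using x \<eta> by (intro mult_left_mono power_mono) auto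
      finally show "\<bar>D i 0 (t - h n * v) - (\<Sum>m\<le>p. D i m t / fact m * (- (h n * v)) ^ m)\<bar> \<le> \<eta> * h n ^ p" by simp
    qed (use elim in auto)
  qed
qed

text \<open>The means of the density estimator at \<open>t\<close> and of its derivative.\<close>

definition "E0 n i = (LBINT v. k v * D i 0 (t - h n * v))"
definition "E1 n i = (LBINT v. deriv k v * D i 0 (t - h n * v)) / h n"

text \<open>The first moment of \<open>k\<close> vanishes, so the first bias term is of order
  \<open>h^2\<close>.\<close>

lemma bias_value:
  assumes i: "i \<le> 1" and R: "\<forall>\<^sub>F n in sequentially. R n * (h n)\<^sup>2 = c" and c: "0 < c"
  shows "(\<lambda>n. R n * (E0 n i - D i 0 t)) \<longlonglongrightarrow> c / 2 * m2 k * D i 2 t"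
proof (rule tendstoI)
  fix \<epsilon> :: real assume \<epsilon>: "0 < \<epsilon>"
  define C where "C = (LBINT v. \<bar>k v\<bar>)"
  have C: "0 \<le> C" unfolding C_def by (auto intro!: integral_nonneg_AE)
  obtain \<eta> where \<eta>: "0 < \<eta>" "\<eta> * c * C < \<epsilon>" using small_multiplier[OF \<epsilon> c C] by blast
  show "\<forall>\<^sub>F n in sequentially. dist (R n * (E0 n i - D i 0 t)) (c / 2 * m2 k * D i 2 t) < \<epsilon>"
    using smoothed_D[OF i disjI1[OF refl] unit_kernel_k \<eta>(1)] R h_pos
  proof eventually_elim
    case (elim n)
    have R0: "0 < R n" using elim(2,3) c by (metis zero_less_mult_pos2 zero_less_power)
    let ?d = "E0 n i - D i 0 t - D i 2 t / 2 * (h n)\<^sup>2 * m2 k"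
    have s: "(\<Sum>m\<le>2. D i m t / fact m * (- h n) ^ m * (LBINT v. v ^ m * k v)) = D i 0 t + D i 2 t / 2 * (h n)\<^sup>2 * m2 k"
    proof -
      have "{..2} = {0, 1, 2::nat}" by auto
      then show ?thesis by (simp add: k_one k_moment_1 k_moment_2)
    qed
    have "\<bar>?d\<bar> \<le> \<eta> * (h n)\<^sup>2 * C"
      using elim(1) unfolding E0_def[symmetric] C_def s by (simp add: diff_diff_add)
    then have "R n * \<bar>?d\<bar> \<le> R n * (\<eta> * (h n)\<^sup>2 * C)" using R0 by (intro mult_left_mono) auto
    also have "\<dots> = \<eta> * (R n * (h n)\<^sup>2) * C" by (simp add: algebra_simps)
    also have "\<dots> < \<epsilon>" using \<eta>(2) elim(2) by simp
    also have "R n * \<bar>?d\<bar> = \<bar>R n * ?d\<bar>" using R0 by (simp add: abs_mult)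
    also have "R n * ?d = R n * (E0 n i - D i 0 t) - (R n * (h n)\<^sup>2) / 2 * m2 k * D i 2 t" by (simp add: algebra_simps)
    finally show ?case using elim(2) by (simp add: dist_real_def)
  qed
qed

text \<open>The moments of \<open>k'\<close> of order 0 and 2 vanish and those of order 1 and 3
  are \<open>-1\<close> and \<open>-3 m2\<close>, so the bias of the derivative has the same shape
  as that of the value, one order of differentiation higher.\<close>

lemma bias_deriv:
  assumes i: "i \<le> 1" and R: "\<forall>\<^sub>F n in sequentially. R n * (h n)\<^sup>2 = c" and c: "0 < c"
  shows "(\<lambda>n. R n * (E1 n i - D i 1 t)) \<longlonglongrightarrow> c / 2 * m2 k * D i 3 t"
proof (rule tendstoI)
  fix \<epsilon> :: real assume \<epsilon>: "0 < \<epsilon>"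
  define C where "C = (LBINT v. \<bar>deriv k v\<bar>)"
  have C: "0 \<le> C" unfolding C_def by (auto intro!: integral_nonneg_AE)
  obtain \<eta> where \<eta>: "0 < \<eta>" "\<eta> * c * C < \<epsilon>" using small_multiplier[OF \<epsilon> c C] by blast
  show "\<forall>\<^sub>F n in sequentially. dist (R n * (E1 n i - D i 1 t)) (c / 2 * m2 k * D i 3 t) < \<epsilon>"
    using smoothed_D[OF i disjI2[OF refl] unit_kernel_k1 \<eta>(1)] R h_pos
  proof eventually_elim
    case (elim n)
    have R0: "0 < R n" using elim(2,3) c by (metis zero_less_mult_pos2 zero_less_power)
    let ?d = "E1 n i - D i 1 t - D i 3 t / 2 * (h n)\<^sup>2 * m2 k"
    have s: "(\<Sum>m\<le>3. D i m t / fact m * (- h n) ^ m * (LBINT v. v ^ m * deriv k v)) = D i 1 t * h n + D i 3 t / 2 * h n ^ 3 * m2 k"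
    proof -
      have "{..3} = {0, 1, 2, 3::nat}" by auto
      then show ?thesis by (simp add: k1_moment_0 k1_moment_1 k1_moment_2 k1_moment_3 fact_numeral)
    qed
    have E1h: "(LBINT v. deriv k v * D i 0 (t - h n * v)) = E1 n i * h n" using elim(3) by (simp add: E1_def)
    have "\<bar>E1 n i * h n - (D i 1 t * h n + D i 3 t / 2 * h n ^ 3 * m2 k)\<bar> \<le> \<eta> * h n ^ 3 * C"
      using elim(1) unfolding E1h C_def s .
    also have "E1 n i * h n - (D i 1 t * h n + D i 3 t / 2 * h n ^ 3 * m2 k) = h n * ?d"
      by (simp add: power3_eq_cube power2_eq_square algebra_simps)
    also have "\<bar>h n * ?d\<bar> = h n * \<bar>?d\<bar>" using elim(3) by (simp add: abs_mult)
    also have "\<eta> * h n ^ 3 * C = h n * (\<eta> * (h n)\<^sup>2 * C)" by (simp add: power3_eq_cube power2_eq_square)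
    finally have "\<bar>?d\<bar> \<le> \<eta> * (h n)\<^sup>2 * C" using elim(3) by simp
    then have "R n * \<bar>?d\<bar> \<le> R n * (\<eta> * (h n)\<^sup>2 * C)" using R0 by (intro mult_left_mono) auto
    also have "\<dots> = \<eta> * (R n * (h n)\<^sup>2) * C" by (simp add: algebra_simps)
    also have "\<dots> < \<epsilon>" using \<eta>(2) elim(2) by simp
    also have "R n * \<bar>?d\<bar> = \<bar>R n * ?d\<bar>" using R0 by (simp add: abs_mult)
    also have "R n * ?d = R n * (E1 n i - D i 1 t) - (R n * (h n)\<^sup>2) / 2 * m2 k * D i 3 t" by (simp add: algebra_simps)
    finally show ?case using elim(2) by (simp add: dist_real_def)
  qed
qed

text \<open>The naive hazard is \<open>A g1' - B g0'\<close> with coefficients \<open>A = 1 / (g0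
  + g1)\<close> and \<open>B = g1 / (g0 (g0 + g1))\<close> of the estimated values. Splitting off
  the fluctuation of the derivatives with limiting coefficients \<open>\<A>\<close> and
  \<open>\<B>\<close> leaves the bias of the derivatives and the error of the coefficients. By
  \<open>val\<close> the latter is only bias as well, and it is linearized exactly, as a
  difference of fractions, and not by a derivative.\<close>

theorem naive_expansion:
  fixes R :: "nat \<Rightarrow> real" and c :: real
  assumes R: "\<forall>\<^sub>F n in sequentially. R n * (h n)\<^sup>2 = c" and c: "0 < c"
    and val: "\<And>i. i \<le> 1 \<Longrightarrow> (\<lambda>n. R n * (gh n i t - E0 n i)) \<longlonglongrightarrow> 0"
  defines "q0 \<equiv> D 0 0 t" and "q1 \<equiv> D 1 0 t"
  defines "\<A> \<equiv> 1 / (q0 + q1)" and "\<B> \<equiv> q1 / (q0 * (q0 + q1))"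
  shows "(\<lambda>n. R n * (lambda_naive k (h n) n (T n) (\<Delta> n) t - (\<A> * D 1 1 t - \<B> * D 0 1 t))
      - R n * (\<A> * (gh' n 1 t - E1 n 1) - \<B> * (gh' n 0 t - E1 n 0)))
    \<longlonglongrightarrow> c / 2 * m2 k * (\<A> * D 1 3 t - \<B> * D 0 3 t - (D 0 2 t + D 1 2 t) / (q0 + q1)\<^sup>2 * D 1 1 t
        - (D 1 2 t * q0 * (q0 + q1) - q1 * (D 0 2 t * (q0 + q1) + q0 * (D 0 2 t + D 1 2 t))) / (q0 * (q0 + q1))\<^sup>2 * D 0 1 t)"
proof -
  have q: "0 < q0" "0 < q1" using D_pos[of 0] D_pos[of 1] by (auto simp: q0_def q1_def)
  define \<beta> where "\<beta> i = c / 2 * m2 k * D i 2 t" for i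
  have lim0: "(\<lambda>n. gh n i t) \<longlonglongrightarrow> D i 0 t" "(\<lambda>n. gh' n i t) \<longlonglongrightarrow> D i 1 t" if "i \<le> 1" for i
  proof -
    have "\<forall>\<^sub>F n in sequentially. \<bar>gh n i t - D i 0 t\<bar> \<le> e / 2 \<and> \<bar>gh' n i t - D i 1 t\<bar> \<le> e / 2" if "0 < e" for e
      using uniform_consistency[of "e / 2"] that \<open>i \<le> 1\<close> \<rho> by (auto elim!: eventually_mono)
    then have H: "\<forall>\<^sub>F n in sequentially. \<bar>gh n i t - D i 0 t\<bar> < e \<and> \<bar>gh' n i t - D i 1 t\<bar> < e" if "0 < e" for e
      using that by (smt (verit) eventually_mono field_sum_of_halves)
    show "(\<lambda>n. gh n i t) \<longlonglongrightarrow> D i 0 t"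
      by (rule tendstoI) (use H in \<open>fastforce simp: dist_real_def elim!: eventually_mono\<close>)
    show "(\<lambda>n. gh' n i t) \<longlonglongrightarrow> D i 1 t"
      by (rule tendstoI) (use H in \<open>fastforce simp: dist_real_def elim!: eventually_mono\<close>)
  qed
  have l: "(\<lambda>n. gh n 0 t) \<longlonglongrightarrow> q0" "(\<lambda>n. gh n 1 t) \<longlonglongrightarrow> q1" "(\<lambda>n. gh' n 0 t) \<longlonglongrightarrow> D 0 1 t" "(\<lambda>n. gh' n 1 t) \<longlonglongrightarrow> D 1 1 t"
    using lim0[of 0] lim0[of 1] by (auto simp: q0_def q1_def)
  have lR: "(\<lambda>n. R n * (gh n i t - D i 0 t)) \<longlonglongrightarrow> \<beta> i" if "i \<le> 1" for i
    using tendsto_add[OF val[OF that] bias_value[OF that R c]] by (simp add: \<beta>_def algebra_simps)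
  have R0: "(\<lambda>n. R n * (gh n 0 t - q0)) \<longlonglongrightarrow> \<beta> 0" and R1: "(\<lambda>n. R n * (gh n 1 t - q1)) \<longlonglongrightarrow> \<beta> 1"
    using lR[of 0] lR[of 1] by (auto simp: q0_def q1_def)
  let ?dA = "\<lambda>n. - (R n * (gh n 0 t - q0) + R n * (gh n 1 t - q1)) / ((gh n 0 t + gh n 1 t) * (q0 + q1))"
  let ?dB = "\<lambda>n. (R n * (gh n 1 t - q1) * q0 * (q0 + q1) - q1 * (R n * (gh n 0 t - q0) * (gh n 0 t + gh n 1 t) + q0 * (R n * (gh n 0 t - q0) + R n * (gh n 1 t - q1))))
      / (gh n 0 t * (gh n 0 t + gh n 1 t) * (q0 * (q0 + q1)))"
  have dA: "?dA \<longlonglongrightarrow> - (\<beta> 0 + \<beta> 1) / ((q0 + q1) * (q0 + q1))"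
    using q by (intro tendsto_intros R0 R1 l) auto
  have dB: "?dB \<longlonglongrightarrow> (\<beta> 1 * q0 * (q0 + q1) - q1 * (\<beta> 0 * (q0 + q1) + q0 * (\<beta> 0 + \<beta> 1))) / (q0 * (q0 + q1) * (q0 * (q0 + q1)))"
    using q by (intro tendsto_intros R0 R1 l) auto
  have b1: "(\<lambda>n. R n * (E1 n 1 - D 1 1 t)) \<longlonglongrightarrow> c / 2 * m2 k * D 1 3 t" "(\<lambda>n. R n * (E1 n 0 - D 0 1 t)) \<longlonglongrightarrow> c / 2 * m2 k * D 0 3 t"
    by (intro bias_deriv[OF _ R c]; simp)+
  have "(\<lambda>n. \<A> * (R n * (E1 n 1 - D 1 1 t)) - \<B> * (R n * (E1 n 0 - D 0 1 t)) + ?dA n * gh' n 1 t - ?dB n * gh' n 0 t)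
    \<longlonglongrightarrow> \<A> * (c / 2 * m2 k * D 1 3 t) - \<B> * (c / 2 * m2 k * D 0 3 t) + (- (\<beta> 0 + \<beta> 1) / ((q0 + q1) * (q0 + q1))) * D 1 1 t
      - ((\<beta> 1 * q0 * (q0 + q1) - q1 * (\<beta> 0 * (q0 + q1) + q0 * (\<beta> 0 + \<beta> 1))) / (q0 * (q0 + q1) * (q0 * (q0 + q1)))) * D 0 1 t"
    by (intro tendsto_add tendsto_diff tendsto_mult[OF dA] tendsto_mult[OF dB] tendsto_mult[OF tendsto_const] b1 l)
  also have "\<A> * (c / 2 * m2 k * D 1 3 t) - \<B> * (c / 2 * m2 k * D 0 3 t) + (- (\<beta> 0 + \<beta> 1) / ((q0 + q1) * (q0 + q1))) * D 1 1 t
      - ((\<beta> 1 * q0 * (q0 + q1) - q1 * (\<beta> 0 * (q0 + q1) + q0 * (\<beta> 0 + \<beta> 1))) / (q0 * (q0 + q1) * (q0 * (q0 + q1)))) * D 0 1 t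
    = c / 2 * m2 k * (\<A> * D 1 3 t - \<B> * D 0 3 t - (D 0 2 t + D 1 2 t) / (q0 + q1)\<^sup>2 * D 1 1 t
        - (D 1 2 t * q0 * (q0 + q1) - q1 * (D 0 2 t * (q0 + q1) + q0 * (D 0 2 t + D 1 2 t))) / (q0 * (q0 + q1))\<^sup>2 * D 0 1 t)"
  proof -
    let ?C = "c / 2 * m2 k"
    have 1: "- (\<beta> 0 + \<beta> 1) / ((q0 + q1) * (q0 + q1)) = ?C * (- ((D 0 2 t + D 1 2 t) / (q0 + q1)\<^sup>2))"
    proof -
      have "\<beta> 0 + \<beta> 1 = ?C * (D 0 2 t + D 1 2 t)" by (simp add: \<beta>_def algebra_simps)
      then show ?thesis
        by (simp only: power2_eq_square minus_divide_left[symmetric] mult_minus_right times_divide_eq_right)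
    qed
    have 2: "(\<beta> 1 * q0 * (q0 + q1) - q1 * (\<beta> 0 * (q0 + q1) + q0 * (\<beta> 0 + \<beta> 1))) = ?C * (D 1 2 t * q0 * (q0 + q1) - q1 * (D 0 2 t * (q0 + q1) + q0 * (D 0 2 t + D 1 2 t)))"
    proof -
      have "K * a * q0 * q - q1 * (K * b * q + q0 * (K * b + K * a)) = K * (a * q0 * q - q1 * (b * q + q0 * (b + a)))"
        for K a b q :: real by (simp add: algebra_simps)
      then show ?thesis unfolding \<beta>_def .
    qed
    have 3: "a * (K * x) - b * (K * y) + K * (- u) * z - K * w / v * s = K * (a * x - b * y - u * z - w / v * s)"
      for K a b x y u z w v s :: real by (simp add: algebra_simps)
    show ?thesis unfolding 1 2 power2_eq_square by (rule 3)
  qed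
  finally have main: "(\<lambda>n. \<A> * (R n * (E1 n 1 - D 1 1 t)) - \<B> * (R n * (E1 n 0 - D 0 1 t)) + ?dA n * gh' n 1 t - ?dB n * gh' n 0 t)
    \<longlonglongrightarrow> c / 2 * m2 k * (\<A> * D 1 3 t - \<B> * D 0 3 t - (D 0 2 t + D 1 2 t) / (q0 + q1)\<^sup>2 * D 1 1 t
        - (D 1 2 t * q0 * (q0 + q1) - q1 * (D 0 2 t * (q0 + q1) + q0 * (D 0 2 t + D 1 2 t))) / (q0 * (q0 + q1))\<^sup>2 * D 0 1 t)" .
  have "\<forall>\<^sub>F n in sequentially. 0 < gh n 0 t" "\<forall>\<^sub>F n in sequentially. 0 < gh n 1 t"
    using l(1,2) q by (auto intro: order_tendstoD(1))
  then have eq: "\<forall>\<^sub>F n in sequentially. R n * (lambda_naive k (h n) n (T n) (\<Delta> n) t - (\<A> * D 1 1 t - \<B> * D 0 1 t))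
      - R n * (\<A> * (gh' n 1 t - E1 n 1) - \<B> * (gh' n 0 t - E1 n 0))
    = \<A> * (R n * (E1 n 1 - D 1 1 t)) - \<B> * (R n * (E1 n 0 - D 0 1 t)) + ?dA n * gh' n 1 t - ?dB n * gh' n 0 t"
  proof eventually_elim
    case (elim n)
    define x0 x1 where x: "x0 = gh n 0 t" "x1 = gh n 1 t"
    have p: "0 < x0" "0 < x1" using elim by (auto simp: x)
    have lam: "lambda_naive k (h n) n (T n) (\<Delta> n) t = 1 / (x0 + x1) * gh' n 1 t - x1 / (x0 * (x0 + x1)) * gh' n 0 t"
    proof -
      have "1 - x1 / (x0 + x1) = x0 / (x0 + x1)" using p by (simp add: field_simps)
      then have "lambda_naive k (h n) n (T n) (\<Delta> n) t = ((x0 * gh' n 1 t - gh' n 0 t * x1) / (x0 + x1)\<^sup>2) / (x0 / (x0 + x1))"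
        unfolding lambda_naive_def f_naive_eq by (simp add: F_naive_def g_est_tot_def x)
      also have "\<dots> = 1 / (x0 + x1) * gh' n 1 t - x1 / (x0 * (x0 + x1)) * gh' n 0 t"
        using p by (simp add: divide_simps power2_eq_square)
      finally show ?thesis .
    qed
    have A: "R n * (1 / (x0 + x1) - \<A>) = ?dA n"
    proof -
      have "1 / (x0 + x1) - 1 / (q0 + q1) = - ((x0 - q0) + (x1 - q1)) / ((x0 + x1) * (q0 + q1))"
        using p q by (simp add: divide_simps)
      then show ?thesis unfolding \<A>_def x by (simp add: algebra_simps)
    qed
    have B: "R n * (x1 / (x0 * (x0 + x1)) - \<B>) = ?dB n"
    proof -
      have "x1 / (x0 * (x0 + x1)) - q1 / (q0 * (q0 + q1))
        = (x1 * (q0 * (q0 + q1)) - q1 * (x0 * (x0 + x1))) / (x0 * (x0 + x1) * (q0 * (q0 + q1)))"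
        using p q by (simp add: divide_simps)
      also have "x1 * (q0 * (q0 + q1)) - q1 * (x0 * (x0 + x1))
        = (x1 - q1) * q0 * (q0 + q1) - q1 * ((x0 - q0) * (x0 + x1) + q0 * ((x0 - q0) + (x1 - q1)))" by (simp add: algebra_simps)
      finally have "R n * (x1 / (x0 * (x0 + x1)) - \<B>) = R n * ((x1 - q1) * q0 * (q0 + q1) - q1 * ((x0 - q0) * (x0 + x1) + q0 * ((x0 - q0) + (x1 - q1)))) / (x0 * (x0 + x1) * (q0 * (q0 + q1)))"
        by (simp add: \<B>_def)
      also have "R n * ((x1 - q1) * q0 * (q0 + q1) - q1 * ((x0 - q0) * (x0 + x1) + q0 * ((x0 - q0) + (x1 - q1))))
        = R n * (x1 - q1) * q0 * (q0 + q1) - q1 * (R n * (x0 - q0) * (x0 + x1) + q0 * (R n * (x0 - q0) + R n * (x1 - q1)))"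
        by (simp add: algebra_simps)
      finally show ?thesis unfolding x .
    qed
    show ?case unfolding lam A[symmetric] B[symmetric] by (simp add: algebra_simps)
  qed
  show ?thesis by (rule Lim_transform_eventually[OF main]) (use eq in \<open>auto elim!: eventually_mono\<close>)
qed

end

section \<open>A countable description of the slope of the lower hull\<close>

text \<open>For a monotone function a one-sided limit can be read off from a single sequence,
  which is a countable operation.\<close>

lemma monotone_right_limit_iff:
  fixes q :: "real \<Rightarrow> real"
  assumes d: "0 < d" and mono: "(\<forall>y z. x < y \<longrightarrow> y \<le> z \<longrightarrow> z < x + d \<longrightarrow> q y \<le> q z) \<or> (\<forall>y z. x < y \<longrightarrow> y \<le> z \<longrightarrow> z < x + d \<longrightarrow> q z \<le> q y)"
  shows "(q \<longlongrightarrow> l) (at_right x) \<longleftrightarrow> (\<lambda>m. q (x + 1 / real (Suc m))) \<longlonglongrightarrow> l"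
proof
  assume q: "(q \<longlongrightarrow> l) (at_right x)"
  have "(\<lambda>m. x + 1 / real (Suc m)) \<longlonglongrightarrow> x + 0"
    by (intro tendsto_intros LIMSEQ_Suc[OF lim_1_over_n])
  then have "filterlim (\<lambda>m. x + 1 / real (Suc m)) (at_right x) sequentially"
    by (auto simp: filterlim_at)
  from filterlim_compose[OF q this] show "(\<lambda>m. q (x + 1 / real (Suc m))) \<longlonglongrightarrow> l" .
next
  assume s: "(\<lambda>m. q (x + 1 / real (Suc m))) \<longlonglongrightarrow> l"
  have *: "(q \<longlongrightarrow> l) (at_right x)" if s: "(\<lambda>m. q (x + 1 / real (Suc m))) \<longlonglongrightarrow> l"
    and mono: "\<And>y z. x < y \<Longrightarrow> y \<le> z \<Longrightarrow> z < x + d \<Longrightarrow> q y \<le> q z" for q :: "real \<Rightarrow> real" and l :: real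
  proof (rule tendstoI)
    fix e :: real assume e: "0 < e"
    have "\<forall>\<^sub>F m in sequentially. dist (q (x + 1 / real (Suc m))) l < e" using s e by (rule tendstoD)
    moreover have "\<forall>\<^sub>F m in sequentially. 1 / real (Suc m) < d"
      using LIMSEQ_Suc[OF lim_1_over_n] d by (rule order_tendstoD(2))
    ultimately have "\<forall>\<^sub>F m in sequentially. dist (q (x + 1 / real (Suc m))) l < e \<and> 1 / real (Suc m) < d"
      by (rule eventually_conj)
    then obtain m0 where m0: "\<And>m. m \<ge> m0 \<Longrightarrow> dist (q (x + 1 / real (Suc m))) l < e \<and> 1 / real (Suc m) < d"
      unfolding eventually_sequentially by blast
    have "dist (q y) l < e" if y: "x < y" "y < x + 1 / real (Suc m0)" for y
    proof -
      have up: "q y \<le> q (x + 1 / real (Suc m0))" using y m0[of m0] by (intro mono) auto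
      obtain m where m: "inverse (real (Suc m)) < y - x" using reals_Archimedean[of "y - x"] y by auto
      define m' where "m' = max m m0"
      have "1 / real (Suc m') \<le> inverse (real (Suc m))" by (simp add: m'_def inverse_eq_divide frac_le)
      then have "x + 1 / real (Suc m') \<le> y" using m by linarith
      then have lo: "q (x + 1 / real (Suc m')) \<le> q y" using y m0[of m0] by (intro mono) auto
      have "dist (q (x + 1 / real (Suc m0))) l < e" "dist (q (x + 1 / real (Suc m'))) l < e"
        using m0[of m0] m0[of m'] by (auto simp: m'_def)
      then show ?thesis using up lo unfolding dist_real_def by linarith
    qed
    then show "\<forall>\<^sub>F y in at_right x. dist (q y) l < e"
      unfolding eventually_at_right_field by (intro exI[of _ "x + 1 / real (Suc m0)"]) auto
  qed
  from mono show "(q \<longlongrightarrow> l) (at_right x)"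
  proof
    assume "\<forall>y z. x < y \<longrightarrow> y \<le> z \<longrightarrow> z < x + d \<longrightarrow> q y \<le> q z"
    then show ?thesis using *[OF s] by blast
  next
    assume a: "\<forall>y z. x < y \<longrightarrow> y \<le> z \<longrightarrow> z < x + d \<longrightarrow> q z \<le> q y"
    have "((\<lambda>y. - q y) \<longlongrightarrow> - l) (at_right x)"
      by (rule *) (use a tendsto_minus[OF s] in auto)
    then show ?thesis by (simp add: tendsto_minus_cancel_left)
  qed
qed

lemma rational_between: "(a::real) < b \<Longrightarrow> \<exists>r\<in>\<rat>. a < r \<and> r < b"
  by (rule Rats_dense_in_real)

lemma INF_rational:
  fixes f :: "real \<Rightarrow> real"
  assumes c: "continuous_on {0..} f" and b: "bdd_below (f ` {0..})"
  shows "(INF s\<in>{0..}. f s) = (INF s\<in>\<rat> \<inter> {0..}. f s)"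
proof (rule antisym)
  show "(INF s\<in>{0..}. f s) \<le> (INF s\<in>\<rat> \<inter> {0..}. f s)"
    by (rule cINF_superset_mono[OF _ b]) (auto intro: exI[of _ 0])
  have b': "bdd_below (f ` (\<rat> \<inter> {0..}))" using b by (rule bdd_below_mono) auto
  show "(INF s\<in>\<rat> \<inter> {0..}. f s) \<le> (INF s\<in>{0..}. f s)"
  proof (rule cINF_greatest)
    fix s :: real assume s: "s \<in> {0..}"
    show "(INF s\<in>\<rat> \<inter> {0..}. f s) \<le> f s"
    proof (rule field_le_epsilon)
      fix e :: real assume "0 < e"
      then obtain d where d: "d > 0" "\<And>y. y \<in> {0..} \<Longrightarrow> dist y s < d \<Longrightarrow> dist (f y) (f s) < e"
        using c s unfolding continuous_on_iff by metis
      obtain r where r: "r \<in> \<rat>" "s < r" "r < s + d" using rational_between[of s "s + d"] d by auto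
      have "(INF s\<in>\<rat> \<inter> {0..}. f s) \<le> f r" using b' r s by (intro cINF_lower) auto
      also have "\<dots> \<le> f s + e" using d(2)[of r] r s unfolding dist_real_def by auto
      finally show "(INF s\<in>\<rat> \<inter> {0..}. f s) \<le> f s + e" .
    qed
  qed auto
qed

text \<open>The lower hull of a curve as the supremum of its supporting lines with rational
  slopes, each given by an infimum over rational parameters. Over points outside the projection of
  the curve there is no point of the hull, and the infimum in \<open>lower_hull\<close> is taken
  over the empty set; this value has to be reproduced because difference quotients at the right
  end of the curve refer to it.\<close>

definition hull_rat :: "(real \<Rightarrow> real) \<Rightarrow> (real \<Rightarrow> real) \<Rightarrow> real \<Rightarrow> real" where
  "hull_rat a b x = (if (INF s\<in>\<rat> \<inter> {0..}. a s) \<le> x \<and> x \<le> (SUP s\<in>\<rat> \<inter> {0..}. a s)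
     then SUP p\<in>\<rat>. (INF s\<in>\<rat> \<inter> {0..}. b s - p * a s) + p * x else Inf {})"

definition hull_slope :: "(real \<Rightarrow> real) \<Rightarrow> (real \<Rightarrow> real) \<Rightarrow> real \<Rightarrow> real" where
  "hull_slope a b x = lim (\<lambda>m. (hull_rat a b (x + 1 / real (Suc m)) - hull_rat a b x) * real (Suc m))"

lemma borel_measurable_cSUP_real:
  fixes F :: "'i \<Rightarrow> 'a \<Rightarrow> real"
  assumes "countable I" "\<And>i. i \<in> I \<Longrightarrow> F i \<in> borel_measurable M"
  shows "(\<lambda>x. SUP i\<in>I. F i x) \<in> borel_measurable M"
proof -
  have "(\<lambda>x. - (INF i\<in>I. - F i x)) \<in> borel_measurable M"
    using assms by (intro borel_measurable_uminus borel_measurable_cINF_real) auto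
  then show ?thesis by (simp add: Inf_real_def image_image)
qed

lemma hull_slope_measurable:
  assumes a[measurable]: "\<And>s. 0 \<le> s \<Longrightarrow> (\<lambda>\<omega>. a \<omega> s) \<in> borel_measurable M"
    and b[measurable]: "\<And>s. 0 \<le> s \<Longrightarrow> (\<lambda>\<omega>. b \<omega> s) \<in> borel_measurable M"
    and x[measurable]: "x \<in> borel_measurable M"
  shows "(\<lambda>\<omega>. hull_slope (a \<omega>) (b \<omega>) (x \<omega>)) \<in> borel_measurable M"
proof -
  have c: "countable (\<rat> \<inter> {0::real..})" by (rule countable_subset[OF _ countable_rat]) auto
  have i: "(\<lambda>\<omega>. INF s\<in>\<rat> \<inter> {0..}. b \<omega> s - p * a \<omega> s) \<in> borel_measurable M" for p
    by (intro borel_measurable_cINF_real c) (auto intro!: borel_measurable_diff borel_measurable_times a b)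
  have [measurable]: "(\<lambda>\<omega>. INF s\<in>\<rat> \<inter> {0..}. a \<omega> s) \<in> borel_measurable M" "(\<lambda>\<omega>. SUP s\<in>\<rat> \<inter> {0..}. a \<omega> s) \<in> borel_measurable M"
    by (intro borel_measurable_cINF_real borel_measurable_cSUP_real c a; simp)+
  have r: "(\<lambda>\<omega>. hull_rat (a \<omega>) (b \<omega>) (y \<omega>)) \<in> borel_measurable M" if [measurable]: "y \<in> borel_measurable M" for y
  proof -
    have [measurable]: "(\<lambda>\<omega>. SUP p\<in>\<rat>. (INF s\<in>\<rat> \<inter> {0..}. b \<omega> s - p * a \<omega> s) + p * y \<omega>) \<in> borel_measurable M"
      by (intro borel_measurable_cSUP_real countable_rat borel_measurable_add i) measurable
    show ?thesis unfolding hull_rat_def by measurable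
  qed
  show ?thesis unfolding hull_slope_def
    by (intro borel_measurable_lim_metric borel_measurable_times borel_measurable_diff r) measurable
qed

text \<open>A continuous curve over the half line with a compact trace, such as a curve that
  eventually stops moving.\<close>

locale planar_curve =
  fixes a b :: "real \<Rightarrow> real"
  assumes ac: "continuous_on {0..} a" and bc: "continuous_on {0..} b"
    and comp: "compact ((\<lambda>s. (a s, b s)) ` {0..})"
begin

definition "S = (\<lambda>s. (a s, b s)) ` {0..}"
definition "H = lower_hull S"
definition "xmin = (INF s\<in>{0..}. a s)"
definition "xmax = (SUP s\<in>{0..}. a s)"
definition "L p = (INF s\<in>{0..}. b s - p * a s)"

lemma S_compact: "compact S" using comp by (simp add: S_def)
lemma K_compact: "compact (convex hull S)" by (rule compact_convex_hull[OF S_compact])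

lemma linear_bdd: "bdd_below ((\<lambda>s. b s - p * a s) ` {0..})" "bdd_below (a ` {0..})" "bdd_above (a ` {0..})"
proof -
  have "compact ((\<lambda>z. snd z - p * fst z) ` S)" "compact (fst ` S)"
    by (intro compact_continuous_image S_compact continuous_intros)+
  then have "bounded ((\<lambda>z. snd z - p * fst z) ` S)" "bounded (fst ` S)" by (auto intro: compact_imp_bounded)
  moreover have "(\<lambda>z. snd z - p * fst z) ` S = (\<lambda>s. b s - p * a s) ` {0..}" "fst ` S = a ` {0..}"
    by (auto simp: S_def image_image)
  ultimately show "bdd_below ((\<lambda>s. b s - p * a s) ` {0..})" "bdd_below (a ` {0..})" "bdd_above (a ` {0..})"
    by (auto intro: bounded_imp_bdd_below bounded_imp_bdd_above)
qed

lemma L_le: "(x, y) \<in> convex hull S \<Longrightarrow> L p \<le> y - p * x"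
proof -
  have "{z. L p \<le> snd z - p * fst z} = {z. inner (- p, 1) z \<ge> L p}" by (auto simp: inner_prod_def algebra_simps)
  then have "convex {z. L p \<le> snd z - p * fst z}" by (simp add: convex_halfspace_ge)
  moreover have "S \<subseteq> {z. L p \<le> snd z - p * fst z}"
    unfolding S_def L_def using linear_bdd(1)[of p] by (auto intro!: cINF_lower)
  ultimately have "convex hull S \<subseteq> {z. L p \<le> snd z - p * fst z}" by (intro hull_minimal)
  moreover assume "(x, y) \<in> convex hull S"
  ultimately show "L p \<le> y - p * x" by auto
qed

lemma x_range: "(\<exists>y. (x, y) \<in> convex hull S) \<longleftrightarrow> xmin \<le> x \<and> x \<le> xmax"
proof
  assume "\<exists>y. (x, y) \<in> convex hull S"
  then obtain y where y: "(x, y) \<in> convex hull S" by auto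
  have "{z. xmin \<le> fst z \<and> fst z \<le> xmax} = {z. inner (1, 0) z \<ge> xmin} \<inter> {z::real \<times> real. inner (1, 0) z \<le> xmax}"
    by (auto simp: inner_prod_def)
  then have "convex {z::real \<times> real. xmin \<le> fst z \<and> fst z \<le> xmax}"
    by (simp add: convex_Int convex_halfspace_ge convex_halfspace_le)
  moreover have "S \<subseteq> {z. xmin \<le> fst z \<and> fst z \<le> xmax}"
    unfolding S_def xmin_def xmax_def using linear_bdd(2,3) by (auto intro!: cINF_lower cSUP_upper)
  ultimately have "convex hull S \<subseteq> {z. xmin \<le> fst z \<and> fst z \<le> xmax}" by (intro hull_minimal)
  with y show "xmin \<le> x \<and> x \<le> xmax" by auto
next
  assume x: "xmin \<le> x \<and> x \<le> xmax"
  have img: "fst ` S = a ` {0..}" by (auto simp: S_def image_image)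
  have cl: "compact (fst ` S)" by (intro compact_continuous_image S_compact continuous_intros)
  then have "closed (a ` {0..})" unfolding img by (rule compact_imp_closed)
  then have "xmin \<in> fst ` S" "xmax \<in> fst ` S" unfolding img xmin_def xmax_def
    using linear_bdd(2,3) by (auto intro!: closed_contains_Inf closed_contains_Sup)
  then obtain y1 y2 where y: "(xmin, y1) \<in> S" "(xmax, y2) \<in> S" by auto
  have "x \<in> closed_segment xmin xmax" using x by (simp add: closed_segment_eq_real_ivl)
  then obtain u where u: "0 \<le> u" "u \<le> 1" "x = (1 - u) * xmin + u * xmax" by (auto simp: in_segment)
  have "(1 - u) *\<^sub>R (xmin, y1) + u *\<^sub>R (xmax, y2) \<in> convex hull S"
    using u y by (intro convexD_alt convex_convex_hull hull_inc) auto
  then show "\<exists>y. (x, y) \<in> convex hull S" using u by auto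
qed

lemma H_in: "xmin \<le> x \<Longrightarrow> x \<le> xmax \<Longrightarrow> (x, H x) \<in> convex hull S"
  and H_le: "(x, y) \<in> convex hull S \<Longrightarrow> H x \<le> y"
proof -
  let ?Y = "{y. (x, y) \<in> convex hull S}"
  have bd: "bdd_below ?Y" using L_le[of x _ 0] by (auto simp: bdd_below_def)
  show "(x, y) \<in> convex hull S \<Longrightarrow> H x \<le> y"
    unfolding H_def lower_hull_def using bd by (intro cInf_lower) auto
  have "closed ?Y"
  proof -
    have "?Y = (\<lambda>y. (x, y)) -` (convex hull S)" by auto
    also have "closed \<dots>" using K_compact by (intro closed_vimage continuous_intros compact_imp_closed)
    finally show ?thesis .
  qed
  assume "xmin \<le> x" "x \<le> xmax"
  then have "?Y \<noteq> {}" using x_range[of x] by auto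
  from closed_contains_Inf[OF this bd \<open>closed ?Y\<close>] show "(x, H x) \<in> convex hull S"
    by (simp add: H_def lower_hull_def)
qed

text \<open>A point strictly below the hull is separated from it by a line, which is not vertical
  because the hull contains a point above it. As the curve is bounded, a small change of the slope
  hardly moves the line, so the slope may be taken rational.\<close>

lemma H_dual:
  assumes x: "xmin \<le> x" "x \<le> xmax"
  shows "H x = (SUP p\<in>\<rat>. L p + p * x)"
proof (rule antisym)
  have le: "L p + p * x \<le> H x" for p using L_le[OF H_in[OF x], of p] by simp
  then have bd: "bdd_above ((\<lambda>p. L p + p * x) ` \<rat>)" by (auto simp: bdd_above_def)
  show "(SUP p\<in>\<rat>. L p + p * x) \<le> H x" by (rule cSUP_least) (use le in auto)
  show "H x \<le> (SUP p\<in>\<rat>. L p + p * x)"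
  proof (rule field_le_epsilon)
    fix e0 :: real assume e0: "0 < e0"
    define e where "e = e0 / 2"
    have e: "0 < e" using e0 by (simp add: e_def)
    have "(x, H x - e) \<notin> convex hull S" using H_le[of x "H x - e"] e by auto
    then obtain w c where w: "inner w (x, H x - e) < c" "\<And>z. z \<in> convex hull S \<Longrightarrow> inner w z > c"
      using separating_hyperplane_closed_point[of "convex hull S" "(x, H x - e)"] K_compact compact_imp_closed
      by (metis convex_convex_hull)
    obtain \<alpha> \<beta> where ab: "w = (\<alpha>, \<beta>)" by (cases w)
    have 1: "\<alpha> * x + \<beta> * (H x - e) < c" using w(1) by (simp add: ab inner_prod_def)
    have 2: "c < \<alpha> * x' + \<beta> * y'" if "(x', y') \<in> convex hull S" for x' y'
      using w(2)[OF that] by (simp add: ab inner_prod_def)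
    have "\<beta> * e > 0" using 1 2[OF H_in[OF x]] by (simp add: algebra_simps)
    then have \<beta>: "0 < \<beta>" using e by (simp add: zero_less_mult_iff)
    define p0 where "p0 = - \<alpha> / \<beta>"
    define c0 where "c0 = c / \<beta>"
    have dv: "(\<alpha> * x' + \<beta> * y') / \<beta> = y' - p0 * x'" for x' y'
      using \<beta> by (simp add: p0_def field_simps)
    have 3: "H x - e - p0 * x < c0"
      using divide_strict_right_mono[OF 1 \<beta>] unfolding dv c0_def .
    have 4: "c0 < y' - p0 * x'" if "(x', y') \<in> convex hull S" for x' y'
      using divide_strict_right_mono[OF 2[OF that] \<beta>] unfolding dv c0_def .
    obtain B where B: "B > 0" "\<And>s. 0 \<le> s \<Longrightarrow> \<bar>a s\<bar> \<le> B"
    proof -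
      have "bounded (fst ` S)"
        by (intro compact_imp_bounded compact_continuous_image S_compact continuous_intros)
      moreover have "fst ` S = a ` {0..}" by (auto simp: S_def image_image)
      ultimately have "bounded (a ` {0..})" by simp
      then show thesis using that unfolding bounded_pos by auto
    qed
    define g where "g = c0 - (H x - e - p0 * x)"
    have g: "0 < g" using 3 by (simp add: g_def)
    define \<delta> where "\<delta> = e / (B + \<bar>x\<bar> + 1)"
    have \<delta>: "0 < \<delta>" using e B by (simp add: \<delta>_def add_pos_nonneg)
    obtain p where p: "p \<in> \<rat>" "p0 < p" "p < p0 + \<delta>" using rational_between[of p0 "p0 + \<delta>"] \<delta> by auto
    have "H x - e - p0 * x - \<delta> * B \<le> L p" unfolding L_def
    proof (rule cINF_greatest)
      fix s :: real assume "s \<in> {0..}"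
      then have s: "(a s, b s) \<in> convex hull S" "\<bar>a s\<bar> \<le> B" using B by (auto simp: S_def intro!: hull_inc)
      have "\<bar>(p - p0) * a s\<bar> \<le> \<delta> * B" unfolding abs_mult using p s(2) by (intro mult_mono) auto
      then show "H x - e - p0 * x - \<delta> * B \<le> b s - p * a s" using 4[OF s(1)] 3 by (simp add: algebra_simps abs_le_iff)
    qed auto
    moreover have "\<bar>(p - p0) * x\<bar> \<le> \<delta> * \<bar>x\<bar>" unfolding abs_mult using p by (intro mult_right_mono) auto
    moreover have "\<delta> * B + \<delta> * \<bar>x\<bar> \<le> e"
    proof -
      have "\<delta> * (B + \<bar>x\<bar>) \<le> \<delta> * (B + \<bar>x\<bar> + 1)" using \<delta> by (intro mult_left_mono) auto
      also have "\<dots> = e" using B by (simp add: \<delta>_def add_pos_nonneg[THEN less_imp_neq, THEN not_sym])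
      finally show ?thesis by (simp add: algebra_simps)
    qed
    moreover have "(p - p0) * x = p * x - p0 * x" by (simp add: algebra_simps)
    ultimately have "H x \<le> (L p + p * x) + (e + e)" by (simp only: abs_le_iff) linarith
    also have "\<dots> \<le> (SUP p\<in>\<rat>. L p + p * x) + (e + e)" using p(1) bd by (intro add_right_mono cSUP_upper)
    finally show "H x \<le> (SUP p\<in>\<rat>. L p + p * x) + e0" by (simp add: e_def)
  qed
qed

lemma H_outside: "\<not> (xmin \<le> x \<and> x \<le> xmax) \<Longrightarrow> H x = Inf {}"
  unfolding H_def lower_hull_def using x_range[of x] by auto

abbreviation "H_rat \<equiv> hull_rat a b"
abbreviation "\<R> \<equiv> hull_slope a b"

lemma H_eq_H_rat: "H x = H_rat x"
proof -
  have 1: "L p = (INF s\<in>\<rat> \<inter> {0..}. b s - p * a s)" for p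
    unfolding L_def by (rule INF_rational) (auto intro!: continuous_intros ac bc linear_bdd)
  have 2: "xmin = (INF s\<in>\<rat> \<inter> {0..}. a s)"
    unfolding xmin_def by (rule INF_rational) (auto intro!: ac linear_bdd)
  have "(INF s\<in>{0..}. - a s) = (INF s\<in>\<rat> \<inter> {0..}. - a s)"
    by (rule INF_rational) (use linear_bdd(3) in \<open>auto intro!: continuous_intros ac simp: bdd_below_def bdd_above_def\<close>, metis neg_le_iff_le)
  then have 3: "xmax = (SUP s\<in>\<rat> \<inter> {0..}. a s)"
    unfolding xmax_def by (simp add: Inf_real_def image_image)
  show ?thesis unfolding hull_rat_def 1[symmetric] 2[symmetric] 3[symmetric] using H_dual H_outside by auto
qed

lemma H_convex:
  assumes "xmin \<le> x" "x < y" "y < z" "z \<le> xmax"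
  shows "(H y - H x) / (y - x) \<le> (H z - H x) / (z - x)"
    and "(H y - H x) / (y - x) \<le> (H z - H y) / (z - y)"
proof -
  define u where "u = (y - x) / (z - x)"
  have u: "0 \<le> u" "u \<le> 1" using assms by (auto simp: u_def)
  have uz: "u * (z - x) = y - x" using assms by (simp add: u_def)
  have "(1 - u) *\<^sub>R (x, H x) + u *\<^sub>R (z, H z) \<in> convex hull S"
    using u assms by (intro convexD_alt convex_convex_hull H_in) auto
  moreover have "(1 - u) *\<^sub>R (x, H x) + u *\<^sub>R (z, H z) = (y, (1 - u) * H x + u * H z)"
    using uz by (simp add: algebra_simps)
  ultimately have "H y \<le> (1 - u) * H x + u * H z" using H_le by simp
  then have "(H y - H x) * (z - x) \<le> (u * (H z - H x)) * (z - x)"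
    using assms by (intro mult_right_mono) (auto simp: algebra_simps)
  also have "\<dots> = (u * (z - x)) * (H z - H x)" by (simp add: algebra_simps)
  finally have *: "(H y - H x) * (z - x) \<le> (y - x) * (H z - H x)" unfolding uz .
  show "(H y - H x) / (y - x) \<le> (H z - H x) / (z - x)"
    using * assms by (simp add: divide_simps mult.commute)
  have "(H y - H x) * (z - y) \<le> (H z - H y) * (y - x)" using * by (simp add: algebra_simps)
  then show "(H y - H x) / (y - x) \<le> (H z - H y) / (z - y)"
    using assms by (simp add: divide_simps mult.commute)
qed

text \<open>Difference quotients of a convex function are monotone. At the right end
  \<open>xmax\<close> the values of \<open>H\<close> to the right are one constant, and the
  difference quotient is a multiple of \<open>1 / (y - x)\<close>, which is monotone too.\<close>

lemma right_limit_iff: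
  assumes x: "xmin \<le> x" "x \<le> xmax"
  shows "((\<lambda>y. (H y - H x) / (y - x)) \<longlongrightarrow> l) (at_right x) \<longleftrightarrow>
    (\<lambda>m. (H (x + 1 / real (Suc m)) - H x) * real (Suc m)) \<longlonglongrightarrow> l"
proof -
  have "((\<lambda>y. (H y - H x) / (y - x)) \<longlongrightarrow> l) (at_right x) \<longleftrightarrow>
    (\<lambda>m. (H (x + 1 / real (Suc m)) - H x) / (x + 1 / real (Suc m) - x)) \<longlonglongrightarrow> l"
  proof (cases "x < xmax")
    case True
    have "(H y - H x) / (y - x) \<le> (H z - H x) / (z - x)" if "x < y" "y \<le> z" "z < xmax" for y z
      using H_convex(1)[of x y z] x that by (cases "y = z") auto
    then show ?thesis using True by (intro monotone_right_limit_iff[of "xmax - x"]) auto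
  next
    case False
    then have xe: "x = xmax" using x by auto
    have H': "(H y - H x) / (y - x) = (Inf {} - H x) / (y - x)" if "x < y" for y
      using H_outside[of y] that xe by auto
    show ?thesis
    proof (rule monotone_right_limit_iff[of 1])
      show "(\<forall>y z. x < y \<longrightarrow> y \<le> z \<longrightarrow> z < x + 1 \<longrightarrow> (H y - H x) / (y - x) \<le> (H z - H x) / (z - x)) \<or>
        (\<forall>y z. x < y \<longrightarrow> y \<le> z \<longrightarrow> z < x + 1 \<longrightarrow> (H z - H x) / (z - x) \<le> (H y - H x) / (y - x))"
      proof (cases "0 \<le> Inf {} - H x")
        case True
        then have "(H z - H x) / (z - x) \<le> (H y - H x) / (y - x)" if "x < y" "y \<le> z" for y z
          using that H'[of y] H'[of z] by (auto intro!: divide_left_mono)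
        then show ?thesis by blast
      next
        case False
        then have "(H y - H x) / (y - x) \<le> (H z - H x) / (z - x)" if "x < y" "y \<le> z" for y z
          using that H'[of y] H'[of z] by (auto intro!: divide_left_mono_neg)
        then show ?thesis by blast
      qed
    qed simp
  qed
  then show ?thesis by simp
qed

text \<open>Both sides are choices of a limit, by the same choice operator; the possible limits
  agree by \<open>right_limit_iff\<close>, whether or not one exists.\<close>

lemma right_slope_eq:
  assumes x: "xmin \<le> x" "x \<le> xmax"
  shows "right_slope H x = \<R> x"
  unfolding right_slope_def hull_slope_def lim_def Lim_def t2_space_class.Lim_def H_eq_H_rat[symmetric] using right_limit_iff[OF x]
  by simp

lemma hull_slope_mono:
  assumes "xmin < x" "x \<le> y" "y < xmax"
  shows "\<R> x \<le> \<R> y"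
proof -
  have conv: "(\<lambda>m. (H (x + 1 / real (Suc m)) - H x) * real (Suc m)) \<longlonglongrightarrow> \<R> x"
    and le: "x < z \<Longrightarrow> z \<le> xmax \<Longrightarrow> \<R> x \<le> (H z - H x) / (z - x)"
    and ge: "xmin \<le> z \<Longrightarrow> z < x \<Longrightarrow> (H x - H z) / (x - z) \<le> \<R> x"
    if x: "xmin < x" "x < xmax" for x z
  proof -
    let ?q = "\<lambda>m. (H (x + 1 / real (Suc m)) - H x) * real (Suc m)"
    have q: "?q m = (H (x + 1 / real (Suc m)) - H x) / (x + 1 / real (Suc m) - x)" for m by simp
    have "\<forall>\<^sub>F m in sequentially. 1 / real (Suc m) < xmax - x"
      using LIMSEQ_Suc[OF lim_1_over_n] x by (intro order_tendstoD(2)) auto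
    then obtain N where N: "\<And>m. m \<ge> N \<Longrightarrow> x + 1 / real (Suc m) < xmax" unfolding eventually_sequentially by force
    have dec: "?q m' \<le> ?q m" if "N \<le> m" "m \<le> m'" for m m'
    proof (cases "m = m'")
      case False
      then have "x + 1 / real (Suc m') < x + 1 / real (Suc m)" using that by (auto intro!: divide_strict_left_mono)
      then show ?thesis unfolding q using H_convex(1)[of x "x + 1 / real (Suc m')" "x + 1 / real (Suc m)"] x N[OF that(1)] by auto
    qed simp
    have lower: "(H x - H z) / (x - z) \<le> ?q m" if "xmin \<le> z" "z < x" "N \<le> m" for z m
      unfolding q using H_convex(2)[of z x "x + 1 / real (Suc m)"] that N[OF that(3)] by auto
    have "convergent (\<lambda>m. ?q (m + N))"
    proof (rule Bseq_monoseq_convergent)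
      show "monoseq (\<lambda>m. ?q (m + N))" unfolding monoseq_def by (intro disjI2 allI impI dec) auto
      show "Bseq (\<lambda>m. ?q (m + N))"
      proof (rule BseqI')
        fix m
        have "?q (m + N) \<le> ?q N" by (rule dec) auto
        moreover have "(H x - H xmin) / (x - xmin) \<le> ?q (m + N)" by (rule lower) (use x in auto)
        ultimately show "norm (?q (m + N)) \<le> \<bar>?q N\<bar> + \<bar>(H x - H xmin) / (x - xmin)\<bar>"
          unfolding real_norm_def by linarith
      qed
    qed
    then have "convergent ?q" by (subst (asm) convergent_ignore_initial_segment)
    then show c: "?q \<longlonglongrightarrow> \<R> x" unfolding hull_slope_def H_eq_H_rat[symmetric] by (simp only: convergent_LIMSEQ_iff)
    show "\<R> x \<le> (H z - H x) / (z - x)" if z: "x < z" "z \<le> xmax"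
    proof (rule LIMSEQ_le_const2[OF c])
      have "\<forall>\<^sub>F m in sequentially. 1 / real (Suc m) < z - x"
        using LIMSEQ_Suc[OF lim_1_over_n] z by (intro order_tendstoD(2)) auto
      then obtain M where M: "\<And>m. m \<ge> M \<Longrightarrow> x + 1 / real (Suc m) < z" unfolding eventually_sequentially by force
      show "\<exists>N. \<forall>n\<ge>N. ?q n \<le> (H z - H x) / (z - x)"
        unfolding q using M z x by (intro exI[of _ M] allI impI H_convex(1)) auto
    qed
    show "(H x - H z) / (x - z) \<le> \<R> x" if "xmin \<le> z" "z < x"
      by (rule LIMSEQ_le_const[OF c]) (use lower that in blast)
  qed
  show ?thesis
  proof (cases "x = y")
    case False
    have "\<R> x \<le> (H y - H x) / (y - x)" using assms False by (intro le) auto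
    also have "\<dots> \<le> \<R> y" using assms False by (intro ge) auto
    finally show ?thesis .
  qed simp
qed

text \<open>The slope is monotone along the curve where \<open>a\<close> is interior. If \<open>a
  s\<close> is extremal, the curve does not move in the first coordinate on one side of
  \<open>s\<close>, and a rational point on that side has the very same slope.\<close>

lemma slope_rational_sandwich:
  assumes h: "0 \<le> h" and mono: "\<And>u v. h \<le> u \<Longrightarrow> u \<le> v \<Longrightarrow> a u \<le> a v" and s: "h < s" and d: "0 < d"
  shows "\<exists>r1\<in>\<rat>. \<exists>r2\<in>\<rat>. h < r1 \<and> \<bar>r1 - s\<bar> < d \<and> h < r2 \<and> \<bar>r2 - s\<bar> < d \<and>
    \<R> (a r1) \<le> \<R> (a s) \<and> \<R> (a s) \<le> \<R> (a r2)"
proof -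
  have rng: "xmin \<le> a u" "a u \<le> xmax" if "0 \<le> u" for u
    unfolding xmin_def xmax_def using that linear_bdd by (auto intro!: cINF_lower cSUP_upper)
  have below: "\<exists>r\<in>\<rat>. h < r \<and> r < s \<and> \<bar>r - s\<bar> < d'" if "0 < d'" for d'
  proof -
    have "max h (s - d') < s" using s that by auto
    from rational_between[OF this] show ?thesis by auto
  qed
  have above: "\<exists>r\<in>\<rat>. s < r \<and> \<bar>r - s\<bar> < d'" if "0 < d'" for d'
  proof -
    have "s < s + d'" using that by simp
    from rational_between[OF this] show ?thesis by auto
  qed
  have near: "\<exists>d'>0. \<forall>u\<ge>0. \<bar>u - s\<bar> < d' \<longrightarrow> \<bar>a u - a s\<bar> < e" if "0 < e" for e
    using ac[unfolded continuous_on_iff, rule_format, of s e] that s h by (auto simp: dist_real_def)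
  consider "a s = xmin" | "a s = xmax" | "xmin < a s" "a s < xmax" using rng[of s] s h by fastforce
  then show ?thesis
  proof cases
    case 1
    obtain r where r: "r \<in> \<rat>" "h < r" "r < s" "\<bar>r - s\<bar> < d" using below[OF d] by auto
    have "a r = a s" using mono[of r s] rng[of r] r h 1 by auto
    then show ?thesis using r by (intro bexI[of _ r]) auto
  next
    case 2
    obtain r where r: "r \<in> \<rat>" "s < r" "\<bar>r - s\<bar> < d" using above[OF d] by auto
    have "a r = a s" using mono[of s r] rng[of r] r s h 2 by auto
    then show ?thesis using r s by (intro bexI[of _ r]) auto
  next
    case 3
    obtain d1 where d1: "d1 > 0" "\<And>u. u \<ge> 0 \<Longrightarrow> \<bar>u - s\<bar> < d1 \<Longrightarrow> \<bar>a u - a s\<bar> < min (a s - xmin) (xmax - a s)"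
      using near[of "min (a s - xmin) (xmax - a s)"] 3 by auto
    obtain r1 where r1: "r1 \<in> \<rat>" "h < r1" "r1 < s" "\<bar>r1 - s\<bar> < min d d1" using below[of "min d d1"] d d1 by auto
    obtain r2 where r2: "r2 \<in> \<rat>" "s < r2" "\<bar>r2 - s\<bar> < min d d1" using above[of "min d d1"] d d1 by auto
    have "xmin < a r1" using d1(2)[of r1] r1 h by auto
    then have "\<R> (a r1) \<le> \<R> (a s)" using 3 mono[of r1 s] r1 by (intro hull_slope_mono) auto
    moreover have "a r2 < xmax" using d1(2)[of r2] r2 s h by auto
    then have "\<R> (a s) \<le> \<R> (a r2)" using 3 mono[of s r2] r2 s by (intro hull_slope_mono) auto
    ultimately show ?thesis using r1 r2 s by (intro bexI[of _ r1] bexI[of _ r2]) auto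
  qed
qed

end

text \<open>Differentiability at \<open>t\<close> is equivalent to a Cauchy condition on the
  difference quotients at rational points, because the value at any other point lies between the
  values at two rational points that are as close to it as desired. Where the derivative does not
  exist, \<open>deriv\<close> is one fixed constant.\<close>

lemma borel_measurable_deriv:
  fixes F :: "'a \<Rightarrow> real \<Rightarrow> real"
  assumes h: "h < t" and meas: "\<And>s. h < s \<Longrightarrow> (\<lambda>\<omega>. F \<omega> s) \<in> borel_measurable M"
    and sand: "\<And>\<omega> s d. \<omega> \<in> space M \<Longrightarrow> h < s \<Longrightarrow> 0 < d \<Longrightarrow> \<exists>r1\<in>\<rat>. \<exists>r2\<in>\<rat>. h < r1 \<and> \<bar>r1 - s\<bar> < d \<and> h < r2 \<and> \<bar>r2 - s\<bar> < d \<and>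
      F \<omega> r1 \<le> F \<omega> s \<and> F \<omega> s \<le> F \<omega> r2"
  shows "(\<lambda>\<omega>. deriv (F \<omega>) t) \<in> borel_measurable M"
proof -
  define Q where "Q \<omega> r = (F \<omega> r - F \<omega> t) / (r - t)" for \<omega> r
  define A where "A m = {r \<in> \<rat>. h < r \<and> r \<noteq> t \<and> \<bar>r - t\<bar> < 1 / real (Suc m)}" for m
  define C where "C \<omega> \<longleftrightarrow> (\<forall>l. \<exists>m. \<forall>r\<in>A m. \<forall>r'\<in>A m. \<bar>Q \<omega> r - Q \<omega> r'\<bar> \<le> 1 / real (Suc l))" for \<omega>
  have cA: "countable (A m)" for m unfolding A_def by (rule countable_subset[OF _ countable_rat]) auto
  have ht: "h < t" by fact
  have "\<exists>r\<in>\<rat>. t < r \<and> r < t + 1 / real (Suc m)" for m by (rule rational_between) simp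
  then obtain \<rho> where \<rho>: "\<And>m. \<rho> m \<in> \<rat> \<and> t < \<rho> m \<and> \<rho> m < t + 1 / real (Suc m)" by metis
  have \<rho>A: "\<rho> m' \<in> A m" if "m \<le> m'" for m m'
  proof -
    have "1 / real (Suc m') \<le> 1 / real (Suc m)" using that by (simp add: frac_le)
    then show ?thesis using \<rho>[of m'] ht by (auto simp: A_def)
  qed
  have Qm[measurable]: "(\<lambda>\<omega>. Q \<omega> r) \<in> borel_measurable M" if "h < r" for r
  proof -
    note [measurable] = meas[OF that] meas[OF ht]
    show ?thesis unfolding Q_def by measurable
  qed
  have Cm[measurable]: "Measurable.pred M C"
  proof -
    have "Measurable.pred M (\<lambda>\<omega>. \<bar>Q \<omega> r - Q \<omega> r'\<bar> \<le> 1 / real (Suc l))" if "r \<in> A m" "r' \<in> A m" for r r' l m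
    proof -
      have "h < r" "h < r'" using that by (auto simp: A_def)
      note [measurable] = Qm[OF this(1)] Qm[OF this(2)]
      show ?thesis by measurable
    qed
    then show ?thesis unfolding C_def[abs_def]
      by (intro pred_intros_countable measurable_pred_countable cA)
  qed
  have yes: "(F \<omega> has_real_derivative lim (\<lambda>m. Q \<omega> (\<rho> m))) (at t)" if C: "C \<omega>" and \<omega>: "\<omega> \<in> space M" for \<omega>
  proof -
    define D where "D = lim (\<lambda>m. Q \<omega> (\<rho> m))"
    have cau: "\<exists>m. \<forall>r\<in>A m. \<forall>r'\<in>A m. \<bar>Q \<omega> r - Q \<omega> r'\<bar> < e" if "0 < e" for e
    proof -
      obtain l where "inverse (real (Suc l)) < e" using reals_Archimedean[OF \<open>0 < e\<close>] by auto
      then have l: "1 / real (Suc l) < e" by (simp add: inverse_eq_divide)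
      obtain m where "\<forall>r\<in>A m. \<forall>r'\<in>A m. \<bar>Q \<omega> r - Q \<omega> r'\<bar> \<le> 1 / real (Suc l)" using C unfolding C_def by blast
      then show ?thesis using l by (meson order.strict_trans1)
    qed
    have "Cauchy (\<lambda>m. Q \<omega> (\<rho> m))"
    proof (rule metric_CauchyI)
      fix e :: real assume "0 < e"
      from cau[OF this] obtain m where "\<forall>r\<in>A m. \<forall>r'\<in>A m. \<bar>Q \<omega> r - Q \<omega> r'\<bar> < e" by auto
      then show "\<exists>M. \<forall>m\<ge>M. \<forall>n\<ge>M. dist (Q \<omega> (\<rho> m)) (Q \<omega> (\<rho> n)) < e"
        unfolding dist_real_def using \<rho>A by blast
    qed
    then have lim: "(\<lambda>m. Q \<omega> (\<rho> m)) \<longlonglongrightarrow> D" unfolding D_def by (simp add: Cauchy_convergent_iff convergent_LIMSEQ_iff)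
    have near: "\<exists>m. \<forall>r\<in>A m. \<bar>Q \<omega> r - D\<bar> \<le> e" if e: "0 < e" for e
    proof -
      obtain m where m: "\<And>r r'. r \<in> A m \<Longrightarrow> r' \<in> A m \<Longrightarrow> \<bar>Q \<omega> r - Q \<omega> r'\<bar> < e" using cau[OF e] by blast
      have "\<bar>Q \<omega> r - D\<bar> \<le> e" if r: "r \<in> A m" for r
      proof (rule LIMSEQ_le_const2)
        show "(\<lambda>n. \<bar>Q \<omega> r - Q \<omega> (\<rho> n)\<bar>) \<longlonglongrightarrow> \<bar>Q \<omega> r - D\<bar>" by (intro tendsto_intros lim)
        show "\<exists>N. \<forall>n\<ge>N. \<bar>Q \<omega> r - Q \<omega> (\<rho> n)\<bar> \<le> e" using m[OF r \<rho>A] by (intro exI[of _ m]) (auto intro: less_imp_le)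
      qed
      then show ?thesis by blast
    qed
    have "((\<lambda>s. (F \<omega> s - F \<omega> t) / (s - t)) \<longlongrightarrow> D) (at t)"
    proof (rule tendstoI)
      fix e :: real assume e: "0 < e"
      obtain m where m: "\<And>r. r \<in> A m \<Longrightarrow> \<bar>Q \<omega> r - D\<bar> \<le> e / 2" using near[of "e / 2"] e by auto
      define d where "d = min (t - h) (1 / real (Suc m))"
      have d: "0 < d" using ht by (simp add: d_def)
      have "\<bar>F \<omega> s - F \<omega> t - D * (s - t)\<bar> < e * \<bar>s - t\<bar>" if s: "s \<noteq> t" "\<bar>s - t\<bar> < d" for s
      proof -
        have hs: "h < s" using s unfolding d_def by linarith
        define K where "K = e / 2 + \<bar>D\<bar>"
        have K: "0 < K" using e by (simp add: K_def add_pos_nonneg)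
        \<comment> \<open>Rational points within \<open>z\<close> of \<open>s\<close> stay in the
          punctured interval around \<open>t\<close>, and replacing \<open>s\<close> by them
          changes the linear approximation by at most a quarter of the admitted error.\<close>
        define z where "z = min (min \<bar>s - t\<bar> (d - \<bar>s - t\<bar>)) (e * \<bar>s - t\<bar> / (4 * K))"
        have z: "0 < z" using s e K by (simp add: z_def)
        obtain r1 r2 where r: "r1 \<in> \<rat>" "r2 \<in> \<rat>" "h < r1" "h < r2" "\<bar>r1 - s\<bar> < z" "\<bar>r2 - s\<bar> < z"
          "F \<omega> r1 \<le> F \<omega> s" "F \<omega> s \<le> F \<omega> r2" using sand[OF \<omega> hs z] by blast
        have zK: "K * z \<le> e * \<bar>s - t\<bar> / 4"
        proof -
          have "z \<le> e * \<bar>s - t\<bar> / (4 * K)" by (simp add: z_def)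
          then have "K * z \<le> K * (e * \<bar>s - t\<bar> / (4 * K))" using K by (intro mult_left_mono) auto
          then show ?thesis using K by simp
        qed
        have B: "\<bar>F \<omega> r - F \<omega> t - D * (s - t)\<bar> \<le> e / 2 * \<bar>s - t\<bar> + e * \<bar>s - t\<bar> / 4"
          if r: "r \<in> \<rat>" "h < r" "\<bar>r - s\<bar> < z" for r
        proof -
          have rt: "r \<noteq> t" "\<bar>r - t\<bar> < 1 / real (Suc m)" using r(3) unfolding z_def d_def by linarith+
          then have "r \<in> A m" using r by (auto simp: A_def)
          from m[OF this] have q: "\<bar>Q \<omega> r - D\<bar> * \<bar>r - t\<bar> \<le> e / 2 * \<bar>r - t\<bar>" by (intro mult_right_mono) auto
          have "Q \<omega> r * (r - t) = F \<omega> r - F \<omega> t" using rt by (simp add: Q_def)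
          then have "F \<omega> r - F \<omega> t - D * (r - t) = (Q \<omega> r - D) * (r - t)" by (simp add: left_diff_distrib)
          then have 1: "\<bar>F \<omega> r - F \<omega> t - D * (r - t)\<bar> \<le> e / 2 * \<bar>r - t\<bar>" using q by (simp add: abs_mult)
          have 2: "e / 2 * \<bar>r - t\<bar> \<le> e / 2 * (\<bar>s - t\<bar> + z)" using r(3) e by (intro mult_left_mono) linarith+
          have 3: "\<bar>D * (r - s)\<bar> \<le> \<bar>D\<bar> * z" unfolding abs_mult using r(3) by (intro mult_left_mono) auto
          have "F \<omega> r - F \<omega> t - D * (s - t) = (F \<omega> r - F \<omega> t - D * (r - t)) + D * (r - s)" by (simp add: algebra_simps)
          then have "\<bar>F \<omega> r - F \<omega> t - D * (s - t)\<bar> \<le> e / 2 * (\<bar>s - t\<bar> + z) + \<bar>D\<bar> * z" using 1 2 3 by linarith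
          also have "\<dots> = e / 2 * \<bar>s - t\<bar> + K * z" by (simp add: K_def algebra_simps)
          finally show ?thesis using zK by linarith
        qed
        have "0 < e * \<bar>s - t\<bar>" using e s by simp
        then show ?thesis using B[OF r(1,3,5)] B[OF r(2,4,6)] r(7,8) by linarith
      qed
      note * = this
      have "dist ((F \<omega> s - F \<omega> t) / (s - t)) D < e" if s: "s \<noteq> t" "dist s t < d" for s
      proof -
        have "\<bar>F \<omega> s - F \<omega> t - D * (s - t)\<bar> / \<bar>s - t\<bar> < e"
          using *[of s] s by (simp add: dist_real_def pos_divide_less_eq)
        also have "\<bar>F \<omega> s - F \<omega> t - D * (s - t)\<bar> / \<bar>s - t\<bar> = \<bar>(F \<omega> s - F \<omega> t - D * (s - t)) / (s - t)\<bar>" by simp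
        also have "(F \<omega> s - F \<omega> t - D * (s - t)) / (s - t) = (F \<omega> s - F \<omega> t) / (s - t) - D"
          using s by (simp add: diff_divide_distrib)
        finally show ?thesis by (simp add: dist_real_def)
      qed
      then show "\<forall>\<^sub>F s in at t. dist ((F \<omega> s - F \<omega> t) / (s - t)) D < e"
        unfolding eventually_at using d by auto
    qed
    then show ?thesis unfolding D_def[symmetric] has_field_derivative_iff .
  qed
  have no: "\<not> (F \<omega> has_real_derivative D) (at t)" if C: "\<not> C \<omega>" for \<omega> D
  proof
    assume "(F \<omega> has_real_derivative D) (at t)"
    then have lim: "((\<lambda>s. (F \<omega> s - F \<omega> t) / (s - t)) \<longlongrightarrow> D) (at t)" unfolding has_field_derivative_iff .
    have "C \<omega>" unfolding C_def
    proof
      fix l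
      have "0 < 1 / real (Suc l) / 2" by simp
      from tendstoD[OF lim this] obtain d where d: "d > 0" "\<And>s. s \<noteq> t \<Longrightarrow> dist s t < d \<Longrightarrow> dist (Q \<omega> s) D < 1 / real (Suc l) / 2"
        unfolding eventually_at Q_def by auto
      obtain m where m: "inverse (real (Suc m)) < d" using reals_Archimedean[OF d(1)] by auto
      have QD: "\<bar>Q \<omega> r - D\<bar> < 1 / real (Suc l) / 2" if "r \<in> A m" for r
        using that d(2)[of r] m by (auto simp: A_def dist_real_def inverse_eq_divide)
      then have "\<bar>Q \<omega> r - Q \<omega> r'\<bar> \<le> 1 / real (Suc l)" if "r \<in> A m" "r' \<in> A m" for r r'
      proof -
        have "\<bar>p - q\<bar> \<le> x" if "\<bar>p - D\<bar> < x / 2" "\<bar>q - D\<bar> < x / 2" for p q x :: real using that by linarith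
        then show ?thesis using QD[OF that(1)] QD[OF that(2)] by blast
      qed
      then show "\<exists>m. \<forall>r\<in>A m. \<forall>r'\<in>A m. \<bar>Q \<omega> r - Q \<omega> r'\<bar> \<le> 1 / real (Suc l)" by blast
    qed
    with C show False by simp
  qed
  have eq: "deriv (F \<omega>) t = (if C \<omega> then lim (\<lambda>m. Q \<omega> (\<rho> m)) else (SOME D. False))" if "\<omega> \<in> space M" for \<omega>
  proof (cases "C \<omega>")
    case True
    show ?thesis using DERIV_imp_deriv[OF yes[OF True that]] True by simp
  next
    case False
    then show ?thesis unfolding deriv_def using no[OF False] by simp
  qed
  have [measurable]: "(\<lambda>\<omega>. Q \<omega> (\<rho> m)) \<in> borel_measurable M" for m
    using \<rho>[of m] ht by (intro Qm) auto
  have "(\<lambda>\<omega>. if C \<omega> then lim (\<lambda>m. Q \<omega> (\<rho> m)) else (SOME D. False)) \<in> borel_measurable M" by measurable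
  then show ?thesis using eq by (subst measurable_cong[OF eq])
qed

context smoothing
begin

section \<open>Measurability of the maximum smoothed likelihood estimator\<close>

lemma g_est_measurable_param:
  assumes T: "\<And>j. j \<in> {1..n} \<Longrightarrow> T j \<in> borel_measurable N"
    and \<Delta>: "\<And>j. j \<in> {1..n} \<Longrightarrow> (\<lambda>x. \<Delta> x j) \<in> N \<rightarrow>\<^sub>M count_space UNIV"
    and s: "s \<in> borel_measurable N"
  shows "(\<lambda>x. g_est k h n (\<lambda>j. T j x) (\<Delta> x) i (s x)) \<in> borel_measurable N"
proof -
  have "g_est k h n (\<lambda>j. T j x) (\<Delta> x) i (s x) = (\<Sum>j=1..n. if 0 \<le> T j x \<and> \<Delta> x j = i then obs_kernel h (s x) (T j x) else 0) / real n" for x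
    unfolding g_est_eq class_obs_def by (subst sum.inter_filter) auto
  moreover have "(\<lambda>x. (\<Sum>j=1..n. if 0 \<le> T j x \<and> \<Delta> x j = i then obs_kernel h (s x) (T j x) else 0) / real n) \<in> borel_measurable N"
  proof (intro borel_measurable_divide borel_measurable_sum borel_measurable_const)
    fix j assume j: "j \<in> {1..n}"
    note [measurable] = T[OF j] \<Delta>[OF j] s
    show "(\<lambda>x. if 0 \<le> T j x \<and> \<Delta> x j = i then obs_kernel h (s x) (T j x) else 0) \<in> borel_measurable N"
      by measurable
  qed
  ultimately show ?thesis by simp
qed

lemma G_est_measurable_param:
  assumes T: "\<And>j. j \<in> {1..n} \<Longrightarrow> T j \<in> borel_measurable M"
    and \<Delta>: "\<And>j. j \<in> {1..n} \<Longrightarrow> (\<lambda>x. \<Delta> x j) \<in> M \<rightarrow>\<^sub>M count_space UNIV"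
  shows "(\<lambda>x. G_est k h n (\<lambda>j. T j x) (\<Delta> x) i v) \<in> borel_measurable M"
  unfolding G_est_def set_lebesgue_integral_def
proof (rule lborel.borel_measurable_lebesgue_integral)
  have [measurable]: "(\<lambda>z. g_est k h n (\<lambda>j. T j (fst z)) (\<Delta> (fst z)) i (snd z)) \<in> borel_measurable (M \<Otimes>\<^sub>M lborel)"
  proof (rule g_est_measurable_param)
    fix j assume j: "j \<in> {1..n}"
    show "(\<lambda>z. T j (fst z)) \<in> borel_measurable (M \<Otimes>\<^sub>M lborel)" using T[OF j] by measurable
    show "(\<lambda>z. \<Delta> (fst z) j) \<in> M \<Otimes>\<^sub>M lborel \<rightarrow>\<^sub>M count_space UNIV"
      by (rule measurable_compose[OF measurable_fst \<Delta>[OF j]])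
  qed measurable
  show "(\<lambda>(x, u). indicat_real {0..v} u *\<^sub>R g_est k h n (\<lambda>j. T j x) (\<Delta> x) i u) \<in> borel_measurable (M \<Otimes>\<^sub>M lborel)"
    unfolding split_beta' by measurable
qed

text \<open>The estimator depends on the data only through the density estimates.\<close>

lemma lambda_MS_cong:
  assumes "\<And>i s. g_est k h n T \<Delta> i s = g_est k h n' T' \<Delta>' i s"
  shows "lambda_MS k h n T \<Delta> t = lambda_MS k h n' T' \<Delta>' t"
proof -
  have "G_est_tot k h n T \<Delta> = G_est_tot k h n' T' \<Delta>'" "G_est k h n T \<Delta> = G_est k h n' T' \<Delta>'"
    "tau_est k h n T \<Delta> = tau_est k h n' T' \<Delta>'"
    using assms by (auto simp: G_est_tot_def G_est_def g_est_tot_def tau_est_def fun_eq_iff)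
  then have "F_MS k h n T \<Delta> = F_MS k h n' T' \<Delta>'"
    by (simp add: F_MS_def curve_def fun_eq_iff)
  then show ?thesis by (simp add: lambda_MS_def f_MS_def)
qed

lemma g_est_degenerate:
  assumes h: "0 < h" and T: "\<And>j. j \<in> {1..n} \<Longrightarrow> T j \<le> 0"
  shows "g_est k h n T \<Delta> i s = 0"
proof -
  have "obs_kernel h s (T j) = 0" if "j \<in> class_obs n T \<Delta> i" for j
  proof -
    have j: "T j = 0" using T[of j] that by (auto simp: class_obs_def)
    show ?thesis
    proof (cases "h < s")
      case True
      then have "1 \<le> s / h" using h by (simp add: field_simps)
      then have "k (s / h) = 0" by (rule unit_kernel_zero[OF unit_kernel_k order_trans[OF _ abs_ge_self]])
      then show ?thesis using True by (simp add: obs_kernel_def j)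
    next
      case False
      then show ?thesis unfolding j by (intro obs_kernel_zero[OF h]) auto
    qed
  qed
  then show ?thesis by (simp add: g_est_eq)
qed

lemma G_est_mono:
  assumes h: "0 < h" and u: "h \<le> u" "u \<le> v"
  shows "G_est k h n T \<Delta> i u \<le> G_est k h n T \<Delta> i v"
proof -
  have "0 \<le> (LBINT w:{u<..v}. g_est k h n T \<Delta> i w)"
    unfolding set_lebesgue_integral_def using g_est_nonneg[OF h] u
    by (intro integral_nonneg_AE AE_I2) (auto simp: indicator_def)
  then show ?thesis using G_est_diff[OF h, of u v n T \<Delta> i] u h by simp
qed

text \<open>A positive observation makes the density estimate positive somewhere beyond
  \<open>h\<close>, so the end point of the curve exceeds \<open>h\<close>. After it the density
  estimates vanish and the curve stays where it is, so it may be parameterized by the half line,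
  independently of the random end point.\<close>

lemma curve_full:
  assumes h: "0 < h" and T: "j \<in> {1..n}" "0 < T j" and \<Delta>: "\<Delta> j \<le> 1"
  shows "curve k h n T \<Delta> = (\<lambda>s. (G_est_tot k h n T \<Delta> s, G_est k h n T \<Delta> 1 s)) ` {0..}"
    and "planar_curve (\<lambda>s. G_est_tot k h n T \<Delta> s) (\<lambda>s. G_est k h n T \<Delta> 1 s)"
proof -
  let ?\<tau> = "tau_est k h n T \<Delta>"
  define l where "l = max (- 1) ((h - T j) / h)"
  have "l < 1" using T h by (simp add: l_def field_simps)
  then obtain u where u: "u \<in> {l<..<1}" "0 < k u" using k_pos_near[of l 1] by (auto simp: l_def)
  define s where "s = T j + h * u"
  have "(h - T j) / h < u" using u by (auto simp: l_def)
  then have hs: "h < s" using h by (simp add: s_def field_simps)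
  have "\<Delta> j = 0 \<or> \<Delta> j = 1" using \<Delta> by auto
  moreover have "0 < g_est k h n T \<Delta> (\<Delta> j) s"
  proof -
    have "0 < obs_kernel h s (T j)" using u h hs by (simp add: obs_kernel_def s_def)
    moreover have "j \<in> class_obs n T \<Delta> (\<Delta> j)" using T by (auto simp: class_obs_def)
    ultimately have "0 < (\<Sum>j\<in>class_obs n T \<Delta> (\<Delta> j). obs_kernel h s (T j))"
      using obs_kernel_nonneg[OF h hs] by (intro sum_pos2) auto
    then show ?thesis using T by (simp add: g_est_eq)
  qed
  ultimately have "0 < g_est_tot k h n T \<Delta> s"
    unfolding g_est_tot_def using g_est_nonneg[OF h hs, of n T \<Delta> 0] g_est_nonneg[OF h hs, of n T \<Delta> 1]
    by (auto intro: add_pos_nonneg add_nonneg_pos)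
  then have "s \<le> ?\<tau>" using hs h by (intro le_tau_est) auto
  then have \<tau>: "h < ?\<tau>" using hs by simp
  have z: "g_est k h n T \<Delta> i u = 0" if u: "?\<tau> < u" and i: "i = 0 \<or> i = 1" for u i
  proof -
    have "\<not> 0 < g_est_tot k h n T \<Delta> u" using le_tau_est[OF h, of u n T \<Delta>] u \<tau> h by auto
    then show ?thesis using g_est_nonneg[OF h, of u n T \<Delta> 0] g_est_nonneg[OF h, of u n T \<Delta> 1] i u \<tau>
      unfolding g_est_tot_def by auto
  qed
  have const: "G_est k h n T \<Delta> i v = G_est k h n T \<Delta> i ?\<tau>" if v: "?\<tau> \<le> v" and i: "i = 0 \<or> i = 1" for v i
  proof -
    have "(LBINT w:{?\<tau><..v}. g_est k h n T \<Delta> i w) = (LBINT w:{?\<tau><..v}. 0)"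
      by (intro set_lebesgue_integral_cong) (use z i in auto)
    then show ?thesis using G_est_diff[OF h, of ?\<tau> v n T \<Delta> i] v \<tau> h by simp
  qed
  let ?P = "\<lambda>s. (G_est_tot k h n T \<Delta> s, G_est k h n T \<Delta> 1 s)"
  have "?P v \<in> ?P ` {0..?\<tau>}" if "0 \<le> v" for v
  proof (cases "v \<le> ?\<tau>")
    case False
    then have "?\<tau> \<le> v" by simp
    from const[OF this, of 0] const[OF this, of 1] have "?P v = ?P ?\<tau>" unfolding G_est_tot_eq[OF h] by simp
    then show ?thesis using \<tau> h by auto
  qed (use that in auto)
  then have eq: "?P ` {0..?\<tau>} = ?P ` {0..}" by auto
  then show "curve k h n T \<Delta> = ?P ` {0..}" by (simp add: curve_def)
  have c: "continuous_on {0..} (\<lambda>s. G_est_tot k h n T \<Delta> s)" "continuous_on {0..} (\<lambda>s. G_est k h n T \<Delta> 1 s)"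
    unfolding G_est_tot_eq[OF h] using G_est_continuous[OF h, of n T \<Delta>] by (auto intro!: continuous_intros)
  show "planar_curve (\<lambda>s. G_est_tot k h n T \<Delta> s) (\<lambda>s. G_est k h n T \<Delta> 1 s)"
  proof
    have "compact (?P ` {0..?\<tau>})"
      using c by (intro compact_continuous_image continuous_on_Pair) (auto intro: continuous_on_subset)
    then show "compact (?P ` {0..})" unfolding eq .
  qed (rule c)+
qed

text \<open>If some observation is positive, the distribution function estimate is
  \<open>hull_slope\<close> along the curve, a countable expression in the integrated estimators,
  and its derivative is measurable by \<open>borel_measurable_deriv\<close>.\<close>

theorem lambda_MS_measurable:
  assumes h: "0 < h" "h < t"
    and T: "\<And>j. j \<in> {1..n} \<Longrightarrow> T j \<in> borel_measurable M"
    and \<Delta>: "\<And>j. j \<in> {1..n} \<Longrightarrow> (\<lambda>x. \<Delta> x j) \<in> M \<rightarrow>\<^sub>M count_space UNIV"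
    and \<Delta>1: "\<And>x j. \<Delta> x j \<le> 1"
  shows "(\<lambda>\<omega>. lambda_MS k h n (\<lambda>j. T j \<omega>) (\<Delta> \<omega>) t) \<in> borel_measurable M"
proof -
  define a where "a \<omega> s = G_est_tot k h n (\<lambda>j. T j \<omega>) (\<Delta> \<omega>) s" for \<omega> s
  define b where "b \<omega> s = G_est k h n (\<lambda>j. T j \<omega>) (\<Delta> \<omega>) 1 s" for \<omega> s
  define P where "P \<omega> \<longleftrightarrow> (\<exists>j\<in>{1..n}. 0 < T j \<omega>)" for \<omega>
  have bm: "(\<lambda>\<omega>. b \<omega> s) \<in> borel_measurable M" for s
    unfolding b_def by (rule G_est_measurable_param[OF T \<Delta>])
  have am: "(\<lambda>\<omega>. a \<omega> s) \<in> borel_measurable M" for s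
    unfolding a_def G_est_tot_eq[OF h(1)] by (intro borel_measurable_add G_est_measurable_param[OF T \<Delta>])
  have Pm[measurable]: "Measurable.pred M P"
  proof -
    have "Measurable.pred M (\<lambda>\<omega>. 0 < T j \<omega>)" if "j \<in> {1..n}" for j
      using T[OF that] by measurable
    then show ?thesis unfolding P_def[abs_def] by (intro measurable_pred_countable) auto
  qed
  have pc: "planar_curve (a \<omega>) (b \<omega>)" and cv: "curve k h n (\<lambda>j. T j \<omega>) (\<Delta> \<omega>) = planar_curve.S (a \<omega>) (b \<omega>)"
    if P: "P \<omega>" for \<omega>
  proof -
    obtain j where j: "j \<in> {1..n}" "0 < T j \<omega>" using P by (auto simp: P_def)
    note c = curve_full[where T="\<lambda>j. T j \<omega>" and \<Delta>="\<Delta> \<omega>", OF h(1) j \<Delta>1, folded a_def b_def]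
    show "planar_curve (a \<omega>) (b \<omega>)" by (rule c(2))
    then show "curve k h n (\<lambda>j. T j \<omega>) (\<Delta> \<omega>) = planar_curve.S (a \<omega>) (b \<omega>)"
      using c(1) by (simp add: planar_curve.S_def)
  qed
  have F_eq: "F_MS k h n (\<lambda>j. T j \<omega>) (\<Delta> \<omega>) s = hull_slope (a \<omega>) (b \<omega>) (a \<omega> s)" if P: "P \<omega>" and s: "0 \<le> s" for \<omega> s
  proof -
    interpret planar_curve "a \<omega>" "b \<omega>" by (rule pc[OF P])
    have "xmin \<le> a \<omega> s" "a \<omega> s \<le> xmax"
      unfolding xmin_def xmax_def using s linear_bdd by (auto intro!: cINF_lower cSUP_upper)
    from right_slope_eq[OF this] show ?thesis
      unfolding F_MS_def cv[OF P] H_def a_def[symmetric] .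
  qed
  define F where "F \<omega> s = (if P \<omega> then hull_slope (a \<omega>) (b \<omega>) (a \<omega> s) else 0)" for \<omega> s
  have Fm[measurable]: "(\<lambda>\<omega>. F \<omega> s) \<in> borel_measurable M" for s
  proof -
    have [measurable]: "(\<lambda>\<omega>. hull_slope (a \<omega>) (b \<omega>) (a \<omega> s)) \<in> borel_measurable M"
      by (rule hull_slope_measurable[OF am bm am])
    show ?thesis unfolding F_def by measurable
  qed
  have [measurable]: "(\<lambda>\<omega>. deriv (F \<omega>) t) \<in> borel_measurable M"
  proof (rule borel_measurable_deriv[OF h(2) Fm])
    fix \<omega> and s d :: real
    assume "\<omega> \<in> space M" and s: "h < s" and d: "0 < d"
    show "\<exists>r1\<in>\<rat>. \<exists>r2\<in>\<rat>. h < r1 \<and> \<bar>r1 - s\<bar> < d \<and> h < r2 \<and> \<bar>r2 - s\<bar> < d \<and> F \<omega> r1 \<le> F \<omega> s \<and> F \<omega> s \<le> F \<omega> r2"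
    proof (cases "P \<omega>")
      case True
      interpret planar_curve "a \<omega>" "b \<omega>" by (rule pc[OF True])
      have "a \<omega> u \<le> a \<omega> v" if "h \<le> u" "u \<le> v" for u v
        unfolding a_def G_est_tot_eq[OF h(1)] by (intro add_mono G_est_mono h that)
      from slope_rational_sandwich[OF less_imp_le[OF h(1)] this s d] show ?thesis
        using True by (simp add: F_def)
    next
      case False
      have "s < s + d" using d by simp
      from rational_between[OF this] obtain r where "r \<in> \<rat>" "s < r" "r < s + d" by blast
      then show ?thesis using False s by (intro bexI[of _ r]) (auto simp: F_def)
    qed
  qed
  \<comment> \<open>Without a positive observation all density estimates vanish, and the estimator
    has the value it takes on the empty sample.\<close>
  define K where "K = lambda_MS k h 0 (\<lambda>_. 0) (\<lambda>_. 0) t"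
  have "lambda_MS k h n (\<lambda>j. T j \<omega>) (\<Delta> \<omega>) t = (if P \<omega> then deriv (F \<omega>) t / (1 - F \<omega> t) else K)" for \<omega>
  proof (cases "P \<omega>")
    case True
    have "\<forall>\<^sub>F s in nhds t. s \<in> {0<..}" using h by (intro eventually_nhds_in_open) auto
    then have "\<forall>\<^sub>F s in nhds t. F_MS k h n (\<lambda>j. T j \<omega>) (\<Delta> \<omega>) s = F \<omega> s"
      by eventually_elim (simp add: F_eq[OF True] F_def True)
    then have "f_MS k h n (\<lambda>j. T j \<omega>) (\<Delta> \<omega>) t = deriv (F \<omega>) t"
      unfolding f_MS_def by (intro deriv_cong_ev) auto
    then show ?thesis using True F_eq[OF True, of t] h by (simp add: lambda_MS_def F_def)
  next
    case False
    have "lambda_MS k h n (\<lambda>j. T j \<omega>) (\<Delta> \<omega>) t = K" unfolding K_def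
    proof (rule lambda_MS_cong)
      have "T j \<omega> \<le> 0" if "j \<in> {1..n}" for j using False that by (auto simp: P_def not_less)
      then show "g_est k h n (\<lambda>j. T j \<omega>) (\<Delta> \<omega>) i s = g_est k h 0 (\<lambda>_. 0) (\<lambda>_. 0) i s" for i s
        using g_est_degenerate[OF h(1), of n "\<lambda>j. T j \<omega>" "\<Delta> \<omega>"] g_est_degenerate[OF h(1), of 0 "\<lambda>_. 0" "\<lambda>_. 0"] by simp
    qed
    then show ?thesis using False by simp
  qed
  moreover have "(\<lambda>\<omega>. if P \<omega> then deriv (F \<omega>) t / (1 - F \<omega> t) else K) \<in> borel_measurable M" by measurable
  ultimately show ?thesis by simp
qed

end

section \<open>Functions of independent observations\<close>

text \<open>The density of the inspection times with status \<open>i\<close>; like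
  \<open>class_obs\<close> it ignores negative times, so that empirical and limiting quantities
  match exactly.\<close>

definition subdens :: "(real \<Rightarrow> real) \<Rightarrow> (real \<Rightarrow> real) \<Rightarrow> nat \<Rightarrow> real \<Rightarrow> real" where
  "subdens F0 g i u = (if 0 \<le> u then (if i = 1 then F0 u else 1 - F0 u) * g u else 0)"

context current_status_model
begin

lemma X_measurable[measurable]: "1 \<le> j \<Longrightarrow> X j \<in> borel_measurable M"
  and T_measurable[measurable]: "1 \<le> j \<Longrightarrow> T j \<in> borel_measurable M"
proof -
  assume j: "1 \<le> j"
  have "random_variable borel (case_sum X T z)" if "z \<in> {1..} <+> {1..}" for z
    using indep that unfolding indep_vars_def by blast
  from this[of "Inl j"] this[of "Inr j"] show "X j \<in> borel_measurable M" "T j \<in> borel_measurable M"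
    using j by auto
qed

lemma F0_bounds: "0 \<le> F0 x" "F0 x \<le> 1" and F0_mono: "x \<le> y \<Longrightarrow> F0 x \<le> F0 y"
proof -
  interpret D: real_distribution "distr M borel (X 1)" by (rule real_distribution_distr) simp
  show "0 \<le> F0 x" "F0 x \<le> 1" "x \<le> y \<Longrightarrow> F0 x \<le> F0 y"
    using df_X[of 1] D.cdf_nonneg[of x] D.cdf_bounded_prob[of x] D.cdf_nondecreasing[of x y] by auto
qed

lemma F0_measurable[measurable]: "F0 \<in> borel_measurable borel"
  by (rule borel_measurable_mono) (auto simp: mono_def F0_mono)

lemma g_measurable[measurable]: "g \<in> borel_measurable borel" and g_nonneg: "0 \<le> g x"
  and g_int: "set_integrable lborel {..x} g" and G_eq: "G x = (LBINT u:{..x}. g u)"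
  using density_T unfolding df_density_def by auto

text \<open>The density of the distribution function has total mass one because the distribution
  function tends to one, so it defines a probability measure with the same distribution
  function.\<close>

lemma distr_T: assumes j: "1 \<le> j" shows "distr M borel (T j) = density lborel g"
proof -
  interpret D: real_distribution "distr M borel (T j)" by (rule real_distribution_distr) (use j in simp)
  let ?N = "density lborel (\<lambda>x. ennreal (g x))"
  have em: "emeasure ?N {..x} = ennreal (G x)" for x
  proof -
    have "emeasure ?N {..x} = (\<integral>\<^sup>+ u. ennreal (indicator {..x} u *\<^sub>R g u) \<partial>lborel)"
      by (subst emeasure_density) (auto intro!: nn_integral_cong simp: indicator_def)
    also have "\<dots> = ennreal (LBINT u. indicator {..x} u *\<^sub>R g u)"
      using g_int[of x] g_nonneg unfolding set_integrable_def
      by (intro nn_integral_eq_integral) auto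
    finally show ?thesis by (simp add: G_eq set_lebesgue_integral_def)
  qed
  have G0: "0 \<le> G x" for x unfolding G_eq set_lebesgue_integral_def using g_nonneg by (intro integral_nonneg_AE) auto
  have lim: "(\<lambda>i. G (real i)) \<longlonglongrightarrow> 1" using D.cdf_lim_infty_prob df_T[OF j] by simp
  have "(\<lambda>i. emeasure ?N {..real i}) \<longlonglongrightarrow> emeasure ?N (\<Union>i::nat. {..real i})"
    by (rule Lim_emeasure_incseq) (auto simp: incseq_def)
  moreover have "(\<Union>i::nat. {..real i}) = UNIV" using real_arch_simple by auto
  moreover have "(\<lambda>i. emeasure ?N {..real i}) \<longlonglongrightarrow> ennreal 1" unfolding em by (intro tendsto_ennrealI lim)
  ultimately have "emeasure ?N UNIV = 1" using LIMSEQ_unique by fastforce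
  then have N: "real_distribution ?N"
    unfolding real_distribution_def real_distribution_axioms_def by (auto intro!: prob_spaceI)
  have "cdf ?N = G" unfolding cdf_def measure_def em using G0 by (auto simp: fun_eq_iff)
  with cdf_unique[OF D.real_distribution_axioms N] df_T[OF j] show ?thesis by simp
qed

text \<open>The function of the \<open>j\<close>-th observation with values \<open>\<phi>0
  T\<close> or \<open>\<phi>1 T\<close> according to its status. Averages of such variables
  comprise the empirical subdistribution functions, the density estimators at a point, and their
  derivatives.\<close>

definition V :: "(real \<Rightarrow> real) \<Rightarrow> (real \<Rightarrow> real) \<Rightarrow> nat \<Rightarrow> 'a \<Rightarrow> real" where
  "V \<phi>0 \<phi>1 j \<omega> = (if 0 \<le> T j \<omega> then if X j \<omega> \<le> T j \<omega> then \<phi>1 (T j \<omega>) else \<phi>0 (T j \<omega>) else 0)"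

lemma V_sq: "(V \<phi>0 \<phi>1 j \<omega>)\<^sup>2 = V (\<lambda>u. (\<phi>0 u)\<^sup>2) (\<lambda>u. (\<phi>1 u)\<^sup>2) j \<omega>"
  by (simp add: V_def)

lemma V_measurable[measurable]:
  assumes "1 \<le> j" and [measurable]: "\<phi>0 \<in> borel_measurable borel" "\<phi>1 \<in> borel_measurable borel"
  shows "V \<phi>0 \<phi>1 j \<in> borel_measurable M"
proof -
  note [measurable] = X_measurable[OF assms(1)] T_measurable[OF assms(1)]
  show ?thesis unfolding V_def[abs_def] by measurable
qed

lemma V_bound:
  assumes "\<And>u. \<bar>\<phi>0 u\<bar> \<le> B" "\<And>u. \<bar>\<phi>1 u\<bar> \<le> B"
  shows "\<bar>V \<phi>0 \<phi>1 j \<omega>\<bar> \<le> B"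
  using assms order_trans[OF abs_ge_zero assms(1)] by (auto simp: V_def)

lemma V_sum: "(\<Sum>j\<in>class_obs n (\<lambda>j. T j \<omega>) (status X T \<omega>) i. \<phi> (T j \<omega>))
    = (\<Sum>j=1..n. V (if i = 0 then \<phi> else (\<lambda>_. 0)) (if i = 1 then \<phi> else (\<lambda>_. 0)) j \<omega>)"
  unfolding class_obs_def by (subst sum.inter_filter) (auto intro!: sum.cong simp: V_def status_def)

text \<open>The variables depend on disjoint groups \<open>{X j, T j}\<close> of the independent
  family.\<close>

lemma V_indep:
  assumes [measurable]: "\<phi>0 \<in> borel_measurable borel" "\<phi>1 \<in> borel_measurable borel"
  shows "indep_vars (\<lambda>_. borel) (V \<phi>0 \<phi>1) {1..n}"
proof -
  let ?K = "\<lambda>j::nat. {Inl j, Inr j} :: (nat + nat) set"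
  have ind: "indep_vars (\<lambda>j. PiM (?K j) (\<lambda>_. borel)) (\<lambda>j \<omega>. restrict (\<lambda>i. case_sum X T i \<omega>) (?K j)) {1..n}"
    by (rule indep_vars_restrict[OF indep]) (auto simp: disjoint_family_on_def)
  define \<psi> where "\<psi> j f = (if 0 \<le> f (Inr j) then if f (Inl j) \<le> f (Inr j) then \<phi>1 (f (Inr j)) else \<phi>0 (f (Inr j)) else 0)"
    for j :: nat and f :: "nat + nat \<Rightarrow> real"
  have \<psi>m: "\<psi> j \<in> borel_measurable (PiM (?K j) (\<lambda>_. borel))" for j
  proof -
    have [measurable]: "(\<lambda>f. f (Inl j)) \<in> borel_measurable (PiM (?K j) (\<lambda>_. borel :: real measure))"
      "(\<lambda>f. f (Inr j)) \<in> borel_measurable (PiM (?K j) (\<lambda>_. borel :: real measure))"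
      by (rule measurable_component_singleton, simp)+
    show ?thesis unfolding \<psi>_def[abs_def] by measurable
  qed
  have "indep_vars (\<lambda>_. borel) (\<lambda>j \<omega>. \<psi> j (restrict (\<lambda>i. case_sum X T i \<omega>) (?K j))) {1..n}"
    by (rule indep_vars_compose2[OF ind \<psi>m])
  moreover have "(\<lambda>j \<omega>. \<psi> j (restrict (\<lambda>i. case_sum X T i \<omega>) (?K j))) = V \<phi>0 \<phi>1"
    by (auto simp: \<psi>_def V_def fun_eq_iff)
  ultimately show ?thesis by simp
qed

lemma XT_indep: assumes j: "1 \<le> j" shows "indep_var borel (X j) borel (T j)"
proof -
  have "indep_vars (\<lambda>_. borel) (case_sum X T) {Inl j, Inr j}" by (rule indep_vars_subset[OF indep]) (use j in auto)
  then have "indep_var (PiM {Inl j} (\<lambda>_. borel)) (\<lambda>\<omega>. restrict (\<lambda>i. case_sum X T i \<omega>) {Inl j})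
     (PiM {Inr j} (\<lambda>_. borel)) (\<lambda>\<omega>. restrict (\<lambda>i. case_sum X T i \<omega>) {Inr j})"
    by (rule indep_var_restrict) auto
  then have "indep_var borel ((\<lambda>f. f (Inl j)) \<circ> (\<lambda>\<omega>. restrict (\<lambda>i. case_sum X T i \<omega>) {Inl j}))
     borel ((\<lambda>f. f (Inr j)) \<circ> (\<lambda>\<omega>. restrict (\<lambda>i. case_sum X T i \<omega>) {Inr j}))"
    by (rule indep_var_compose) (auto intro!: measurable_component_singleton)
  then show ?thesis by (simp add: comp_def)
qed

text \<open>Given \<open>T = u\<close>, the status is 1 with probability \<open>F0 u\<close>, by
  independence of \<open>X\<close> and \<open>T\<close>.\<close>

lemma V_mean:
  assumes j: "1 \<le> j" and m[measurable]: "\<phi>0 \<in> borel_measurable borel" "\<phi>1 \<in> borel_measurable borel"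
    and b: "\<And>u. \<bar>\<phi>0 u\<bar> \<le> B" "\<And>u. \<bar>\<phi>1 u\<bar> \<le> B"
  shows "expectation (V \<phi>0 \<phi>1 j) = (LBINT u. \<phi>0 u * subdens F0 g 0 u + \<phi>1 u * subdens F0 g 1 u)"
proof -
  note [measurable] = X_measurable[OF j] T_measurable[OF j]
  let ?PX = "distr M borel (X j)" and ?PT = "distr M borel (T j)"
  interpret PX: prob_space ?PX by (rule prob_space_distr) simp
  interpret PT: prob_space ?PT by (rule prob_space_distr) simp
  interpret PP: pair_prob_space ?PX ?PT ..
  define f where "f x u = (if 0 \<le> u then if x \<le> u then \<phi>1 u else \<phi>0 u else 0)" for x u :: real
  have fm: "case_prod f \<in> borel_measurable (borel \<Otimes>\<^sub>M borel)" unfolding f_def by measurable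
  have fb: "\<bar>f x u\<bar> \<le> B" for x u using b order_trans[OF abs_ge_zero b(1)] by (auto simp: f_def)
  have J: "?PX \<Otimes>\<^sub>M ?PT = distr M (borel \<Otimes>\<^sub>M borel) (\<lambda>\<omega>. (X j \<omega>, T j \<omega>))"
    using XT_indep[OF j] unfolding indep_var_distribution_eq by auto
  have inner: "(LINT x|?PX. f x u) = (if 0 \<le> u then F0 u * \<phi>1 u + (1 - F0 u) * \<phi>0 u else 0)" for u
  proof (cases "0 \<le> u")
    case True
    have cu: "measure ?PX {..u} = F0 u" using df_X[OF j] by (simp add: cdf_def fun_eq_iff)
    have "(LINT x|?PX. f x u) = (LINT x|?PX. indicator {..u} x * (\<phi>1 u - \<phi>0 u) + \<phi>0 u)"
      using True by (intro Bochner_Integration.integral_cong) (auto simp: f_def indicator_def)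
    also have "\<dots> = measure ?PX {..u} * (\<phi>1 u - \<phi>0 u) + \<phi>0 u"
      using PX.prob_space by (simp add: Bochner_Integration.integral_add PX.emeasure_eq_measure)
    finally show ?thesis using True cu by (simp add: algebra_simps)
  qed (simp add: f_def)
  have "expectation (V \<phi>0 \<phi>1 j) = (\<integral>\<omega>. case_prod f (X j \<omega>, T j \<omega>) \<partial>M)"
    by (intro Bochner_Integration.integral_cong) (auto simp: V_def f_def)
  also have "\<dots> = (\<integral>z. case_prod f z \<partial>(?PX \<Otimes>\<^sub>M ?PT))"
    unfolding J by (subst integral_distr) (auto intro: fm)
  also have "\<dots> = (\<integral>u. \<integral>x. f x u \<partial>?PX \<partial>?PT)"
  proof (rule PP.integral_snd[symmetric])
    show "integrable (?PX \<Otimes>\<^sub>M ?PT) (case_prod f)"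
    proof (rule PP.integrable_const_bound[where B=B])
      have "sets (?PX \<Otimes>\<^sub>M ?PT) = sets (borel \<Otimes>\<^sub>M borel)" by (intro sets_pair_measure_cong) auto
      then show "case_prod f \<in> borel_measurable (?PX \<Otimes>\<^sub>M ?PT)"
        using fm measurable_cong_sets by blast
    qed (use fb in auto)
  qed
  also have "\<dots> = (\<integral>u. (if 0 \<le> u then F0 u * \<phi>1 u + (1 - F0 u) * \<phi>0 u else 0) \<partial>density lborel g)"
    unfolding inner distr_T[OF j] ..
  also have "\<dots> = (LBINT u. g u *\<^sub>R (if 0 \<le> u then F0 u * \<phi>1 u + (1 - F0 u) * \<phi>0 u else 0))"
    using g_nonneg by (intro integral_density) auto
  also have "\<dots> = (LBINT u. \<phi>0 u * subdens F0 g 0 u + \<phi>1 u * subdens F0 g 1 u)"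
    by (intro Bochner_Integration.integral_cong) (auto simp: subdens_def algebra_simps)
  finally show ?thesis .
qed

text \<open>Hoeffding's inequality for variables with values in \<open>[-B, B]\<close>.\<close>

lemma V_average_deviation:
  assumes m[measurable]: "\<phi>0 \<in> borel_measurable borel" "\<phi>1 \<in> borel_measurable borel"
    and b: "\<And>u. \<bar>\<phi>0 u\<bar> \<le> B" "\<And>u. \<bar>\<phi>1 u\<bar> \<le> B" and B: "0 < B" and a: "0 \<le> a" and n: "1 \<le> n"
  shows "prob {\<omega>\<in>space M. \<bar>(\<Sum>j=1..n. V \<phi>0 \<phi>1 j \<omega>) / real n
      - (LBINT u. \<phi>0 u * subdens F0 g 0 u + \<phi>1 u * subdens F0 g 1 u)\<bar> \<ge> a} \<le> 2 * exp (- (real n * a\<^sup>2 / (2 * B\<^sup>2)))"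
proof -
  define \<mu> where "\<mu> = (LBINT u. \<phi>0 u * subdens F0 g 0 u + \<phi>1 u * subdens F0 g 1 u)"
  have mean: "expectation (V \<phi>0 \<phi>1 j) = \<mu>" if "j \<in> {1..n}" for j
    unfolding \<mu>_def by (rule V_mean[where B=B]) (use that b in auto)
  interpret I: indep_interval_bounded_random_variables M "{1..n}" "V \<phi>0 \<phi>1" "\<lambda>_. - B" "\<lambda>_. B"
  proof
    show "AE x in M. V \<phi>0 \<phi>1 i x \<in> {- B..B}" for i
      using V_bound[of \<phi>0 B \<phi>1 i] b by (intro AE_I2) (auto simp: abs_le_iff minus_le_iff)
    show "indep_vars (\<lambda>_. borel) (V \<phi>0 \<phi>1) {1..n}" by (rule V_indep) (rule m)+
  qed auto
  interpret H: Hoeffding_ineq M "{1..n}" "V \<phi>0 \<phi>1" "\<lambda>_. - B" "\<lambda>_. B" "real n * \<mu>"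
    by unfold_locales (simp add: mean)
  have "{\<omega>\<in>space M. \<bar>(\<Sum>j=1..n. V \<phi>0 \<phi>1 j \<omega>) / real n - \<mu>\<bar> \<ge> a}
      = {\<omega>\<in>space M. \<bar>(\<Sum>j=1..n. V \<phi>0 \<phi>1 j \<omega>) - real n * \<mu>\<bar> \<ge> real n * a}"
  proof -
    have "a \<le> \<bar>x / real n - \<mu>\<bar> \<longleftrightarrow> real n * a \<le> \<bar>x - real n * \<mu>\<bar>" for x
    proof -
      have "\<bar>x - real n * \<mu>\<bar> = real n * \<bar>x / real n - \<mu>\<bar>"
      proof -
        have "x - real n * \<mu> = real n * (x / real n - \<mu>)" using n by (simp add: algebra_simps)
        then show ?thesis by (simp add: abs_mult)
      qed
      then show ?thesis using n by simp
    qed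
    then show ?thesis by simp
  qed
  also have "prob \<dots> \<le> 2 * exp (- 2 * (real n * a)\<^sup>2 / (\<Sum>i=1..n. (B - - B)\<^sup>2))"
    using H.Hoeffding_ineq_abs_ge[of "real n * a"] a B n by (auto intro!: sum_pos)
  also have "- 2 * (real n * a)\<^sup>2 / (\<Sum>i=1..n. (B - - B)\<^sup>2) = - (real n * a\<^sup>2 / (2 * B\<^sup>2))"
    using n B by (simp add: power2_eq_square field_simps)
  finally show ?thesis unfolding \<mu>_def .
qed

end

section \<open>The limiting subdensities\<close>

lemma halfline_integral_has_derivative:
  fixes f :: "real \<Rightarrow> real"
  assumes int: "\<And>x. set_integrable lborel {..x} f" and c: "\<And>x. l < x \<Longrightarrow> x < r \<Longrightarrow> isCont f x"
    and x: "l < x" "x < r"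
  shows "((\<lambda>v. LBINT u:{..v}. f u) has_real_derivative f x) (at x)"
proof -
  define a where "a = (l + x) / 2"
  define b where "b = (x + r) / 2"
  have ab: "l < a" "a < x" "x < b" "b < r" using x by (auto simp: a_def b_def)
  have cont: "continuous_on {a..b} f" using c ab by (intro continuous_at_imp_continuous_on) auto
  have "((\<lambda>v. integral {a..v} f) has_real_derivative f x) (at x within {a..b})"
    by (rule integral_has_real_derivative[OF cont]) (use ab in auto)
  moreover have "at x within {a..b} = at x" using ab by (intro at_within_interior) auto
  ultimately have A: "((\<lambda>v. (LBINT u:{..a}. f u) + integral {a..v} f) has_real_derivative f x) (at x)"
    by (auto intro!: derivative_eq_intros)
  have B: "(LBINT u:{..a}. f u) + integral {a..v} f = (LBINT u:{..v}. f u)" if v: "a < v" for v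
  proof -
    have i: "set_integrable lborel {a..v} f" "set_integrable lborel {a<..v} f"
      by (rule set_integrable_subset[OF int[of v]]; auto)+
    have "{..v} = {..a} \<union> {a<..v}" using v by auto
    then have "(LBINT u:{..v}. f u) = (LBINT u:{..a}. f u) + (LBINT u:{a<..v}. f u)"
      by (simp, intro set_integral_Un int i) auto
    also have "(LBINT u:{a<..v}. f u) = (LBINT u:{a..v}. f u)"
      unfolding set_lebesgue_integral_def
    proof (intro integral_cong_AE)
      have "AE u in lborel. u \<noteq> a" by (rule AE_lborel_singleton)
      then show "AE u in lborel. indicat_real {a<..v} u *\<^sub>R f u = indicat_real {a..v} u *\<^sub>R f u"
        by eventually_elim (auto simp: indicator_def)
    qed (use i in \<open>auto simp: set_integrable_def\<close>)
    also have "\<dots> = integral {a..v} f" by (rule set_borel_integral_eq_integral(2)[OF i(1)])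
    finally show ?thesis by simp
  qed
  show ?thesis
    by (rule has_field_derivative_transform_within_open[OF A, of "{a<..}"]) (use ab B in auto)
qed

lemma cont_nth_deriv_at_3:
  assumes "cont_nth_deriv_at 3 f t"
  shows "\<exists>d>0. \<forall>u m. \<bar>u - t\<bar> < d \<longrightarrow> m < 3 \<longrightarrow> ((deriv ^^ m) f has_real_derivative (deriv ^^ Suc m) f u) (at u)"
    and "isCont ((deriv ^^ 3) f) t"
proof -
  have e: "\<forall>\<^sub>F x in nhds t. \<forall>i<3. (deriv ^^ i) f differentiable (at x)" and c: "isCont ((deriv ^^ 3) f) t"
    using assms unfolding cont_nth_deriv_at_def by auto
  show "isCont ((deriv ^^ 3) f) t" by (rule c)
  obtain d where "d > 0" "\<And>x. dist x t < d \<Longrightarrow> \<forall>i<3. (deriv ^^ i) f differentiable (at x)"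
    using e unfolding eventually_nhds_metric by auto
  then show "\<exists>d>0. \<forall>u m. \<bar>u - t\<bar> < d \<longrightarrow> m < 3 \<longrightarrow> ((deriv ^^ m) f has_real_derivative (deriv ^^ Suc m) f u) (at u)"
    by (intro exI[of _ d]) (auto simp: dist_real_def DERIV_deriv_iff_real_differentiable)
qed

locale smooth_current_status = current_status_model M X T F0 G g + smoothing k
  for M :: "'a measure" and X T :: "nat \<Rightarrow> 'a \<Rightarrow> real" and F0 G g k :: "real \<Rightarrow> real" +
  fixes f0 :: "real \<Rightarrow> real" and M0 t :: real
  assumes F_supp: "df_support F0 = {0..M0}"
    and F_mono: "strict_mono_on {0..M0} F0"
    and F_density: "df_density F0 f0"
    and F_away: "\<exists>\<delta>>0. \<forall>x\<in>{0..M0}. \<delta> \<le> f0 x"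
    and G_away: "\<exists>\<delta>>0. \<forall>x\<in>{0..M0}. \<delta> \<le> g x"
    and t_pos: "0 < t" and t_lt: "F0 t < 1"
    and f0_smooth: "cont_nth_deriv_at 3 f0 t" and g_smooth: "cont_nth_deriv_at 3 g t"
begin

text \<open>Beyond its support \<open>F0\<close> is locally constant, so constant, and the
  constant can only be 1; by right continuity \<open>F0 M0 = 1\<close>, while \<open>F0 t <
  1\<close>.\<close>

lemma t_less_M0: "t < M0"
proof (rule ccontr)
  assume "\<not> t < M0"
  then have M0: "M0 \<le> t" by simp
  interpret D: real_distribution "distr M borel (X 1)" by (rule real_distribution_distr) simp
  have F0_eq: "cdf (distr M borel (X 1)) = F0" using df_X[of 1] by simp
  have D0: "(F0 has_real_derivative 0) (at x)" if x: "t < x" for x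
  proof -
    have "x \<notin> df_support F0" unfolding F_supp using x M0 by auto
    then obtain e where e: "0 < e" "F0 (x + e) \<le> F0 (x - e)" by (auto simp: df_support_def not_less)
    have loc: "F0 x = F0 y" if "y \<in> {x - e<..<x + e}" for y
      using F0_mono[of "x - e" y] F0_mono[of y "x + e"] F0_mono[of "x - e" x] F0_mono[of x "x + e"] e that by auto
    show ?thesis
    proof (rule has_field_derivative_transform_within_open[of "\<lambda>_. F0 x" 0 x "{x - e<..<x + e}"])
      show "F0 x = F0 y" if "y \<in> {x - e<..<x + e}" for y by (rule loc[OF that])
    qed (use e in auto)
  qed
  have const: "F0 x = F0 y" if "t < x" "x < y" for x y
  proof -
    have "\<exists>z>x. z < y \<and> F0 y - F0 x = (y - x) * 0"
      by (rule MVT2[OF that(2)]) (use that D0 in auto)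
    then show ?thesis by auto
  qed
  have one: "F0 x = 1" if x: "t < x" for x
  proof -
    have "(\<lambda>i. F0 (real i)) \<longlonglongrightarrow> 1" using D.cdf_lim_infty_prob unfolding F0_eq .
    moreover have "\<forall>\<^sub>F i in sequentially. F0 (real i) = F0 x"
    proof -
      obtain N :: nat where "x < real N" using reals_Archimedean2 by blast
      then show ?thesis by (intro eventually_sequentiallyI[of N] const[symmetric, OF x]) auto
    qed
    then have "(\<lambda>i. F0 (real i)) \<longlonglongrightarrow> F0 x" by (rule tendsto_eventually)
    ultimately show ?thesis by (rule LIMSEQ_unique[symmetric])
  qed
  have "(F0 \<longlongrightarrow> F0 t) (at_right t)" using D.cdf_is_right_cont[of t] unfolding F0_eq continuous_within .
  moreover have "(F0 \<longlongrightarrow> 1) (at_right t)"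
    by (rule tendsto_eventually) (auto simp: eventually_at_right_field one intro: exI[of _ "t + 1"])
  ultimately have "F0 t = 1" by (intro tendsto_unique[OF trivial_limit_at_right_real])
  with t_lt show False by simp
qed

lemma F0_pos: "0 < F0 t"
proof -
  have "F0 0 < F0 t" using t_pos t_less_M0 by (intro strict_mono_onD[OF F_mono]) auto
  then show ?thesis using F0_bounds(1)[of 0] by simp
qed

lemma g_pos: "0 < g t" and f0_pos: "0 < f0 t"
proof -
  have "t \<in> {0..M0}" using t_pos t_less_M0 by auto
  then show "0 < g t" "0 < f0 t" using G_away F_away by (auto intro: less_le_trans)
qed

lemma radius:
  obtains \<rho> where "0 < \<rho>" "\<rho> \<le> t" "t + \<rho> \<le> M0"
    "\<And>u m. \<bar>u - t\<bar> < \<rho> \<Longrightarrow> m < 3 \<Longrightarrow> ((deriv ^^ m) f0 has_real_derivative (deriv ^^ Suc m) f0 u) (at u)"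
    "\<And>u m. \<bar>u - t\<bar> < \<rho> \<Longrightarrow> m < 3 \<Longrightarrow> ((deriv ^^ m) g has_real_derivative (deriv ^^ Suc m) g u) (at u)"
proof -
  obtain d1 d2 where d: "d1 > 0" "d2 > 0"
    "\<And>u m. \<bar>u - t\<bar> < d1 \<Longrightarrow> m < 3 \<Longrightarrow> ((deriv ^^ m) f0 has_real_derivative (deriv ^^ Suc m) f0 u) (at u)"
    "\<And>u m. \<bar>u - t\<bar> < d2 \<Longrightarrow> m < 3 \<Longrightarrow> ((deriv ^^ m) g has_real_derivative (deriv ^^ Suc m) g u) (at u)"
    using cont_nth_deriv_at_3(1)[OF f0_smooth] cont_nth_deriv_at_3(1)[OF g_smooth] by blast
  show thesis
  proof (rule that[of "min (min d1 d2) (min t (M0 - t))"])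
    fix u m assume u: "\<bar>u - t\<bar> < min (min d1 d2) (min t (M0 - t))" and m: "m < (3::nat)"
    show "((deriv ^^ m) f0 has_real_derivative (deriv ^^ Suc m) f0 u) (at u)" using u m by (intro d(3)) auto
    show "((deriv ^^ m) g has_real_derivative (deriv ^^ Suc m) g u) (at u)" using u m by (intro d(4)) auto
  qed (use d t_pos t_less_M0 in auto)
qed

definition \<rho> where "\<rho> = (SOME \<rho>. 0 < \<rho> \<and> \<rho> \<le> t \<and> t + \<rho> \<le> M0 \<and>
    (\<forall>u m. \<bar>u - t\<bar> < \<rho> \<longrightarrow> m < 3 \<longrightarrow> ((deriv ^^ m) f0 has_real_derivative (deriv ^^ Suc m) f0 u) (at u)) \<and>
    (\<forall>u m. \<bar>u - t\<bar> < \<rho> \<longrightarrow> m < 3 \<longrightarrow> ((deriv ^^ m) g has_real_derivative (deriv ^^ Suc m) g u) (at u)))"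

lemma \<rho>: "0 < \<rho>" "\<rho> \<le> t" "t + \<rho> \<le> M0"
    "\<And>u m. \<bar>u - t\<bar> < \<rho> \<Longrightarrow> m < 3 \<Longrightarrow> ((deriv ^^ m) f0 has_real_derivative (deriv ^^ Suc m) f0 u) (at u)"
    "\<And>u m. \<bar>u - t\<bar> < \<rho> \<Longrightarrow> m < 3 \<Longrightarrow> ((deriv ^^ m) g has_real_derivative (deriv ^^ Suc m) g u) (at u)"
proof -
  have "\<exists>\<rho>. 0 < \<rho> \<and> \<rho> \<le> t \<and> t + \<rho> \<le> M0 \<and>
    (\<forall>u m. \<bar>u - t\<bar> < \<rho> \<longrightarrow> m < 3 \<longrightarrow> ((deriv ^^ m) f0 has_real_derivative (deriv ^^ Suc m) f0 u) (at u)) \<and>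
    (\<forall>u m. \<bar>u - t\<bar> < \<rho> \<longrightarrow> m < 3 \<longrightarrow> ((deriv ^^ m) g has_real_derivative (deriv ^^ Suc m) g u) (at u))"
    using radius by metis
  from someI_ex[OF this, folded \<rho>_def]
  show "0 < \<rho>" "\<rho> \<le> t" "t + \<rho> \<le> M0"
    "\<And>u m. \<bar>u - t\<bar> < \<rho> \<Longrightarrow> m < 3 \<Longrightarrow> ((deriv ^^ m) f0 has_real_derivative (deriv ^^ Suc m) f0 u) (at u)"
    "\<And>u m. \<bar>u - t\<bar> < \<rho> \<Longrightarrow> m < 3 \<Longrightarrow> ((deriv ^^ m) g has_real_derivative (deriv ^^ Suc m) g u) (at u)"
    by blast+
qed

text \<open>The factor of \<open>g\<close> in the subdensity, \<open>F0\<close> or \<open>1 -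
  F0\<close>, together with its derivatives.\<close>

definition W :: "nat \<Rightarrow> nat \<Rightarrow> real \<Rightarrow> real" where
  "W i m u = (case m of 0 \<Rightarrow> if i = 1 then F0 u else 1 - F0 u | Suc m \<Rightarrow> (if i = 1 then 1 else -1) * (deriv ^^ m) f0 u)"

abbreviation "gd m u \<equiv> (deriv ^^ m) g u"

text \<open>The derivatives of the subdensity near \<open>t\<close> by Leibniz' rule. The order
  zero is the subdensity on the whole line, because it is also the integrand of the mean values;
  every order from 3 on stands for the third derivative.\<close>

definition D :: "nat \<Rightarrow> nat \<Rightarrow> real \<Rightarrow> real" where
  "D i m u = (if m = 0 then subdens F0 g i u
     else if m = 1 then W i 1 u * gd 0 u + W i 0 u * gd 1 u
     else if m = 2 then W i 2 u * gd 0 u + 2 * (W i 1 u * gd 1 u) + W i 0 u * gd 2 u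
     else W i 3 u * gd 0 u + 3 * (W i 2 u * gd 1 u) + 3 * (W i 1 u * gd 2 u) + W i 0 u * gd 3 u)"

lemma F0_deriv: assumes u: "\<bar>u - t\<bar> < \<rho>" shows "(F0 has_real_derivative f0 u) (at u)"
proof -
  have "((\<lambda>v. LBINT u:{..v}. f0 u) has_real_derivative f0 u) (at u)"
  proof (rule halfline_integral_has_derivative)
    show "set_integrable lborel {..x} f0" for x using F_density by (auto simp: df_density_def)
    fix x assume "t - \<rho> < x" "x < t + \<rho>"
    then have "\<bar>x - t\<bar> < \<rho>" by (simp add: abs_less_iff)
    from DERIV_isCont[OF \<rho>(4)[OF this, of 0]] show "isCont f0 x" by simp
  qed (use u in \<open>auto simp: abs_less_iff\<close>)
  moreover have "(\<lambda>v. LBINT u:{..v}. f0 u) = F0" using F_density by (auto simp: df_density_def fun_eq_iff)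
  ultimately show ?thesis by simp
qed

lemma W_D: assumes u: "\<bar>u - t\<bar> < \<rho>" and m: "m < 4" shows "(W i m has_real_derivative W i (Suc m) u) (at u)"
proof (cases m)
  case 0
  have "((\<lambda>u. if i = 1 then F0 u else 1 - F0 u) has_real_derivative (if i = 1 then 1 else -1) * f0 u) (at u)"
    using F0_deriv[OF u] by (cases "i = 1") (auto intro!: derivative_eq_intros)
  then show ?thesis using 0 by (simp add: W_def[abs_def])
next
  case (Suc m')
  then show ?thesis using \<rho>(4)[OF u, of m'] m by (auto simp: W_def[abs_def] intro!: DERIV_cmult DERIV_minus)
qed

lemma gd_D: "\<bar>u - t\<bar> < \<rho> \<Longrightarrow> m < 3 \<Longrightarrow> ((\<lambda>u. gd m u) has_real_derivative gd (Suc m) u) (at u)"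
  using \<rho>(5)[of u m] by simp

lemma subdens_near: "\<bar>u - t\<bar> < \<rho> \<Longrightarrow> subdens F0 g i u = W i 0 u * g u"
  using \<rho>(2) by (auto simp: subdens_def W_def)

lemma D_deriv:
  assumes m: "m < 3" and u: "\<bar>u - t\<bar> < \<rho>"
  shows "(D i m has_real_derivative D i (Suc m) u) (at u)"
proof -
  have w: "(W i m has_real_derivative W i (Suc m) u) (at u)" if "m < 4" for m using W_D[OF u that] .
  have gg: "((\<lambda>u. gd m u) has_real_derivative gd (Suc m) u) (at u)" if "m < 3" for m using gd_D[OF u that] .
  consider "m = 0" | "m = 1" | "m = 2" using m by linarith
  then show ?thesis
  proof cases
    case 1
    have "((\<lambda>u. W i 0 u * gd 0 u) has_real_derivative W i (Suc 0) u * gd 0 u + gd (Suc 0) u * W i 0 u) (at u)"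
      by (rule DERIV_mult[OF w gg]) auto
    moreover have "open {t - \<rho><..<t + \<rho>}" "u \<in> {t - \<rho><..<t + \<rho>}" using u by (auto simp: abs_less_iff)
    ultimately have "(D i 0 has_real_derivative W i (Suc 0) u * gd 0 u + gd (Suc 0) u * W i 0 u) (at u)"
      by (rule has_field_derivative_transform_within_open) (auto simp: D_def subdens_near abs_less_iff)
    then show ?thesis using 1 by (simp add: D_def mult.commute)
  next
    case 2
    have "((\<lambda>u. W i 1 u * gd 0 u + W i 0 u * gd 1 u) has_real_derivative
       (W i (Suc 1) u * gd 0 u + gd (Suc 0) u * W i 1 u) + (W i (Suc 0) u * gd 1 u + gd (Suc 1) u * W i 0 u)) (at u)"
      by (intro DERIV_add DERIV_mult w gg) auto
    then show ?thesis using 2 by (simp add: D_def[abs_def] numeral_2_eq_2 algebra_simps)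
  next
    case 3
    have "((\<lambda>u. W i 2 u * gd 0 u + 2 * (W i 1 u * gd 1 u) + W i 0 u * gd 2 u) has_real_derivative
       (W i (Suc 2) u * gd 0 u + gd (Suc 0) u * W i 2 u) + 2 * (W i (Suc 1) u * gd 1 u + gd (Suc 1) u * W i 1 u)
        + (W i (Suc 0) u * gd 2 u + gd (Suc 2) u * W i 0 u)) (at u)"
      by (intro DERIV_add DERIV_cmult DERIV_mult w gg) auto
    then show ?thesis using 3 by (simp add: D_def[abs_def] numeral_2_eq_2 numeral_3_eq_3 algebra_simps)
  qed
qed

lemma D_cont: "isCont (D i 3) t"
proof -
  have w: "isCont (W i m) t" if "m < 4" for m using DERIV_isCont[OF W_D[of t m i]] that \<rho>(1) by simp
  have gg: "isCont (\<lambda>u. gd m u) t" if "m < 3" for m using DERIV_isCont[OF gd_D[of t m]] that \<rho>(1) by simp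
  have g3: "isCont (\<lambda>u. gd 3 u) t" using cont_nth_deriv_at_3(2)[OF g_smooth] by simp
  have "isCont (\<lambda>u. W i 3 u * gd 0 u + 3 * (W i 2 u * gd 1 u) + 3 * (W i 1 u * gd 2 u) + W i 0 u * gd 3 u) t"
    by (intro continuous_intros w gg g3) auto
  then show ?thesis by (simp add: D_def[abs_def])
qed

lemma subdens_measurable[measurable]: "subdens F0 g i \<in> borel_measurable borel"
  unfolding subdens_def[abs_def] by measurable

lemma subdens_nonneg: "0 \<le> subdens F0 g i u"
  using F0_bounds g_nonneg by (simp add: subdens_def)

lemma g_integrable: "integrable lborel g" and g_one: "(LBINT u. g u) = 1"
proof -
  interpret N: prob_space "density lborel g" using distr_T[of 1] prob_space_distr[of "T 1" borel] by simp
  have "(\<integral>\<^sup>+u. ennreal (g u) \<partial>lborel) = 1" using N.emeasure_space_1 by (simp add: emeasure_density)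
  then have "has_bochner_integral lborel g 1"
    using g_nonneg by (intro has_bochner_integral_nn_integral) auto
  then show "integrable lborel g" "(LBINT u. g u) = 1" by (auto simp: has_bochner_integral_iff)
qed

lemma subdens_le: "subdens F0 g i u \<le> g u"
proof -
  have "(if i = 1 then F0 u else 1 - F0 u) * g u \<le> 1 * g u" using F0_bounds[of u] g_nonneg by (intro mult_right_mono) auto
  then show ?thesis using g_nonneg[of u] by (simp add: subdens_def)
qed

lemma subdens_integrable: "integrable lborel (subdens F0 g i)"
  by (rule Bochner_Integration.integrable_bound[OF g_integrable])
    (use subdens_le subdens_nonneg g_nonneg in \<open>auto simp: abs_of_nonneg\<close>)

lemma subdens_set_integrable: "A \<in> sets borel \<Longrightarrow> set_integrable lborel A (subdens F0 g i)"
  unfolding set_integrable_def by (rule integrable_mult_indicator[OF _ subdens_integrable]) simp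

definition Gs :: "nat \<Rightarrow> real \<Rightarrow> real" where "Gs i v = (LBINT u:{..v}. subdens F0 g i u)"

lemma Gs_deriv: assumes u: "\<bar>u - t\<bar> < \<rho>" shows "(Gs i has_real_derivative D i 0 u) (at u)"
proof -
  have "((\<lambda>v. LBINT u:{..v}. subdens F0 g i u) has_real_derivative subdens F0 g i u) (at u)"
  proof (rule halfline_integral_has_derivative)
    show "set_integrable lborel {..x} (subdens F0 g i)" for x by (rule subdens_set_integrable) simp
    fix x assume "t - \<rho> < x" "x < t + \<rho>"
    then have "\<bar>x - t\<bar> < \<rho>" by (simp add: abs_less_iff)
    from DERIV_isCont[OF D_deriv[OF _ this, of 0 i]] show "isCont (subdens F0 g i) x" by (simp add: D_def[abs_def])
  qed (use u in \<open>auto simp: abs_less_iff\<close>)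
  then show ?thesis by (simp add: Gs_def[abs_def] D_def)
qed

lemma Gs_diff: "x \<le> y \<Longrightarrow> Gs i y - Gs i x = (LBINT u:{x<..y}. subdens F0 g i u)"
proof -
  assume "x \<le> y"
  then have "{..y} = {..x} \<union> {x<..y}" by auto
  then have "Gs i y = Gs i x + (LBINT u:{x<..y}. subdens F0 g i u)"
    unfolding Gs_def by (simp, intro set_integral_Un subdens_set_integrable) auto
  then show ?thesis by simp
qed

lemma Gs_mono: "x \<le> y \<Longrightarrow> Gs i x \<le> Gs i y"
proof -
  assume "x \<le> y"
  have "0 \<le> (LBINT u:{x<..y}. subdens F0 g i u)"
    unfolding set_lebesgue_integral_def using subdens_nonneg by (intro integral_nonneg_AE AE_I2) auto
  then show ?thesis using Gs_diff[OF \<open>x \<le> y\<close>, of i] by simp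
qed

lemma Gs_bd: "0 \<le> Gs i x" "Gs i x \<le> 1"
proof -
  show "0 \<le> Gs i x" unfolding Gs_def set_lebesgue_integral_def using subdens_nonneg by (intro integral_nonneg_AE AE_I2) auto
  have "Gs i x \<le> (LBINT u. g u)" unfolding Gs_def set_lebesgue_integral_def
    using subdens_set_integrable[of "{..x}" i] subdens_le[of i] g_nonneg g_integrable
    by (intro integral_mono) (auto simp: set_integrable_def indicator_def)
  then show "Gs i x \<le> 1" using g_one by simp
qed

lemma Gs_neg: "v < 0 \<Longrightarrow> Gs i v = 0"
proof -
  assume "v < 0"
  then have "(LBINT u:{..v}. subdens F0 g i u) = (LBINT u:{..v}. 0)"
    by (intro set_lebesgue_integral_cong) (auto simp: subdens_def)
  then show ?thesis by (simp add: Gs_def)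
qed

lemma Gs_HK: "0 \<le> v \<Longrightarrow> Gs i v = integral {0..v} (subdens F0 g i)"
proof -
  have "(LBINT u:{..v}. subdens F0 g i u) = (LBINT u:{0..v}. subdens F0 g i u)"
    unfolding set_lebesgue_integral_def
    by (intro Bochner_Integration.integral_cong) (auto simp: subdens_def indicator_def)
  also have "\<dots> = integral {0..v} (subdens F0 g i)"
    by (rule set_borel_integral_eq_integral(2)) (rule subdens_set_integrable, simp)
  finally show ?thesis by (simp add: Gs_def)
qed

lemma Gs_continuous: "continuous_on {0..b} (Gs i)"
proof -
  have "continuous_on {0..b} (\<lambda>v. integral {0..v} (subdens F0 g i))"
    by (intro indefinite_integral_continuous_1 set_borel_integral_eq_integral(1) subdens_set_integrable) simp
  then show ?thesis by (subst continuous_on_cong[OF refl Gs_HK]) auto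
qed

lemma Gs_zero: "Gs i 0 = 0" by (simp add: Gs_HK)

lemma Gs_at_0: "(Gs i \<longlongrightarrow> 0) (at_right 0)"
proof -
  have "(Gs i \<longlongrightarrow> Gs i 0) (at 0 within {0..1})" using Gs_continuous[of 1 i] by (auto simp: continuous_on_def)
  moreover have "at 0 within {0..1::real} = at_right 0" by (rule at_within_Icc_at_right) simp
  ultimately show ?thesis by (simp add: Gs_zero)
qed

text \<open>The integrand of \<open>Gs 1\<close> is \<open>F0\<close> times that of \<open>Gs 0 +
  Gs 1\<close>, and \<open>F0\<close> is monotone.\<close>

lemma cross:
  assumes xy: "x \<le> y"
  shows "F0 x * ((Gs 0 y + Gs 1 y) - (Gs 0 x + Gs 1 x)) \<le> Gs 1 y - Gs 1 x"
    and "Gs 1 y - Gs 1 x \<le> F0 y * ((Gs 0 y + Gs 1 y) - (Gs 0 x + Gs 1 x))"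
proof -
  let ?s = "\<lambda>i u. subdens F0 g i u"
  have i: "set_integrable lborel {x<..y} (?s i)" for i by (rule subdens_set_integrable) simp
  have s: "(Gs 0 y + Gs 1 y) - (Gs 0 x + Gs 1 x) = (LBINT u:{x<..y}. ?s 0 u + ?s 1 u)"
    using Gs_diff[OF xy, of 0] Gs_diff[OF xy, of 1] set_integral_add(2)[OF i[of 0] i[of 1]] by simp
  have i2: "set_integrable lborel {x<..y} (\<lambda>u. c * (?s 0 u + ?s 1 u))" for c
    by (intro set_integrable_mult_right set_integral_add(1) i)
  have eq: "?s 1 u = F0 u * (?s 0 u + ?s 1 u)" for u by (simp add: subdens_def algebra_simps)
  have nn: "0 \<le> ?s 0 u + ?s 1 u" for u using subdens_nonneg[of 0 u] subdens_nonneg[of 1 u] by simp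
  have "F0 x * (LBINT u:{x<..y}. ?s 0 u + ?s 1 u) = (LBINT u:{x<..y}. F0 x * (?s 0 u + ?s 1 u))" by simp
  also have "\<dots> \<le> (LBINT u:{x<..y}. ?s 1 u)"
  proof (rule set_integral_mono[OF i2 i])
    fix u assume "u \<in> {x<..y}"
    then have "F0 x * (?s 0 u + ?s 1 u) \<le> F0 u * (?s 0 u + ?s 1 u)" using nn by (intro mult_right_mono F0_mono) auto
    then show "F0 x * (?s 0 u + ?s 1 u) \<le> ?s 1 u" using eq[of u] by linarith
  qed
  finally show "F0 x * ((Gs 0 y + Gs 1 y) - (Gs 0 x + Gs 1 x)) \<le> Gs 1 y - Gs 1 x" unfolding s Gs_diff[OF xy] .
  have "(LBINT u:{x<..y}. ?s 1 u) \<le> (LBINT u:{x<..y}. F0 y * (?s 0 u + ?s 1 u))"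
  proof (rule set_integral_mono[OF i i2])
    fix u assume "u \<in> {x<..y}"
    then have "F0 u * (?s 0 u + ?s 1 u) \<le> F0 y * (?s 0 u + ?s 1 u)" using nn by (intro mult_right_mono F0_mono) auto
    then show "?s 1 u \<le> F0 y * (?s 0 u + ?s 1 u)" using eq[of u] by linarith
  qed
  also have "\<dots> = F0 y * (LBINT u:{x<..y}. ?s 0 u + ?s 1 u)" by simp
  finally show "Gs 1 y - Gs 1 x \<le> F0 y * ((Gs 0 y + Gs 1 y) - (Gs 0 x + Gs 1 x))" unfolding s Gs_diff[OF xy] .
qed

lemma D_at_t:
  "D 0 0 t = (1 - F0 t) * g t" "D 1 0 t = F0 t * g t"
  "D 0 1 t = - f0 t * g t + (1 - F0 t) * deriv g t" "D 1 1 t = f0 t * g t + F0 t * deriv g t"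
  using subdens_near[of t] \<rho>(1) by (auto simp: D_def W_def)

text \<open>The derivative of \<open>D 1 0 / (D 0 0 + D 1 0) = F0\<close> has the numerator
  \<open>f0 * g^2\<close> at \<open>t\<close>, so the positive slope of the naive estimator comes
  from the positive density \<open>f0\<close>.\<close>

sublocale target k Gs D F0 t \<rho>
proof unfold_locales
  show "0 < \<rho>" "\<rho> \<le> t" by (rule \<rho>)+
  show "(Gs i has_real_derivative D i 0 u) (at u)" if "\<bar>u - t\<bar> < \<rho>" for i u by (rule Gs_deriv[OF that])
  show "(D i m has_real_derivative D i (Suc m) u) (at u)" if "m < 3" "\<bar>u - t\<bar> < \<rho>" for i m u by (rule D_deriv[OF that])
  show "isCont (D i 3) t" for i by (rule D_cont)
  show "D i 0 \<in> borel_measurable borel" for i by (simp add: D_def[abs_def])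
  show "Gs i x \<le> Gs i y" if "x \<le> y" for i x y by (rule Gs_mono[OF that])
  show "0 \<le> Gs i x \<and> Gs i x \<le> 1" for i x using Gs_bd by simp
  show "(Gs i \<longlongrightarrow> 0) (at_right 0)" for i by (rule Gs_at_0)
  show "F0 x \<le> F0 y" if "x \<le> y" for x y by (rule F0_mono[OF that])
  show "0 \<le> F0 x \<and> F0 x \<le> 1" for x using F0_bounds by simp
  show "F0 x < F0 y" if "\<bar>x - t\<bar> < \<rho>" "\<bar>y - t\<bar> < \<rho>" "x < y" for x y
    using that \<rho> by (intro strict_mono_onD[OF F_mono]) auto
  show "F0 x * ((Gs 0 y + Gs 1 y) - (Gs 0 x + Gs 1 x)) \<le> Gs 1 y - Gs 1 x"
    "Gs 1 y - Gs 1 x \<le> F0 y * ((Gs 0 y + Gs 1 y) - (Gs 0 x + Gs 1 x))" if "x \<le> y" for x y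
    by (rule cross[OF that])+
  show "D 1 0 u = F0 u * (D 0 0 u + D 1 0 u)" for u by (simp add: D_def subdens_def algebra_simps)
  show "0 < D i 0 t" for i
    using D_at_t(1,2) F0_pos t_lt g_pos subdens_near[of t i] \<rho>(1) by (auto simp: D_def W_def)
  have "D 0 0 t * D 1 1 t - D 0 1 t * D 1 0 t = f0 t * (g t)\<^sup>2"
    unfolding D_at_t by (simp add: power2_eq_square algebra_simps)
  also have "0 < \<dots>" using f0_pos g_pos by simp
  finally show "0 < D 0 0 t * D 1 1 t - D 0 1 t * D 1 0 t" .
qed

lemma hazard_eq:
  "hazard F0 f0 t = 1 / (D 0 0 t + D 1 0 t) * D 1 1 t - D 1 0 t / (D 0 0 t * (D 0 0 t + D 1 0 t)) * D 0 1 t"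
proof -
  have s: "0 < 1 - F0 t" using t_lt by simp
  have "D 0 0 t + D 1 0 t = g t" unfolding D_at_t by (simp add: algebra_simps)
  then show ?thesis unfolding D_at_t hazard_def using s g_pos
    by (simp add: divide_simps) (simp add: algebra_simps)
qed

text \<open>The bias of \<open>naive_expansion\<close> in terms of \<open>f0\<close>,
  \<open>g\<close> and their derivatives; the third derivative of \<open>g\<close> cancels, and
  \<open>F0\<close> survives only through \<open>1 - F0\<close>.\<close>

lemma bias_eq:
  "1 / (D 0 0 t + D 1 0 t) * D 1 3 t - D 1 0 t / (D 0 0 t * (D 0 0 t + D 1 0 t)) * D 0 3 t
    - (D 0 2 t + D 1 2 t) / (D 0 0 t + D 1 0 t)\<^sup>2 * D 1 1 t
    - (D 1 2 t * D 0 0 t * (D 0 0 t + D 1 0 t) - D 1 0 t * (D 0 2 t * (D 0 0 t + D 1 0 t) + D 0 0 t * (D 0 2 t + D 1 2 t)))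
       / (D 0 0 t * (D 0 0 t + D 1 0 t))\<^sup>2 * D 0 1 t = r_bias F0 f0 g t"
proof -
  define s where "s = 1 - F0 t"
  have F: "F0 t = 1 - s" by (simp add: s_def)
  define a f f1 f2 g1 g2 g3 where "a = g t" and "f = f0 t" and "f1 = deriv f0 t" and "f2 = (deriv ^^ 2) f0 t"
    and "g1 = deriv g t" and "g2 = (deriv ^^ 2) g t" and "g3 = (deriv ^^ 3) g t"
  note ds = this
  have s: "s \<noteq> 0" using t_lt by (simp add: s_def)
  have a: "a \<noteq> 0" using g_pos by (simp add: ds)
  have d: "D 0 0 t = s * a" "D 1 0 t = (1 - s) * a" "D 0 1 t = - f * a + s * g1" "D 1 1 t = f * a + (1 - s) * g1"
    using D_at_t by (auto simp: ds F)
  have d2: "D 0 2 t = - f1 * a - 2 * f * g1 + s * g2" "D 1 2 t = f1 * a + 2 * f * g1 + (1 - s) * g2"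
    by (auto simp: D_def W_def numeral_2_eq_2 ds s_def algebra_simps)
  have d3: "D 0 3 t = - f2 * a - 3 * f1 * g1 - 3 * f * g2 + s * g3" "D 1 3 t = f2 * a + 3 * f1 * g1 + 3 * f * g2 + (1 - s) * g3"
    by (auto simp: D_def W_def numeral_2_eq_2 numeral_3_eq_3 ds s_def algebra_simps)
  have sum: "s * a + (1 - s) * a = a" by (simp add: algebra_simps)
  have sum2: "- f1 * a - 2 * f * g1 + s * g2 + (f1 * a + 2 * f * g1 + (1 - s) * g2) = g2" by (simp add: algebra_simps)
  have r: "r_bias F0 f0 g t = 1 / s * (f2 + 2 * ((g2 * f + g1 * f1) / a) - 2 * (g1\<^sup>2 * f / a\<^sup>2)) + f / s\<^sup>2 * (f1 + 2 * g1 * f / a)"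
    by (simp add: r_bias_def ds s_def)
  show ?thesis
    unfolding r d d2 d3 sum sum2 using s a
    by (simp add: divide_simps) (simp add: power2_eq_square power4_eq_xxxx algebra_simps)
qed

end

section \<open>An event of high probability\<close>

text \<open>The expansion of order zero: smoothing with a shrinking window converges to the value
  at a point of continuity.\<close>

lemma unit_kernel_smooth_limit:
  fixes \<phi> :: "real \<Rightarrow> real"
  assumes \<kappa>: "unit_kernel \<kappa>" and m: "\<phi> \<in> borel_measurable borel" and c: "isCont \<phi> t"
    and h: "h \<longlonglongrightarrow> 0" "\<forall>\<^sub>F n in sequentially. 0 < h n"
  shows "(\<lambda>n. LBINT v. \<kappa> v * \<phi> (t - h n * v)) \<longlonglongrightarrow> \<phi> t * (LBINT v. \<kappa> v)"
proof (rule tendstoI)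
  fix \<epsilon> :: real assume \<epsilon>: "0 < \<epsilon>"
  define C where "C = (LBINT v. \<bar>\<kappa> v\<bar>)"
  have C: "0 \<le> C" unfolding C_def by (intro integral_nonneg_AE) auto
  define \<eta> where "\<eta> = \<epsilon> / (C + 1)"
  have \<eta>: "0 < \<eta>" using \<epsilon> C by (simp add: \<eta>_def)
  have \<eta>C: "\<eta> * C < \<epsilon>"
  proof -
    have "\<eta> * C < \<eta> * (C + 1)" using \<eta> by simp
    also have "\<dots> = \<epsilon>" using C by (simp add: \<eta>_def)
    finally show ?thesis .
  qed
  obtain d where d: "d > 0" "\<And>y. \<bar>y - t\<bar> < d \<Longrightarrow> \<bar>\<phi> y - \<phi> t\<bar> < \<eta>"
    using c[unfolded continuous_at_eps_delta, rule_format, OF \<eta>] by (auto simp: dist_real_def)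
  have "\<forall>\<^sub>F n in sequentially. h n < d" using h(1) d(1) by (rule order_tendstoD(2))
  then show "\<forall>\<^sub>F n in sequentially. dist (LBINT v. \<kappa> v * \<phi> (t - h n * v)) (\<phi> t * (LBINT v. \<kappa> v)) < \<epsilon>"
    using h(2)
  proof eventually_elim
    case (elim n)
    have "\<bar>(LBINT v. \<kappa> v * \<phi> (t - h n * v)) - (\<Sum>m\<le>(0::nat). \<phi> t * (- h n) ^ m * (LBINT v. v ^ m * \<kappa> v))\<bar>
      \<le> \<eta> * (LBINT v. \<bar>\<kappa> v\<bar>)"
    proof (rule unit_kernel_taylor[OF \<kappa> m])
      fix v :: real assume v: "\<bar>v\<bar> \<le> 1"
      have "\<bar>h n * v\<bar> \<le> h n" using v elim by (simp add: abs_mult mult_left_le)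
      then have "\<bar>(t - h n * v) - t\<bar> < d" using elim by simp
      from d(2)[OF this] show "\<bar>\<phi> (t - h n * v) - (\<Sum>m\<le>(0::nat). \<phi> t * (- (h n * v)) ^ m)\<bar> \<le> \<eta>" by simp
    qed (use elim in auto)
    then show ?case using \<eta>C by (simp add: dist_real_def C_def)
  qed
qed

lemma kernel_substitution:
  assumes "0 < h"
  shows "(LBINT u. \<kappa> ((t - u) / h) * q u) = h * (LBINT v. \<kappa> v * (q (t - h * v) :: real))"
  using lborel_integral_real_affine[of "- h" "\<lambda>u. \<kappa> ((t - u) / h) * q u" t] assms by simp

context smooth_current_status
begin

text \<open>The empirical measure of the observations with status \<open>i\<close>; below it is
  compared with its limit \<open>lim_set\<close> on the finitely many sets of a grid.\<close>

definition emp_set :: "nat \<Rightarrow> 'a \<Rightarrow> nat \<Rightarrow> real set \<Rightarrow> real" where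
  "emp_set n \<omega> i B = (\<Sum>j=1..n. V (if i = 0 then indicator B else (\<lambda>_. 0)) (if i = 1 then indicator B else (\<lambda>_. 0)) j \<omega>) / real n"

definition lim_set :: "nat \<Rightarrow> real set \<Rightarrow> real" where
  "lim_set i B = (LBINT u. indicator B u * subdens F0 g i u)"

lemma emp_subdf_emp_set: "emp_subdf n (\<lambda>j. T j \<omega>) (status X T \<omega>) i v = emp_set n \<omega> i {..v}"
  unfolding emp_subdf_eq emp_set_def V_sum ..

lemma Gs_lim_set: "Gs i v = lim_set i {..v}"
  unfolding Gs_def lim_set_def set_lebesgue_integral_def by simp

lemma emp_set_mono: "B \<subseteq> C \<Longrightarrow> emp_set n \<omega> i B \<le> emp_set n \<omega> i C"
  unfolding emp_set_def by (intro divide_right_mono sum_mono) (auto simp: V_def indicator_def)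

lemma indicator_subdens_integrable: "B \<in> sets borel \<Longrightarrow> integrable lborel (\<lambda>u. indicator B u * subdens F0 g i u)"
  using subdens_set_integrable[of B i] by (simp add: set_integrable_def)

lemma lim_set_mono: "B \<subseteq> C \<Longrightarrow> B \<in> sets borel \<Longrightarrow> C \<in> sets borel \<Longrightarrow> lim_set i B \<le> lim_set i C"
  unfolding lim_set_def using subdens_nonneg[of i]
  by (intro integral_mono indicator_subdens_integrable) (auto simp: indicator_def)

lemma lim_set_total: "lim_set 0 UNIV + lim_set 1 UNIV \<le> 1"
proof -
  have "lim_set 0 UNIV + lim_set 1 UNIV = (LBINT u. subdens F0 g 0 u + subdens F0 g 1 u)"
    unfolding lim_set_def using subdens_integrable by simp
  also have "\<dots> \<le> (LBINT u. g u)"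
  proof (rule integral_mono)
    show "integrable lborel (\<lambda>u. subdens F0 g 0 u + subdens F0 g 1 u)" using subdens_integrable by simp
    fix u
    have "subdens F0 g 0 u + subdens F0 g 1 u = (if 0 \<le> u then g u else 0)" by (simp add: subdens_def algebra_simps)
    then show "subdens F0 g 0 u + subdens F0 g 1 u \<le> g u" using g_nonneg[of u] by simp
  qed (rule g_integrable)
  finally show ?thesis using g_one by simp
qed

abbreviation "mass \<equiv> lim_set 0 UNIV + lim_set 1 UNIV"

text \<open>The sum of the two limiting subdistribution functions is continuous from zero to its
  total mass, so all its quantiles exist.\<close>

lemma quantile_grid:
  assumes m: "1 \<le> m"
  shows "\<exists>x :: nat \<Rightarrow> real. x 0 = 0 \<and> (\<forall>j<m. Gs 0 (x j) + Gs 1 (x j) = real j / real m * mass)"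
proof -
  have ex: "\<exists>x\<ge>0. Gs 0 x + Gs 1 x = real j / real m * mass" if j: "j < m" for j
  proof (cases "mass = 0")
    case True
    then show ?thesis by (intro exI[of _ 0]) (simp add: Gs_zero)
  next
    case False
    have "0 \<le> mass" unfolding lim_set_def using subdens_nonneg by (intro add_nonneg_nonneg integral_nonneg_AE) auto
    then have pos: "0 < mass" using False by simp
    have "((\<lambda>v. Gs i v) \<longlongrightarrow> lim_set i UNIV) at_top" for i
      unfolding Gs_def set_lebesgue_integral_def lim_set_def
      using tendsto_integral_at_top[of lborel "subdens F0 g i"] subdens_integrable by simp
    then have "((\<lambda>v. Gs 0 v + Gs 1 v) \<longlongrightarrow> mass) at_top" by (intro tendsto_add)
    moreover have "real j / real m * mass < 1 * mass" using j pos by (intro mult_strict_right_mono) auto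
    ultimately have "\<forall>\<^sub>F v in at_top. real j / real m * mass < Gs 0 v + Gs 1 v" by (intro order_tendstoD(1)) auto
    then obtain b where "\<And>v. b \<le> v \<Longrightarrow> real j / real m * mass < Gs 0 v + Gs 1 v" unfolding eventually_at_top_linorder by auto
    then have b: "real j / real m * mass \<le> Gs 0 (max b 0) + Gs 1 (max b 0)" by (simp add: less_imp_le)
    have "\<exists>x\<ge>0. x \<le> max b 0 \<and> Gs 0 x + Gs 1 x = real j / real m * mass"
      by (rule IVT') (use b pos Gs_continuous in \<open>auto simp: Gs_zero intro!: continuous_intros\<close>)
    then show ?thesis by auto
  qed
  define x where "x j = (if j = 0 then 0 else (SOME x. 0 \<le> x \<and> Gs 0 x + Gs 1 x = real j / real m * mass))" for j :: nat
  have "Gs 0 (x j) + Gs 1 (x j) = real j / real m * mass" if "j < m" for j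
    using someI_ex[OF ex[OF that]] by (auto simp: x_def Gs_zero)
  then show ?thesis by (intro exI[of _ x]) (auto simp: x_def)
qed

definition grid :: "nat \<Rightarrow> nat \<Rightarrow> real" where
  "grid m = (SOME x. x 0 = 0 \<and> (\<forall>j<m. Gs 0 (x j) + Gs 1 (x j) = real j / real m * mass))"

lemma grid: "1 \<le> m \<Longrightarrow> grid m 0 = 0" "1 \<le> m \<Longrightarrow> j < m \<Longrightarrow> Gs 0 (grid m j) + Gs 1 (grid m j) = real j / real m * mass"
  using someI_ex[OF quantile_grid[of m], folded grid_def] by auto

text \<open>The half lines up to the quantiles, closed off by the whole line in the role of the
  quantile at infinity, which may not exist.\<close>

definition grid_set :: "nat \<Rightarrow> nat \<Rightarrow> real set" where "grid_set m j = (if j < m then {..grid m j} else UNIV)"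

lemma grid_set_borel[measurable]: "grid_set m j \<in> sets borel" by (simp add: grid_set_def)

text \<open>Each half line lies between two consecutive sets of the grid, whose limiting masses
  differ by at most \<open>1 / m\<close>; both measures are monotone. This replaces infinitely
  many half lines by \<open>m + 1\<close> sets.\<close>

lemma bracketing:
  assumes m: "1 \<le> m" and close: "\<And>j i. j \<le> m \<Longrightarrow> i \<le> 1 \<Longrightarrow> \<bar>emp_set n \<omega> i (grid_set m j) - lim_set i (grid_set m j)\<bar> \<le> \<epsilon>"
    and i: "i \<le> 1" and \<epsilon>: "0 \<le> \<epsilon>"
  shows "\<bar>emp_subdf n (\<lambda>j. T j \<omega>) (status X T \<omega>) i v - Gs i v\<bar> \<le> \<epsilon> + 1 / real m"
proof (cases "v < 0")
  case True
  then have "emp_subdf n (\<lambda>j. T j \<omega>) (status X T \<omega>) i v = 0" by (simp add: emp_subdf_def)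
  then show ?thesis using Gs_neg[OF True] \<epsilon> m by simp
next
  case False
  define J where "J = {j. j < m \<and> grid m j \<le> v}"
  define j where "j = Max J"
  have J: "finite J" "0 \<in> J" using m False grid(1) by (auto simp: J_def)
  have "j \<in> J" unfolding j_def by (rule Max_in) (use J in auto)
  then have j: "j < m" "grid m j \<le> v" by (auto simp: J_def)
  have sub1: "grid_set m j \<subseteq> {..v}" using j by (auto simp: grid_set_def)
  have next_gt: "v < grid m (Suc j)" if "Suc j < m"
  proof (rule ccontr)
    assume "\<not> v < grid m (Suc j)"
    then have "Suc j \<in> J" using that by (auto simp: J_def)
    then have "Suc j \<le> j" unfolding j_def using J(1) by (rule Max_ge[rotated])
    then show False by simp
  qed
  have sub2: "{..v} \<subseteq> grid_set m (Suc j)" using next_gt by (auto simp: grid_set_def)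
  have inc: "lim_set i (grid_set m (Suc j)) - lim_set i (grid_set m j) \<le> 1 / real m"
  proof -
    have mono: "lim_set i' (grid_set m j) \<le> lim_set i' (grid_set m (Suc j))" for i'
      using sub1 sub2 by (intro lim_set_mono) auto
    have tot: "lim_set 0 (grid_set m (Suc j)) + lim_set 1 (grid_set m (Suc j)) = real (Suc j) / real m * mass"
    proof (cases "Suc j < m")
      case True
      then show ?thesis using grid(2)[OF m True] by (simp add: grid_set_def Gs_lim_set)
    next
      case False
      then have "Suc j = m" using j by simp
      then show ?thesis using m by (simp add: grid_set_def)
    qed
    have "lim_set 0 (grid_set m j) + lim_set 1 (grid_set m j) = real j / real m * mass"
      using grid(2)[OF m j(1)] j(1) by (simp add: grid_set_def Gs_lim_set)
    then have "(lim_set 0 (grid_set m (Suc j)) + lim_set 1 (grid_set m (Suc j))) - (lim_set 0 (grid_set m j) + lim_set 1 (grid_set m j)) = mass / real m"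
      unfolding tot using m by (simp add: field_simps)
    also have "\<dots> \<le> 1 / real m" using lim_set_total m by (intro divide_right_mono) auto
    finally have "(lim_set 0 (grid_set m (Suc j)) + lim_set 1 (grid_set m (Suc j))) - (lim_set 0 (grid_set m j) + lim_set 1 (grid_set m j)) \<le> 1 / real m" .
    moreover have "i = 0 \<or> i = 1" using i by auto
    ultimately show ?thesis using mono[of 0] mono[of 1] by auto
  qed
  have "lim_set i (grid_set m j) \<le> Gs i v" "Gs i v \<le> lim_set i (grid_set m (Suc j))"
    unfolding Gs_lim_set using sub1 sub2 by (auto intro!: lim_set_mono)
  moreover have "emp_set n \<omega> i (grid_set m j) \<le> emp_set n \<omega> i {..v}" "emp_set n \<omega> i {..v} \<le> emp_set n \<omega> i (grid_set m (Suc j))"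
    using sub1 sub2 by (auto intro!: emp_set_mono)
  moreover have "\<bar>emp_set n \<omega> i (grid_set m j) - lim_set i (grid_set m j)\<bar> \<le> \<epsilon>" "\<bar>emp_set n \<omega> i (grid_set m (Suc j)) - lim_set i (grid_set m (Suc j))\<bar> \<le> \<epsilon>"
    using close[of j i] close[of "Suc j" i] j i by auto
  ultimately show ?thesis unfolding emp_subdf_emp_set using inc by linarith
qed

lemma emp_set_deviation:
  assumes B: "B \<in> sets borel" and i: "i \<le> 1" and a: "0 \<le> a" and n: "1 \<le> n"
  shows "prob {\<omega>\<in>space M. \<bar>emp_set n \<omega> i B - lim_set i B\<bar> \<ge> a} \<le> 2 * exp (- (real n * a\<^sup>2 / 2))"
proof -
  let ?\<phi> = "\<lambda>j. if i = j then indicator B else (\<lambda>_. 0::real)"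
  have "prob {\<omega>\<in>space M. \<bar>(\<Sum>j=1..n. V (?\<phi> 0) (?\<phi> 1) j \<omega>) / real n
      - (LBINT u. ?\<phi> 0 u * subdens F0 g 0 u + ?\<phi> 1 u * subdens F0 g 1 u)\<bar> \<ge> a} \<le> 2 * exp (- (real n * a\<^sup>2 / (2 * 1\<^sup>2)))"
    using B by (intro V_average_deviation a n) (auto simp: indicator_def)
  moreover have "(LBINT u. ?\<phi> 0 u * subdens F0 g 0 u + ?\<phi> 1 u * subdens F0 g 1 u) = lim_set i B"
    using i by (cases "i = 0") (auto simp: lim_set_def le_Suc_eq)
  ultimately show ?thesis by (simp add: emp_set_def)
qed

lemma emp_set_measurable[measurable]: "B \<in> sets borel \<Longrightarrow> (\<lambda>\<omega>. emp_set n \<omega> i B) \<in> borel_measurable M"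
  unfolding emp_set_def by (intro borel_measurable_divide borel_measurable_sum V_measurable) auto

end

locale bandwidth = smooth_current_status +
  fixes c :: real
  assumes c: "0 < c"
begin

text \<open>The exponents leave room on both sides: \<open>emp_tol\<close> is
  \<open>o(h^2)\<close> although \<open>n * emp_tol^2\<close> tends to infinity as
  \<open>n^(1/3)\<close>, and \<open>val_tol\<close> is \<open>o(1 / R)\<close> although \<open>n
  * val_tol^2 * h^2\<close> tends to infinity as \<open>n^(1/14)\<close>, so that Hoeffding's
  bounds vanish even after multiplication by the size of the grid.\<close>

definition h where "h n = c * real n powr (- 1 / 7)"
definition R where "R n = real n powr (2 / 7)"
definition emp_tol where "emp_tol n = real n powr (- 1 / 3)"
definition grid_size where "grid_size n = nat \<lceil>real n powr (1 / 3)\<rceil>"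
definition val_tol where "val_tol n = real n powr (- 9 / 28)"

lemma h_pos: "1 \<le> n \<Longrightarrow> 0 < h n" using c by (simp add: h_def)
lemma eventually_ge_1: "\<forall>\<^sub>F n in sequentially. 1 \<le> (n::nat)" by (rule eventually_ge_at_top)
lemma h_pos_ev: "\<forall>\<^sub>F n in sequentially. 0 < h n" using eventually_ge_1 by eventually_elim (rule h_pos)
lemma h_0: "h \<longlonglongrightarrow> 0" unfolding h_def using c by real_asymp
lemma h_less_t: "\<forall>\<^sub>F n in sequentially. h n < t" using h_0 t_pos by (rule order_tendstoD(2))
lemma Rh2: "1 \<le> n \<Longrightarrow> R n * (h n)\<^sup>2 = c\<^sup>2"
  by (simp add: R_def h_def power_mult_distrib powr_realpow[symmetric] powr_powr flip: powr_numeral) (simp add: powr_minus field_simps powr_add[symmetric])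

text \<open>The density estimator at \<open>t\<close> as an average of independent variables, and
  its mean in the form of a smoothed subdensity.\<close>

definition val :: "nat \<Rightarrow> 'a \<Rightarrow> nat \<Rightarrow> real" where
  "val n \<omega> i = (\<Sum>j=1..n. V (if i = 0 then (\<lambda>u. k ((t - u) / h n) / h n) else (\<lambda>_. 0))
      (if i = 1 then (\<lambda>u. k ((t - u) / h n) / h n) else (\<lambda>_. 0)) j \<omega>) / real n"

definition val0 :: "nat \<Rightarrow> nat \<Rightarrow> real" where "val0 n i = (LBINT v. k v * subdens F0 g i (t - h n * v))"

lemma val_eq: assumes n: "1 \<le> n" "h n < t"
  shows "g_est k (h n) n (\<lambda>j. T j \<omega>) (status X T \<omega>) i t = val n \<omega> i"
proof -
  have "g_est k (h n) n (\<lambda>j. T j \<omega>) (status X T \<omega>) i t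
     = (\<Sum>j\<in>class_obs n (\<lambda>j. T j \<omega>) (status X T \<omega>) i. (\<lambda>u. k ((t - u) / h n) / h n) (T j \<omega>)) / real n"
    using g_est_interior[OF n(2)] by (simp add: sum_divide_distrib mult.commute)
  then show ?thesis unfolding val_def
    using V_sum[where \<phi>="\<lambda>u. k ((t - u) / h n) / h n" and n=n and \<omega>=\<omega> and i=i] by simp
qed

lemma val_measurable[measurable]: "(\<lambda>\<omega>. val n \<omega> i) \<in> borel_measurable M"
  unfolding val_def by (intro borel_measurable_divide borel_measurable_sum V_measurable) auto

lemma val_deviation:
  assumes i: "i \<le> 1" and a: "0 \<le> a" and n: "1 \<le> n"
  shows "prob {\<omega>\<in>space M. \<bar>val n \<omega> i - val0 n i\<bar> \<ge> a} \<le> 2 * exp (- (real n * a\<^sup>2 / (2 * (kmax / h n)\<^sup>2)))"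
proof -
  let ?f = "\<lambda>u. k ((t - u) / h n) / h n"
  let ?\<phi> = "\<lambda>j. if i = j then ?f else (\<lambda>_. 0::real)"
  have h: "0 < h n" by (rule h_pos[OF n])
  have b: "\<bar>?\<phi> j u\<bar> \<le> kmax / h n" for j u
    using k_le[of "(t - u) / h n"] h kmax_pos by (auto simp: abs_divide intro!: divide_right_mono)
  have "prob {\<omega>\<in>space M. \<bar>(\<Sum>j=1..n. V (?\<phi> 0) (?\<phi> 1) j \<omega>) / real n
      - (LBINT u. ?\<phi> 0 u * subdens F0 g 0 u + ?\<phi> 1 u * subdens F0 g 1 u)\<bar> \<ge> a} \<le> 2 * exp (- (real n * a\<^sup>2 / (2 * (kmax / h n)\<^sup>2)))"
    by (rule V_average_deviation) (use b a n h kmax_pos in auto)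
  moreover have "(LBINT u. ?\<phi> 0 u * subdens F0 g 0 u + ?\<phi> 1 u * subdens F0 g 1 u) = val0 n i"
  proof -
    have "(LBINT u. ?\<phi> 0 u * subdens F0 g 0 u + ?\<phi> 1 u * subdens F0 g 1 u) = (LBINT u. k ((t - u) / h n) * subdens F0 g i u / h n)"
      using i by (intro Bochner_Integration.integral_cong) (auto simp: le_Suc_eq)
    also have "\<dots> = (LBINT u. k ((t - u) / h n) * subdens F0 g i u) / h n" by (rule integral_divide_zero)
    also have "\<dots> = val0 n i" unfolding kernel_substitution[OF h] val0_def using h by simp
    finally show ?thesis .
  qed
  ultimately show ?thesis by (simp add: val_def)
qed

text \<open>The estimated derivatives are absent: their deviations are of the order of the limit
  itself and remain as the random part.\<close>

definition good :: "nat \<Rightarrow> 'a set" where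
  "good n = {\<omega>\<in>space M. (\<forall>j\<in>{..grid_size n}. \<forall>i\<in>{..1}. \<bar>emp_set n \<omega> i (grid_set (grid_size n) j) - lim_set i (grid_set (grid_size n) j)\<bar> < emp_tol n) \<and>
     (\<forall>i\<in>{..1}. \<bar>val n \<omega> i - val0 n i\<bar> < val_tol n)}"

lemma good_measurable[measurable]: "good n \<in> events"
  unfolding good_def by measurable

text \<open>A union bound over the sets of the grid and over the two status values, with
  Hoeffding's inequality for each of the events.\<close>

lemma good_prob:
  assumes n: "1 \<le> n"
  shows "1 - prob (good n) \<le> 4 * (real n powr (1 / 3) + 2) * exp (- (real n powr (1 / 3) / 2))
     + 4 * exp (- (c\<^sup>2 / (2 * kmax\<^sup>2) * real n powr (1 / 14)))"
proof -
  let ?b1 = "\<lambda>z. {\<omega>\<in>space M. \<bar>emp_set n \<omega> (snd z) (grid_set (grid_size n) (fst z)) - lim_set (snd z) (grid_set (grid_size n) (fst z))\<bar> \<ge> emp_tol n}"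
  let ?b2 = "\<lambda>i. {\<omega>\<in>space M. \<bar>val n \<omega> i - val0 n i\<bar> \<ge> val_tol n}"
  let ?Z = "{..grid_size n} \<times> {..1::nat}"
  have [measurable]: "?b1 z \<in> events" "?b2 i \<in> events" for z i by measurable
  have sub: "space M - good n \<subseteq> (\<Union>z\<in>?Z. ?b1 z) \<union> (\<Union>i\<in>{..1}. ?b2 i)"
    unfolding good_def by (auto simp: not_less) 
  have "1 - prob (good n) = prob (space M - good n)" by (simp add: prob_compl)
  also have "\<dots> \<le> prob ((\<Union>z\<in>?Z. ?b1 z) \<union> (\<Union>i\<in>{..1}. ?b2 i))"
    by (rule finite_measure_mono[OF sub]) (intro sets.Un sets.finite_UN; simp)
  also have "\<dots> \<le> prob (\<Union>z\<in>?Z. ?b1 z) + prob (\<Union>i\<in>{..1}. ?b2 i)"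
    by (rule measure_subadditive) (auto intro!: sets.finite_UN)
  also have "prob (\<Union>z\<in>?Z. ?b1 z) \<le> (\<Sum>z\<in>?Z. prob (?b1 z))"
    by (rule finite_measure_subadditive_finite) auto
  also have "(\<Sum>z\<in>?Z. prob (?b1 z)) \<le> (\<Sum>z\<in>?Z. 2 * exp (- (real n * (emp_tol n)\<^sup>2 / 2)))"
    by (intro sum_mono emp_set_deviation n) (auto simp: emp_tol_def)
  also have "\<dots> = 4 * (real (grid_size n) + 1) * exp (- (real n * (emp_tol n)\<^sup>2 / 2))" by simp
  also have "real n * (emp_tol n)\<^sup>2 = real n powr (1 / 3)"
  proof -
    have "real n * (emp_tol n)\<^sup>2 = real n powr 1 * real n powr (- 2 / 3)"
      using n by (simp add: emp_tol_def power2_eq_square powr_add[symmetric])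
    also have "\<dots> = real n powr (1 / 3)" unfolding powr_add[symmetric] by simp
    finally show ?thesis .
  qed
  also have "4 * (real (grid_size n) + 1) * exp (- (real n powr (1 / 3) / 2)) \<le> 4 * (real n powr (1 / 3) + 2) * exp (- (real n powr (1 / 3) / 2))"
  proof -
    have "real (grid_size n) \<le> real n powr (1 / 3) + 1" by (simp add: grid_size_def)
    then show ?thesis by (intro mult_right_mono) auto
  qed
  also have "prob (\<Union>i\<in>{..1}. ?b2 i) \<le> (\<Sum>i\<in>{..1::nat}. prob (?b2 i))"
    by (rule finite_measure_subadditive_finite) auto
  also have "(\<Sum>i\<in>{..1::nat}. prob (?b2 i)) \<le> (\<Sum>i\<in>{..1::nat}. 2 * exp (- (real n * (val_tol n)\<^sup>2 / (2 * (kmax / h n)\<^sup>2))))"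
    by (intro sum_mono val_deviation n) (auto simp: val_tol_def)
  also have "\<dots> = 4 * exp (- (real n * (val_tol n)\<^sup>2 / (2 * (kmax / h n)\<^sup>2)))" by simp
  also have "real n * (val_tol n)\<^sup>2 / (2 * (kmax / h n)\<^sup>2) = c\<^sup>2 / (2 * kmax\<^sup>2) * real n powr (1 / 14)"
  proof -
    have "real n * (val_tol n)\<^sup>2 / (2 * (kmax / h n)\<^sup>2) = 1 / (2 * kmax\<^sup>2) * (real n * (val_tol n)\<^sup>2 * (h n)\<^sup>2)"
      using h_pos[OF n] kmax_pos by (simp add: power_divide)
    also have "real n * (val_tol n)\<^sup>2 * (h n)\<^sup>2 = c\<^sup>2 * (real n powr 1 * (real n powr (- 9 / 28) * real n powr (- 9 / 28)) * (real n powr (- 1 / 7) * real n powr (- 1 / 7)))"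
      using n by (simp add: val_tol_def h_def power2_eq_square algebra_simps)
    also have "\<dots> = c\<^sup>2 * real n powr (1 / 14)" unfolding powr_add[symmetric] by simp
    finally show ?thesis by simp
  qed
  finally show ?thesis by simp
qed

lemma good_prob_lim: "(\<lambda>n. prob (good n)) \<longlonglongrightarrow> 1"
proof -
  define C where "C = c\<^sup>2 / (2 * kmax\<^sup>2)"
  have C: "0 < C" using c kmax_pos by (simp add: C_def)
  have "(\<lambda>n. 4 * (real n powr (1 / 3) + 2) * exp (- (real n powr (1 / 3) / 2))
     + 4 * exp (- (C * real n powr (1 / 14)))) \<longlonglongrightarrow> 0"
    using C by real_asymp
  then have "(\<lambda>n. 1 - prob (good n)) \<longlonglongrightarrow> 0"
  proof (rule Lim_null_comparison[rotated])
    show "\<forall>\<^sub>F n in sequentially. norm (1 - prob (good n)) \<le> 4 * (real n powr (1 / 3) + 2) * exp (- (real n powr (1 / 3) / 2))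
     + 4 * exp (- (C * real n powr (1 / 14)))"
      using eventually_ge_1 by eventually_elim (use good_prob in \<open>simp add: C_def\<close>)
  qed
  from tendsto_diff[OF tendsto_const this, of 1] show ?thesis by simp
qed

text \<open>The error \<open>2 * emp_tol\<close> is the sum of the tolerance on the grid and of
  the mesh of the grid.\<close>

lemma good_data_seq:
  assumes w: "\<forall>\<^sub>F n in sequentially. w n \<in> good n"
  shows "good_data k Gs D F0 t \<rho> (\<lambda>n j. T j (w n)) (\<lambda>n. status X T (w n)) h (\<lambda>n. 2 * emp_tol n)"
proof unfold_locales
  show "\<forall>\<^sub>F n in sequentially. 0 < h n" by (rule h_pos_ev)
  show "h \<longlonglongrightarrow> 0" by (rule h_0)
  show "(\<lambda>n. 2 * emp_tol n) \<longlonglongrightarrow> 0" unfolding emp_tol_def by real_asymp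
  have "(\<lambda>n. 2 * emp_tol n / (h n)\<^sup>2) \<longlonglongrightarrow> 0" unfolding emp_tol_def h_def using c by real_asymp
  then show "(\<lambda>n. 2 * emp_tol n / (h n)\<^sup>2) \<longlonglongrightarrow> 0" .
  show "\<forall>\<^sub>F n in sequentially. \<forall>i\<le>1. \<forall>v. \<bar>emp_subdf n (\<lambda>j. T j (w n)) (status X T (w n)) i v - Gs i v\<bar> \<le> 2 * emp_tol n"
    using w eventually_ge_1
  proof eventually_elim
    case (elim n)
    have grid_size: "1 \<le> grid_size n" using elim(2) by (simp add: grid_size_def Suc_le_eq zero_less_nat_eq zero_less_ceiling)
    have "real n powr (1 / 3) \<le> real (grid_size n)" by (simp add: grid_size_def)
    then have "1 / real (grid_size n) \<le> 1 / real n powr (1 / 3)" using elim(2) by (intro frac_le) auto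
    also have "\<dots> = emp_tol n" using elim(2) by (simp add: emp_tol_def powr_minus_divide)
    finally have m2: "1 / real (grid_size n) \<le> emp_tol n" .
    have br: "\<bar>emp_subdf n (\<lambda>j. T j (w n)) (status X T (w n)) i v - Gs i v\<bar> \<le> emp_tol n + 1 / real (grid_size n)" if "i \<le> 1" for i v
      using elim(1) by (intro bracketing[OF grid_size _ that]) (auto simp: good_def emp_tol_def intro: less_imp_le)
    show ?case
    proof (intro allI impI)
      fix i :: nat and v assume "i \<le> 1"
      then show "\<bar>emp_subdf n (\<lambda>j. T j (w n)) (status X T (w n)) i v - Gs i v\<bar> \<le> 2 * emp_tol n"
        using br[of i v] m2 by linarith
    qed
  qed
qed

section \<open>The central limit theorem for the linear part\<close>

text \<open>The linear part of the expansion is \<open>coef1 * g1' - coef0 * g0'\<close> in the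
  estimated derivatives. The variable \<open>Y n j\<close> is the centered contribution of the
  \<open>j\<close>-th observation to \<open>R n\<close> times this expression;
  \<open>\<phi>0\<close> and \<open>\<phi>1\<close> are its contributions before division by
  \<open>n h^2\<close>.\<close>

definition coef1 where "coef1 = 1 / (D 0 0 t + D 1 0 t)"
definition coef0 where "coef0 = D 1 0 t / (D 0 0 t * (D 0 0 t + D 1 0 t))"
definition scale where "scale n = R n / (real n * (h n)\<^sup>2)"
definition \<phi>0 where "\<phi>0 n u = - coef0 * deriv k ((t - u) / h n)"
definition \<phi>1 where "\<phi>1 n u = coef1 * deriv k ((t - u) / h n)"
definition \<mu> where "\<mu> n = (LBINT u. \<phi>0 n u * subdens F0 g 0 u + \<phi>1 n u * subdens F0 g 1 u)"
definition Y where "Y n j \<omega> = scale n * (V (\<phi>0 n) (\<phi>1 n) j \<omega> - \<mu> n)"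

definition "k1_sq = (LBINT u. (deriv k u)\<^sup>2)"

lemma \<phi>_measurable[measurable]: "\<phi>0 n \<in> borel_measurable borel" "\<phi>1 n \<in> borel_measurable borel"
  unfolding \<phi>0_def[abs_def] \<phi>1_def[abs_def] by measurable

definition "score_bound = (\<bar>coef1\<bar> + \<bar>coef0\<bar>) * kmax"

lemma \<phi>_bound: "\<bar>\<phi>0 n u\<bar> \<le> score_bound" "\<bar>\<phi>1 n u\<bar> \<le> score_bound"
proof -
  have "\<bar>\<phi>0 n u\<bar> \<le> \<bar>coef0\<bar> * kmax" "\<bar>\<phi>1 n u\<bar> \<le> \<bar>coef1\<bar> * kmax"
    unfolding \<phi>0_def \<phi>1_def abs_mult using k1_le by (auto intro!: mult_left_mono)
  moreover have "0 \<le> \<bar>coef1\<bar> * kmax" "0 \<le> \<bar>coef0\<bar> * kmax" using kmax_pos by auto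
  ultimately show "\<bar>\<phi>0 n u\<bar> \<le> score_bound" "\<bar>\<phi>1 n u\<bar> \<le> score_bound" unfolding score_bound_def by (auto simp: algebra_simps)
qed

lemma V_bounded: "\<bar>V (\<phi>0 n) (\<phi>1 n) j \<omega>\<bar> \<le> score_bound"
  by (rule V_bound[OF \<phi>_bound])

lemma scale_nonneg: "0 \<le> scale n" by (simp add: scale_def R_def)

lemma V_expectation: "j \<in> {1..n} \<Longrightarrow> expectation (V (\<phi>0 n) (\<phi>1 n) j) = \<mu> n"
  unfolding \<mu>_def by (rule V_mean[OF _ \<phi>_measurable \<phi>_bound]) auto

lemma \<mu>_bound: assumes n: "1 \<le> n" shows "\<bar>\<mu> n\<bar> \<le> score_bound"
proof -
  have "\<bar>\<mu> n\<bar> \<le> expectation (\<lambda>\<omega>. \<bar>V (\<phi>0 n) (\<phi>1 n) 1 \<omega>\<bar>)"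
    using V_expectation[of 1 n] n integral_abs_bound[of M "V (\<phi>0 n) (\<phi>1 n) 1"] by simp
  also have "\<dots> \<le> expectation (\<lambda>_. score_bound)"
    using V_bounded n
    by (intro integral_mono integrable_const integrable_abs integrable_const_bound[where B=score_bound] AE_I2) auto
  finally show ?thesis using prob_space by simp
qed

lemma Y_indep: "indep_vars (\<lambda>_. borel) (Y n) {1..n}"
  unfolding Y_def[abs_def]
  by (rule indep_vars_compose2[where Y="\<lambda>_ x. scale n * (x - \<mu> n)", OF V_indep[OF \<phi>_measurable]]) measurable

lemma Y_bound: "j \<in> {1..n} \<Longrightarrow> \<bar>Y n j \<omega>\<bar> \<le> scale n * (2 * score_bound)"
proof -
  assume "j \<in> {1..n}"
  then have "\<bar>V (\<phi>0 n) (\<phi>1 n) j \<omega> - \<mu> n\<bar> \<le> 2 * score_bound"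
    using V_bounded[of n j \<omega>] \<mu>_bound[of n] by auto
  then show ?thesis unfolding Y_def abs_mult using scale_nonneg[of n] by (intro mult_mono) auto
qed

lemma scale_0: "scale \<longlonglongrightarrow> 0"
  unfolding scale_def R_def h_def using c by real_asymp

lemma V_int: "j \<in> {1..n} \<Longrightarrow> integrable M (V (\<phi>0 n) (\<phi>1 n) j)"
  "j \<in> {1..n} \<Longrightarrow> integrable M (\<lambda>\<omega>. (V (\<phi>0 n) (\<phi>1 n) j \<omega>)\<^sup>2)"
proof -
  assume j: "j \<in> {1..n}"
  have [measurable]: "V (\<phi>0 n) (\<phi>1 n) j \<in> borel_measurable M" using j by (intro V_measurable) auto
  show "integrable M (V (\<phi>0 n) (\<phi>1 n) j)"
    by (rule integrable_const_bound[where B=score_bound]) (use V_bounded in auto)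
  have "(V (\<phi>0 n) (\<phi>1 n) j \<omega>)\<^sup>2 \<le> score_bound\<^sup>2" for \<omega>
    using power_mono[OF V_bounded[of n j \<omega>], of 2] by simp
  then show "integrable M (\<lambda>\<omega>. (V (\<phi>0 n) (\<phi>1 n) j \<omega>)\<^sup>2)"
    by (intro integrable_const_bound[where B="score_bound\<^sup>2"] AE_I2) auto
qed

lemma Y_mean: "j \<in> {1..n} \<Longrightarrow> expectation (Y n j) = 0"
proof -
  assume j: "j \<in> {1..n}"
  have "expectation (Y n j) = scale n * (expectation (V (\<phi>0 n) (\<phi>1 n) j) - \<mu> n)"
    unfolding Y_def using V_int(1)[OF j] prob_space by simp
  then show ?thesis using V_expectation[OF j] by simp
qed

definition V2 where "V2 n = (LBINT u. (\<phi>0 n u)\<^sup>2 * subdens F0 g 0 u + (\<phi>1 n u)\<^sup>2 * subdens F0 g 1 u)"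

lemma Y_var: "j \<in> {1..n} \<Longrightarrow> expectation (\<lambda>\<omega>. (Y n j \<omega>)\<^sup>2) = (scale n)\<^sup>2 * (V2 n - (\<mu> n)\<^sup>2)"
proof -
  assume j: "j \<in> {1..n}"
  have sq: "\<bar>(\<phi>0 n u)\<^sup>2\<bar> \<le> score_bound\<^sup>2" "\<bar>(\<phi>1 n u)\<^sup>2\<bar> \<le> score_bound\<^sup>2" for u
    using power_mono[OF \<phi>_bound(1)[of n u], of 2] power_mono[OF \<phi>_bound(2)[of n u], of 2] by simp_all
  have E2: "expectation (\<lambda>\<omega>. (V (\<phi>0 n) (\<phi>1 n) j \<omega>)\<^sup>2) = V2 n"
    unfolding V_sq V2_def using j sq by (intro V_mean[where B="score_bound\<^sup>2"]) auto
  have "(Y n j \<omega>)\<^sup>2 = (scale n)\<^sup>2 * ((V (\<phi>0 n) (\<phi>1 n) j \<omega>)\<^sup>2 - 2 * \<mu> n * V (\<phi>0 n) (\<phi>1 n) j \<omega> + (\<mu> n)\<^sup>2)" for \<omega>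
    unfolding Y_def by (simp add: power2_eq_square algebra_simps)
  then have "expectation (\<lambda>\<omega>. (Y n j \<omega>)\<^sup>2)
      = (scale n)\<^sup>2 * (expectation (\<lambda>\<omega>. (V (\<phi>0 n) (\<phi>1 n) j \<omega>)\<^sup>2) - 2 * \<mu> n * expectation (V (\<phi>0 n) (\<phi>1 n) j) + (\<mu> n)\<^sup>2)"
    using V_int[OF j] prob_space by simp
  then show ?thesis using V_expectation[OF j] E2 by (simp add: power2_eq_square algebra_simps)
qed

text \<open>After substituting \<open>u = t - h v\<close> the second and the first moment of a
  score are \<open>h\<close> times integrals over a fixed window, which converge because the
  subdensities are continuous at \<open>t\<close>.\<close>

definition "I2 n = (LBINT v. (deriv k v)\<^sup>2 * (coef0\<^sup>2 * subdens F0 g 0 (t - h n * v) + coef1\<^sup>2 * subdens F0 g 1 (t - h n * v)))"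
definition "I1 n = (LBINT v. deriv k v * (coef1 * subdens F0 g 1 (t - h n * v) - coef0 * subdens F0 g 0 (t - h n * v)))"

lemma V2_eq: "1 \<le> n \<Longrightarrow> V2 n = h n * I2 n"
  unfolding V2_def I2_def
  by (subst kernel_substitution[OF h_pos, of n, where t=t and \<kappa>="\<lambda>v. (deriv k v)\<^sup>2" and q="\<lambda>u. coef0\<^sup>2 * subdens F0 g 0 u + coef1\<^sup>2 * subdens F0 g 1 u", symmetric])
    (auto intro!: Bochner_Integration.integral_cong simp: \<phi>0_def \<phi>1_def power_mult_distrib algebra_simps)

lemma \<mu>_eq: "1 \<le> n \<Longrightarrow> \<mu> n = h n * I1 n"
  unfolding \<mu>_def I1_def
  by (subst kernel_substitution[OF h_pos, of n, where t=t and \<kappa>="deriv k" and q="\<lambda>u. coef1 * subdens F0 g 1 u - coef0 * subdens F0 g 0 u", symmetric])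
    (auto intro!: Bochner_Integration.integral_cong simp: \<phi>0_def \<phi>1_def algebra_simps)

lemma subdens_cont: "isCont (subdens F0 g i) t"
  using DERIV_isCont[OF D_deriv[of 0 t i]] \<rho>(1) by (simp add: D_def[abs_def])

lemma I2_lim: "I2 \<longlonglongrightarrow> (coef0\<^sup>2 * D 0 0 t + coef1\<^sup>2 * D 1 0 t) * k1_sq"
proof -
  have "(\<lambda>n. LBINT v. (deriv k v)\<^sup>2 * (\<lambda>u. coef0\<^sup>2 * subdens F0 g 0 u + coef1\<^sup>2 * subdens F0 g 1 u) (t - h n * v))
     \<longlonglongrightarrow> (\<lambda>u. coef0\<^sup>2 * subdens F0 g 0 u + coef1\<^sup>2 * subdens F0 g 1 u) t * (LBINT v. (deriv k v)\<^sup>2)"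
  proof (rule unit_kernel_smooth_limit[OF _ _ _ h_0 h_pos_ev])
    show "unit_kernel (\<lambda>v. (deriv k v)\<^sup>2)"
      unfolding power2_eq_square using unit_kernel_k1 by (intro unit_kernel_mult) (auto simp: unit_kernel_def)
    show "isCont (\<lambda>u. coef0\<^sup>2 * subdens F0 g 0 u + coef1\<^sup>2 * subdens F0 g 1 u) t" by (intro continuous_intros subdens_cont)
  qed measurable
  then show ?thesis by (simp add: I2_def[abs_def] k1_sq_def D_def)
qed

lemma I1_lim: "I1 \<longlonglongrightarrow> 0"
proof -
  have "(\<lambda>n. LBINT v. deriv k v * (\<lambda>u. coef1 * subdens F0 g 1 u - coef0 * subdens F0 g 0 u) (t - h n * v))
     \<longlonglongrightarrow> (\<lambda>u. coef1 * subdens F0 g 1 u - coef0 * subdens F0 g 0 u) t * (LBINT v. deriv k v)"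
  proof (rule unit_kernel_smooth_limit[OF unit_kernel_k1 _ _ h_0 h_pos_ev])
    show "isCont (\<lambda>u. coef1 * subdens F0 g 1 u - coef0 * subdens F0 g 0 u) t" by (intro continuous_intros subdens_cont)
  qed measurable
  then show ?thesis by (simp add: I1_def[abs_def] k1_moment_0)
qed

text \<open>The squared mean of a score is of order \<open>h^2\<close> and does not contribute to
  the limit, since the second moment is of order \<open>h\<close>; the normalization is \<open>n
  (R / (n h^2))^2 h = 1 / c^3\<close> exactly.\<close>

lemma var_lim: "(\<lambda>n. real n * ((scale n)\<^sup>2 * (V2 n - (\<mu> n)\<^sup>2))) \<longlonglongrightarrow> 1 / c ^ 3 * ((coef0\<^sup>2 * D 0 0 t + coef1\<^sup>2 * D 1 0 t) * k1_sq)"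
proof -
  have "(\<lambda>n. real n * (scale n)\<^sup>2 * h n) \<longlonglongrightarrow> 1 / c ^ 3"
  proof (rule tendsto_eventually)
    show "\<forall>\<^sub>F n in sequentially. real n * (scale n)\<^sup>2 * h n = 1 / c ^ 3"
      using eventually_ge_1
    proof eventually_elim
      case (elim n)
      define x where "x = real n powr (1 / 7)"
      have x: "0 < x" using elim by (simp add: x_def)
      have n: "real n = x ^ 7" using elim by (simp add: x_def powr_realpow[symmetric] powr_powr)
      have r: "R n = x\<^sup>2" using elim by (simp add: x_def R_def powr_realpow[symmetric] powr_powr)
      have h: "h n = c / x" by (simp add: x_def h_def powr_minus_divide)
      show ?case unfolding scale_def r h n using x c by (simp add: field_simps power_divide) (simp add: power2_eq_square power3_eq_cube power_numeral_reduce)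
    qed
  qed
  from tendsto_mult[OF this tendsto_diff[OF I2_lim tendsto_mult[OF h_0 tendsto_mult[OF I1_lim I1_lim]]]]
  have "(\<lambda>n. real n * (scale n)\<^sup>2 * h n * (I2 n - h n * (I1 n * I1 n))) \<longlonglongrightarrow> 1 / c ^ 3 * ((coef0\<^sup>2 * D 0 0 t + coef1\<^sup>2 * D 1 0 t) * k1_sq)"
    by simp
  then show ?thesis
    by (rule Lim_transform_eventually)
      (use eventually_ge_1 in \<open>eventually_elim, simp add: V2_eq \<mu>_eq power2_eq_square algebra_simps\<close>)
qed

lemma sigma_eq: "1 / c ^ 3 * ((coef0\<^sup>2 * D 0 0 t + coef1\<^sup>2 * D 1 0 t) * k1_sq) = sigma2_lambda k F0 g t c"
proof -
  have s: "1 - F0 t \<noteq> 0" using t_lt by simp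
  have g: "g t \<noteq> 0" using g_pos by simp
  have sum: "(1 - F0 t) * g t + F0 t * g t = g t" by (simp add: algebra_simps)
  have "coef0\<^sup>2 * D 0 0 t + coef1\<^sup>2 * D 1 0 t = F0 t / (g t * (1 - F0 t))"
    unfolding coef1_def coef0_def D_at_t(1,2) sum using s g
    by (simp add: divide_simps) (simp add: power2_eq_square algebra_simps)
  then show ?thesis unfolding sigma2_lambda_def k1_sq_def by simp
qed

lemma sigma_pos: "0 < sigma2_lambda k F0 g t c"
  unfolding sigma2_lambda_def using F0_pos t_lt g_pos c k1_sq_pos
  by (intro mult_pos_pos divide_pos_pos) auto

definition "bias = mu_lambda k F0 f0 g t c"

lemma clt: "weak_conv_m (\<lambda>n. distr M borel (\<lambda>\<omega>. (\<Sum>j=1..n. Y n j \<omega>) + bias)) (normal_law bias (sigma2_lambda k F0 g t c))"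
proof (rule triangular_array_clt[OF Y_indep Y_bound _ Y_mean Y_var])
  show "(\<lambda>n. scale n * (2 * score_bound)) \<longlonglongrightarrow> 0" using tendsto_mult[OF scale_0 tendsto_const, of "2 * score_bound"] by simp
  show "(\<lambda>n. real n * ((scale n)\<^sup>2 * (V2 n - (\<mu> n)\<^sup>2))) \<longlonglongrightarrow> sigma2_lambda k F0 g t c"
    using var_lim unfolding sigma_eq .
qed (auto intro: sigma_pos)

text \<open>The centering constants are the means \<open>E1\<close> of the derivative
  estimators.\<close>

lemma Y_sum:
  assumes n: "1 \<le> n" "h n < t"
  shows "(\<Sum>j=1..n. Y n j \<omega>) = R n * (coef1 * (g_est_deriv k (h n) n (\<lambda>j. T j \<omega>) (status X T \<omega>) 1 t - (LBINT v. deriv k v * D 1 0 (t - h n * v)) / h n)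
      - coef0 * (g_est_deriv k (h n) n (\<lambda>j. T j \<omega>) (status X T \<omega>) 0 t - (LBINT v. deriv k v * D 0 0 (t - h n * v)) / h n))"
proof -
  let ?d = "\<lambda>u. deriv k ((t - u) / h n)"
  let ?S = "\<lambda>i. \<Sum>j\<in>class_obs n (\<lambda>j. T j \<omega>) (status X T \<omega>) i. ?d (T j \<omega>)"
  have h: "0 < h n" by (rule h_pos[OF n(1)])
  have S: "(\<Sum>j=1..n. V (\<phi>0 n) (\<phi>1 n) j \<omega>) = coef1 * ?S 1 - coef0 * ?S 0"
  proof -
    have "?S 1 = (\<Sum>j=1..n. V (\<lambda>_. 0) ?d j \<omega>)" "?S 0 = (\<Sum>j=1..n. V ?d (\<lambda>_. 0) j \<omega>)"
      using V_sum[where \<phi>="?d" and n=n and \<omega>=\<omega> and i=1] V_sum[where \<phi>="?d" and n=n and \<omega>=\<omega> and i=0] by simp_all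
    then have "coef1 * ?S 1 - coef0 * ?S 0 = (\<Sum>j=1..n. coef1 * V (\<lambda>_. 0) ?d j \<omega> - coef0 * V ?d (\<lambda>_. 0) j \<omega>)"
      by (simp add: sum_subtractf sum_distrib_left)
    also have "\<dots> = (\<Sum>j=1..n. V (\<phi>0 n) (\<phi>1 n) j \<omega>)"
      by (intro sum.cong) (auto simp: V_def \<phi>0_def \<phi>1_def)
    finally show ?thesis by simp
  qed
  have I: "I1 n = coef1 * (LBINT v. deriv k v * D 1 0 (t - h n * v)) - coef0 * (LBINT v. deriv k v * D 0 0 (t - h n * v))"
  proof -
    have ii: "integrable lborel (\<lambda>v. deriv k v * subdens F0 g i (t - h n * v))" for i
    proof -
      have "integrable lborel (\<lambda>v. subdens F0 g i (t + (- h n) * v))"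
        by (rule lborel_integrable_real_affine[OF subdens_integrable]) (use h in auto)
      then have j: "integrable lborel (\<lambda>v. kmax * subdens F0 g i (t - h n * v))" by simp
      show ?thesis
        by (rule Bochner_Integration.integrable_bound[OF j])
          (use k1_le subdens_nonneg kmax_pos in \<open>auto simp: abs_mult intro!: mult_right_mono\<close>)
    qed
    have "I1 n = (LBINT v. coef1 * (deriv k v * subdens F0 g 1 (t - h n * v)) - coef0 * (deriv k v * subdens F0 g 0 (t - h n * v)))"
      unfolding I1_def by (intro Bochner_Integration.integral_cong) (auto simp: algebra_simps)
    also have "\<dots> = coef1 * (LBINT v. deriv k v * subdens F0 g 1 (t - h n * v)) - coef0 * (LBINT v. deriv k v * subdens F0 g 0 (t - h n * v))"
      using ii by simp
    finally show ?thesis by (simp add: D_def)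
  qed
  have "(\<Sum>j=1..n. Y n j \<omega>) = scale n * ((\<Sum>j=1..n. V (\<phi>0 n) (\<phi>1 n) j \<omega>) - real n * \<mu> n)"
    unfolding Y_def by (simp add: sum_distrib_left[symmetric] sum_subtractf)
  also have "\<dots> = scale n * ((coef1 * ?S 1 - coef0 * ?S 0) - real n * (h n * I1 n))" unfolding S \<mu>_eq[OF n(1)] ..
  also have "\<dots> = R n * (((coef1 * ?S 1 - coef0 * ?S 0) / real n / (h n)\<^sup>2) - I1 n / h n)"
    using n h by (simp add: scale_def field_simps power2_eq_square)
  also have "\<dots> = R n * (coef1 * (g_est_deriv k (h n) n (\<lambda>j. T j \<omega>) (status X T \<omega>) 1 t - (LBINT v. deriv k v * D 1 0 (t - h n * v)) / h n)
      - coef0 * (g_est_deriv k (h n) n (\<lambda>j. T j \<omega>) (status X T \<omega>) 0 t - (LBINT v. deriv k v * D 0 0 (t - h n * v)) / h n))"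
    unfolding I g_est_deriv_interior[OF h n(2)] by (simp add: diff_divide_distrib right_diff_distrib algebra_simps)
  finally show ?thesis .
qed

section \<open>Limit distributions and the optimal bandwidth\<close>

abbreviation "lamN n \<omega> \<equiv> lambda_naive k (h n) n (\<lambda>j. T j \<omega>) (status X T \<omega>) t"
abbreviation "lamM n \<omega> \<equiv> lambda_MS k (h n) n (\<lambda>j. T j \<omega>) (status X T \<omega>) t"

lemma bias_limit:
  "c\<^sup>2 / 2 * m2 k * (1 / (D 0 0 t + D 1 0 t) * D 1 3 t - D 1 0 t / (D 0 0 t * (D 0 0 t + D 1 0 t)) * D 0 3 t
    - (D 0 2 t + D 1 2 t) / (D 0 0 t + D 1 0 t)\<^sup>2 * D 1 1 t
    - (D 1 2 t * D 0 0 t * (D 0 0 t + D 1 0 t) - D 1 0 t * (D 0 2 t * (D 0 0 t + D 1 0 t) + D 0 0 t * (D 0 2 t + D 1 2 t)))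
       / (D 0 0 t * (D 0 0 t + D 1 0 t))\<^sup>2 * D 0 1 t) = bias"
  unfolding bias_eq by (simp add: bias_def mu_lambda_def)

text \<open>A sequence of good sample points is an instance of \<open>good_data\<close>, so that
  the deterministic results apply to it.\<close>

lemma along_good_sequences:
  assumes w: "\<forall>\<^sub>F n in sequentially. w n \<in> good n"
  shows "(\<lambda>n. R n * (lamN n (w n) - hazard F0 f0 t) - (\<Sum>j=1..n. Y n j (w n))) \<longlonglongrightarrow> bias"
    and "\<forall>\<^sub>F n in sequentially. lamM n (w n) = lamN n (w n)"
proof -
  interpret S: good_data k Gs D F0 t \<rho> "\<lambda>n j. T j (w n)" "\<lambda>n. status X T (w n)" h "\<lambda>n. 2 * emp_tol n"
    by (rule good_data_seq[OF w])
  show "\<forall>\<^sub>F n in sequentially. lamM n (w n) = lamN n (w n)" by (rule S.eventually_MS_eq_naive)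
  have Rc: "\<forall>\<^sub>F n in sequentially. R n * (h n)\<^sup>2 = c\<^sup>2" using eventually_ge_1 by eventually_elim (rule Rh2)
  have val: "(\<lambda>n. R n * (g_est k (h n) n (\<lambda>j. T j (w n)) (status X T (w n)) i t - S.E0 n i)) \<longlonglongrightarrow> 0" if i: "i \<le> 1" for i
  proof (rule Lim_null_comparison)
    show "(\<lambda>n. R n * val_tol n) \<longlonglongrightarrow> 0" unfolding R_def val_tol_def by real_asymp
    show "\<forall>\<^sub>F n in sequentially. norm (R n * (g_est k (h n) n (\<lambda>j. T j (w n)) (status X T (w n)) i t - S.E0 n i)) \<le> R n * val_tol n"
      using w eventually_ge_1 h_less_t
    proof eventually_elim
      case (elim n)
      have "\<bar>val n (w n) i - val0 n i\<bar> < val_tol n" using elim(1) i by (auto simp: good_def)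
      moreover have "S.E0 n i = val0 n i" unfolding S.E0_def val0_def by (simp add: D_def)
      ultimately have "\<bar>g_est k (h n) n (\<lambda>j. T j (w n)) (status X T (w n)) i t - S.E0 n i\<bar> \<le> val_tol n"
        using val_eq[OF elim(2,3), of "w n" i] by simp
      then show ?case by (simp add: abs_mult R_def mult_left_mono)
    qed
  qed
  have c2: "0 < c\<^sup>2" using c by simp
  note main0 = S.naive_expansion[OF Rc c2 val, unfolded bias_limit hazard_eq[symmetric]]
  note main = main0[unfolded coef1_def[symmetric] coef0_def[symmetric]]
  show "(\<lambda>n. R n * (lamN n (w n) - hazard F0 f0 t) - (\<Sum>j=1..n. Y n j (w n))) \<longlonglongrightarrow> bias"
  proof (rule Lim_transform_eventually[OF main])
    show "\<forall>\<^sub>F n in sequentially. R n * (lamN n (w n) - hazard F0 f0 t)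
      - R n * (coef1 * (g_est_deriv k (h n) n (\<lambda>j. T j (w n)) (status X T (w n)) 1 t - S.E1 n 1)
        - coef0 * (g_est_deriv k (h n) n (\<lambda>j. T j (w n)) (status X T (w n)) 0 t - S.E1 n 0))
      = R n * (lamN n (w n) - hazard F0 f0 t) - (\<Sum>j=1..n. Y n j (w n))"
      using eventually_ge_1 h_less_t
    proof eventually_elim
      case (elim n)
      show ?case unfolding Y_sum[OF elim] S.E1_def ..
    qed
  qed
qed

lemma good_nonempty: "\<forall>\<^sub>F n in sequentially. good n \<noteq> {}"
proof -
  have "\<forall>\<^sub>F n in sequentially. 0 < prob (good n)" using good_prob_lim by (rule order_tendstoD(1)) simp
  then show ?thesis by eventually_elim auto
qed

lemma status_measurable: "j \<in> {1..n} \<Longrightarrow> (\<lambda>\<omega>. status X T \<omega> j) \<in> M \<rightarrow>\<^sub>M count_space UNIV"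
proof -
  assume "j \<in> {1..n}"
  then have [measurable]: "X j \<in> borel_measurable M" "T j \<in> borel_measurable M" by auto
  show ?thesis unfolding status_def by measurable
qed

lemma lamM_measurable: "\<forall>\<^sub>F n in sequentially. (\<lambda>\<omega>. lamM n \<omega>) \<in> borel_measurable M"
  using eventually_ge_1 h_less_t
proof eventually_elim
  case (elim n)
  show ?case
    by (rule lambda_MS_measurable[OF h_pos[OF elim(1)] elim(2) _ status_measurable]) (auto simp: status_def)
qed

lemma lamN_measurable: "\<forall>\<^sub>F n in sequentially. (\<lambda>\<omega>. lamN n \<omega>) \<in> borel_measurable M"
  using eventually_ge_1 h_less_t
proof eventually_elim
  case (elim n)
  have [measurable]: "(\<lambda>\<omega>. g_est k (h n) n (\<lambda>j. T j \<omega>) (status X T \<omega>) i t) \<in> borel_measurable M" for i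
    by (rule g_est_measurable_param[OF _ status_measurable]) auto
  have [measurable]: "(\<lambda>\<omega>. g_est_deriv k (h n) n (\<lambda>j. T j \<omega>) (status X T \<omega>) i t) \<in> borel_measurable M" for i
  proof -
    let ?d = "\<lambda>u. deriv k ((t - u) / h n)"
    have "g_est_deriv k (h n) n (\<lambda>j. T j \<omega>) (status X T \<omega>) i t
        = (\<Sum>j=1..n. V (if i = 0 then ?d else (\<lambda>_. 0)) (if i = 1 then ?d else (\<lambda>_. 0)) j \<omega>) / real n / (h n)\<^sup>2" for \<omega>
      unfolding g_est_deriv_interior[OF h_pos[OF elim(1)] elim(2)]
      using V_sum[where \<phi>="?d" and n=n and \<omega>=\<omega> and i=i] by simp
    moreover have "(\<lambda>\<omega>. (\<Sum>j=1..n. V (if i = 0 then ?d else (\<lambda>_. 0)) (if i = 1 then ?d else (\<lambda>_. 0)) j \<omega>) / real n / (h n)\<^sup>2) \<in> borel_measurable M"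
      by (intro borel_measurable_divide borel_measurable_sum V_measurable) auto
    ultimately show ?thesis by simp
  qed
  show ?case
    unfolding lambda_naive_def f_naive_def F_naive_def g_est_tot_def g_est_tot_deriv_def by measurable
qed

text \<open>An estimator that agrees with the naive one along good sequences has its limit
  distribution: the central limit theorem for the linear part carries over by
  \<open>weak_conv_m_transfer\<close> on the good events.\<close>

lemma weak_limit:
  assumes meas: "\<forall>\<^sub>F n in sequentially. (\<lambda>\<omega>. lam n \<omega>) \<in> borel_measurable M"
    and eq: "\<And>w. \<forall>\<^sub>F n in sequentially. w n \<in> good n \<Longrightarrow> \<forall>\<^sub>F n in sequentially. lam n (w n) = lamN n (w n)"
  shows "weak_conv_m (\<lambda>n. distr M borel (\<lambda>\<omega>. R n * (lam n \<omega> - hazard F0 f0 t)))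
    (normal_law (mu_lambda k F0 f0 g t c) (sigma2_lambda k F0 g t c))"
  unfolding bias_def[symmetric]
proof (rule weak_conv_m_transfer[OF clt isCont_cdf_normal_law[OF sigma_pos] _ _ good_measurable good_prob_lim])
  show "(\<lambda>\<omega>. (\<Sum>j=1..n. Y n j \<omega>) + bias) \<in> borel_measurable M" for n
    unfolding Y_def by (intro borel_measurable_add borel_measurable_sum borel_measurable_times borel_measurable_diff V_measurable) auto
  show "\<forall>\<^sub>F n in sequentially. (\<lambda>\<omega>. R n * (lam n \<omega> - hazard F0 f0 t)) \<in> borel_measurable M"
    using meas
  proof eventually_elim
    case (elim n)
    note [measurable] = elim
    show ?case by measurable
  qed
  fix e :: real assume e: "0 < e"
  show "\<forall>\<^sub>F n in sequentially. \<forall>\<omega>\<in>good n. \<bar>R n * (lam n \<omega> - hazard F0 f0 t) - ((\<Sum>j=1..n. Y n j \<omega>) + bias)\<bar> \<le> e"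
  proof (rule eventually_Ball_if_sequences[OF good_nonempty])
    fix w assume w: "\<forall>\<^sub>F n in sequentially. w n \<in> good n"
    show "\<forall>\<^sub>F n in sequentially. \<bar>R n * (lam n (w n) - hazard F0 f0 t) - ((\<Sum>j=1..n. Y n j (w n)) + bias)\<bar> \<le> e"
      using tendstoD[OF along_good_sequences(1)[OF w] e] eq[OF w]
      by eventually_elim (simp add: dist_real_def)
  qed
qed

lemma weak_limit_naive:
  "weak_conv_m (\<lambda>n. distr M borel (\<lambda>\<omega>. R n * (lamN n \<omega> - hazard F0 f0 t)))
    (normal_law (mu_lambda k F0 f0 g t c) (sigma2_lambda k F0 g t c))"
  by (rule weak_limit[OF lamN_measurable]) simp

lemma weak_limit_MS:
  "weak_conv_m (\<lambda>n. distr M borel (\<lambda>\<omega>. R n * (lamM n \<omega> - hazard F0 f0 t)))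
    (normal_law (mu_lambda k F0 f0 g t c) (sigma2_lambda k F0 g t c))"
  by (rule weak_limit[OF lamM_measurable along_good_sequences(2)])

end

text \<open>With \<open>c = x m\<close> for the claimed minimizer \<open>m\<close>, the excess
  over the minimum is a positive multiple of \<open>3 x^7 + 4 - 7 x^3\<close>, in which \<open>(x
  - 1)^2\<close> splits off with a cofactor whose coefficients are positive.\<close>

lemma is_arg_min_quartic_plus_cube_inverse:
  fixes a b :: real
  assumes a: "0 < a" and b: "0 < b"
  shows "is_arg_min (\<lambda>c. a * c ^ 4 + b / c ^ 3) (\<lambda>c. 0 < c) c \<longleftrightarrow> c = (3 * b / (4 * a)) powr (1 / 7)"
proof -
  define m where "m = (3 * b / (4 * a)) powr (1 / 7)"
  have m: "0 < m" using a b by (simp add: m_def)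
  have "m powr 7 = 3 * b / (4 * a)" using a b by (simp add: m_def powr_powr)
  then have m7: "m ^ 7 = 3 * b / (4 * a)" using m powr_numeral[of m num.One] powr_realpow[of m 7] by simp
  then have beq: "b = 4 * a * m ^ 7 / 3" using a by (simp add: field_simps)
  have less: "a * m ^ 4 + b / m ^ 3 < a * c ^ 4 + b / c ^ 3" if c: "0 < c" "c \<noteq> m" for c
  proof -
    define x where "x = c / m"
    have x: "0 < x" "x \<noteq> 1" "c = x * m" using c m by (auto simp: x_def)
    have 1: "a * c ^ 4 + b / c ^ 3 - (a * m ^ 4 + b / m ^ 3)
        = a * m ^ 4 / (3 * x ^ 3) * (3 * x ^ 7 + 4 - 7 * x ^ 3)"
      unfolding x beq using m x by (simp add: field_simps power_mult_distrib power_numeral_reduce)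
    have 2: "3 * x ^ 7 + 4 - 7 * x ^ 3 = (x - 1)\<^sup>2 * (3*x^5 + 6*x^4 + 9*x^3 + 12*x\<^sup>2 + 8*x + 4)"
      by (simp add: algebra_simps power2_eq_square power_numeral_reduce)
    have "0 < (x - 1)\<^sup>2 * (3*x^5 + 6*x^4 + 9*x^3 + 12*x\<^sup>2 + 8*x + 4)"
      using x by (intro mult_pos_pos add_pos_pos) auto
    then have "0 < a * m ^ 4 / (3 * x ^ 3) * (3 * x ^ 7 + 4 - 7 * x ^ 3)"
      unfolding 2 using x a m by (intro mult_pos_pos[of "a * m ^ 4 / (3 * x ^ 3)"]) auto
    with 1 show ?thesis by simp
  qed
  show ?thesis
    unfolding m_def[symmetric] is_arg_min_def
  proof safe
    assume c: "0 < c" "\<nexists>y. 0 < y \<and> a * y ^ 4 + b / y ^ 3 < a * c ^ 4 + b / c ^ 3"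
    show "c = m" using less[of c] c m by blast
  next
    fix y assume "0 < y" "a * y ^ 4 + b / y ^ 3 < a * m ^ 4 + b / m ^ 3"
    then show False using less[of y] by (cases "y = m") auto
  qed (use m in auto)
qed

text \<open>The squared bias is proportional to \<open>c^4\<close> and the variance to \<open>1 /
  c^3\<close>; the coefficient of \<open>c^4\<close> is positive because \<open>r_bias\<close>
  does not vanish.\<close>

lemma (in smooth_current_status) optimal_bandwidth:
  assumes r: "r_bias F0 f0 g t \<noteq> 0"
  shows "is_arg_min (\<lambda>c. (mu_lambda k F0 f0 g t c)\<^sup>2 + sigma2_lambda k F0 g t c) (\<lambda>c. 0 < c) c \<longleftrightarrow> c = c_lambda k F0 f0 g t"
proof -
  define a where "a = (m2 k)\<^sup>2 * (r_bias F0 f0 g t)\<^sup>2 / 4"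
  define b where "b = F0 t / (g t * (1 - F0 t)) * (LBINT u. (deriv k u)\<^sup>2)"
  have a: "0 < a" using m2_pos r by (simp add: a_def)
  have b: "0 < b" unfolding b_def using F0_pos t_lt g_pos k1_sq_pos by (intro mult_pos_pos divide_pos_pos) auto
  have f: "(\<lambda>c. (mu_lambda k F0 f0 g t c)\<^sup>2 + sigma2_lambda k F0 g t c) = (\<lambda>c. a * c ^ 4 + b / c ^ 3)"
  proof
    fix c
    have "(mu_lambda k F0 f0 g t c)\<^sup>2 = a * c ^ 4"
      unfolding mu_lambda_def a_def by (simp add: power_mult_distrib power_divide flip: power_mult)
    moreover have "sigma2_lambda k F0 g t c = b / c ^ 3"
      unfolding sigma2_lambda_def b_def by (simp add: mult.assoc)
    ultimately show "(mu_lambda k F0 f0 g t c)\<^sup>2 + sigma2_lambda k F0 g t c = a * c ^ 4 + b / c ^ 3" by simp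
  qed
  have "c_lambda k F0 f0 g t = (3 * b) powr (1 / 7) * (4 * a) powr (- 1 / 7)"
    unfolding c_lambda_def a_def b_def by (simp add: mult.assoc)
  also have "\<dots> = (3 * b / (4 * a)) powr (1 / 7)"
    using a b by (simp add: powr_divide powr_minus_divide)
  finally show ?thesis unfolding f is_arg_min_quartic_plus_cube_inverse[OF a b] by simp
qed

theorem corollary3p7:
  fixes M :: "'a measure" and X T :: "nat \<Rightarrow> 'a \<Rightarrow> real"
    and F0 G f0 g k :: "real \<Rightarrow> real" and M0 t :: real
  assumes model: "current_status_model M X T F0 G g"
    and kernel: "smoothing_kernel k"
    and F_supp: "df_support F0 = {0..M0}"
    and F_mono: "strict_mono_on {0..M0} F0"
    and F_density: "df_density F0 f0"
    and F_away: "\<exists>\<delta>>0. \<forall>x\<in>{0..M0}. \<delta> \<le> f0 x"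
    and G_supp: "df_support G = {0..}"
    and G_mono: "strict_mono_on {0..M0} G"
    and G_away: "\<exists>\<delta>>0. \<forall>x\<in>{0..M0}. \<delta> \<le> g x"
    and G_deriv: "\<exists>g' C. \<forall>x\<in>{0..M0}.
          (g has_real_derivative g' x) (at x within {0..M0}) \<and> \<bar>g' x\<bar> \<le> C"
    and t_pos: "0 < t"
    and t_lt: "F0 t < 1"
    and f0_smooth: "cont_nth_deriv_at 3 f0 t"
    and g_smooth: "cont_nth_deriv_at 3 g t"
    and r_nz: "r_bias F0 f0 g t \<noteq> 0"
  shows "(\<forall>c>0. weak_conv_m
            (\<lambda>n. distr M borel (\<lambda>\<omega>. real n powr (2 / 7) *
               (lambda_MS k (c * real n powr (- 1 / 7)) n (\<lambda>j. T j \<omega>) (status X T \<omega>) t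
                  - hazard F0 f0 t)))
            (normal_law (mu_lambda k F0 f0 g t c) (sigma2_lambda k F0 g t c)))
       \<and> (\<forall>c>0. weak_conv_m
            (\<lambda>n. distr M borel (\<lambda>\<omega>. real n powr (2 / 7) *
               (lambda_naive k (c * real n powr (- 1 / 7)) n (\<lambda>j. T j \<omega>) (status X T \<omega>) t
                  - hazard F0 f0 t)))
            (normal_law (mu_lambda k F0 f0 g t c) (sigma2_lambda k F0 g t c)))
       \<and> (\<forall>c. is_arg_min (\<lambda>c. (mu_lambda k F0 f0 g t c)\<^sup>2 + sigma2_lambda k F0 g t c) (\<lambda>c. 0 < c) c
              \<longleftrightarrow> c = c_lambda k F0 f0 g t)"
proof -
  interpret smooth_current_status M X T F0 G g k f0 M0 t
    by (intro smooth_current_status.intro smoothing.intro smooth_current_status_axioms.intro)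
      (fact model kernel F_supp F_mono F_density F_away G_away t_pos t_lt f0_smooth g_smooth)+
  have limits: "weak_conv_m (\<lambda>n. distr M borel (\<lambda>\<omega>. real n powr (2 / 7) *
               (lambda_MS k (c * real n powr (- 1 / 7)) n (\<lambda>j. T j \<omega>) (status X T \<omega>) t
                  - hazard F0 f0 t)))
            (normal_law (mu_lambda k F0 f0 g t c) (sigma2_lambda k F0 g t c))"
    "weak_conv_m (\<lambda>n. distr M borel (\<lambda>\<omega>. real n powr (2 / 7) *
               (lambda_naive k (c * real n powr (- 1 / 7)) n (\<lambda>j. T j \<omega>) (status X T \<omega>) t
                  - hazard F0 f0 t)))
            (normal_law (mu_lambda k F0 f0 g t c) (sigma2_lambda k F0 g t c))" if "0 < c" for c
  proof -
    interpret bandwidth M X T F0 G g k f0 M0 t c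
      by unfold_locales (fact that)
    note weak_limit_MS weak_limit_naive
    from this[unfolded R_def h_def] show
      "weak_conv_m (\<lambda>n. distr M borel (\<lambda>\<omega>. real n powr (2 / 7) *
               (lambda_MS k (c * real n powr (- 1 / 7)) n (\<lambda>j. T j \<omega>) (status X T \<omega>) t
                  - hazard F0 f0 t)))
            (normal_law (mu_lambda k F0 f0 g t c) (sigma2_lambda k F0 g t c))"
      "weak_conv_m (\<lambda>n. distr M borel (\<lambda>\<omega>. real n powr (2 / 7) *
               (lambda_naive k (c * real n powr (- 1 / 7)) n (\<lambda>j. T j \<omega>) (status X T \<omega>) t
                  - hazard F0 f0 t)))
            (normal_law (mu_lambda k F0 f0 g t c) (sigma2_lambda k F0 g t c))"
      by this
  qed
  show ?thesis
    using limits optimal_bandwidth[OF r_nz] by blast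
qed

end
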